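(* Let $q$ be a large prime number and assume that $L(\tfrac12, \chi) \neq 0$ for every primitive Dirichlet character $\chi \pmod q$. Then for any real number $k < 0$, \[ \sum^{*}_{\chi \bmod q} |L(\tfrac{1}{2},\chi)|^{2k} \gg_k \phi^*(q)(\log q)^{k^2}. \]
   Context: Here $\sum^{*}_{\chi \bmod q}$ denotes the sum over primitive Dirichlet characters modulo $q$, and $\phi^*(q)$ denotes the number of primitive Dirichlet characters modulo $q$. *)

theory Defs
  imports
    "HOL-Complex_Analysis.Complex_Analysis"
    "HOL-Computational_Algebra.Primes"
begin

definition dirichlet_character :: "nat \<Rightarrow> (int \<Rightarrow> complex) \<Rightarrow> bool" where
  "dirichlet_character q \<psi> \<longleftrightarrow>
     q > 0 \<and>
     (\<forall>a b. \<psi> (a * b) = \<psi> a * \<psi> b) \<and>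
     (\<forall>a. \<psi> (a + int q) = \<psi> a) \<and>
     (\<forall>a. \<psi> a \<noteq> 0 \<longleftrightarrow> coprime a (int q))"

definition induced_from :: "nat \<Rightarrow> nat \<Rightarrow> (int \<Rightarrow> complex) \<Rightarrow> bool" where
  "induced_from d q \<psi> \<longleftrightarrow>
     (\<exists>\<theta>. dirichlet_character d \<theta> \<and> (\<forall>a. coprime a (int q) \<longrightarrow> \<psi> a = \<theta> a))"

definition primitive_character :: "nat \<Rightarrow> (int \<Rightarrow> complex) \<Rightarrow> bool" where
  "primitive_character q \<psi> \<longleftrightarrow>
     dirichlet_character q \<psi> \<and> (\<forall>d. d dvd q \<and> d < q \<longrightarrow> \<not> induced_from d q \<psi>)"

definition primitive_characters :: "nat \<Rightarrow> (int \<Rightarrow> complex) set" where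
  "primitive_characters q = {\<psi>. primitive_character q \<psi>}"

definition phi_star :: "nat \<Rightarrow> nat" where
  "phi_star q = card (primitive_characters q)"

definition dirichlet_series :: "(int \<Rightarrow> complex) \<Rightarrow> complex \<Rightarrow> complex" where
  "dirichlet_series \<psi> s = (\<Sum>n. \<psi> (int (Suc n)) / of_nat (Suc n) powr s)"

text \<open>
  The value at s of the analytic continuation of the Dirichlet series of a character from
  Re s > 1 to Re s > 0. The point 1 is removed because principal characters have a pole there.
  The domain is connected, so the continuation is unique; the definition is meaningful only
  for s in that domain.
\<close>
definition dirichlet_L :: "complex \<Rightarrow> (int \<Rightarrow> complex) \<Rightarrow> complex" where
  "dirichlet_L s \<psi> =
     (THE v. \<exists>f. f holomorphic_on ({z. Re z > 0} - {1}) \<and>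
                 (\<forall>z. Re z > 1 \<longrightarrow> f z = dirichlet_series \<psi> z) \<and>
                 f s = v)"

end

theory Submission
  imports Defs "HOL-Number_Theory.Number_Theory" "HOL-Probability.Probability"
begin

text \<open>
  Put \<open>m = -k\<close> and restrict to even characters. Split the primes up to a small power of \<open>q\<close> into the blocks
  \<open>(2^2^j, 2^2^(j+1)]\<close> and let \<open>P\<^sub>j\<close> be the sum of \<open>\<psi>(p) / sqrt p\<close> over the \<open>j\<close>-th block. The Taylor polynomials of
  \<open>exp (-(m+1) P\<^sub>j)\<close> and \<open>exp (-m P\<^sub>j)\<close>, truncated at a degree growing linearly in the distance to the last
  block, have products \<open>B\<close> and \<open>C\<close> over all blocks that are short Dirichlet polynomials imitating \<open>L^(-(m+1))\<close> and
  \<open>L^(-m)\<close>. Orthogonality gives a mean square of \<open>C\<close> of order \<open>(log q)^(m\<^sup>2)\<close>, of which most comes from characters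
  with all \<open>P\<^sub>j\<close> small compared with the degrees; for these \<open>|C|\<^sup>2\<close> is at most a constant times
  \<open>|B|^(2m/(m+1))\<close>. A twisted second moment of \<open>L(1/2,\<psi>)\<close> bounds the mean of \<open>|L B|\<^sup>2\<close> by the same order, and
  the pointwise inequality \<open>b^(2m/(m+1)) \<le> \<tau>^(-m) x^(-2m) + \<tau> x\<^sup>2 b\<^sup>2\<close> with \<open>x = |L|\<close>, \<open>b = |B|\<close> then forces the
  mean of \<open>|L|^(-2m)\<close> to be at least of this order.

  For the second moment, \<open>L(1/2,\<psi>)\<close> times a constant is the Mellin transform of the theta function. The functional
  equation of theta, a consequence of Poisson summation, folds the double integral for \<open>|L|\<^sup>2\<close> onto a half-plane on
  which the resulting double sum has a rapidly decaying weight, so that averaging over the characters leaves a diagonal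
  and a negligible remainder.
\<close>

section \<open>Dirichlet characters modulo a prime\<close>

text \<open>The blocks grow doubly exponentially so that \<open>ln\<close> doubles from one to the
  next: each has a bounded sum of reciprocals, and with \<open>2 ^ n\<close> of order
  \<open>log q\<close> there are so many blocks that a constant lost in each would cost a power of
  \<open>log q\<close>. Losses must therefore be summable over the blocks. The degree
  \<open>Q * (n - j)\<close> in block \<open>j\<close> achieves this: truncation errors have order
  \<open>exp (- Q * (n - j))\<close>, while the logarithm of the total length, about
  \<open>Q\<close> times the sum of \<open>2 ^ j * (n - j)\<close>, is still
  \<open>O(2 ^ n)\<close>. Taking \<open>2 ^ n\<close> as a small multiple of \<open>log q\<close>
  keeps all lengths below a small power of \<open>q\<close>. The twist by \<open>B\<close> gives the
  second moment the order \<open>(log q) * exp ((m\<^sup>2 - 1) * S)\<close>, where \<open>S\<close>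
  is the sum of \<open>1 / p\<close>. As \<open>exp S\<close> is at least of order
  \<open>log q\<close>, this is at most of order \<open>exp (m\<^sup>2 * S)\<close>, the size of the
  mean square of \<open>C\<close>. So \<open>\<tau>\<close> can be a constant, small enough for the
  term with \<open>|L B|\<^sup>2\<close> to take only half of the lower bound. With even characters
  a single theta function suffices; dropping the odd ones costs a constant factor, as all terms are
  nonnegative.\<close>

definition even_characters :: "nat \<Rightarrow> (int \<Rightarrow> complex) set" where
  "even_characters q = {\<psi>. dirichlet_character q \<psi> \<and> \<psi> (-1) = 1}"

definition principal :: "nat \<Rightarrow> int \<Rightarrow> complex" where
  "principal q a = (if coprime a (int q) then 1 else 0)"

lemma dirichlet_character_mult:
  "dirichlet_character q \<psi> \<Longrightarrow> \<psi> (a * b) = \<psi> a * \<psi> b"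
  by (simp add: dirichlet_character_def)

lemma dirichlet_character_eq_0_iff:
  "dirichlet_character q \<psi> \<Longrightarrow> \<psi> a = 0 \<longleftrightarrow> \<not> coprime a (int q)"
  by (auto simp: dirichlet_character_def)

lemma dirichlet_character_1 [simp]:
  assumes "dirichlet_character q \<psi>"
  shows "\<psi> 1 = 1"
proof -
  have "\<psi> 1 \<noteq> 0" "\<psi> (1 * 1) = \<psi> 1 * \<psi> 1"
    using assms unfolding dirichlet_character_def by (simp, blast)
  thus ?thesis by simp
qed

lemma dirichlet_character_power:
  assumes "dirichlet_character q \<psi>"
  shows "\<psi> (a ^ n) = \<psi> a ^ n"
  by (induction n) (use assms in \<open>auto simp: dirichlet_character_mult\<close>)

lemma dirichlet_character_periodic:
  assumes "dirichlet_character q \<psi>"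
  shows "\<psi> (a + int q * k) = \<psi> a"
proof -
  have 1: "\<psi> (a + int q) = \<psi> a" for a using assms by (simp add: dirichlet_character_def)
  have 2: "\<psi> (a + int q * int n) = \<psi> a" for a n
  proof (induction n)
    case (Suc n)
    have "\<psi> (a + int q * int (Suc n)) = \<psi> ((a + int q * int n) + int q)" by (simp add: algebra_simps)
    with Suc 1 show ?case by simp
  qed simp
  have 3: "\<psi> (a - int q * int n) = \<psi> a" for a n
    using 2[of "a - int q * int n" n] by simp
  show ?thesis
    using 2[of a "nat k"] 3[of a "nat (-k)"] by (cases "k \<ge> 0") auto
qed

lemma dirichlet_character_cong:
  assumes "dirichlet_character q \<psi>" "[a = b] (mod int q)"
  shows "\<psi> a = \<psi> b"
proof -
  from assms(2) obtain k where "b = a + int q * k" by (auto simp: cong_iff_lin)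
  thus ?thesis using dirichlet_character_periodic[OF assms(1)] by simp
qed

text \<open>By Euler's theorem the value at an argument coprime to \<open>q\<close> is a root of
  unity of order dividing \<open>totient q\<close>.\<close>

lemma dirichlet_character_norm:
  assumes \<psi>: "dirichlet_character q \<psi>" and a: "coprime a (int q)"
  shows "norm (\<psi> a) = 1"
proof -
  have q: "q > 0" using \<psi> by (simp add: dirichlet_character_def)
  define b where "b = nat (a mod int q)"
  have b: "[int b = a] (mod int q)" using q by (simp add: b_def cong_def)
  hence "coprime (int b) (int q)" using a cong_imp_coprime cong_sym by blast
  hence "coprime b q" by simp
  hence "[b ^ totient q = 1] (mod q)" by (rule euler_theorem)
  hence "[int b ^ totient q = 1] (mod int q)"
    using cong_int_iff[of "b ^ totient q" 1 q] by simp
  hence "\<psi> (int b ^ totient q) = 1"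
    using dirichlet_character_cong[OF \<psi>] dirichlet_character_1[OF \<psi>] by metis
  hence "\<psi> a ^ totient q = 1"
    using dirichlet_character_cong[OF \<psi> b] by (simp add: dirichlet_character_power[OF \<psi>])
  hence "norm (\<psi> a) ^ totient q = 1" by (metis norm_one norm_power)
  moreover have "totient q > 0" using q by simp
  ultimately show ?thesis using power_eq_1_iff[of "norm (\<psi> a)" "totient q"] by simp
qed

lemma dirichlet_character_norm_le_1:
  assumes "dirichlet_character q \<psi>"
  shows "norm (\<psi> a) \<le> 1"
proof (cases "\<psi> a = 0")
  case False
  hence "coprime a (int q)" using dirichlet_character_eq_0_iff[OF assms] by blast
  thus ?thesis using dirichlet_character_norm[OF assms] by simp
qed simp

lemma coprime_add_modulus_iff: "coprime (a + int q) (int q) \<longleftrightarrow> coprime a (int q)"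
  by (simp only: coprime_iff_gcd_eq_1 gcd_add1)

lemma dirichlet_character_principal:
  assumes "q > 0"
  shows "dirichlet_character q (principal q)"
  unfolding dirichlet_character_def principal_def using assms
  by (auto simp: coprime_add_modulus_iff)

lemma dirichlet_character_times:
  assumes "dirichlet_character q \<psi>" "dirichlet_character q \<theta>"
  shows "dirichlet_character q (\<lambda>a. \<psi> a * \<theta> a)"
  using assms by (auto simp: dirichlet_character_def)

text \<open>Period 1 forces \<open>\<theta>\<close> to be constantly 1. The only proper divisor of a
  prime is 1, so this is the one case that primitivity has to exclude.\<close>

lemma induced_from_1:
  assumes "dirichlet_character q \<psi>" "induced_from 1 q \<psi>"
  shows "\<psi> = principal q"
proof -
  obtain \<theta> where \<theta>: "dirichlet_character 1 \<theta>" "\<And>a. coprime a (int q) \<Longrightarrow> \<psi> a = \<theta> a"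
    using assms(2) by (auto simp: induced_from_def)
  have "\<theta> a = 1" for a
    using dirichlet_character_periodic[OF \<theta>(1), of 0 a] dirichlet_character_periodic[OF \<theta>(1), of 0 1]
      dirichlet_character_1[OF \<theta>(1)] by simp
  thus ?thesis using \<theta>(2) dirichlet_character_eq_0_iff[OF assms(1)] by (auto simp: principal_def)
qed

lemma primitive_character_prime:
  assumes "prime q" "dirichlet_character q \<psi>" "\<psi> \<noteq> principal q"
  shows "primitive_character q \<psi>"
  unfolding primitive_character_def
proof (intro conjI allI impI assms(2))
  fix d assume "d dvd q \<and> d < q"
  hence "d = 1" using assms(1) by (auto simp: prime_nat_iff)
  thus "\<not> induced_from d q \<psi>" using induced_from_1[OF assms(2)] assms(3) by blast
qed

lemma residue_primroot_prime_exists: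
  assumes "prime q"
  obtains g where "residue_primroot q g"
  using prime_primitive_root_exists[OF prime_gt_1_nat[OF assms] assms] that by blast

lemma residue_primroot_generates:
  assumes q: "prime q" and g: "residue_primroot q g" and a: "coprime a (int q)"
  obtains i where "i < q - 1" "[a = int g ^ i] (mod int q)"
proof -
  have q1: "q > 1" using q prime_gt_1_nat by blast
  define b where "b = nat (a mod int q)"
  have b: "[int b = a] (mod int q)" using q1 by (simp add: b_def cong_def)
  hence "coprime (int b) (int q)" using a cong_imp_coprime cong_sym by blast
  moreover have "b < q" using q1 by (simp add: b_def nat_less_iff)
  moreover from calculation have "b \<noteq> 0" using q1 by (intro notI) simp
  ultimately have "b \<in> totatives q"
    by (simp add: totatives_def)
  hence "b \<in> (\<lambda>i. g ^ i mod q) ` {..<totient q}"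
    using bij_betw_imp_surj_on[OF residue_primroot_is_generator[OF q1 g]] by simp
  then obtain i where i: "i < totient q" "g ^ i mod q = b" by blast
  have "[g ^ i = b] (mod q)" using i(2) \<open>b < q\<close> by (auto simp: cong_def)
  hence "[int g ^ i = int b] (mod int q)" using cong_int_iff[of "g ^ i" b q] by simp
  with b i show ?thesis using that totient_prime[OF q] by (metis cong_sym cong_trans)
qed

lemma dirichlet_character_eqI:
  assumes q: "prime q" and g: "residue_primroot q g"
    and "dirichlet_character q \<psi>" "dirichlet_character q \<theta>" "\<psi> (int g) = \<theta> (int g)"
  shows "\<psi> = \<theta>"
proof
  fix a show "\<psi> a = \<theta> a"
  proof (cases "coprime a (int q)")
    case True
    obtain i where i: "[a = int g ^ i] (mod int q)"
      using residue_primroot_generates[OF q g True] by blast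
    show ?thesis
      using dirichlet_character_cong[OF assms(3) i] dirichlet_character_cong[OF assms(4) i] assms
      by (simp add: dirichlet_character_power)
  next
    case False
    with assms(3,4) show ?thesis using dirichlet_character_eq_0_iff by metis
  qed
qed

text \<open>A character is determined by its value at a primitive root, and this value is a
  \<open>(q - 1)\<close>-th root of unity.\<close>

lemma card_dirichlet_characters_le:
  assumes q: "prime q"
  shows "finite {\<psi>. dirichlet_character q \<psi>} \<and> card {\<psi>. dirichlet_character q \<psi>} \<le> q - 1"
proof -
  obtain g where g: "residue_primroot q g" using residue_primroot_prime_exists[OF q] .
  have q1: "q > 1" using q prime_gt_1_nat by blast
  have inj: "inj_on (\<lambda>\<psi>. \<psi> (int g)) {\<psi>. dirichlet_character q \<psi>}"
    using dirichlet_character_eqI[OF q g] by (auto intro!: inj_onI)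
  have "coprime g q" using g by (simp add: residue_primroot_def coprime_commute)
  hence "[g ^ (q - 1) = 1] (mod q)" using euler_theorem[of g q] totient_prime[OF q] by simp
  hence c: "[int g ^ (q - 1) = 1] (mod int q)" using cong_int_iff[of "g ^ (q - 1)" 1 q] by simp
  have sub: "(\<lambda>\<psi>. \<psi> (int g)) ` {\<psi>. dirichlet_character q \<psi>} \<subseteq> {z. z ^ (q - 1) = 1}"
    using dirichlet_character_cong[OF _ c] by (auto simp: dirichlet_character_power)
  have fin: "finite {z::complex. z ^ (q - 1) = 1}" using q1 by (intro finite_roots_unity) auto
  show ?thesis
    using inj sub fin card_roots_unity_eq[of "q - 1"] q1 card_inj_on_le[OF inj sub fin]
      finite_imageD[OF finite_subset[OF sub fin] inj] by simp
qed

lemma finite_primitive_characters: "prime q \<Longrightarrow> finite (primitive_characters q)"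
  by (rule finite_subset[OF _ conjunct1[OF card_dirichlet_characters_le]])
     (auto simp: primitive_characters_def primitive_character_def)

lemma phi_star_le: 
  assumes "prime q" shows "phi_star q \<le> q - 1"
proof -
  have "phi_star q \<le> card {\<psi>. dirichlet_character q \<psi>}"
    unfolding phi_star_def using card_dirichlet_characters_le[OF assms]
    by (intro card_mono) (auto simp: primitive_characters_def primitive_character_def)
  with card_dirichlet_characters_le[OF assms] show ?thesis by simp
qed

text \<open>The character is \<open>w\<close> raised to the discrete logarithm \<open>ix\<close> to
  base \<open>g\<close>. Congruent powers of \<open>g\<close> have exponents that agree modulo
  \<open>q - 1\<close>, so the arbitrary choice in \<open>ix\<close> does not affect the power of
  \<open>w\<close>.\<close>

lemma dirichlet_character_of_root_unity:
  fixes w :: complex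
  assumes q: "prime q" and g: "residue_primroot q g" and w: "w ^ (q - 1) = 1"
  obtains \<psi> where "dirichlet_character q \<psi>" "\<And>i. \<psi> (int g ^ i) = w ^ i"
proof -
  have q1: "q > 1" using q prime_gt_1_nat by blast
  have ord: "ord q g = q - 1" and cop: "coprime q g"
    using g totient_prime[OF q] by (auto simp: residue_primroot_def)
  define ix where "ix a = (SOME i. [a = int g ^ i] (mod int q))" for a
  have ix: "[a = int g ^ ix a] (mod int q)" if a: "coprime a (int q)" for a
  proof -
    obtain i where "[a = int g ^ i] (mod int q)" using residue_primroot_generates[OF q g a] .
    thus ?thesis unfolding ix_def by (rule someI)
  qed
  have pow: "w ^ i = w ^ j" if "[int g ^ i = int g ^ j] (mod int q)" for i j
  proof -
    have "[g ^ i = g ^ j] (mod q)" using that cong_int_iff[of "g ^ i" "g ^ j" q] by simp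
    hence c: "[i = j] (mod (q - 1))" using order_divides_expdiff[OF cop] ord by metis
    have "w ^ i = w ^ (i mod (q - 1))" for i
    proof -
      have "w ^ i = w ^ ((q - 1) * (i div (q - 1)) + i mod (q - 1))" by simp
      also have "\<dots> = w ^ (i mod (q - 1))" by (simp only: power_add power_mult w) simp
      finally show ?thesis .
    qed
    with c show ?thesis unfolding cong_def by metis
  qed
  have w0: "w \<noteq> 0" using w q1 by (auto simp: power_0_left)
  define \<psi> where "\<psi> a = (if coprime a (int q) then w ^ ix a else 0)" for a
  have cg: "coprime (int g ^ i) (int q)" for i using cop by (simp add: coprime_commute)
  have *: "\<psi> a = w ^ i" if "[a = int g ^ i] (mod int q)" for a i
  proof -
    have a: "coprime a (int q)" using that cg cong_imp_coprime cong_sym by blast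
    have "[int g ^ ix a = int g ^ i] (mod int q)" using that ix[OF a] cong_sym cong_trans by blast
    thus ?thesis using pow a by (simp add: \<psi>_def)
  qed
  have "dirichlet_character q \<psi>"
    unfolding dirichlet_character_def
  proof (intro conjI allI)
    show "\<psi> (a * b) = \<psi> a * \<psi> b" for a b
    proof (cases "coprime a (int q) \<and> coprime b (int q)")
      case True
      have "[a * b = int g ^ (ix a + ix b)] (mod int q)"
        using True cong_mult[OF ix ix] by (simp add: power_add)
      from *[OF this] True show ?thesis by (simp add: \<psi>_def power_add)
    qed (auto simp: \<psi>_def)
    show "\<psi> (a + int q) = \<psi> a" for a
    proof (cases "coprime a (int q)")
      case True
      have "[a + int q = int g ^ ix a] (mod int q)" using ix[OF True] by (simp add: cong_def)
      from *[OF this] True show ?thesis by (simp add: \<psi>_def)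
    next
      case False
      hence "\<not> coprime (a + int q) (int q)" by (simp add: coprime_add_modulus_iff)
      with False show ?thesis by (simp add: \<psi>_def)
    qed
  qed (use q1 w0 in \<open>auto simp: \<psi>_def\<close>)
  thus ?thesis by (rule that) (rule *[OF cong_refl])
qed

text \<open>The power is a square root of 1 in the field of residues, and the order
  \<open>q - 1\<close> of \<open>g\<close> rules out the value 1.\<close>

lemma primroot_half_power:
  assumes q: "prime q" "q > 2" and g: "residue_primroot q g"
  shows "[int g ^ ((q - 1) div 2) = -1] (mod int q)"
proof -
  have ord: "ord q g = q - 1" and cop: "coprime q g"
    using g totient_prime[OF q(1)] by (auto simp: residue_primroot_def)
  have "odd q" using prime_odd_nat[of q] q by simp
  then obtain h where h: "q = 2 * h + 1" by (rule oddE)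
  let ?x = "int g ^ h"
  have "[g ^ (2 * h) = 1] (mod q)" using ord ord_divides[of g "2*h" q] h by simp
  hence "[int g ^ (2 * h) = 1] (mod int q)" using cong_int_iff[of "g ^ (2 * h)" 1 q] by simp
  hence "int q dvd int g ^ (2 * h) - 1" by (simp add: cong_iff_dvd_diff)
  also have "int g ^ (2 * h) - 1 = (?x - 1) * (?x + 1)"
    by (simp only: mult_2 power_add) (simp add: algebra_simps)
  finally have "int q dvd ?x - 1 \<or> int q dvd ?x + 1"
    using q(1) prime_dvd_multD[of "int q"] by (metis prime_nat_int_transfer)
  moreover have "\<not> int q dvd ?x - 1"
  proof
    assume "int q dvd ?x - 1"
    hence "[int g ^ h = 1] (mod int q)" by (simp add: cong_iff_dvd_diff)
    hence "[g ^ h = 1] (mod q)" using cong_int_iff[of "g^h" 1 q] by simp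
    hence "ord q g dvd h" using ord_divides by blast
    hence "q - 1 \<le> h" using ord h q(2) dvd_imp_le[of "q - 1" h] by simp
    thus False using h q(2) by simp
  qed
  ultimately show ?thesis using h by (simp add: cong_iff_dvd_diff)
qed

lemma finite_even_characters: "prime q \<Longrightarrow> finite (even_characters q)"
  by (rule finite_subset[OF _ conjunct1[OF card_dirichlet_characters_le]])
     (auto simp: even_characters_def)

text \<open>With \<open>h = (q - 1) div 2\<close> and \<open>w\<close> of order \<open>h\<close>,
  the value at \<open>-1\<close>, which is \<open>g ^ h\<close> modulo \<open>q\<close>, becomes
  \<open>w ^ h = 1\<close>. The character distinguishes residues exactly up to sign, which is as
  much as even characters can do.\<close>

lemma even_character_separating:
  assumes q: "prime q" "q > 2" and g: "residue_primroot q g"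
  obtains \<psi> where "\<psi> \<in> even_characters q" "\<And>i. \<psi> (int g ^ i) = cis (2 * pi * real i / real ((q - 1) div 2))"
proof -
  define h where "h = (q - 1) div 2"
  have "odd q" using prime_odd_nat[of q] q by simp
  hence h: "q - 1 = h * 2" "h > 0" using q(2) by (auto simp: h_def elim: oddE)
  define w where "w = cis (2 * pi / real h)"
  have wp: "w ^ i = cis (2 * pi * real i / real h)" for i by (simp add: w_def Complex.DeMoivre field_simps)
  have wh: "w ^ h = 1" using h wp[of h] by simp
  obtain \<psi> where \<psi>: "dirichlet_character q \<psi>" "\<And>i. \<psi> (int g ^ i) = w ^ i"
    using dirichlet_character_of_root_unity[OF q(1) g, of w] wh h(1) by (auto simp: power_mult)
  have "\<psi> (-1) = w ^ h"
    using dirichlet_character_cong[OF \<psi>(1) primroot_half_power[OF q g]] \<psi>(2) h_def by simp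
  hence "\<psi> \<in> even_characters q" using \<psi>(1) wh by (simp add: even_characters_def)
  moreover have "\<psi> (int g ^ i) = cis (2 * pi * real i / real ((q - 1) div 2))" for i
    using \<psi>(2)[of i] wp[of i] by (simp only: h_def)
  ultimately show ?thesis by (rule that)
qed

lemma cis_eq_imp_cong:
  assumes "h > 0" "cis (2 * pi * real i / real h) = cis (2 * pi * real j / real h)"
  shows "[i = j] (mod h)"
proof -
  have "exp (\<i> * of_real (2 * pi * real i / real h)) = exp (\<i> * of_real (2 * pi * real j / real h))"
    using assms(2) by (simp add: cis_conv_exp)
  then obtain n :: int where "\<i> * complex_of_real (2 * pi * real i / real h) = 
     \<i> * complex_of_real (2 * pi * real j / real h) + of_int (2 * n) * pi * \<i>"
    unfolding exp_eq by blast
  hence "\<i> * complex_of_real (2 * pi * real i / real h) = \<i> * complex_of_real (2 * pi * real j / real h + 2 * of_int n * pi)"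
    by (simp add: algebra_simps)
  hence "2 * pi * real i / real h = 2 * pi * real j / real h + 2 * of_int n * pi"
    by (simp only: mult_cancel_left complex_i_not_zero of_real_eq_iff simp_thms)
  hence "pi * (real i) = pi * (real j + of_int n * real h)" using assms(1) by (simp add: field_simps)
  hence "real i = real j + of_int n * real h" by simp
  hence "real_of_int (int i) = real_of_int (int j + n * int h)" by simp
  hence "int i = int j + n * int h" by linarith
  hence "[int i = int j] (mod int h)" by (simp add: cong_def)
  thus ?thesis by (simp add: cong_int_iff)
qed

lemma card_even_characters_ge:
  assumes q: "prime q" "q > 2"
  shows "card (even_characters q) \<ge> (q - 1) div 2"
proof -
  obtain g where g: "residue_primroot q g" using residue_primroot_prime_exists[OF q(1)] .
  obtain \<psi> where \<psi>: "\<psi> \<in> even_characters q" "\<And>i. \<psi> (int g ^ i) = cis (2 * pi * real i / real ((q - 1) div 2))"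
    using even_character_separating[OF q g] by metis
  define h where "h = (q - 1) div 2"
  have h: "h > 0" using q by (simp add: h_def)
  have dc: "dirichlet_character q \<psi>" using \<psi> by (simp add: even_characters_def)
  \<comment> \<open>The zeroth power has to be the principal character, so the value 0 off the
    coprime arguments is imposed instead of being taken from \<open>\<psi> a ^ k\<close>.\<close>
  define P where "P k = (\<lambda>a. if coprime a (int q) then \<psi> a ^ k else 0)" for k
  have "dirichlet_character q (P k)" for k
    using dc by (auto simp: P_def dirichlet_character_def power_mult_distrib coprime_add_modulus_iff)
  hence sub: "P ` {..<h} \<subseteq> even_characters q"
    using \<psi>(1) by (auto simp: even_characters_def P_def)
  have cg: "coprime (int g) (int q)" using g by (simp add: residue_primroot_def coprime_commute)
  have "inj_on P {..<h}"
  proof (rule inj_onI)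
    fix k l assume kl: "k \<in> {..<h}" "l \<in> {..<h}" "P k = P l"
    have "P k (int g) = cis (2 * pi * real k / real h)" for k
      using \<psi>(2)[of 1] cg by (simp add: P_def h_def Complex.DeMoivre mult_ac)
    hence "[k = l] (mod h)" using kl cis_eq_imp_cong[OF h] by metis
    thus "k = l" using kl by (simp add: cong_def)
  qed
  hence "card {..<h} \<le> card (even_characters q)"
    by (rule card_inj_on_le[OF _ sub finite_even_characters[OF q(1)]])
  thus ?thesis by (simp add: h_def)
qed

text \<open>Multiplication by the separating character \<open>\<omega>\<close> permutes the even
  characters, so the sum equals itself times \<open>\<omega> a * cnj (\<omega> b)\<close>, a factor
  other than 1 unless \<open>a\<close> is congruent to \<open>b\<close> or
  \<open>-b\<close>.\<close>

lemma even_characters_orthogonality: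
  assumes q: "prime q" "q > 2" and a: "coprime a (int q)" and b: "coprime b (int q)"
  shows "(\<Sum>\<psi>\<in>even_characters q. \<psi> a * cnj (\<psi> b)) =
           (if [a = b] (mod int q) \<or> [a = -b] (mod int q) then of_nat (card (even_characters q)) else 0)"
proof (cases "[a = b] (mod int q) \<or> [a = -b] (mod int q)")
  case True
  have "\<psi> a * cnj (\<psi> b) = 1" if \<psi>: "\<psi> \<in> even_characters q" for \<psi>
  proof -
    have dc: "dirichlet_character q \<psi>" and ev: "\<psi> (-1) = 1" using \<psi> by (auto simp: even_characters_def)
    have "\<psi> (-b) = \<psi> b" using dirichlet_character_mult[OF dc, of "-1" b] ev by simp
    hence "\<psi> a = \<psi> b" using True dirichlet_character_cong[OF dc] by metis
    thus ?thesis using dirichlet_character_norm[OF dc b] by (simp add: complex_norm_square[symmetric])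
  qed
  thus ?thesis using True by simp
next
  case False
  obtain g where g: "residue_primroot q g" using residue_primroot_prime_exists[OF q(1)] .
  obtain \<omega> where \<omega>: "\<omega> \<in> even_characters q" "\<And>i. \<omega> (int g ^ i) = cis (2 * pi * real i / real ((q - 1) div 2))"
    using even_character_separating[OF q g] by metis
  have dc: "dirichlet_character q \<omega>" using \<omega> by (auto simp: even_characters_def)
  define h where "h = (q - 1) div 2"
  have h: "h > 0" using q by (simp add: h_def)
  have "odd q" using prime_odd_nat[of q] q by simp
  hence q2h: "q - 1 = h * 2" by (auto simp: h_def elim: oddE)
  \<comment> \<open>If the factor were 1, the exponents of \<open>a\<close> and \<open>b\<close>
    would agree modulo \<open>h\<close>, and a shift of the exponent by \<open>h\<close> multiplies
    by \<open>g ^ h\<close>, that is by \<open>-1\<close>.\<close>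
  have ne: "\<omega> a * cnj (\<omega> b) \<noteq> 1"
  proof
    assume *: "\<omega> a * cnj (\<omega> b) = 1"
    have "\<omega> a = \<omega> a * (cnj (\<omega> b) * \<omega> b)"
      using dirichlet_character_norm[OF dc b] by (simp add: complex_norm_square[symmetric] mult.commute)
    hence eq: "\<omega> a = \<omega> b" using * by (simp add: mult.assoc[symmetric])
    obtain i where i: "[a = int g ^ i] (mod int q)" using residue_primroot_generates[OF q(1) g a] .
    obtain j where j: "[b = int g ^ j] (mod int q)" using residue_primroot_generates[OF q(1) g b] .
    have "cis (2 * pi * real i / real h) = cis (2 * pi * real j / real h)"
      using eq \<omega>(2) dirichlet_character_cong[OF dc i] dirichlet_character_cong[OF dc j] h_def by simp
    hence ij: "[i = j] (mod h)" by (rule cis_eq_imp_cong[OF h])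
    have mk: "[int g ^ (j + h * k) = int g ^ j * (-1) ^ k] (mod int q)" for j k
      using cong_mult[OF cong_refl[of "int g ^ j"] cong_pow[OF primroot_half_power[OF q g], of k]]
      by (simp add: power_add power_mult h_def)
    have key: "[int g ^ i = int g ^ j] (mod int q) \<or> [int g ^ i = - (int g ^ j)] (mod int q)"
      if ij: "[i = j] (mod h)" and "i \<ge> j" for i j
    proof -
      obtain k where "i = k * h + j" using \<open>[i = j] (mod h)\<close> \<open>i \<ge> j\<close> cong_le_nat[of j i h] by blast
      hence "i = j + h * k" by (simp add: mult.commute)
      thus ?thesis using mk[of j k] by (cases "even k") auto
    qed
    have "[int g ^ i = int g ^ j] (mod int q) \<or> [int g ^ i = - (int g ^ j)] (mod int q)"
    proof (cases "i \<ge> j")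
      case False
      hence "[int g ^ j = int g ^ i] (mod int q) \<or> [int g ^ j = - (int g ^ i)] (mod int q)"
        using key[of j i] ij cong_sym by auto
      thus ?thesis
        by (metis cong_minus_minus_iff cong_sym minus_minus)
    qed (use key ij in auto)
    hence "[a = b] (mod int q) \<or> [a = -b] (mod int q)"
      using i j by (metis cong_minus_minus_iff cong_sym cong_trans)
    with False show False by blast
  qed
  let ?S = "\<Sum>\<psi>\<in>even_characters q. \<psi> a * cnj (\<psi> b)"
  let ?f = "\<lambda>\<psi> x. \<omega> x * \<psi> x"
  have sub: "?f ` even_characters q \<subseteq> even_characters q"
    using \<omega>(1) by (auto simp: even_characters_def intro: dirichlet_character_times)
  have inj: "inj_on ?f (even_characters q)"
  proof (rule inj_onI)
    fix \<psi> \<theta> assume *: "\<psi> \<in> even_characters q" "\<theta> \<in> even_characters q" "?f \<psi> = ?f \<theta>"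
    show "\<psi> = \<theta>"
    proof
      fix x show "\<psi> x = \<theta> x"
      proof (cases "coprime x (int q)")
        case True
        hence "\<omega> x \<noteq> 0" using dirichlet_character_eq_0_iff[OF dc] by simp
        thus ?thesis using fun_cong[OF *(3), of x] by simp
      next
        case False
        moreover have "dirichlet_character q \<psi>" "dirichlet_character q \<theta>"
          using *(1,2) by (auto simp: even_characters_def)
        ultimately show ?thesis using dirichlet_character_eq_0_iff by metis
      qed
    qed
  qed
  have "bij_betw ?f (even_characters q) (even_characters q)"
    using sub inj endo_inj_surj[OF finite_even_characters[OF q(1)] sub inj] by (simp add: bij_betw_def)
  hence "?S = (\<Sum>\<psi>\<in>even_characters q. ?f \<psi> a * cnj (?f \<psi> b))"
    using sum.reindex_bij_betw[of ?f _ _ "\<lambda>\<psi>. \<psi> a * cnj (\<psi> b)"] by simp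
  also have "\<dots> = \<omega> a * cnj (\<omega> b) * ?S" by (simp add: sum_distrib_left mult_ac)
  finally have "(\<omega> a * cnj (\<omega> b) - 1) * ?S = 0" by (simp add: algebra_simps)
  hence "?S = 0" using ne by simp
  with False show ?thesis by simp
qed

section \<open>Central values as limits of partial sums\<close>

lemma sum_by_parts_lessThan:
  fixes a w :: "nat \<Rightarrow> 'a :: comm_ring"
  shows "(\<Sum>i<n. a i * w i) = sum a {..<n} * w n + (\<Sum>i<n. sum a {..<Suc i} * (w i - w (Suc i)))"
  by (induction n) (simp_all add: algebra_simps)

text \<open>Summation by parts, with telescoping differences of \<open>w\<close>. The bound is
  uniform in \<open>n\<close> and keeps only the first weight, as needed to dominate partial sums
  under an integral.\<close>

lemma norm_sum_mult_antimono_le: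
  fixes a :: "nat \<Rightarrow> 'a :: real_normed_field" and w :: "nat \<Rightarrow> real"
  assumes bd: "\<And>n. norm (sum a {..<n}) \<le> C"
    and dec: "\<And>n. w (Suc n) \<le> w n" and nn: "\<And>n. 0 \<le> w n"
  shows "norm (\<Sum>i<n. a i * of_real (w i)) \<le> C * w 0"
proof -
  have C: "0 \<le> C" using bd[of 0] by simp
  have "norm (\<Sum>i<n. a i * of_real (w i)) 
     \<le> norm (sum a {..<n} * of_real (w n)) + (\<Sum>i<n. norm (sum a {..<Suc i} * (of_real (w i) - of_real (w (Suc i)))))"
    unfolding sum_by_parts_lessThan[of a "\<lambda>i. of_real (w i)" n] by (rule order_trans[OF norm_triangle_ineq add_left_mono[OF norm_sum]])
  also have "\<dots> \<le> C * w n + (\<Sum>i<n. C * (w i - w (Suc i)))"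
  proof (intro add_mono sum_mono)
    show "norm (sum a {..<n} * of_real (w n)) \<le> C * w n"
      using bd nn[of n] C by (simp add: norm_mult mult_mono)
    fix i
    have "norm (of_real (w i) - of_real (w (Suc i)) :: 'a) = w i - w (Suc i)"
      using dec[of i] by (metis abs_of_nonneg diff_ge_0_iff_ge norm_of_real of_real_diff)
    thus "norm (sum a {..<Suc i} * (of_real (w i) - of_real (w (Suc i)))) \<le> C * (w i - w (Suc i))"
      unfolding norm_mult using bd[of "Suc i"] dec[of i] C by (intro mult_mono) auto
  qed
  also have "(\<Sum>i<n. C * (w i - w (Suc i))) = C * (w 0 - w n)"
    by (simp only: sum_distrib_left[symmetric] sum_lessThan_telescope')
  also have "C * w n + C * (w 0 - w n) = C * w 0"
    by (simp add: algebra_simps)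
  finally show ?thesis .
qed

lemma dirichlet_character_sum_zero:
  assumes q: "prime q" and dc: "dirichlet_character q \<psi>" and np: "\<psi> \<noteq> principal q"
  shows "(\<Sum>a\<in>{0..<int q}. \<psi> a) = 0"
proof -
  have q0: "int q > 0" using q prime_gt_0_nat by simp
  obtain b where b: "coprime b (int q)" "\<psi> b \<noteq> 1"
  proof -
    obtain b where b: "\<psi> b \<noteq> principal q b" using np by (auto simp: fun_eq_iff)
    hence "coprime b (int q)" using dirichlet_character_eq_0_iff[OF dc, of b] by (auto simp: principal_def)
    with b show ?thesis using that[of b] by (simp add: principal_def)
  qed
  let ?f = "\<lambda>a. (b * a) mod int q"
  have inj: "inj_on ?f {0..<int q}"
  proof (rule inj_onI)
    fix x y assume xy: "x \<in> {0..<int q}" "y \<in> {0..<int q}" "?f x = ?f y"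
    hence "[b * x = b * y] (mod int q)" by (simp add: cong_def)
    hence "[x = y] (mod int q)" using cong_mult_lcancel[OF b(1)] by simp
    thus "x = y" using xy by (simp add: cong_def)
  qed
  have sub: "?f ` {0..<int q} \<subseteq> {0..<int q}" using q0 by auto
  have "?f ` {0..<int q} = {0..<int q}" by (rule endo_inj_surj[OF _ sub inj]) simp
  hence "bij_betw ?f {0..<int q} {0..<int q}" using inj by (simp add: bij_betw_def)
  hence "(\<Sum>a\<in>{0..<int q}. \<psi> a) = (\<Sum>a\<in>{0..<int q}. \<psi> (?f a))"
    using sum.reindex_bij_betw[of ?f _ _ \<psi>] by simp
  also have "\<dots> = (\<Sum>a\<in>{0..<int q}. \<psi> b * \<psi> a)"
  proof (rule sum.cong[OF refl])
    fix a
    have "[?f a = b * a] (mod int q)" by (simp add: cong_def)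
    from dirichlet_character_cong[OF dc this] show "\<psi> (?f a) = \<psi> b * \<psi> a"
      by (simp add: dirichlet_character_mult[OF dc])
  qed
  also have "\<dots> = \<psi> b * (\<Sum>a\<in>{0..<int q}. \<psi> a)" by (simp add: sum_distrib_left)
  finally have "(\<psi> b - 1) * (\<Sum>a\<in>{0..<int q}. \<psi> a) = 0" by (simp add: algebra_simps)
  with b(2) show ?thesis by simp
qed

text \<open>Full periods cancel, so fewer than \<open>q\<close> terms of norm at most 1 are left.
  Starting at 1 changes nothing because \<open>\<psi> 0 = 0\<close>.\<close>

lemma dirichlet_character_partial_sums_bounded:
  assumes q: "prime q" and dc: "dirichlet_character q \<psi>" and np: "\<psi> \<noteq> principal q"
  shows "norm (\<Sum>i<n. \<psi> (int (Suc i))) \<le> real q"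
proof -
  have q0: "q > 0" using q prime_gt_0_nat by simp
  define S where "S n = (\<Sum>i<n. \<psi> (int i))" for n
  have Sq: "S q = 0"
  proof -
    have "S q = (\<Sum>a\<in>int ` {..<q}. \<psi> a)" by (simp add: S_def sum.reindex)
    also have "int ` {..<q} = {0..<int q}" by (simp add: image_int_atLeastLessThan lessThan_atLeast0)
    finally show ?thesis using dirichlet_character_sum_zero[OF assms] by simp
  qed
  have per: "S (m + q) = S m" for m
  proof (induction m)
    case (Suc m)
    have "\<psi> (int (m + q)) = \<psi> (int m)" using dc by (simp add: dirichlet_character_def)
    with Suc show ?case by (simp add: S_def)
  qed (simp add: S_def Sq[unfolded S_def])
  have "norm (S m) \<le> real q" for m
  proof (induction m rule: less_induct)
    case (less m)
    show ?case
    proof (cases "m < q")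
      case True
      have "norm (S m) \<le> (\<Sum>i<m. norm (\<psi> (int i)))" unfolding S_def by (rule norm_sum)
      also have "\<dots> \<le> (\<Sum>i<m. 1)" by (intro sum_mono dirichlet_character_norm_le_1[OF dc])
      finally show ?thesis using True by simp
    next
      case False
      then obtain k where k: "m = k + q" by (metis le_add_diff_inverse2 not_less)
      thus ?thesis using less[of k] per[of k] q0 by simp
    qed
  qed
  moreover have "S (Suc n) = (\<Sum>i<n. \<psi> (int (Suc i)))"
  proof -
    have "\<not> coprime 0 (int q)" using q prime_gt_1_nat[OF q] by simp
    hence "\<psi> 0 = 0" using dirichlet_character_eq_0_iff[OF dc] by simp
    thus ?thesis unfolding S_def by (simp only: sum.lessThan_Suc_shift) simp
  qed
  ultimately show ?thesis by metis
qed

lemma norm_powr_diff_le: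
  fixes z :: complex
  assumes "0 < Re z"
  shows "norm (of_nat (Suc n) powr (-z) - of_nat (Suc (Suc n)) powr (-z)) \<le> norm z * real (Suc n) powr (- Re z - 1)"
proof -
  let ?S = "closed_segment (of_nat (Suc n)) (of_nat (Suc (Suc n))) :: complex set"
  have el: "\<exists>x\<ge>real (Suc n). w = of_real x" if "w \<in> ?S" for w
  proof -
    obtain u where u: "0 \<le> u" "w = (1 - u) *\<^sub>R of_nat (Suc n) + u *\<^sub>R of_nat (Suc (Suc n))"
      using \<open>w \<in> ?S\<close> unfolding closed_segment_def by auto
    hence "w = of_real (real (Suc n) + u)" by (simp add: scaleR_conv_of_real algebra_simps)
    with u(1) show ?thesis by (intro exI[of _ "real (Suc n) + u"]) auto
  qed
  have "norm (of_nat (Suc (Suc n)) powr (-z) - of_nat (Suc n) powr (-z)) \<le> 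
     (norm z * real (Suc n) powr (- Re z - 1)) * norm (of_nat (Suc (Suc n)) - of_nat (Suc n) :: complex)"
  proof (rule field_differentiable_bound[of ?S _ "\<lambda>w. -z * w powr (-z - 1)"])
    fix w assume "w \<in> ?S"
    then obtain x where x: "x \<ge> real (Suc n)" "w = of_real x" using el by blast
    have x0: "x > 0" using x(1) by linarith
    show "((\<lambda>w. w powr - z) has_field_derivative - z * w powr (- z - 1)) (at w within ?S)"
    proof (rule has_field_derivative_at_within, rule has_field_derivative_powr)
      show "w \<notin> \<real>\<^sub>\<le>\<^sub>0" using x0 x(2) by (simp add: complex_nonpos_Reals_iff)
    qed
    have "norm (w powr (- z - 1)) = x powr (- Re z - 1)"
      using x0 by (subst x(2), subst norm_powr_real_powr) auto
    also have "\<dots> \<le> real (Suc n) powr (- Re z - 1)"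
      using x(1) assms by (intro powr_mono2') auto
    finally show "norm (- z * w powr (- z - 1)) \<le> norm z * real (Suc n) powr (- Re z - 1)"
      by (simp only: norm_mult norm_minus_cancel mult_left_mono norm_ge_zero)
  qed auto
  thus ?thesis by (simp add: norm_minus_commute)
qed

text \<open>Summation by parts trades a conditionally convergent series for one with terms of order
  \<open>n powr (- Re z - 1)\<close>, by the mean value bound on differences of powers. The new
  series converges locally uniformly, hence to a holomorphic function, and the boundary term tends
  to 0.\<close>

lemma bounded_partial_sums_dirichlet_series:
  fixes a :: "nat \<Rightarrow> complex"
  assumes bd: "\<And>n. norm (sum a {..<n}) \<le> C"
  obtains f where "f holomorphic_on {z. Re z > 0}"
    "\<And>z. Re z > 0 \<Longrightarrow> (\<lambda>n. a n / of_nat (Suc n) powr z) sums f z"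
proof -
  have C: "0 \<le> C" using bd[of 0] by simp
  define t where "t i z = sum a {..<Suc i} * (of_nat (Suc i) powr (-z) - of_nat (Suc (Suc i)) powr (-z))" for i and z :: complex
  define f where "f z = (\<Sum>i. t i z)" for z
  have hol: "f holomorphic_on {z. Re z > 0}"
  proof (rule holomorphic_uniform_sequence)
    show "open {z. Re z > 0}" by (rule open_halfspace_Re_gt)
    show "(\<lambda>z. \<Sum>i<n. t i z) holomorphic_on {z. Re z > 0}" for n
      unfolding t_def by (auto intro!: holomorphic_intros)
    fix x assume "x \<in> {z. Re z > 0}"
    hence x: "Re x > 0" by simp
    define d where "d = Re x / 2"
    have d: "d > 0" using x by (simp add: d_def)
    have Rz: "Re z \<ge> d" "norm z \<le> norm x + d" if "z \<in> cball x d" for z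
    proof -
      have nd: "norm (x - z) \<le> d" using that by (simp add: dist_norm)
      hence "Re (x - z) \<le> d" using complex_Re_le_cmod[of "x - z"] by linarith
      thus "Re z \<ge> d" by (simp add: d_def)
      show "norm z \<le> norm x + d" using nd norm_triangle_ineq2[of z x] by (simp add: norm_minus_commute)
    qed
    have "uniform_limit (cball x d) (\<lambda>n z. \<Sum>i<n. t i z) (\<lambda>z. suminf (\<lambda>i. t i z)) sequentially"
    proof (rule Weierstrass_m_test)
      fix n z assume z: "z \<in> cball x d"
      have "norm (t n z) \<le> C * (norm z * real (Suc n) powr (- Re z - 1))"
        unfolding t_def norm_mult using bd[of "Suc n"] norm_powr_diff_le[of z n] Rz(1)[OF z] d C
        by (intro mult_mono) auto
      also have "\<dots> \<le> C * ((norm x + d) * real (Suc n) powr (- d - 1))"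
        using Rz[OF z] d C by (intro mult_left_mono mult_mono powr_mono) auto
      finally show "norm (t n z) \<le> C * ((norm x + d) * real (Suc n) powr (- d - 1))" .
    next
      have "summable (\<lambda>n. real n powr (- d - 1))" using d by (subst summable_real_powr_iff) auto
      hence "summable (\<lambda>n. real (Suc n) powr (- d - 1))" by (subst summable_Suc_iff)
      thus "summable (\<lambda>n. C * ((norm x + d) * real (Suc n) powr (- d - 1)))" by (intro summable_mult)
    qed
    thus "\<exists>d>0. cball x d \<subseteq> {z. 0 < Re z} \<and> uniform_limit (cball x d) (\<lambda>n z. \<Sum>i<n. t i z) f sequentially"
      using d Rz(1) unfolding f_def by (intro exI[of _ d]) force
  qed
  have "(\<lambda>n. a n / of_nat (Suc n) powr z) sums f z" if z: "Re z > 0" for z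
  proof -
    have "summable (\<lambda>i. t i z)"
    proof (rule summable_comparison_test')
      have "summable (\<lambda>n. real n powr (- Re z - 1))" using z by (subst summable_real_powr_iff) auto
      hence "summable (\<lambda>n. real (Suc n) powr (- Re z - 1))" by (subst summable_Suc_iff)
      thus "summable (\<lambda>n. C * (norm z * real (Suc n) powr (- Re z - 1)))" by (intro summable_mult)
      show "norm (t n z) \<le> C * (norm z * real (Suc n) powr (- Re z - 1))" for n
        unfolding t_def norm_mult using bd[of "Suc n"] norm_powr_diff_le[of z n] z C
        by (intro mult_mono) auto
    qed
    hence l1: "(\<lambda>n. \<Sum>i<n. t i z) \<longlonglongrightarrow> f z" unfolding f_def by (rule summable_LIMSEQ)
    have l2: "(\<lambda>n. sum a {..<n} * of_nat (Suc n) powr (-z)) \<longlonglongrightarrow> 0"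
    proof (rule Lim_null_comparison)
      show "eventually (\<lambda>n. norm (sum a {..<n} * of_nat (Suc n) powr (-z)) \<le> C * real (Suc n) powr (- Re z)) sequentially"
      proof (rule always_eventually, rule allI)
        fix n
        have "norm ((of_nat (Suc n) :: complex) powr (-z)) = real (Suc n) powr (- Re z)"
          by (subst norm_powr_real_powr) (auto simp del: of_nat_Suc)
        thus "norm (sum a {..<n} * of_nat (Suc n) powr (-z)) \<le> C * real (Suc n) powr (- Re z)"
          unfolding norm_mult using bd[of n] by (simp add: mult_right_mono del: of_nat_Suc)
      qed
      have "(\<lambda>n. C * real n powr (- Re z)) \<longlonglongrightarrow> C * 0"
        using z by (intro tendsto_mult tendsto_const tendsto_neg_powr filterlim_real_sequentially) auto
      thus "(\<lambda>n. C * real (Suc n) powr (- Re z)) \<longlonglongrightarrow> 0" using LIMSEQ_Suc by fastforce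
    qed
    have "(\<Sum>i<n. a i / of_nat (Suc i) powr z) = sum a {..<n} * of_nat (Suc n) powr (-z) + (\<Sum>i<n. t i z)" for n
      using sum_by_parts_lessThan[of a "\<lambda>i. of_nat (Suc i) powr (-z)" n]
      by (simp add: t_def powr_minus divide_inverse)
    with tendsto_add[OF l2 l1] show ?thesis by (simp add: sums_def)
  qed
  thus ?thesis using that hol by blast
qed

text \<open>The sum \<open>f\<close> of the series is one continuation; by the identity theorem on
  the connected punctured half-plane every other one agrees with it at 1/2. So the definite
  description denotes the conditionally convergent sum.\<close>

theorem dirichlet_L_half_sums:
  assumes q: "prime q" and dc: "dirichlet_character q \<psi>" and np: "\<psi> \<noteq> principal q"
  shows "(\<lambda>n. \<psi> (int (Suc n)) / of_real (sqrt (real (Suc n)))) sums dirichlet_L (1/2) \<psi>"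
proof -
  obtain f where f: "f holomorphic_on {z. Re z > 0}"
    "\<And>z. Re z > 0 \<Longrightarrow> (\<lambda>n. \<psi> (int (Suc n)) / of_nat (Suc n) powr z) sums f z"
    using bounded_partial_sums_dirichlet_series[of "\<lambda>n. \<psi> (int (Suc n))" "real q"] 
      dirichlet_character_partial_sums_bounded[OF assms] by blast
  let ?D = "{z. Re z > 0} - {1 :: complex}"
  have op: "open {z. Re z > 0}" "open ?D" by (auto intro!: open_halfspace_Re_gt open_delete)
  have conn: "connected ?D"
    by (intro connected_open_delete op convex_connected convex_halfspace_Re_gt) simp
  have "dirichlet_L (1/2) \<psi> = f (1/2)"
    unfolding dirichlet_L_def
  proof (rule the_equality)
    have "f holomorphic_on ?D" using f(1) by (rule holomorphic_on_subset) auto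
    moreover have "f z = dirichlet_series \<psi> z" if "1 < Re z" for z
      using f(2)[of z] that by (simp add: dirichlet_series_def sums_iff)
    ultimately show "\<exists>g. g holomorphic_on ?D \<and> (\<forall>z. Re z > 1 \<longrightarrow> g z = dirichlet_series \<psi> z) \<and> g (1/2) = f (1/2)"
      by blast
  next
    fix v assume "\<exists>g. g holomorphic_on ?D \<and> (\<forall>z. 1 < Re z \<longrightarrow> g z = dirichlet_series \<psi> z) \<and> g (1/2) = v"
    then obtain g where g: "g holomorphic_on ?D" "\<And>z. 1 < Re z \<Longrightarrow> g z = dirichlet_series \<psi> z" "g (1/2) = v"
      by blast
    have "g (1/2) = f (1/2)"
    proof (rule analytic_continuation_open[where s = "{z. Re z > 1}" and s' = ?D and f = g and g = f and z = "1/2"])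
      show "open {z. Re z > 1}" by (rule open_halfspace_Re_gt)
      show "{z. Re z > 1} \<noteq> {}" by (auto intro: exI[of _ 2])
      show "f holomorphic_on ?D" using f(1) by (rule holomorphic_on_subset) auto
      show "g z = f z" if "z \<in> {z. Re z > 1}" for z
        using f(2)[of z] that g(2)[of z] by (simp add: dirichlet_series_def sums_iff)
    qed (use g op conn in auto)
    with g show "v = f (1/2)" by simp
  qed
  moreover have "(of_nat (Suc n) :: complex) powr (1/2) = of_real (sqrt (real (Suc n)))" for n
  proof -
    have "(of_nat (Suc n) :: complex) powr (1/2) = of_real (real (Suc n)) powr of_real (1/2)"
      by simp
    also have "\<dots> = of_real (real (Suc n) powr (1/2))" by (rule powr_of_real) simp
    finally show ?thesis by (simp add: powr_half_sqrt)
  qed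
  ultimately show ?thesis using f(2)[of "1/2"] by simp
qed

section \<open>Poisson summation and the theta functional equation\<close>

lemma cos_2pi_antimono: "0 \<le> x \<Longrightarrow> x \<le> y \<Longrightarrow> y \<le> 1/2 \<Longrightarrow> cos (2 * pi * y) \<le> cos (2 * pi * x)"
  by (rule cos_monotone_0_pi_le) auto

lemma cos_2pi_strict_antimono: "0 \<le> x \<Longrightarrow> x < y \<Longrightarrow> y \<le> 1/2 \<Longrightarrow> cos (2 * pi * y) < cos (2 * pi * x)"
  by (rule cos_monotone_0_pi) auto

text \<open>
  If \<open>D\<close> were positive on a neighbourhood of \<open>0\<close>, the powers of \<open>\<alpha> + cos (2 \<pi> x)\<close>, which are at least \<open>1\<close> near \<open>0\<close> and at
  most \<open>1\<close> in absolute value elsewhere, would concentrate the integral there.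
\<close>
lemma cos_coefficients_zero_imp_nonpos:
  fixes D :: "real \<Rightarrow> real"
  assumes cont: "continuous_on {-1/2..1/2} D"
    and coeff: "\<And>k::nat. integral {-1/2..1/2} (\<lambda>x. D x * cos (2 * pi * k * x)) = 0"
  shows "D 0 \<le> 0"
proof (rule ccontr)
  assume "\<not> D 0 \<le> 0"
  hence D0: "D 0 > 0" by simp
  have "\<exists>d>0. \<forall>x\<in>{-1/2..1/2}. dist x 0 < d \<longrightarrow> dist (D x) (D 0) < D 0 / 2"
    using cont[unfolded continuous_on_iff, rule_format, of 0 "D 0 / 2"] D0 by simp
  then obtain d where d: "d > 0" and d': "\<forall>x\<in>{-1/2..1/2}. dist x 0 < d \<longrightarrow> dist (D x) (D 0) < D 0 / 2"
    by blast
  have d2: "\<bar>D x - D 0\<bar> < D 0 / 2" if "\<bar>x\<bar> \<le> 1/2" "\<bar>x\<bar> < d" for x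
  proof -
    have "x \<in> {-1/2..1/2}" using that by (auto simp: abs_le_iff)
    with d' that show ?thesis by (simp add: dist_real_def)
  qed
  define \<delta> where "\<delta> = min (d / 2) (1/4)"
  have \<delta>: "\<delta> > 0" "\<delta> < d" "\<delta> \<le> 1/4" using d by (auto simp: \<delta>_def)
  define \<alpha> where "\<alpha> = 1 - cos (2 * pi * \<delta>)"
  define T where "T x = \<alpha> + cos (2 * pi * x)" for x
  have cosd: "0 \<le> cos (2 * pi * \<delta>)" using cos_2pi_antimono[of \<delta> "1/4"] \<delta> by simp
  have cosd1: "cos (2 * pi * \<delta>) < 1" 
    using cos_2pi_strict_antimono[of 0 \<delta>] \<delta> by simp
  have near: "T x \<ge> 1 + (cos (2 * pi * (\<delta>/2)) - cos (2 * pi * \<delta>))" if "\<bar>x\<bar> \<le> \<delta>/2" for x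
  proof -
    have "cos (2 * pi * (\<delta>/2)) \<le> cos (2 * pi * \<bar>x\<bar>)"
      using that \<delta> by (intro cos_2pi_antimono) auto
    also have "cos (2 * pi * \<bar>x\<bar>) = cos (2 * pi * x)" by (cases "x \<ge> 0") (auto simp: abs_if)
    finally show ?thesis by (simp add: T_def \<alpha>_def)
  qed
  define \<eta> where "\<eta> = cos (2 * pi * (\<delta>/2)) - cos (2 * pi * \<delta>)"
  have \<eta>: "\<eta> > 0" unfolding \<eta>_def using \<delta> cos_2pi_strict_antimono[of "\<delta>/2" \<delta>] by simp
  have mid: "T x \<ge> 1" if "\<bar>x\<bar> \<le> \<delta>" for x
  proof -
    have "cos (2 * pi * \<delta>) \<le> cos (2 * pi * \<bar>x\<bar>)"
      using that \<delta> by (intro cos_2pi_antimono) auto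
    also have "cos (2 * pi * \<bar>x\<bar>) = cos (2 * pi * x)" by (cases "x \<ge> 0") (auto simp: abs_if)
    finally show ?thesis by (simp add: T_def \<alpha>_def)
  qed
  have far: "\<bar>T x\<bar> \<le> 1" if "\<bar>x\<bar> \<ge> \<delta>" "\<bar>x\<bar> \<le> 1/2" for x
  proof -
    have "cos (2 * pi * \<bar>x\<bar>) \<le> cos (2 * pi * \<delta>)"
      using that \<delta> by (intro cos_2pi_antimono) auto
    also have "cos (2 * pi * \<bar>x\<bar>) = cos (2 * pi * x)" by (cases "x \<ge> 0") (auto simp: abs_if)
    finally show ?thesis unfolding T_def \<alpha>_def abs_le_iff
      using cosd cosd1 cos_ge_minus_one[of "2 * pi * x"] by linarith
  qed
  have contT: "continuous_on S T" for S unfolding T_def by (intro continuous_intros)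
  have int: "(\<lambda>x. D x * T x ^ N * cos (2 * pi * real k * x)) integrable_on {-1/2..1/2}" for N k
    by (intro integrable_continuous_real continuous_intros cont contT)
  have zero: "integral {-1/2..1/2} (\<lambda>x. D x * T x ^ N * cos (2 * pi * real k * x)) = 0" for N k
  proof (induction N arbitrary: k)
    case 0 show ?case using coeff by simp
  next
    case (Suc N)
    \<comment> \<open>Multiplication by \<open>cos (2 * pi * x)\<close> produces the frequencies
      \<open>k + 1\<close> and \<open>\<bar>k - 1\<bar>\<close>. For \<open>k = 0\<close> the latter
      is 1, where truncated subtraction would give 0.\<close>
    define k' where "k' = (if k = 0 then 1 else k - 1)"
    have "D x * T x ^ Suc N * cos (2 * pi * real k * x) = \<alpha> * (D x * T x ^ N * cos (2 * pi * real k * x))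
       + (1/2) * (D x * T x ^ N * cos (2 * pi * real (k + 1) * x)) + (1/2) * (D x * T x ^ N * cos (2 * pi * real k' * x))" for x
    proof -
      have k': "cos (2 * pi * real k' * x) = cos (2 * pi * real k * x - 2 * pi * x)"
        by (cases "k = 0") (auto simp: k'_def of_nat_diff algebra_simps)
      have "cos (2 * pi * x) * cos (2 * pi * real k * x) = 
          (1/2) * cos (2 * pi * real (k + 1) * x) + (1/2) * cos (2 * pi * real k' * x)"
        unfolding k' by (simp add: algebra_simps cos_add cos_diff)
      hence eq: "P * (cos (2 * pi * x) * cos (2 * pi * real k * x)) = 
          (1/2) * (P * cos (2 * pi * real (k + 1) * x)) + (1/2) * (P * cos (2 * pi * real k' * x))" for P
        by (simp add: algebra_simps)
      have "D x * T x ^ Suc N * C = \<alpha> * (D x * T x ^ N * C) + D x * T x ^ N * (cos (2 * pi * x) * C)" for C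
      proof -
        have "T x ^ Suc N = T x ^ N * (\<alpha> + cos (2 * pi * x))" by (simp add: T_def)
        thus ?thesis by (simp only: distrib_left distrib_right mult_ac)
      qed
      from this[of "cos (2 * pi * real k * x)"] eq[of "D x * T x ^ N"] show ?thesis
        by linarith
    qed
    hence "integral {-1/2..1/2} (\<lambda>x. D x * T x ^ Suc N * cos (2 * pi * real k * x)) =
       integral {-1/2..1/2} (\<lambda>x. \<alpha> * (D x * T x ^ N * cos (2 * pi * real k * x))
       + (1/2) * (D x * T x ^ N * cos (2 * pi * real (k + 1) * x)) + (1/2) * (D x * T x ^ N * cos (2 * pi * real k' * x)))"
      by presburger
    also have "\<dots> = \<alpha> * 0 + (1/2) * 0 + (1/2) * 0"
      by (subst integral_add | subst integral_mult_right | subst Suc.IH | intro integrable_add integrable_on_mult_right int | rule refl)+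
    finally show ?case by simp
  qed
  have zero': "integral {-1/2..1/2} (\<lambda>x. D x * T x ^ N) = 0" for N
    using zero[of N 0] by simp
  have intN: "(\<lambda>x. D x * T x ^ N) integrable_on {-1/2..1/2}" for N
    by (intro integrable_continuous_real continuous_intros cont contT)
  obtain M where "\<forall>y\<in>D ` {-1/2..1/2}. \<bar>y\<bar> \<le> M"
    using compact_imp_bounded[OF compact_continuous_image[OF cont compact_Icc]]
    unfolding bounded_real by blast
  hence M: "\<bar>D x\<bar> \<le> M" if "x \<in> {-1/2..1/2}" for x using that by blast
  \<comment> \<open>A step function below \<open>D x * T x ^ N\<close>. Its integral is unbounded in
    \<open>N\<close>, whereas the integral of \<open>D x * T x ^ N\<close> is 0.\<close>
  define lo where "lo N x = (if \<bar>x\<bar> \<le> \<delta>/2 then (D 0 / 2) * (1 + \<eta>) ^ N else 0) - M" for N x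
  have Mpos: "M \<ge> 0" using M[of 0] by (simp add: abs_le_iff)
  have lower: "lo N x \<le> D x * T x ^ N" if x: "x \<in> {-1/2..1/2}" for N x
  proof (cases "\<bar>x\<bar> \<le> \<delta>")
    case True
    have Dx: "D x \<ge> D 0 / 2" using d2[of x] True \<delta> by (auto simp: abs_if split: if_splits)
    have T1: "T x \<ge> 1" using mid[OF True] .
    show ?thesis
    proof (cases "\<bar>x\<bar> \<le> \<delta>/2")
      case True
      have "(D 0 / 2) * (1 + \<eta>) ^ N \<le> D x * T x ^ N"
        using near[OF True] Dx D0 \<eta> by (intro mult_mono power_mono) (auto simp: \<eta>_def)
      thus ?thesis using True Mpos by (simp add: lo_def)
    next
      case False
      have "0 \<le> D x * T x ^ N" using Dx D0 T1 by simp
      thus ?thesis using False Mpos by (simp add: lo_def)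
    qed
  next
    case False
    have "\<bar>D x * T x ^ N\<bar> \<le> M * 1"
      unfolding abs_mult power_abs using M[OF x] far[of x] False x Mpos
      by (intro mult_mono power_le_one) auto
    thus ?thesis using False \<delta> Mpos by (auto simp: lo_def)
  qed
  have loI: "(lo N has_integral ((D 0 / 2) * (1 + \<eta>) ^ N * \<delta> - M)) {-1/2..1/2}" for N
  proof -
    have "((\<lambda>x. (D 0 / 2) * (1 + \<eta>) ^ N) has_integral (\<delta>/2 - (-\<delta>/2)) *\<^sub>R ((D 0 / 2) * (1 + \<eta>) ^ N)) {-\<delta>/2..\<delta>/2}"
      using has_integral_const_real[of "(D 0 / 2) * (1 + \<eta>) ^ N" "-\<delta>/2" "\<delta>/2"] \<delta> by simp
    hence "((\<lambda>x. if x \<in> {-\<delta>/2..\<delta>/2} then (D 0 / 2) * (1 + \<eta>) ^ N else 0) has_integral (\<delta>/2 - (-\<delta>/2)) *\<^sub>R ((D 0 / 2) * (1 + \<eta>) ^ N)) {-1/2..1/2}"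
      using \<delta> by (subst has_integral_restrict) auto
    moreover have "((\<lambda>x::real. M) has_integral M) {-1/2..1/2}"
      using has_integral_const_real[of M "-1/2" "1/2"] by simp
    ultimately have "((\<lambda>x. (if x \<in> {-\<delta>/2..\<delta>/2} then (D 0 / 2) * (1 + \<eta>) ^ N else 0) - M) has_integral
       ((\<delta>/2 - (-\<delta>/2)) *\<^sub>R ((D 0 / 2) * (1 + \<eta>) ^ N) - M)) {-1/2..1/2}" by (rule has_integral_diff)
    moreover have "(x \<in> {-\<delta>/2..\<delta>/2}) = (\<bar>x\<bar> \<le> \<delta>/2)" for x by auto
    ultimately show ?thesis by (simp add: lo_def[abs_def] mult_ac)
  qed
  have "(D 0 / 2) * (1 + \<eta>) ^ N * \<delta> \<le> M" for N
    using has_integral_le[OF loI[of N] integrable_integral[OF intN[of N]] lower] zero'[of N] by simp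
  hence bd: "(1 + \<eta>) ^ N \<le> 2 * M / (D 0 * \<delta>)" for N using D0 \<delta> by (simp add: field_simps)
  obtain N where "2 * M / (D 0 * \<delta>) < (1 + \<eta>) ^ N"
    using real_arch_pow[of "1 + \<eta>"] \<eta> by auto
  with bd[of N] show False by simp
qed

lemma cos_coefficients_zero_imp_zero:
  fixes D :: "real \<Rightarrow> real"
  assumes cont: "continuous_on {-1/2..1/2} D"
    and coeff: "\<And>k::nat. integral {-1/2..1/2} (\<lambda>x. D x * cos (2 * pi * k * x)) = 0"
  shows "D 0 = 0"
proof -
  have "- D 0 \<le> 0"
    by (rule cos_coefficients_zero_imp_nonpos[of "\<lambda>x. - D x"]) (use cont coeff in \<open>auto intro: continuous_intros\<close>)
  with cos_coefficients_zero_imp_nonpos[OF assms] show ?thesis by simp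
qed

text \<open>This is the characteristic function of the standard normal distribution, scaled by
  \<open>c = sqrt (2 * pi * t)\<close> to turn the density into \<open>exp (- pi * t * y^2)\<close>.
  The translation by \<open>a\<close> contributes a phase, whose real part is the cosine in
  front.\<close>

lemma gaussian_cos_integral:
  fixes t a :: real and k :: nat
  assumes t: "t > 0"
  shows "integrable lborel (\<lambda>y. exp (- pi * t * (y + a)^2) * cos (2 * pi * k * y))"
    and "(LINT y|lborel. exp (- pi * t * (y + a)^2) * cos (2 * pi * k * y)) 
           = cos (2 * pi * k * a) * exp (- pi * k^2 / t) / sqrt t"
proof -
  define c where "c = sqrt (2 * pi * t)"
  have c: "c > 0" "c^2 = 2 * pi * t" using t by (auto simp: c_def)
  define u where "u = 2 * pi * k / c"
  have gi0: "integrable lborel (\<lambda>y. std_normal_density (0 + c * y))"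
    by (rule lborel_integrable_real_affine) (use c(1) in auto)
  have ex: "sqrt (2 * pi) * std_normal_density (c * y) = exp (- pi * t * y^2)" for y
    unfolding std_normal_density_def by (simp add: power_mult_distrib c(2))
  have "integrable lborel (\<lambda>y. sqrt (2 * pi) * std_normal_density (0 + c * y))"
    by (rule integrable_mult_right[OF gi0])
  hence gi: "integrable lborel (\<lambda>y. exp (- pi * t * y^2))" by (simp only: add_0 ex)
  have gie: "integrable lborel (\<lambda>y. exp (- pi * t * y^2) *\<^sub>R iexp (2 * pi * k * y))"
    by (rule Bochner_Integration.integrable_bound[OF gi]) (auto simp del: of_real_mult)
  have "of_real (exp (- (u^2) / 2)) = (CLINT x|std_normal_distribution. iexp (u * x))"
    using fun_cong[OF char_std_normal_distribution, of u] by (simp only: char_def)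
  also have "\<dots> = (CLINT x|lborel. std_normal_density x *\<^sub>R iexp (u * x))"
    by (subst integral_density) (auto simp del: of_real_mult)
  also have "\<dots> = \<bar>c\<bar> *\<^sub>R (CLINT y|lborel. std_normal_density (0 + c * y) *\<^sub>R iexp (u * (0 + c * y)))"
    by (rule lborel_integral_real_affine) (use c in auto)
  also have "(\<lambda>y. std_normal_density (0 + c * y) *\<^sub>R iexp (u * (0 + c * y))) = 
      (\<lambda>y. (1 / sqrt (2 * pi)) *\<^sub>R (exp (- pi * t * y^2) *\<^sub>R iexp (2 * pi * k * y)))"
  proof
    fix y
    have "std_normal_density (0 + c * y) = (1 / sqrt (2 * pi)) * exp (- pi * t * y^2)"
      unfolding ex[symmetric] by simp
    moreover have "u * (0 + c * y) = 2 * pi * k * y" using c(1) by (simp add: u_def)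
    ultimately show "std_normal_density (0 + c * y) *\<^sub>R iexp (u * (0 + c * y)) = 
      (1 / sqrt (2 * pi)) *\<^sub>R (exp (- pi * t * y^2) *\<^sub>R iexp (2 * pi * k * y))"
      by (simp only: scaleR_scaleR)
  qed
  also have "\<bar>c\<bar> *\<^sub>R (CLINT y|lborel. (1 / sqrt (2 * pi)) *\<^sub>R (exp (- pi * t * y^2) *\<^sub>R iexp (2 * pi * k * y)))
     = (\<bar>c\<bar> * (1 / sqrt (2 * pi))) *\<^sub>R (CLINT y|lborel. (exp (- pi * t * y^2) *\<^sub>R iexp (2 * pi * k * y)))"
    by (subst integral_scaleR_right) (rule scaleR_scaleR)
  also have "\<bar>c\<bar> * (1 / sqrt (2 * pi)) = sqrt t" using t by (simp add: c_def real_sqrt_mult)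
  finally have E: "of_real (exp (- (u^2) / 2)) = sqrt t *\<^sub>R (CLINT y|lborel. (exp (- pi * t * y^2) *\<^sub>R iexp (2 * pi * k * y)))" .
  have "- (u^2) / 2 = - pi * k^2 / t"
    unfolding u_def power_divide c(2) using t by (simp add: power2_eq_square field_simps)
  have E': "(CLINT y|lborel. (exp (- pi * t * y^2) *\<^sub>R iexp (2 * pi * k * y))) = of_real (exp (- pi * k^2 / t) / sqrt t)"
    (is "?X = _")
  proof -
    have "?X = (1 / sqrt t) *\<^sub>R (sqrt t *\<^sub>R ?X)" using t by (simp only: scaleR_scaleR) simp
    also have "sqrt t *\<^sub>R ?X = of_real (exp (- (u^2) / 2))" by (rule E[symmetric])
    also have "- (u^2) / 2 = - pi * k^2 / t" by fact
    finally show ?thesis by (simp add: scaleR_conv_of_real)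
  qed
  let ?e = "iexp (- 2 * pi * k * a)"
  have re: "exp (- pi * t * (y + a)^2) * cos (2 * pi * k * y) = Re (exp (- pi * t * (a + 1 * y)^2) *\<^sub>R iexp (2 * pi * k * (a + 1 * y)) * ?e)" for y
  proof -
    have "iexp (2 * pi * k * (a + 1 * y)) * ?e = iexp (2 * pi * k * y)"
      unfolding exp_add[symmetric] by (simp add: algebra_simps)
    hence "Re (exp (- pi * t * (a + 1 * y)^2) *\<^sub>R iexp (2 * pi * k * (a + 1 * y)) * ?e) = exp (- pi * t * (a + 1 * y)^2) * Re (iexp (2 * pi * k * y))"
      by (simp only: mult_scaleR_left scaleR_complex.sel)
    also have "Re (iexp (2 * pi * k * y)) = cos (2 * pi * k * y)"
      by (simp only: cis_conv_exp[symmetric] cis.sel)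
    finally show ?thesis by (simp add: add.commute)
  qed
  have i1: "integrable lborel (\<lambda>y. exp (- pi * t * (a + 1 * y)^2) *\<^sub>R iexp (2 * pi * k * (a + 1 * y)))"
    by (rule lborel_integrable_real_affine[OF gie, of 1 a]) simp
  have i2: "integrable lborel (\<lambda>y. exp (- pi * t * (a + 1 * y)^2) *\<^sub>R iexp (2 * pi * k * (a + 1 * y)) * ?e)"
    by (rule integrable_mult_left[OF i1])
  show "integrable lborel (\<lambda>y. exp (- pi * t * (y + a)^2) * cos (2 * pi * k * y))"
    unfolding re by (rule integrable_Re[OF i2])
  have "(LINT y|lborel. exp (- pi * t * (y + a)^2) * cos (2 * pi * k * y)) =
     Re (CLINT y|lborel. exp (- pi * t * (a + 1 * y)^2) *\<^sub>R iexp (2 * pi * k * (a + 1 * y)) * ?e)"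
    unfolding re by (rule integral_Re[OF i2])
  also have "(CLINT y|lborel. exp (- pi * t * (a + 1 * y)^2) *\<^sub>R iexp (2 * pi * k * (a + 1 * y)) * ?e)
     = (CLINT y|lborel. exp (- pi * t * (a + 1 * y)^2) *\<^sub>R iexp (2 * pi * k * (a + 1 * y))) * ?e"
    by (rule integral_mult_left_zero)
  also have "(CLINT y|lborel. exp (- pi * t * (a + 1 * y)^2) *\<^sub>R iexp (2 * pi * k * (a + 1 * y))) 
     = (CLINT y|lborel. (exp (- pi * t * y^2) *\<^sub>R iexp (2 * pi * k * y)))"
    using lborel_integral_real_affine[of 1 "\<lambda>y. exp (- pi * t * y^2) *\<^sub>R iexp (2 * pi * k * y)" a] by simp
  also note E'
  also have "Re (of_real (exp (- pi * k^2 / t) / sqrt t) * ?e) = exp (- pi * k^2 / t) / sqrt t * cos (- 2 * pi * k * a)"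
    by (simp only: cis_conv_exp[symmetric] complex_scaleR scaleR_conv_of_real[symmetric] scaleR_complex.sel cis.sel)
  also have "cos (- 2 * pi * k * a) = cos (2 * pi * k * a)" by simp
  finally show "(LINT y|lborel. exp (- pi * t * (y + a)^2) * cos (2 * pi * k * y)) 
           = cos (2 * pi * k * a) * exp (- pi * k^2 / t) / sqrt t" by simp
qed


lemma integral_cos_period:
  fixes m :: int and b :: real
  shows "integral {-1/2..1/2} (\<lambda>x. cos (2 * pi * of_int m * x + b)) = (if m = 0 then cos b else 0)"
proof (cases "m = 0")
  case False
  have "((\<lambda>x. cos (2 * pi * of_int m * x + b)) has_integral
      (sin (2 * pi * of_int m * (1/2) + b) / (2 * pi * of_int m) - sin (2 * pi * of_int m * (-1/2) + b) / (2 * pi * of_int m))) {-1/2..1/2}"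
    by (rule fundamental_theorem_of_calculus)
       (use False in \<open>auto intro!: derivative_eq_intros simp: has_real_derivative_iff_has_vector_derivative[symmetric]\<close>)
  moreover have "sin (2 * pi * of_int m * (1/2) + b) = sin (2 * pi * of_int m * (-1/2) + b)"
    using sin.plus_of_int[of "2 * pi * of_int m * (-1/2) + b" m] by (simp add: algebra_simps)
  ultimately show ?thesis using False by (simp add: integral_unique)
qed simp

lemma integral_cos_times_cos:
  fixes j k :: nat and a :: real
  assumes "j > 0"
  shows "integral {-1/2..1/2} (\<lambda>x. cos (2 * pi * j * (x + a)) * cos (2 * pi * k * x))
      = (if j = k then cos (2 * pi * k * a) / 2 else 0)"
proof -
  have "cos (2 * pi * j * (x + a)) * cos (2 * pi * k * x) =
     (1/2) * cos (2 * pi * of_int (int j - int k) * x + 2 * pi * j * a) +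
     (1/2) * cos (2 * pi * of_int (int j + int k) * x + 2 * pi * j * a)" for x
    unfolding cos_times_cos by (simp add: algebra_simps)
  hence "integral {-1/2..1/2} (\<lambda>x. cos (2 * pi * j * (x + a)) * cos (2 * pi * k * x)) =
    integral {-1/2..1/2} (\<lambda>x. (1/2) * cos (2 * pi * of_int (int j - int k) * x + 2 * pi * j * a) +
     (1/2) * cos (2 * pi * of_int (int j + int k) * x + 2 * pi * j * a))" by presburger
  also have "\<dots> = (1/2) * (if int j - int k = 0 then cos (2 * pi * j * a) else 0) +
      (1/2) * (if int j + int k = 0 then cos (2 * pi * j * a) else 0)"
    by (subst integral_add, (intro integrable_continuous_real continuous_intros)+)
       (simp only: integral_mult_right integral_cos_period)
  finally show ?thesis using assms by auto
qed

text \<open>Both sides are viewed as functions of an additional translation \<open>x\<close>: the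
  periodized Gaussian \<open>f\<close> and the cosine series \<open>s\<close>. They are continuous
  on a period and have equal cosine coefficients, since integrating the periodization over a period
  unfolds to an integral over the line. Hence the difference vanishes at \<open>x = 0\<close>, which
  is all that is claimed.\<close>

theorem poisson_gaussian:
  fixes t a :: real
  assumes t: "t > 0"
  defines "g \<equiv> \<lambda>y. exp (- pi * t * y^2)"
  shows "summable (\<lambda>n. g (a + real (Suc n)) + g (a - real (Suc n)))"
    and "g a + (\<Sum>n. g (a + real (Suc n)) + g (a - real (Suc n))) =
           (1 + 2 * (\<Sum>k. exp (- pi * (real (Suc k))^2 / t) * cos (2 * pi * real (Suc k) * a))) / sqrt t"
proof -
  let ?I = "{-1/2..1/2 :: real}"
  define u where "u n x = g (x + a + real (Suc n)) + g (x + a - real (Suc n))" for n x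
  define w where "w k x = exp (- pi * (real (Suc k))^2 / t) * cos (2 * pi * real (Suc k) * (x + a))" for k x
  define F where "F N x = g (x + a) + (\<Sum>n<N. u n x)" for N x
  define S where "S N x = (1 + 2 * (\<Sum>k<N. w k x)) / sqrt t" for N x
  define f where "f x = g (x + a) + (\<Sum>n. u n x)" for x
  define s where "s x = (1 + 2 * (\<Sum>k. w k x)) / sqrt t" for x
  \<comment> \<open>Bounds \<open>\<bar>x + a\<bar>\<close> on the period, so that the translates by
    \<open>Suc n\<close> have absolute value at least \<open>n - c\<close> and \<open>gbd\<close>
    provides a geometric majorant.\<close>
  define c where "c = 1 + \<bar>a\<bar>"
  have gcont: "continuous_on A g" for A unfolding g_def by (intro continuous_intros)
  have gbd: "g y \<le> exp (pi * t * c^2) * exp (- (pi * t / 2)) ^ n" if "\<bar>y\<bar> \<ge> real n - c" for y n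
  proof -
    have "real n \<le> \<bar>y\<bar> + c" using that by simp
    hence "(real n)^2 \<le> (\<bar>y\<bar> + c)^2" by (intro power_mono) auto
    also have "\<dots> \<le> 2 * y^2 + 2 * c^2"
      using zero_le_power2[of "\<bar>y\<bar> - c"] by (simp add: power2_eq_square algebra_simps)
    finally have "(real n)^2 \<le> 2 * y^2 + 2 * c^2" .
    moreover have "real n \<le> (real n)^2" by (cases n) (auto simp: power2_eq_square)
    ultimately have "real n / 2 \<le> y^2 + c^2" by linarith
    hence "pi * t * (real n / 2) \<le> pi * t * (y^2 + c^2)" using t by (intro mult_left_mono) auto
    hence "- pi * t * y^2 \<le> pi * t * c^2 + real n * (- (pi * t / 2))" by (simp add: algebra_simps)
    hence "g y \<le> exp (pi * t * c^2 + real n * (- (pi * t / 2)))" by (simp add: g_def)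
    thus ?thesis by (simp only: exp_add exp_of_nat_mult)
  qed
  have r1: "norm (exp (- (pi * t / 2))) < 1" using t by simp
  have gpos: "g y \<ge> 0" for y by (simp add: g_def)
  have ub: "norm (u n x) \<le> 2 * (exp (pi * t * c^2) * exp (- (pi * t / 2)) ^ n)" if "x \<in> ?I" for n x
  proof -
    have "\<bar>x + a + real (Suc n)\<bar> \<ge> real n - c" "\<bar>x + a - real (Suc n)\<bar> \<ge> real n - c"
      using that by (auto simp: c_def abs_if)
    from gbd[OF this(1)] gbd[OF this(2)] show ?thesis using gpos by (simp add: u_def)
  qed
  have ubs: "summable (\<lambda>n. 2 * (exp (pi * t * c^2) * exp (- (pi * t / 2)) ^ n))"
    by (intro summable_mult summable_geometric r1)
  have wb: "norm (w k x) \<le> exp (- pi / t) ^ Suc k" for k x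
  proof -
    have "real (Suc k) \<le> (real (Suc k))^2" by (simp add: power2_eq_square)
    hence "pi / t * real (Suc k) \<le> pi / t * (real (Suc k))^2" using t by (intro mult_left_mono) auto
    hence "exp (- pi * (real (Suc k))^2 / t) \<le> exp (real (Suc k) * (- pi / t))"
      by (simp add: algebra_simps)
    also have "\<dots> = exp (- pi / t) ^ Suc k" by (rule exp_of_nat_mult)
    finally have "exp (- pi * (real (Suc k))^2 / t) \<le> exp (- pi / t) ^ Suc k" .
    moreover have "norm (w k x) \<le> exp (- pi * (real (Suc k))^2 / t) * 1"
      unfolding w_def norm_mult by (intro mult_mono) auto
    ultimately show ?thesis by linarith
  qed
  have wbs: "summable (\<lambda>k. exp (- pi / t) ^ Suc k)"
    using t by (subst summable_Suc_iff) (intro summable_geometric, simp)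
  have ulu: "uniform_limit ?I (\<lambda>N x. \<Sum>n<N. u n x) (\<lambda>x. suminf (\<lambda>n. u n x)) sequentially"
    by (rule Weierstrass_m_test[OF ub ubs])
  have ulw: "uniform_limit ?I (\<lambda>N x. \<Sum>k<N. w k x) (\<lambda>x. suminf (\<lambda>k. w k x)) sequentially"
    by (rule Weierstrass_m_test[OF wb wbs])
  have ulF: "uniform_limit ?I F f sequentially"
    by (rule metric_uniform_limit_imp_uniform_limit[OF ulu]) (simp add: F_def f_def dist_norm)
  have ulS: "uniform_limit ?I S s sequentially"
  proof -
    have "uniform_limit ?I (\<lambda>N x. (2 / sqrt t) * (\<Sum>k<N. w k x)) (\<lambda>x. (2 / sqrt t) * suminf (\<lambda>k. w k x)) sequentially"
      using bounded_linear.uniform_limit[OF bounded_linear_mult_right ulw] .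
    thus ?thesis
      by (rule metric_uniform_limit_imp_uniform_limit)
         (simp add: S_def s_def dist_norm diff_divide_distrib[symmetric] algebra_simps)
  qed
  have Fcont: "continuous_on ?I (F N)" for N
    unfolding F_def[abs_def] u_def g_def by (intro continuous_intros)
  have Scont: "continuous_on ?I (S N)" for N
    unfolding S_def[abs_def] w_def using t by (intro continuous_intros) auto
  have fcont: "continuous_on ?I f"
    by (rule uniform_limit_theorem[OF always_eventually[OF allI[OF Fcont]] ulF]) simp
  have scont: "continuous_on ?I s"
    by (rule uniform_limit_theorem[OF always_eventually[OF allI[OF Scont]] ulS]) simp
  have lim: "(\<lambda>N. integral ?I (\<lambda>x. G N x * cos (2 * pi * real k * x))) \<longlonglongrightarrow> integral ?I (\<lambda>x. h x * cos (2 * pi * real k * x))"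
    if ul: "uniform_limit ?I G h sequentially" and Gc: "\<And>N. continuous_on ?I (G N)" for G h and k :: nat
  proof -
    have ul': "uniform_limit ?I (\<lambda>N x. G N x * cos (2 * pi * real k * x)) (\<lambda>x. h x * cos (2 * pi * real k * x)) sequentially"
    proof (rule metric_uniform_limit_imp_uniform_limit[OF ul], rule always_eventually, intro allI ballI)
      fix N x
      have "\<bar>G N x - h x\<bar> * \<bar>cos (2 * pi * real k * x)\<bar> \<le> \<bar>G N x - h x\<bar> * 1"
        by (intro mult_left_mono) auto
      thus "dist (G N x * cos (2 * pi * real k * x)) (h x * cos (2 * pi * real k * x)) \<le> dist (G N x) (h x)"
        by (simp only: dist_real_def left_diff_distrib[symmetric] abs_mult mult_1_right)
    qed
    have cc: "continuous_on ?I (\<lambda>x. G N x * cos (2 * pi * real k * x))" for N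
      by (intro continuous_intros Gc)
    obtain I J where IJ: "\<And>N. ((\<lambda>x. G N x * cos (2 * pi * real k * x)) has_integral I N) ?I"
      "((\<lambda>x. h x * cos (2 * pi * real k * x)) has_integral J) ?I" "I \<longlonglongrightarrow> J"
      using uniform_limit_integral[OF ul' cc] by auto
    thus ?thesis using integral_unique[OF IJ(1)] integral_unique[OF IJ(2)] by simp
  qed
  have intS: "integral ?I (\<lambda>x. S N x * cos (2 * pi * real k * x)) = cos (2 * pi * k * a) * exp (- pi * k^2 / t) / sqrt t"
    if "N > k" for N k
  proof -
    have "integral ?I (\<lambda>x. S N x * cos (2 * pi * real k * x)) = 
       integral ?I (\<lambda>x. (1 / sqrt t) * cos (2 * pi * of_int (int k) * x + 0) + (\<Sum>j<N. (2 / sqrt t * exp (- pi * (real (Suc j))^2 / t)) *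
           (cos (2 * pi * real (Suc j) * (x + a)) * cos (2 * pi * real k * x))))"
    proof (intro arg_cong[of _ _ "integral ?I"] ext)
      fix x
      let ?C = "cos (2 * pi * real k * x)"
      have "S N x * ?C = (1 / sqrt t) * ?C + (2 / sqrt t) * (\<Sum>j<N. w j x) * ?C"
        by (simp add: S_def add_divide_distrib distrib_right)
      also have "(2 / sqrt t) * (\<Sum>j<N. w j x) * ?C = (\<Sum>j<N. (2 / sqrt t * exp (- pi * (real (Suc j))^2 / t)) *
           (cos (2 * pi * real (Suc j) * (x + a)) * ?C))"
        unfolding sum_distrib_left sum_distrib_right w_def by (simp only: mult.assoc)
      finally show "S N x * ?C = (1 / sqrt t) * cos (2 * pi * of_int (int k) * x + 0) + (\<Sum>j<N. (2 / sqrt t * exp (- pi * (real (Suc j))^2 / t)) *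
           (cos (2 * pi * real (Suc j) * (x + a)) * ?C))" by (simp only: of_int_of_nat_eq add_0_right)
    qed
    also have "\<dots> = (1 / sqrt t) * (if k = 0 then 1 else 0) + (\<Sum>j<N. (2 / sqrt t * exp (- pi * (real (Suc j))^2 / t)) *
           (if Suc j = k then cos (2 * pi * k * a) / 2 else 0))"
      by (subst integral_add integral_sum | (intro integrable_continuous_real continuous_intros)
          | simp only: integral_mult_right integral_cos_period integral_cos_times_cos zero_less_Suc finite_lessThan of_nat_eq_0_iff cos_zero)+
    also have "\<dots> = cos (2 * pi * k * a) * exp (- pi * k^2 / t) / sqrt t"
    proof (cases k)
      case (Suc j)
      have "(\<Sum>j'<N. (2 / sqrt t * exp (- pi * (real (Suc j'))^2 / t)) * (if Suc j' = k then cos (2 * pi * k * a) / 2 else 0))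
         = (\<Sum>j'<N. if j' = j then (2 / sqrt t * exp (- pi * (real (Suc j))^2 / t)) * (cos (2 * pi * k * a) / 2) else 0)"
        by (intro sum.cong) (auto simp: Suc)
      also have "\<dots> = (2 / sqrt t * exp (- pi * (real (Suc j))^2 / t)) * (cos (2 * pi * k * a) / 2)"
        using that Suc by (subst sum.delta) auto
      finally show ?thesis using Suc by simp
    qed simp
    finally show ?thesis .
  qed
  \<comment> \<open>Each further pair of translates adds a unit interval at both ends of the domain
    of integration, because the cosine has period 1.\<close>
  have intF: "integral ?I (\<lambda>x. F N x * cos (2 * pi * real k * x)) = 
      integral {-1/2 - real N..1/2 + real N} (\<lambda>y. g (y + a) * cos (2 * pi * real k * y))" for N and k :: nat
  proof (induction N)
    case (Suc N)
    let ?h = "\<lambda>y. g (y + a) * cos (2 * pi * real k * y)"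
    have hc: "continuous_on A ?h" for A unfolding g_def by (intro continuous_intros)
    have hi: "?h integrable_on {x..y}" for x y by (intro integrable_continuous_real hc)
    have sh: "integral ?I (\<lambda>x. ?h (x + d)) = integral {-1/2 + d..1/2 + d} ?h" for d
      using integral_shift_real_ivl[of "-1/2 + d" d "1/2 + d" ?h] by simp
    have hi': "(\<lambda>x. ?h (x + d)) integrable_on ?I" for d
      unfolding g_def by (intro integrable_continuous_real continuous_intros)
    have cp: "cos (2 * pi * real k * (x + real (Suc N))) = cos (2 * pi * real k * x)" 
             "cos (2 * pi * real k * (x + - real (Suc N))) = cos (2 * pi * real k * x)" for x
      using cos.plus_of_nat[of "2 * pi * real k * x" "k * Suc N"] cos.plus_of_nat[of "2 * pi * real k * (x - real (Suc N))" "k * Suc N"]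
      by (simp_all add: algebra_simps)
    have "F (Suc N) x * cos (2 * pi * real k * x) = F N x * cos (2 * pi * real k * x) + (?h (x + real (Suc N)) + ?h (x + - real (Suc N)))" for x
      unfolding cp by (simp add: F_def u_def algebra_simps)
    hence "integral ?I (\<lambda>x. F (Suc N) x * cos (2 * pi * real k * x)) =
       integral ?I (\<lambda>x. F N x * cos (2 * pi * real k * x) + (?h (x + real (Suc N)) + ?h (x + - real (Suc N))))" by presburger
    also have "\<dots> = integral ?I (\<lambda>x. F N x * cos (2 * pi * real k * x)) + (integral ?I (\<lambda>x. ?h (x + real (Suc N))) + integral ?I (\<lambda>x. ?h (x + - real (Suc N))))"
      by (subst integral_add; (intro integrable_add hi' integrable_continuous_real continuous_intros Fcont)?; subst integral_add; (intro hi')?) (rule refl)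
    also have "\<dots> = integral {-1/2 - real N..1/2 + real N} ?h + integral {1/2 + real N..1/2 + real (Suc N)} ?h 
        + integral {-1/2 - real (Suc N)..-1/2 - real N} ?h"
      unfolding sh Suc.IH by (simp add: algebra_simps)
    also have "\<dots> = integral {-1/2 - real (Suc N)..1/2 + real (Suc N)} ?h"
      using Henstock_Kurzweil_Integration.integral_combine[where a = "-1/2 - real (Suc N)" and c = "-1/2 - real N" and b = "1/2 + real N" and f = ?h]
        Henstock_Kurzweil_Integration.integral_combine[where a = "-1/2 - real (Suc N)" and c = "1/2 + real N" and b = "1/2 + real (Suc N)" and f = ?h] hi by simp
    finally show ?case .
  qed (simp add: F_def)
  have limF: "(\<lambda>N. integral ?I (\<lambda>x. F N x * cos (2 * pi * real k * x))) \<longlonglongrightarrow> cos (2 * pi * k * a) * exp (- pi * k^2 / t) / sqrt t" for k :: nat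
  proof -
    let ?h = "\<lambda>y. exp (- pi * t * (y + a)^2) * cos (2 * pi * real k * y)"
    let ?A = "\<lambda>N. {-1/2 - real N..1/2 + real N}"
    note gi = gaussian_cos_integral[OF t, of a k]
    have "(\<lambda>N. LINT y|lborel. indicator (?A N) y *\<^sub>R ?h y) \<longlonglongrightarrow> (LINT y|lborel. ?h y)"
    proof (rule integral_dominated_convergence[where w = "\<lambda>y. \<bar>?h y\<bar>"])
      show "integrable lborel (\<lambda>y. \<bar>?h y\<bar>)" by (rule integrable_abs[OF gi(1)])
      show "AE y in lborel. (\<lambda>N. indicator (?A N) y *\<^sub>R ?h y) \<longlonglongrightarrow> ?h y"
      proof (rule AE_I2)
        fix y :: real
        obtain N0 :: nat where "\<bar>y\<bar> \<le> real N0" using real_arch_simple by blast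
        hence "indicator (?A N) y *\<^sub>R ?h y = ?h y" if "N \<ge> N0" for N
          using that by (auto simp: indicator_def abs_le_iff)
        thus "(\<lambda>N. indicator (?A N) y *\<^sub>R ?h y) \<longlonglongrightarrow> ?h y"
          by (intro tendsto_eventually eventually_sequentiallyI[of N0]) auto
      qed
      show "AE y in lborel. norm (indicator (?A N) y *\<^sub>R ?h y) \<le> \<bar>?h y\<bar>" for N
        by (rule AE_I2) (auto simp: indicator_def)
    qed (use gi in measurable)
    moreover have "(LINT y|lborel. indicator (?A N) y *\<^sub>R ?h y) = integral (?A N) ?h" for N
    proof -
      have "set_integrable lborel (?A N) ?h"
        unfolding set_integrable_def by (rule integrable_mult_indicator[OF _ gi(1)]) simp
      from set_borel_integral_eq_integral(2)[OF this] show ?thesis by (simp add: set_lebesgue_integral_def)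
    qed
    ultimately show ?thesis unfolding intF g_def gi(2) by simp
  qed
  have "f 0 - s 0 = 0"
  proof (rule cos_coefficients_zero_imp_zero)
    show "continuous_on ?I (\<lambda>x. f x - s x)" by (intro continuous_intros fcont scont)
    fix k :: nat
    have "integral ?I (\<lambda>x. f x * cos (2 * pi * k * x)) = cos (2 * pi * k * a) * exp (- pi * k^2 / t) / sqrt t"
      by (rule LIMSEQ_unique[OF lim[OF ulF Fcont] limF])
    moreover have "integral ?I (\<lambda>x. s x * cos (2 * pi * k * x)) = cos (2 * pi * k * a) * exp (- pi * k^2 / t) / sqrt t"
    proof (rule LIMSEQ_unique[OF lim[OF ulS Scont]])
      show "(\<lambda>N. integral ?I (\<lambda>x. S N x * cos (2 * pi * k * x))) \<longlonglongrightarrow> cos (2 * pi * k * a) * exp (- pi * k^2 / t) / sqrt t"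
        using intS by (intro tendsto_eventually eventually_sequentiallyI[of "Suc k"]) auto
    qed
    moreover have "integral ?I (\<lambda>x. f x * cos (2 * pi * k * x) - s x * cos (2 * pi * k * x)) = 
       integral ?I (\<lambda>x. f x * cos (2 * pi * k * x)) - integral ?I (\<lambda>x. s x * cos (2 * pi * k * x))"
      by (intro integral_diff integrable_continuous_real continuous_intros fcont scont)
    ultimately show "integral ?I (\<lambda>x. (f x - s x) * cos (2 * pi * k * x)) = 0"
      by (simp add: left_diff_distrib)
  qed
  thus "g a + (\<Sum>n. g (a + real (Suc n)) + g (a - real (Suc n))) =
           (1 + 2 * (\<Sum>k. exp (- pi * (real (Suc k))^2 / t) * cos (2 * pi * real (Suc k) * a))) / sqrt t"
    by (simp add: f_def s_def u_def w_def)
  show "summable (\<lambda>n. g (a + real (Suc n)) + g (a - real (Suc n)))"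
    using summable_comparison_test'[OF ubs, of 0 "\<lambda>n. u n 0"] ub[of 0] by (simp add: u_def)
qed

text \<open>Summing over positive integers gives half of the usual two-sided series of an even
  character. The division by \<open>q\<close> in the exponent centres the functional equation at
  \<open>y = 1\<close>.\<close>

definition theta :: "nat \<Rightarrow> (int \<Rightarrow> complex) \<Rightarrow> real \<Rightarrow> complex" where
  "theta q \<psi> y = (\<Sum>n. \<psi> (int (Suc n)) * of_real (exp (- pi * (real (Suc n))\<^sup>2 * y / real q)))"

lemma summable_theta_weights:
  assumes "q > 0" "y > 0"
  shows "summable (\<lambda>n. exp (- pi * (real (Suc n))\<^sup>2 * y / real q))"
proof (rule summable_comparison_test')
  show "summable (\<lambda>n. exp (- pi * y / real q) ^ Suc n)"
    using assms by (subst summable_Suc_iff) (intro summable_geometric, simp)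
  fix n
  have "real (Suc n) \<le> (real (Suc n))\<^sup>2" by (simp add: power2_eq_square)
  hence "pi * y / real q * real (Suc n) \<le> pi * y / real q * (real (Suc n))\<^sup>2"
    using assms by (intro mult_left_mono) auto
  hence "exp (- pi * (real (Suc n))\<^sup>2 * y / real q) \<le> exp (real (Suc n) * (- pi * y / real q))"
    by (simp add: algebra_simps)
  also have "\<dots> = exp (- pi * y / real q) ^ Suc n" by (rule exp_of_nat_mult)
  finally show "norm (exp (- pi * (real (Suc n))\<^sup>2 * y / real q)) \<le> exp (- pi * y / real q) ^ Suc n"
    by simp
qed

lemma summable_theta:
  assumes "dirichlet_character q \<psi>" "q > 0" "y > 0"
  shows "summable (\<lambda>n. \<psi> (int (Suc n)) * of_real (exp (- pi * (real (Suc n))\<^sup>2 * y / real q)))"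
proof (rule summable_comparison_test'[OF summable_theta_weights[OF assms(2,3)]])
  fix n
  have "norm (\<psi> (int (Suc n))) * exp (- pi * (real (Suc n))\<^sup>2 * y / real q) \<le> 1 * exp (- pi * (real (Suc n))\<^sup>2 * y / real q)"
    by (intro mult_right_mono dirichlet_character_norm_le_1[OF assms(1)]) auto
  thus "norm (\<psi> (int (Suc n)) * of_real (exp (- pi * (real (Suc n))\<^sup>2 * y / real q))) \<le> exp (- pi * (real (Suc n))\<^sup>2 * y / real q)"
    by (simp only: norm_mult norm_of_real abs_exp_cancel mult_1)
qed

text \<open>A Gauss sum with the cosine in place of the exponential; for even characters the two
  agree. Replacing \<open>a\<close> by \<open>k * a\<close> separates the dependence on
  \<open>k\<close>. If \<open>q\<close> divides \<open>k\<close>, all cosines are 1 and both sides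
  vanish.\<close>

lemma even_character_cos_sum:
  assumes q: "prime q" and dc: "dirichlet_character q \<psi>" and np: "\<psi> \<noteq> principal q"
  defines "\<tau> \<equiv> \<lambda>k. \<Sum>a\<in>{0..<int q}. \<psi> a * of_real (cos (2 * pi * of_int (k * a) / real q))"
  shows "\<tau> k = cnj (\<psi> k) * \<tau> 1"
proof (cases "coprime k (int q)")
  case True
  have q0: "int q > 0" using q prime_gt_0_nat by simp
  let ?f = "\<lambda>a. (k * a) mod int q"
  have inj: "inj_on ?f {0..<int q}"
  proof (rule inj_onI)
    fix x y assume xy: "x \<in> {0..<int q}" "y \<in> {0..<int q}" "?f x = ?f y"
    hence "[k * x = k * y] (mod int q)" by (simp add: cong_def)
    hence "[x = y] (mod int q)" using cong_mult_lcancel[OF True] by simp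
    thus "x = y" using xy by (simp add: cong_def)
  qed
  have sub: "?f ` {0..<int q} \<subseteq> {0..<int q}" using q0 by auto
  have "?f ` {0..<int q} = {0..<int q}" by (rule endo_inj_surj[OF _ sub inj]) simp
  hence bij: "bij_betw ?f {0..<int q} {0..<int q}" using inj by (simp add: bij_betw_def)
  have cosf: "cos (2 * pi * of_int (1 * ?f a) / real q) = cos (2 * pi * of_int (k * a) / real q)" for a
  proof -
    define n where "n = k * a div int q"
    have "k * a = ?f a + n * int q" by (simp add: n_def)
    from arg_cong[OF this, of real_of_int] have "of_int (k * a) = (of_int (?f a) :: real) + of_int n * real q"
      by (simp only: of_int_add of_int_mult of_int_of_nat_eq)
    hence "2 * pi * of_int (k * a) / real q = 2 * pi * of_int (1 * ?f a) / real q + 2 * pi * of_int n"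
      using q0 by (simp add: field_simps)
    thus ?thesis by (simp only: cos_add cos_int_2pin sin_int_2pin mult_zero_right mult_1_right diff_zero)
  qed
  have "\<tau> 1 = (\<Sum>a\<in>{0..<int q}. \<psi> (?f a) * of_real (cos (2 * pi * of_int (1 * ?f a) / real q)))"
    unfolding \<tau>_def using sum.reindex_bij_betw[OF bij, of "\<lambda>a. \<psi> a * of_real (cos (2 * pi * of_int (1 * a) / real q))"] by simp
  also have "\<dots> = (\<Sum>a\<in>{0..<int q}. \<psi> k * (\<psi> a * of_real (cos (2 * pi * of_int (k * a) / real q))))"
  proof (rule sum.cong[OF refl])
    fix a
    have "[?f a = k * a] (mod int q)" by (simp add: cong_def)
    from dirichlet_character_cong[OF dc this] have "\<psi> (?f a) = \<psi> k * \<psi> a"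
      by (simp only: dirichlet_character_mult[OF dc])
    thus "\<psi> (?f a) * of_real (cos (2 * pi * of_int (1 * ?f a) / real q)) = \<psi> k * (\<psi> a * of_real (cos (2 * pi * of_int (k * a) / real q)))"
      unfolding cosf by (simp only: mult.assoc)
  qed
  also have "\<dots> = \<psi> k * \<tau> k" by (simp only: \<tau>_def sum_distrib_left)
  finally have "cnj (\<psi> k) * \<tau> 1 = (\<psi> k * cnj (\<psi> k)) * \<tau> k" by simp
  also have "\<psi> k * cnj (\<psi> k) = 1"
    using dirichlet_character_norm[OF dc True] by (simp add: complex_norm_square[symmetric])
  finally show ?thesis by simp
next
  case False
  have "\<psi> k = 0" using False dirichlet_character_eq_0_iff[OF dc] by simp
  moreover obtain j where j: "k = int q * j"
  proof -
    have "prime (int q)" using q by simp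
    hence "int q dvd k" using prime_imp_coprime[of "int q" k] False by (auto simp: coprime_commute)
    thus ?thesis using that by (rule dvdE)
  qed
  have "cos (2 * pi * of_int (k * a) / real q) = 1" for a
  proof -
    have "2 * pi * of_int (k * a) / real q = 2 * pi * of_int (j * a)"
      using j prime_gt_0_nat[OF q] by simp
    thus ?thesis by (simp only: cos_int_2pin)
  qed
  hence "\<tau> k = 0" unfolding \<tau>_def using dirichlet_character_sum_zero[OF q dc np] by simp
  ultimately show ?thesis by simp
qed

lemma sum_int_residues: "(\<Sum>a\<in>{0..<int q}. f a) = (\<Sum>a<q. f (int a))"
proof -
  have "{0..<int q} = int ` {..<q}" by (simp add: image_int_atLeastLessThan lessThan_atLeast0)
  thus ?thesis by (simp add: sum.reindex)
qed

text \<open>Poisson summation with \<open>t = q * y\<close> at the points \<open>a / q\<close>,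
  weighted with \<open>\<psi> a\<close> and summed over the residues. The Gaussian side regroups
  into \<open>2 * theta q \<psi> y\<close>. On the other side the constant term drops out and the
  Gauss sums turn \<open>\<psi>\<close> into its conjugate. The value of \<open>\<epsilon>\<close>
  is not tracked, since what is needed about its modulus follows from applying the equation
  twice.\<close>

theorem theta_functional_equation:
  assumes q: "prime q" and ev: "\<psi> \<in> even_characters q" and np: "\<psi> \<noteq> principal q"
  obtains \<epsilon> :: complex where "\<And>y. y > 0 \<Longrightarrow> theta q \<psi> y = \<epsilon> / of_real (sqrt y) * cnj (theta q \<psi> (1 / y))"
proof -
  have dc: "dirichlet_character q \<psi>" and e1: "\<psi> (-1) = 1" using ev by (auto simp: even_characters_def)
  have q0: "q > 0" using q prime_gt_0_nat by simp
  have neg: "\<psi> (- x) = \<psi> x" for x using dirichlet_character_mult[OF dc, of "-1" x] e1 by simp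
  have psi0: "\<psi> 0 = 0" using dirichlet_character_eq_0_iff[OF dc, of 0] prime_gt_1_nat[OF q] by simp
  define \<tau> where "\<tau> k = (\<Sum>a\<in>{0..<int q}. \<psi> a * of_real (cos (2 * pi * of_int (k * a) / real q)))" for k
  have tau: "\<tau> k = cnj (\<psi> k) * \<tau> 1" for k
    unfolding \<tau>_def by (rule even_character_cos_sum[OF q dc np])
  have main: "theta q \<psi> y = \<tau> 1 / of_real (sqrt (real q)) / of_real (sqrt y) * cnj (theta q \<psi> (1 / y))" if y: "y > 0" for y
  proof -
    define t where "t = real q * y"
    have t: "t > 0" using y q0 by (simp add: t_def)
    define g where "g v = exp (- pi * t * v^2)" for v
    define H where "H m = \<psi> (int m) * of_real (exp (- pi * (real m)\<^sup>2 * y / real q))" for m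
    have HSuc: "(\<lambda>m. H (Suc m)) sums theta q \<psi> y"
      unfolding H_def theta_def by (rule summable_sums[OF summable_theta[OF dc q0 y]])
    hence H0: "H sums theta q \<psi> y"
      using sums_Suc_iff[of H "theta q \<psi> y"] by (simp add: H_def psi0)
    have gq: "g (real m / real q) = exp (- pi * (real m)\<^sup>2 * y / real q)" for m
      unfolding g_def t_def using q0 by (simp add: power2_eq_square field_simps)
    define P where "P a n = g (real a / real q + real (Suc n)) + g (real a / real q - real (Suc n))" for a n
    \<comment> \<open>Negative translates of \<open>a / q\<close> are reflected to positive integers
      in the class of \<open>-a\<close>, where \<open>\<psi>\<close> has the same value by
      evenness.\<close>
    have P1: "\<psi> (int a) * of_real (P a n) = H (a + Suc n * q) + H (Suc n * q - a)" if "a < q" for a n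
    proof -
      have le: "a \<le> Suc n * q" using that by (simp add: trans_le_add1)
      have 1: "real a / real q + real (Suc n) = real (a + Suc n * q) / real q"
        using q0 by (simp add: field_simps)
      have 2: "real a / real q - real (Suc n) = - (real (Suc n * q - a) / real q)"
        using q0 le by (simp add: field_simps of_nat_diff)
      have g2: "g (- v) = g v" for v by (simp add: g_def)
      have c1: "\<psi> (int (a + Suc n * q)) = \<psi> (int a)"
      proof -
        have "int (a + Suc n * q) = int a + int q * int (Suc n)" by (simp add: algebra_simps)
        thus ?thesis by (simp only: dirichlet_character_periodic[OF dc])
      qed
      have "int (Suc n * q - a) = - int a + int q * int (Suc n)"
        using le by (simp add: of_nat_diff algebra_simps)
      hence c2: "\<psi> (int (Suc n * q - a)) = \<psi> (int a)"
        using dirichlet_character_periodic[OF dc, of "- int a" "int (Suc n)"] neg[of "int a"] by simp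
      show ?thesis unfolding P_def 1 2 g2 gq H_def c1 c2 by (simp add: distrib_left)
    qed
    note poi = poisson_gaussian[OF t, folded g_def]
    have Psum: "summable (P a)" for a unfolding P_def[abs_def] by (rule poi(1))
    define E where "E k = exp (- pi * (real (Suc k))^2 / t)" for k
    have Eq: "E k = exp (- pi * (real (Suc k))\<^sup>2 * (1 / y) / real q)" for k
      unfolding E_def t_def using q0 y by (simp add: field_simps)
    have Esum: "summable E" unfolding Eq[abs_def] using summable_theta_weights[OF q0, of "1/y"] y by simp
    have Ecsum: "summable (\<lambda>k. E k * cos (2 * pi * real (Suc k) * (real a / real q)))" for a
    proof (rule summable_comparison_test'[OF Esum])
      fix n
      have "E n * \<bar>cos (2 * pi * real (Suc n) * (real a / real q))\<bar> \<le> E n * 1"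
        by (intro mult_left_mono) (auto simp: E_def)
      thus "norm (E n * cos (2 * pi * real (Suc n) * (real a / real q))) \<le> E n" by (simp add: E_def abs_mult)
    qed
    have lhs: "(\<Sum>a<q. \<psi> (int a) * of_real (g (real a / real q) + (\<Sum>n. P a n))) = 2 * theta q \<psi> y"
    proof -
      have G1: "(\<lambda>n. \<Sum>a<q. H (a + n * q)) sums theta q \<psi> y"
      proof -
        have "(\<lambda>n. sum H {n * q..<n * q + q}) sums theta q \<psi> y" by (rule sums_group[OF H0 q0])
        moreover have "sum H {n * q..<n * q + q} = (\<Sum>a<q. H (a + n * q))" for n
          using sum.shift_bounds_nat_ivl[of H 0 "n * q" q] by (simp add: lessThan_atLeast0 add.commute)
        ultimately show ?thesis by simp
      qed
      hence G1': "(\<lambda>n. \<Sum>a<q. H (a + Suc n * q)) sums (theta q \<psi> y - (\<Sum>a<q. H a))"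
        using sums_Suc_iff[of "\<lambda>n. \<Sum>a<q. H (a + n * q)" "theta q \<psi> y - (\<Sum>a<q. H a)"] by simp
      \<comment> \<open>For fixed \<open>n\<close> the numbers \<open>Suc n * q - a\<close> run from
        \<open>n * q + 1\<close> to \<open>Suc n * q\<close>, hence the grouping of the series that
        starts at 1.\<close>
      have G2: "(\<lambda>n. \<Sum>a<q. H (Suc n * q - a)) sums theta q \<psi> y"
      proof -
        have "(\<lambda>n. sum (\<lambda>m. H (Suc m)) {n * q..<n * q + q}) sums theta q \<psi> y" by (rule sums_group[OF HSuc q0])
        moreover have "sum (\<lambda>m. H (Suc m)) {n * q..<n * q + q} = (\<Sum>a<q. H (Suc n * q - a))" for n
        proof -
          have "sum (\<lambda>m. H (Suc m)) {n * q..<n * q + q} = (\<Sum>a<q. H (Suc (a + n * q)))"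
            using sum.shift_bounds_nat_ivl[of "\<lambda>m. H (Suc m)" 0 "n * q" q] by (simp add: lessThan_atLeast0 add.commute)
          also have "\<dots> = (\<Sum>a<q. H (Suc ((q - Suc a) + n * q)))"
            by (rule sum.nat_diff_reindex[symmetric])
          also have "\<dots> = (\<Sum>a<q. H (Suc n * q - a))"
            by (intro sum.cong refl arg_cong[of _ _ H]) auto
          finally show ?thesis .
        qed
        ultimately show ?thesis by simp
      qed
      have "(\<lambda>n. \<Sum>a<q. \<psi> (int a) * of_real (P a n)) sums (theta q \<psi> y - (\<Sum>a<q. H a) + theta q \<psi> y)"
      proof -
        have "(\<Sum>a<q. \<psi> (int a) * of_real (P a n)) = (\<Sum>a<q. H (a + Suc n * q)) + (\<Sum>a<q. H (Suc n * q - a))" for n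
          unfolding sum.distrib[symmetric] by (intro sum.cong refl) (simp only: P1 lessThan_iff)
        thus ?thesis using sums_add[OF G1' G2] by simp
      qed
      moreover have "(\<lambda>n. \<Sum>a<q. \<psi> (int a) * of_real (P a n)) sums (\<Sum>a<q. \<psi> (int a) * of_real (\<Sum>n. P a n))"
        by (intro sums_sum sums_mult sums_of_real summable_sums Psum)
      ultimately have "(\<Sum>a<q. \<psi> (int a) * of_real (\<Sum>n. P a n)) = theta q \<psi> y - (\<Sum>a<q. H a) + theta q \<psi> y"
        using sums_unique2 by blast
      moreover have "(\<Sum>a<q. H a) = (\<Sum>a<q. \<psi> (int a) * of_real (g (real a / real q)))"
        unfolding H_def gq ..
      ultimately show ?thesis by (simp add: distrib_left sum.distrib)
    qed
    have pc: "g (real a / real q) + (\<Sum>n. P a n) = 1 / sqrt t + 2 / sqrt t * (\<Sum>k. E k * cos (2 * pi * real (Suc k) * (real a / real q)))" for a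
      unfolding P_def E_def using poi(2)[of "real a / real q"] by (simp add: add_divide_distrib)
    have "2 * theta q \<psi> y = (\<Sum>a<q. \<psi> (int a) * of_real (1 / sqrt t + 2 / sqrt t * (\<Sum>k. E k * cos (2 * pi * real (Suc k) * (real a / real q)))))"
      unfolding lhs[symmetric] pc ..
    also have "\<dots> = of_real (1 / sqrt t) * (\<Sum>a<q. \<psi> (int a)) + of_real (2 / sqrt t) * (\<Sum>a<q. \<psi> (int a) * of_real (\<Sum>k. E k * cos (2 * pi * real (Suc k) * (real a / real q))))"
      unfolding sum_distrib_left sum.distrib[symmetric]
      by (intro sum.cong refl) (simp only: of_real_add of_real_mult distrib_left mult_ac)
    also have "(\<Sum>a<q. \<psi> (int a)) = 0"
      using dirichlet_character_sum_zero[OF q dc np] by (simp only: sum_int_residues)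
    also have "(\<Sum>a<q. \<psi> (int a) * of_real (\<Sum>k. E k * cos (2 * pi * real (Suc k) * (real a / real q)))) = \<tau> 1 * cnj (theta q \<psi> (1 / y))"
    proof -
      have s1: "(\<lambda>k. \<Sum>a<q. \<psi> (int a) * of_real (E k * cos (2 * pi * real (Suc k) * (real a / real q)))) sums
          (\<Sum>a<q. \<psi> (int a) * of_real (\<Sum>k. E k * cos (2 * pi * real (Suc k) * (real a / real q))))"
        by (intro sums_sum sums_mult sums_of_real summable_sums Ecsum)
      have "(\<Sum>a<q. \<psi> (int a) * of_real (E k * cos (2 * pi * real (Suc k) * (real a / real q)))) = 
          \<tau> 1 * cnj (\<psi> (int (Suc k)) * of_real (exp (- pi * (real (Suc k))\<^sup>2 * (1 / y) / real q)))" for k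
      proof -
        have "(\<Sum>a<q. \<psi> (int a) * of_real (E k * cos (2 * pi * real (Suc k) * (real a / real q)))) = of_real (E k) * \<tau> (int (Suc k))"
          unfolding \<tau>_def sum_int_residues sum_distrib_left
          by (intro sum.cong refl) (simp add: mult_ac)
        also have "\<dots> = of_real (E k) * (cnj (\<psi> (int (Suc k))) * \<tau> 1)" by (simp only: tau[of "int (Suc k)"])
        finally show ?thesis unfolding Eq by (simp add: mult_ac)
      qed
      hence s2: "(\<lambda>k. \<tau> 1 * cnj (\<psi> (int (Suc k)) * of_real (exp (- pi * (real (Suc k))\<^sup>2 * (1 / y) / real q)))) sums
          (\<Sum>a<q. \<psi> (int a) * of_real (\<Sum>k. E k * cos (2 * pi * real (Suc k) * (real a / real q))))"
        using s1 by simp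
      have "summable (\<lambda>n. \<psi> (int (Suc n)) * of_real (exp (- pi * (real (Suc n))\<^sup>2 * (1 / y) / real q)))"
        by (rule summable_theta[OF dc q0]) (use y in simp)
      from summable_sums[OF this] have "(\<lambda>n. \<psi> (int (Suc n)) * of_real (exp (- pi * (real (Suc n))\<^sup>2 * (1 / y) / real q))) sums theta q \<psi> (1/y)"
        unfolding theta_def .
      hence "(\<lambda>k. \<tau> 1 * cnj (\<psi> (int (Suc k)) * of_real (exp (- pi * (real (Suc k))\<^sup>2 * (1 / y) / real q)))) sums (\<tau> 1 * cnj (theta q \<psi> (1 / y)))"
        by (intro sums_mult) (simp only: sums_cnj)
      with s2 show ?thesis using sums_unique2 by blast
    qed
    finally have "2 * theta q \<psi> y = of_real (2 / sqrt t) * (\<tau> 1 * cnj (theta q \<psi> (1 / y)))" by simp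
    also have "of_real (2 / sqrt t) * (\<tau> 1 * cnj (theta q \<psi> (1 / y))) = 2 * (of_real (1 / sqrt t) * (\<tau> 1 * cnj (theta q \<psi> (1 / y))))"
      by simp
    finally have "theta q \<psi> y = of_real (1 / sqrt t) * (\<tau> 1 * cnj (theta q \<psi> (1 / y)))"
      by (simp only: mult_cancel_left) simp
    thus ?thesis by (simp add: t_def real_sqrt_mult)
  qed
  show ?thesis by (rule that[OF main])
qed

section \<open>The twisted second moment\<close>

text \<open>With \<open>y = exp s\<close> this is the integrand in the Mellin transform of
  \<open>exp (- pi * y)\<close> at the exponent 1/4; the argument 1/2 is halved because theta
  involves squares. So \<open>kap\<close> is the value of the Gamma function at 1/4 times
  \<open>pi powr (-1/4)\<close>.\<close>

definition mk :: "real \<Rightarrow> real" where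
  "mk s = exp (s / 4) * exp (- pi * exp s)"

abbreviation P2 :: "(real \<times> real) measure" where "P2 \<equiv> lborel \<Otimes>\<^sub>M lborel"

definition kap :: real where "kap = (LINT s|lborel. mk s)"

text \<open>The cut-off of the folded second moment, with the logarithmic size of
  \<open>m * n / q\<close> as argument: it tends to \<open>kap\<^sup>2\<close> for \<open>r\<close>
  far to the left and decays on the right.\<close>

definition tailk :: "real \<Rightarrow> real" where
  "tailk r = (LINT p|P2. (if fst p + snd p > r then mk (fst p) * mk (snd p) else 0))"

lemma mk_pos: "mk s > 0" by (simp add: mk_def)

lemma mk_measurable [measurable]: "mk \<in> borel_measurable borel"
  unfolding mk_def[abs_def] by measurable

lemma integrable_exp_abs:
  fixes c :: real
  assumes c: "c > 0"
  shows "integrable lborel (\<lambda>s. exp (- c * \<bar>s\<bar>))"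
proof -
  interpret prob_space "density lborel (exponential_density c)"
    by (rule prob_space_exponential_density[OF c])
  have "(\<integral>\<^sup>+ x. ennreal (exponential_density c x) \<partial>lborel) = emeasure (density lborel (exponential_density c)) UNIV"
    by (subst emeasure_density) auto
  also have "\<dots> = 1" using emeasure_space_1 by simp
  finally have i: "integrable lborel (exponential_density c)"
    using c by (intro integrableI_nonneg) (auto simp: exponential_density_def)
  have i': "integrable lborel (\<lambda>s. exponential_density c (0 + (-1) * s))"
    by (rule lborel_integrable_real_affine[OF i]) simp
  show ?thesis
  proof (rule Bochner_Integration.integrable_bound)
    show "integrable lborel (\<lambda>s. (1/c) * (exponential_density c s + exponential_density c (0 + (-1) * s)))"
      by (intro integrable_mult_right Bochner_Integration.integrable_add i i')
    show "AE s in lborel. norm (exp (- c * \<bar>s\<bar>)) \<le> norm ((1/c) * (exponential_density c s + exponential_density c (0 + (-1) * s)))"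
      using c by (intro AE_I2) (auto simp: exponential_density_def field_simps)
  qed measurable
qed

text \<open>The range covers two later uses: \<open>\<beta> = 1/2\<close> gives the decay of
  \<open>tailk\<close>, and \<open>\<beta> = -1/8\<close> the error term of the diagonal sum. The
  lower limit leaves half of the decay \<open>exp (s / 4)\<close> of \<open>mk\<close> at minus
  infinity.\<close>

lemma mk_exp_bound:
  assumes "-1/8 \<le> \<beta>" "\<beta> \<le> 1/2"
  shows "exp (\<beta> * s) * mk s \<le> exp (- (1/8) * \<bar>s\<bar>)"
proof (cases "s \<ge> 0")
  case True
  have "2 * s \<le> pi * exp s" 
    using mult_mono[of 2 pi s "exp s"] True pi_gt3 exp_ge_add_one_self[of s] by linarith
  moreover have "\<beta> * s \<le> 1/2 * s" using assms True by (intro mult_right_mono) auto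
  ultimately have "\<beta> * s + s / 4 - pi * exp s \<le> - (1/8) * \<bar>s\<bar>" using True by linarith
  thus ?thesis by (simp add: mk_def exp_add[symmetric] algebra_simps)
next
  case False
  have "\<beta> * s \<le> (-1/8) * s" using assms False by (intro mult_right_mono_neg) auto
  moreover have "pi * exp s \<ge> 0" by simp
  ultimately have "\<beta> * s + s / 4 - pi * exp s \<le> - (1/8) * \<bar>s\<bar>" using False by linarith
  thus ?thesis by (simp add: mk_def exp_add[symmetric] algebra_simps)
qed

lemma mk_abs_bound: "\<bar>s\<bar> * mk s \<le> 8 * exp (- (1/8) * \<bar>s\<bar>)"
proof -
  have "mk s \<le> exp (- (1/4) * \<bar>s\<bar>)"
  proof (cases "s \<ge> 0")
    case True
    have "2 * s \<le> pi * exp s" 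
      using mult_mono[of 2 pi s "exp s"] True pi_gt3 exp_ge_add_one_self[of s] by linarith
    thus ?thesis using True by (simp add: mk_def exp_add[symmetric])
  qed (simp add: mk_def)
  moreover have "\<bar>s\<bar> \<le> 8 * exp (\<bar>s\<bar> / 8)" using exp_ge_add_one_self[of "\<bar>s\<bar> / 8"] by linarith
  ultimately have "\<bar>s\<bar> * mk s \<le> 8 * exp (\<bar>s\<bar> / 8) * exp (- (1/4) * \<bar>s\<bar>)"
    using mk_pos[of s] by (intro mult_mono) auto
  also have "\<dots> = 8 * exp (- (1/8) * \<bar>s\<bar>)" by (simp add: exp_add[symmetric])
  finally show ?thesis .
qed

lemma integrable_mk_exp:
  assumes "-1/8 \<le> \<beta>" "\<beta> \<le> 1/2"
  shows "integrable lborel (\<lambda>s. exp (\<beta> * s) * mk s)"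
proof (rule Bochner_Integration.integrable_bound[OF integrable_exp_abs[of "1/8"]])
  show "AE s in lborel. norm (exp (\<beta> * s) * mk s) \<le> norm (exp (- (1/8) * \<bar>s\<bar>))"
    using mk_exp_bound[OF assms] mk_pos by (intro AE_I2) (simp add: abs_mult less_imp_le)
qed auto

lemma integrable_mk: "integrable lborel mk"
  using integrable_mk_exp[of 0] by simp

lemma integrable_mk_ident: "integrable lborel (\<lambda>s. s * mk s)"
proof (rule Bochner_Integration.integrable_bound)
  show "integrable lborel (\<lambda>s. 8 * exp (- (1/8) * \<bar>s\<bar> :: real))"
    by (intro integrable_mult_right integrable_exp_abs) simp
  show "AE s in lborel. norm (s * mk s) \<le> norm (8 * exp (- (1/8) * \<bar>s\<bar>))"
    using mk_abs_bound mk_pos by (intro AE_I2) (simp add: abs_mult less_imp_le)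
qed auto

lemma kap_pos: "kap > 0"
proof -
  have "kap \<ge> 0" unfolding kap_def using mk_pos by (intro integral_nonneg_AE AE_I2) (simp add: less_imp_le)
  moreover have "kap \<noteq> 0"
  proof
    assume "kap = 0"
    hence "AE s in lborel. mk s = 0"
      unfolding kap_def using integral_nonneg_eq_0_iff_AE[OF integrable_mk] mk_pos by (simp add: less_imp_le)
    hence "AE s in (lborel :: real measure). False" using mk_pos by (simp add: less_le)
    moreover have "(AE s in (lborel :: real measure). False) \<longleftrightarrow> UNIV \<in> null_sets (lborel :: real measure)"
      using AE_iff_null[of lborel "\<lambda>_. False"] by simp
    ultimately have "UNIV \<in> null_sets (lborel :: real measure)" by blast
    thus False by (simp add: null_sets_def)
  qed
  ultimately show ?thesis by simp
qed

lemma integrable_P2_mult: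
  fixes f g :: "real \<Rightarrow> 'a :: {real_normed_field, banach, second_countable_topology}"
  assumes f: "integrable lborel f" and g: "integrable lborel g"
  shows "integrable P2 (\<lambda>p. f (fst p) * g (snd p))"
    and "(LINT p|P2. f (fst p) * g (snd p)) = integral\<^sup>L lborel f * integral\<^sup>L lborel g"
proof -
  have [measurable]: "f \<in> borel_measurable lborel" "g \<in> borel_measurable lborel"
    using f g by auto
  show i: "integrable P2 (\<lambda>p. f (fst p) * g (snd p))"
  proof (rule lborel_pair.Fubini_integrable)
    show "integrable lborel (\<lambda>x. LINT y|lborel. norm (f (fst (x, y)) * g (snd (x, y))))"
      using f by (simp add: norm_mult)
    show "AE x in lborel. integrable lborel (\<lambda>y. f (fst (x, y)) * g (snd (x, y)))"
      using g by simp
  qed measurable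
  show "(LINT p|P2. f (fst p) * g (snd p)) = integral\<^sup>L lborel f * integral\<^sup>L lborel g"
    using lborel_pair.integral_fst'[OF i] by simp
qed

lemma integral_P2_map:
  fixes F :: "real \<times> real \<Rightarrow> 'a :: {banach, second_countable_topology}"
  assumes f: "f \<in> borel_measurable borel" "distr lborel borel f = lborel"
    and g: "g \<in> borel_measurable borel" "distr lborel borel g = lborel"
    and F: "F \<in> borel_measurable P2"
  shows "(LINT p|P2. F (f (fst p), g (snd p))) = (LINT p|P2. F p)"
proof -
  have sf: "sigma_finite_measure (distr lborel borel g)" unfolding g by (rule sigma_finite_lborel)
  have fm: "f \<in> measurable lborel borel" and gm: "g \<in> measurable lborel borel" using f g by auto
  have "P2 = distr P2 (borel \<Otimes>\<^sub>M borel) (\<lambda>(x, y). (f x, g y))"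
    using pair_measure_distr[OF fm gm sf] unfolding f(2) g(2) .
  hence "(LINT p|P2. F p) = (LINT p|distr P2 (borel \<Otimes>\<^sub>M borel) (\<lambda>(x, y). (f x, g y)). F p)" by simp
  also have "\<dots> = (LINT p|P2. F ((\<lambda>(x, y). (f x, g y)) p))"
  proof (rule integral_distr)
    show "(\<lambda>(x, y). (f x, g y)) \<in> P2 \<rightarrow>\<^sub>M borel \<Otimes>\<^sub>M borel"
      using fm gm by measurable
    have "sets P2 = sets (borel \<Otimes>\<^sub>M borel)" by (intro sets_pair_measure_cong) auto
    thus "F \<in> borel_measurable (borel \<Otimes>\<^sub>M borel)" using F by (simp cong: measurable_cong_sets)
  qed
  finally show ?thesis by (simp add: case_prod_unfold)
qed

lemma AE_P2_line: "AE p in P2. fst p + snd p \<noteq> (c :: real)"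
proof (rule AE_I')
  let ?A = "{p :: real \<times> real. fst p + snd p = c}"
  have A: "?A \<in> sets P2"
  proof -
    have "{p \<in> space P2. fst p + snd p = c} \<in> sets P2" by measurable
    thus ?thesis by (simp add: space_pair_measure)
  qed
  have "emeasure P2 ?A = (\<integral>\<^sup>+ x. emeasure lborel (Pair x -` ?A) \<partial>lborel)"
    by (rule lborel.emeasure_pair_measure_alt[OF A])
  also have "(\<lambda>x. Pair x -` ?A) = (\<lambda>x. {c - x})" by (auto simp: fun_eq_iff)
  finally show "?A \<in> null_sets P2" using A by (simp add: null_sets_def)
  show "{p \<in> space P2. \<not> fst p + snd p \<noteq> c} \<subseteq> ?A" by auto
qed

lemma integrable_P2_if:
  fixes F :: "real \<times> real \<Rightarrow> 'a :: {banach, second_countable_topology}"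
  assumes F: "integrable P2 F" and Q [measurable]: "Measurable.pred P2 Q"
  shows "integrable P2 (\<lambda>p. if Q p then F p else 0)"
proof (rule Bochner_Integration.integrable_bound[OF F])
  have [measurable]: "F \<in> borel_measurable P2" using F by auto
  show "(\<lambda>p. if Q p then F p else 0) \<in> borel_measurable P2" by measurable
qed auto

text \<open>Reflection in the origin exchanges the two half-planes and conjugates \<open>F\<close>,
  and the line between them is null. This is the fold through which the functional equation
  acts.\<close>

lemma integral_P2_half_planes:
  fixes F :: "real \<times> real \<Rightarrow> complex"
  assumes F: "integrable P2 F" and sym: "\<And>x y. F (- x, - y) = cnj (F (x, y))"
  shows "(LINT p|P2. F p) = of_real (2 * Re (LINT p|P2. (if fst p + snd p > 0 then F p else 0)))"
proof -
  have Fm [measurable]: "F \<in> borel_measurable P2" using F by auto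
  let ?A = "LINT p|P2. (if fst p + snd p > 0 then F p else 0)"
  have i1: "integrable P2 (\<lambda>p. if fst p + snd p > 0 then F p else 0)"
    and i2: "integrable P2 (\<lambda>p. if fst p + snd p < 0 then F p else 0)"
    by (rule integrable_P2_if[OF F], measurable)+
  have "(LINT p|P2. F p) = (LINT p|P2. (if fst p + snd p > 0 then F p else 0) + (if fst p + snd p < 0 then F p else 0))"
    by (rule integral_cong_AE) (use AE_P2_line[of 0] in \<open>auto elim!: eventually_mono\<close>)
  also have "\<dots> = ?A + (LINT p|P2. (if fst p + snd p < 0 then F p else 0))"
    by (rule Bochner_Integration.integral_add[OF i1 i2])
  also have "(LINT p|P2. (if fst p + snd p < 0 then F p else 0)) = 
     (LINT p|P2. (\<lambda>p. if fst p + snd p < 0 then F p else 0) (- fst p, - snd p))"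
    by (rule integral_P2_map[symmetric]) (auto simp: lborel_distr_uminus)
  also have "(\<lambda>p. (\<lambda>p. if fst p + snd p < 0 then F p else 0) (- fst p, - snd p)) = (\<lambda>p. cnj (if fst p + snd p > 0 then F p else 0))"
    by (auto simp: fun_eq_iff sym)
  also have "(LINT p|P2. cnj (if fst p + snd p > 0 then F p else 0)) = cnj ?A"
    by (rule Bochner_Integration.integral_cnj)
  finally show ?thesis by (simp add: complex_add_cnj)
qed

lemma tailk_shift:
  "(LINT p|P2. (if fst p + snd p > 0 then mk (fst p + \<alpha>) * mk (snd p + \<beta>) else 0)) = tailk (\<alpha> + \<beta>)"
proof -
  have "tailk (\<alpha> + \<beta>) = (LINT p|P2. (\<lambda>p. if fst p + snd p > \<alpha> + \<beta> then mk (fst p) * mk (snd p) else 0) (\<alpha> + fst p, \<beta> + snd p))"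
    unfolding tailk_def by (rule integral_P2_map[symmetric]) (auto simp: lborel_distr_plus)
  also have "(\<lambda>p. (\<lambda>p. if fst p + snd p > \<alpha> + \<beta> then mk (fst p) * mk (snd p) else 0) (\<alpha> + fst p, \<beta> + snd p)) = 
     (\<lambda>p. if fst p + snd p > 0 then mk (fst p + \<alpha>) * mk (snd p + \<beta>) else 0)"
    by (auto simp: fun_eq_iff add.commute)
  finally show ?thesis ..
qed

text \<open>An approximate functional equation in limit form. The function \<open>G\<close> has
  integral \<open>kap\<close> times the central value, so \<open>kap\<^sup>2\<close> times its
  squared modulus is the double integral of \<open>G x * cnj (G y)\<close>. By the functional
  equation the reflection conjugates this integrand, which leaves the half-plane
  \<open>x + y > 0\<close>; expanding both theta series there produces the weights
  \<open>tailk\<close>.\<close>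

theorem norm_L_square_limit:
  assumes q: "prime q" and ev: "\<psi> \<in> even_characters q" and np: "\<psi> \<noteq> principal q"
  shows "(\<lambda>N. 2 * Re (\<Sum>m<N. \<Sum>n<N. \<psi> (int (Suc m)) * cnj (\<psi> (int (Suc n))) *
            of_real (tailk (2 * ln (real (Suc m) * real (Suc n)) - 2 * ln (real q)) / sqrt (real (Suc m) * real (Suc n)))))
          \<longlonglongrightarrow> kap\<^sup>2 * (norm (dirichlet_L (1/2) \<psi>))\<^sup>2"
proof -
  have dc: "dirichlet_character q \<psi>" using ev by (auto simp: even_characters_def)
  have q0: "q > 0" using q prime_gt_0_nat by simp
  \<comment> \<open>Chosen so that \<open>exp (c n) = (Suc n)^2 / q\<close>: the translate of
    \<open>mk\<close> by \<open>c n\<close>, divided by \<open>sqrt (Suc n)\<close>, is the weight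
    of \<open>\<psi> (Suc n)\<close> in \<open>G\<close>.\<close>
  define c where "c n = 2 * ln (real (Suc n)) - ln (real q)" for n
  define S where "S N s = (\<Sum>n<N. (\<psi> (int (Suc n)) / of_real (sqrt (real (Suc n)))) * of_real (mk (s + c n)))" for N s
  define G where "G s = of_real (exp (s / 4) * real q powr (-1/4)) * theta q \<psi> (exp s)" for s
  have mkc: "mk (s + c n) = sqrt (real (Suc n)) * (exp (s / 4) * real q powr (-1/4) * exp (- pi * (real (Suc n))\<^sup>2 * exp s / real q))" for s n
  proof -
    have 1: "exp (2 * ln (real (Suc n)) - ln (real q)) = (real (Suc n))\<^sup>2 / real q"
      using q0 by (simp add: exp_diff exp_double)
    have "exp ((s + c n) / 4) = exp (s / 4 + ln (real (Suc n)) / 2 + (-1/4) * ln (real q))"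
      by (rule arg_cong[of _ _ exp]) (simp add: c_def field_simps)
    also have "\<dots> = exp (s / 4) * exp (ln (real (Suc n)) / 2) * real q powr (-1/4)"
      using q0 by (simp only: exp_add powr_def of_nat_0_eq_iff) simp
    also have "exp (ln (real (Suc n)) / 2) = sqrt (real (Suc n))"
      by (simp add: powr_half_sqrt[symmetric] powr_def)
    finally have 2: "exp ((s + c n) / 4) = exp (s / 4) * sqrt (real (Suc n)) * real q powr (-1/4)" .
    have 3: "exp (s + c n) = (real (Suc n))\<^sup>2 * exp s / real q"
      unfolding exp_add c_def 1 by simp
    show ?thesis unfolding mk_def 2 3 by (simp add: mult_ac)
  qed
  have trm: "(\<psi> (int (Suc n)) / of_real (sqrt (real (Suc n)))) * of_real (mk (s + c n)) = 
      of_real (exp (s / 4) * real q powr (-1/4)) * (\<psi> (int (Suc n)) * of_real (exp (- pi * (real (Suc n))\<^sup>2 * exp s / real q)))" for s n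
  proof -
    have "of_real (sqrt (real (Suc n))) \<noteq> (0 :: complex)" by simp
    thus ?thesis unfolding mkc by (simp del: of_nat_Suc add: field_simps)
  qed
  have SG: "(\<lambda>N. S N s) \<longlonglongrightarrow> G s" for s
  proof -
    have "(\<lambda>n. (\<psi> (int (Suc n)) / of_real (sqrt (real (Suc n)))) * of_real (mk (s + c n))) sums G s"
      unfolding trm G_def theta_def by (intro sums_mult summable_sums summable_theta[OF dc q0]) simp
    thus ?thesis by (simp add: sums_def S_def)
  qed
  \<comment> \<open>Cancellation in the character sums is essential here: the sum of the absolute
    values grows like \<open>exp (- s / 4)\<close> as \<open>s\<close> tends to minus infinity and
    is not integrable.\<close>
  have Sb: "norm (S N s) \<le> real q * mk (s - ln (real q))" for N s
  proof -
    define w where "w n = exp (s / 4) * real q powr (-1/4) * exp (- pi * (real (Suc n))\<^sup>2 * exp s / real q)" for n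
    have "S N s = (\<Sum>n<N. \<psi> (int (Suc n)) * of_real (w n))"
      unfolding S_def trm w_def by (intro sum.cong refl) (simp only: of_real_mult mult_ac)
    also have "norm \<dots> \<le> real q * w 0"
    proof (rule norm_sum_mult_antimono_le)
      show "norm (\<Sum>i<n. \<psi> (int (Suc i))) \<le> real q" for n
        by (rule dirichlet_character_partial_sums_bounded[OF q dc np])
      show "0 \<le> w n" for n by (simp add: w_def)
      show "w (Suc n) \<le> w n" for n
        unfolding w_def using q0
        by (intro mult_left_mono) (auto intro!: divide_right_mono mult_right_mono mult_left_mono power_mono)
    qed
    also have "w 0 = mk (s - ln (real q))"
      using mkc[of s 0] by (simp add: w_def c_def)
    finally show ?thesis .
  qed
  have shift: "integrable lborel (\<lambda>s. mk (s + d))" "(LINT s|lborel. mk (s + d)) = kap" for d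
  proof -
    have "integrable lborel (\<lambda>s. mk (d + 1 * s))" by (rule lborel_integrable_real_affine[OF integrable_mk]) simp
    thus "integrable lborel (\<lambda>s. mk (s + d))" by (simp add: add.commute)
    show "(LINT s|lborel. mk (s + d)) = kap"
      unfolding kap_def using lborel_integral_real_affine[of 1 mk d] by (simp add: add.commute)
  qed
  have dom: "integrable lborel (\<lambda>s. real q * mk (s - ln (real q)))"
    using shift(1)[of "- ln (real q)"] by (intro integrable_mult_right) simp
  have Si: "integrable lborel (S N)" for N
    unfolding S_def[abs_def] by (intro Bochner_Integration.integrable_sum integrable_mult_right integrable_of_real shift)
  have Sm [measurable]: "S N \<in> borel_measurable lborel" for N by (rule borel_measurable_integrable[OF Si])
  have Gm [measurable]: "G \<in> borel_measurable lborel"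
    by (rule borel_measurable_LIMSEQ_metric[OF Sm SG])
  have Sint: "integral\<^sup>L lborel (S N) = of_real kap * (\<Sum>n<N. \<psi> (int (Suc n)) / of_real (sqrt (real (Suc n))))" for N
  proof -
    have "integral\<^sup>L lborel (S N) = (\<Sum>n<N. LINT s|lborel. (\<psi> (int (Suc n)) / of_real (sqrt (real (Suc n)))) * of_real (mk (s + c n)))"
      unfolding S_def[abs_def] by (intro Bochner_Integration.integral_sum integrable_mult_right integrable_of_real shift)
    also have "\<dots> = (\<Sum>n<N. (\<psi> (int (Suc n)) / of_real (sqrt (real (Suc n)))) * of_real kap)"
      by (intro sum.cong refl) (simp only: integral_mult_right_zero integral_complex_of_real shift)
    finally show ?thesis by (simp add: sum_distrib_left mult.commute)
  qed
  have Gi: "integrable lborel G"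
    by (rule integrable_dominated_convergence[where s = S, OF Gm Sm dom AE_I2[OF SG] AE_I2[OF Sb]])
  have "(\<lambda>N. integral\<^sup>L lborel (S N)) \<longlonglongrightarrow> integral\<^sup>L lborel G"
    by (rule integral_dominated_convergence[where s = S, OF Gm Sm dom AE_I2[OF SG] AE_I2[OF Sb]])
  moreover have "(\<lambda>N. integral\<^sup>L lborel (S N)) \<longlonglongrightarrow> of_real kap * dirichlet_L (1/2) \<psi>"
    unfolding Sint using dirichlet_L_half_sums[OF q dc np] by (intro tendsto_mult tendsto_const) (simp only: sums_def)
  ultimately have GL: "integral\<^sup>L lborel G = of_real kap * dirichlet_L (1/2) \<psi>"
    using LIMSEQ_unique by blast
  obtain \<epsilon> where eps: "\<And>y. y > 0 \<Longrightarrow> theta q \<psi> y = \<epsilon> / of_real (sqrt y) * cnj (theta q \<psi> (1 / y))"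
    using theta_functional_equation[OF q ev np] by blast
  have Gneg: "G (- s) = \<epsilon> * cnj (G s)" for s
  proof -
    have "theta q \<psi> (exp (- s)) = \<epsilon> / of_real (sqrt (exp (- s))) * cnj (theta q \<psi> (exp s))"
      using eps[of "exp (- s)"] by (simp add: exp_minus field_simps)
    moreover have "sqrt (exp (- s)) = exp (- s / 2)"
      by (rule real_sqrt_unique) (auto simp: power2_eq_square exp_add[symmetric])
    moreover have "exp (- s / 4) = exp (s / 4) * exp (- s / 2)" by (simp add: exp_add[symmetric])
    ultimately show ?thesis unfolding G_def by (simp add: field_simps)
  qed
  \<comment> \<open>Applying the reflection formula twice amounts to
    \<open>norm \<epsilon> = 1\<close>; in this multiplied form no point with
    \<open>G s \<noteq> 0\<close> has to be exhibited.\<close>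
  have Geps: "G s = of_real ((norm \<epsilon>)\<^sup>2) * G s" for s
  proof -
    have "G s = \<epsilon> * cnj (\<epsilon> * cnj (G s))" using Gneg[of "- s"] Gneg[of s] by simp
    thus ?thesis by (simp only: complex_cnj_mult complex_cnj_cnj complex_norm_square mult.assoc)
  qed
  define F where "F p = G (fst p) * cnj (G (snd p))" for p
  have Fsym: "F (- x, - y) = cnj (F (x, y))" for x y
  proof -
    have "F (- x, - y) = cnj (G x) * (\<epsilon> * cnj \<epsilon> * G y)" by (simp add: F_def Gneg)
    also have "\<epsilon> * cnj \<epsilon> * G y = G y" using Geps[of y] by (simp only: complex_norm_square)
    finally show ?thesis by (simp add: F_def)
  qed
  have Fi: "integrable P2 F" unfolding F_def[abs_def]
    by (rule integrable_P2_mult(1)[OF Gi]) (use Gi in simp)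
  have "(LINT p|P2. F p) = integral\<^sup>L lborel G * (LINT s|lborel. cnj (G s))" unfolding F_def
    by (rule integrable_P2_mult(2)[OF Gi]) (use Gi in simp)
  also have "\<dots> = of_real kap * of_real kap * (dirichlet_L (1/2) \<psi> * cnj (dirichlet_L (1/2) \<psi>))"
    by (simp add: GL)
  also have "dirichlet_L (1/2) \<psi> * cnj (dirichlet_L (1/2) \<psi>) = of_real ((norm (dirichlet_L (1/2) \<psi>))\<^sup>2)"
    by (simp only: complex_norm_square)
  also have "of_real kap * of_real kap * of_real ((norm (dirichlet_L (1/2) \<psi>))\<^sup>2) = 
      (of_real (kap\<^sup>2 * (norm (dirichlet_L (1/2) \<psi>))\<^sup>2) :: complex)"
    by (simp add: power2_eq_square)
  finally have KL: "kap\<^sup>2 * (norm (dirichlet_L (1/2) \<psi>))\<^sup>2 = 2 * Re (LINT p|P2. (if fst p + snd p > 0 then F p else 0))"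
    using integral_P2_half_planes[OF Fi Fsym] by (simp only: of_real_eq_iff)
  have SN: "(LINT p|P2. (if fst p + snd p > 0 then S N (fst p) * cnj (S N (snd p)) else 0)) = 
     (\<Sum>m<N. \<Sum>n<N. \<psi> (int (Suc m)) * cnj (\<psi> (int (Suc n))) *
            of_real (tailk (2 * ln (real (Suc m) * real (Suc n)) - 2 * ln (real q)) / sqrt (real (Suc m) * real (Suc n))))" for N
  proof -
    define a where "a n = \<psi> (int (Suc n)) / of_real (sqrt (real (Suc n)))" for n
    have "(if fst p + snd p > 0 then S N (fst p) * cnj (S N (snd p)) else 0) = 
       (\<Sum>m<N. \<Sum>n<N. (a m * cnj (a n)) * of_real (if fst p + snd p > 0 then mk (fst p + c m) * mk (snd p + c n) else 0))" for p
    proof -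
      have "S N s = (\<Sum>n<N. a n * of_real (mk (s + c n)))" for s by (simp only: S_def a_def)
      thus ?thesis by (simp add: sum_product mult_ac)
    qed
    hence "(LINT p|P2. (if fst p + snd p > 0 then S N (fst p) * cnj (S N (snd p)) else 0)) = 
      (LINT p|P2. (\<Sum>m<N. \<Sum>n<N. (a m * cnj (a n)) * of_real (if fst p + snd p > 0 then mk (fst p + c m) * mk (snd p + c n) else 0)))" by presburger
    also have "\<dots> = (\<Sum>m<N. \<Sum>n<N. (a m * cnj (a n)) * of_real (LINT p|P2. (if fst p + snd p > 0 then mk (fst p + c m) * mk (snd p + c n) else 0)))"
    proof -
      have ii: "integrable P2 (\<lambda>p. (a m * cnj (a n)) * complex_of_real (if fst p + snd p > 0 then mk (fst p + c m) * mk (snd p + c n) else 0))" for m n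
        by (intro integrable_mult_right integrable_of_real integrable_P2_if integrable_P2_mult shift) measurable
      show ?thesis
        by (simp only: Bochner_Integration.integral_sum ii Bochner_Integration.integrable_sum integral_mult_right_zero integral_complex_of_real)
    qed
    also have "\<dots> = (\<Sum>m<N. \<Sum>n<N. (a m * cnj (a n)) * of_real (tailk (c m + c n)))"
      unfolding tailk_shift ..
    finally have X: "(LINT p|P2. (if fst p + snd p > 0 then S N (fst p) * cnj (S N (snd p)) else 0)) = 
      (\<Sum>m<N. \<Sum>n<N. (a m * cnj (a n)) * of_real (tailk (c m + c n)))" .
    have e: "(a m * cnj (a n)) * of_real (tailk (c m + c n)) = \<psi> (int (Suc m)) * cnj (\<psi> (int (Suc n))) *
            of_real (tailk (2 * ln (real (Suc m) * real (Suc n)) - 2 * ln (real q)) / sqrt (real (Suc m) * real (Suc n)))" for m n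
    proof -
      have cc: "c m + c n = 2 * ln (real (Suc m) * real (Suc n)) - 2 * ln (real q)"
        using ln_mult[of "real (Suc m)" "real (Suc n)"] by (simp add: c_def del: of_nat_Suc)
      show ?thesis unfolding cc by (simp add: a_def real_sqrt_mult del: of_nat_Suc)
    qed
    show ?thesis unfolding X e ..
  qed
  have dom2: "integrable P2 (\<lambda>p. (real q * mk (fst p - ln (real q))) * (real q * mk (snd p - ln (real q))))"
    by (rule integrable_P2_mult(1)[OF dom dom])
  have "(\<lambda>N. LINT p|P2. (if fst p + snd p > 0 then S N (fst p) * cnj (S N (snd p)) else 0)) \<longlonglongrightarrow> (LINT p|P2. (if fst p + snd p > 0 then F p else 0))"
  proof (rule integral_dominated_convergence[OF _ _ dom2])
    show "(\<lambda>p. if 0 < fst p + snd p then F p else 0) \<in> borel_measurable P2"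
      by (rule borel_measurable_integrable[OF integrable_P2_if[OF Fi]]) measurable
    show "(\<lambda>p. if 0 < fst p + snd p then S N (fst p) * cnj (S N (snd p)) else 0) \<in> borel_measurable P2" for N
    proof (rule borel_measurable_integrable[OF integrable_P2_if])
      show "integrable P2 (\<lambda>p. S N (fst p) * cnj (S N (snd p)))"
        by (rule integrable_P2_mult(1)[OF Si]) (use Si in simp)
    qed measurable
    show "AE p in P2. (\<lambda>N. if 0 < fst p + snd p then S N (fst p) * cnj (S N (snd p)) else 0) \<longlonglongrightarrow> (if 0 < fst p + snd p then F p else 0)"
      by (rule AE_I2) (auto simp: F_def intro!: tendsto_intros SG)
    show "AE p in P2. norm (if 0 < fst p + snd p then S N (fst p) * cnj (S N (snd p)) else 0) \<le> real q * mk (fst p - ln (real q)) * (real q * mk (snd p - ln (real q)))" for N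
    proof (rule AE_I2)
      fix p :: "real \<times> real"
      have "norm (S N (fst p)) * norm (S N (snd p)) \<le> (real q * mk (fst p - ln (real q))) * (real q * mk (snd p - ln (real q)))"
        using Sb by (intro mult_mono) (auto simp: mk_pos less_imp_le)
      moreover have "0 \<le> (real q * mk (fst p - ln (real q))) * (real q * mk (snd p - ln (real q)))"
        by (simp add: mk_pos less_imp_le)
      ultimately show "norm (if 0 < fst p + snd p then S N (fst p) * cnj (S N (snd p)) else 0) \<le> real q * mk (fst p - ln (real q)) * (real q * mk (snd p - ln (real q)))"
        by (simp add: norm_mult)
    qed
  qed
  from tendsto_mult[OF tendsto_const[of 2] tendsto_Re[OF this]] show ?thesis
    unfolding SN KL .
qed

section \<open>Decay of the cut-off and its sum along the diagonal\<close>

lemma tailk_integrable: "integrable P2 (\<lambda>p. if fst p + snd p > r then mk (fst p) * mk (snd p) else 0)"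
  by (rule integrable_P2_if[OF integrable_P2_mult(1)[OF integrable_mk integrable_mk]]) measurable

lemma tailk_nonneg: "tailk r \<ge> 0"
  unfolding tailk_def by (intro integral_nonneg_AE AE_I2) (simp add: mk_pos less_imp_le)

text \<open>On the half-plane \<open>x + y > r\<close> the factor
  \<open>exp ((x + y - r) / 2)\<close> is at least 1. At \<open>r = 2 * ln (m * n / q)\<close> the
  resulting decay is \<open>q / (m * n)\<close>, enough for absolutely convergent double
  sums.\<close>

lemma tailk_le: "tailk r \<le> (LINT s|lborel. exp (1/2 * s) * mk s)\<^sup>2 * exp (- r / 2)"
proof -
  have i: "integrable lborel (\<lambda>s. exp (1/2 * s) * mk s)" by (rule integrable_mk_exp) auto
  have "tailk r \<le> (LINT p|P2. exp (- r / 2) * ((exp (1/2 * fst p) * mk (fst p)) * (exp (1/2 * snd p) * mk (snd p))))"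
    unfolding tailk_def
  proof (rule integral_mono[OF tailk_integrable])
    show "integrable P2 (\<lambda>p. exp (- r / 2) * ((exp (1/2 * fst p) * mk (fst p)) * (exp (1/2 * snd p) * mk (snd p))))"
      by (intro integrable_mult_right integrable_P2_mult(1)[OF i i])
    fix p :: "real \<times> real"
    have eq: "exp (- r / 2) * ((exp (1/2 * fst p) * mk (fst p)) * (exp (1/2 * snd p) * mk (snd p))) = 
       exp ((fst p + snd p - r) / 2) * (mk (fst p) * mk (snd p))"
    proof -
      have "exp ((fst p + snd p - r) / 2) = exp (- r / 2) * exp (1/2 * fst p) * exp (1/2 * snd p)"
        unfolding exp_add[symmetric] by (rule arg_cong[of _ _ exp]) (simp add: field_simps)
      thus ?thesis by (simp only: mult_ac)
    qed
    show "(if r < fst p + snd p then mk (fst p) * mk (snd p) else 0) \<le> exp (- r / 2) * ((exp (1/2 * fst p) * mk (fst p)) * (exp (1/2 * snd p) * mk (snd p)))"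
      unfolding eq using mk_pos[of "fst p"] mk_pos[of "snd p"] by (auto intro!: mult_right_mono)
  qed
  also have "\<dots> = exp (- r / 2) * ((LINT s|lborel. exp (1/2 * s) * mk s) * (LINT s|lborel. exp (1/2 * s) * mk s))"
    using integrable_P2_mult(2)[OF i i] by simp
  finally show ?thesis by (simp add: power2_eq_square mult_ac)
qed

text \<open>Here \<open>n\<close> counts the positive integers below \<open>X\<close>. The exponent
  -1/2 anticipates the integration with \<open>X = exp ((x + y) / 4) * sqrt T\<close>: an error of
  order \<open>1 / X\<close> would cancel the whole decay of \<open>mk\<close> at minus infinity.
  For \<open>X \<le> 1\<close> the harmonic sum is empty and the error term absorbs
  \<open>- ln X\<close>.\<close>

lemma harm_approx:
  fixes X :: real
  assumes X: "X > 0"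
  defines "n \<equiv> nat (\<lceil>X\<rceil> - 1)"
  shows "\<bar>harm n - ln X - euler_mascheroni\<bar> \<le> 2 * X powr (-1/2)"
proof (cases "X \<le> 1")
  case True
  have n: "n = 0" using True X by (simp add: n_def ceiling_le_iff)
  have x1: "X powr (-1/2) \<ge> 1" using True X powr_mono2'[of "-1/2" X 1] by simp
  have "ln (X powr (-1/2)) \<le> X powr (-1/2) - 1" using X by (intro ln_le_minus_one) simp
  hence "- ln X \<le> 2 * X powr (-1/2) - 2" using X by (simp add: ln_powr)
  moreover have "ln X \<le> 0" using True X by simp
  moreover have "(0::real) < euler_mascheroni" "(euler_mascheroni::real) < 1" 
    using euler_mascheroni_pos euler_mascheroni_less_13_over_22 by auto
  ultimately show ?thesis using n x1 by (simp add: harm_def abs_le_iff)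
next
  case False
  hence "n \<ge> 1" unfolding n_def by (simp add: le_nat_iff le_ceiling_iff)
  then obtain k where k: "n = Suc k" by (cases n) auto
  have n1: "real n < X" "X \<le> real n + 1"
    using False unfolding n_def by linarith+
  have lo: "euler_mascheroni \<ge> harm n - ln (real n + 1) + 1 / real (2 * (k + 2))"
    and up: "euler_mascheroni \<le> harm n - ln (real n + 1) + 1 / real (2 * (k + 1))"
    using euler_mascheroni_lower[of k] euler_mascheroni_upper[of k] by (simp_all add: k add_ac)
  have np: "real n > 0" using k by simp
  have "ln (real n + 1) - ln (real n) = ln (1 + 1 / real n)"
  proof -
    have "1 + 1 / real n = (real n + 1) / real n" using np by (simp add: field_simps)
    thus ?thesis using np ln_div[of "real n + 1" "real n"] by simp
  qed
  also have "\<dots> \<le> 1 / real n" using np by (intro ln_add_one_self_le_self) auto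
  finally have l: "ln (real n + 1) - ln (real n) \<le> 1 / real n" .
  have "ln (real n) \<le> ln X" "ln X \<le> ln (real n + 1)" using n1 np by auto
  moreover have "1 / real (2 * (k + 1)) \<le> 1 / real n" "1 / real (2 * (k + 2)) \<ge> 0" using k by (auto simp: field_simps)
  ultimately have "\<bar>harm n - ln X - euler_mascheroni\<bar> \<le> 1 / real n"
    using lo up l by linarith
  also have "\<dots> \<le> 2 / X"
  proof -
    have "X \<le> 2 * real n" using n1 k by simp
    thus ?thesis using np X by (simp add: divide_simps)
  qed
  also have "2 / X \<le> 2 * X powr (-1/2)"
  proof -
    have "X powr (-1) \<le> X powr (-1/2)" by (rule powr_mono) (use False in auto)
    moreover have "X powr (-1) = 1 / X" using X by (simp only: powr_minus_divide) simp
    ultimately show ?thesis by simp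
  qed
  finally show ?thesis .
qed

text \<open>Sum and integral are interchanged: at a fixed point \<open>(x, y)\<close> the sum over
  \<open>l\<close> is the harmonic sum below \<open>X = exp ((x + y) / 4) * sqrt T\<close>.
  Replacing it by \<open>ln X\<close> plus Euler's constant, the factor \<open>sqrt T\<close> yields
  \<open>kap\<^sup>2 / 2 * ln T\<close>, and the rest integrates to \<open>C1\<close>, independent
  of \<open>T\<close>.\<close>

lemma tailk_diagonal_sum:
  obtains C1 C2 :: real where "C2 \<ge> 0"
    "\<And>T. T > 0 \<Longrightarrow> \<exists>J. (\<lambda>M. \<Sum>l<M. tailk (2 * ln ((real (Suc l))\<^sup>2 / T)) / real (Suc l)) \<longlonglongrightarrow> J \<and>
            \<bar>J - (kap\<^sup>2 / 2 * ln T + C1)\<bar> \<le> C2 * T powr (-1/4)"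
proof -
  define em :: real where "em = euler_mascheroni"
  have im: "integrable lborel (\<lambda>s. exp ((-1/8) * s) * mk s)" by (rule integrable_mk_exp) auto
  define k2 where "k2 = (LINT s|lborel. exp ((-1/8) * s) * mk s)"
  have ikk: "integrable P2 (\<lambda>p. mk (fst p) * mk (snd p))" "(LINT p|P2. mk (fst p) * mk (snd p)) = kap\<^sup>2"
    using integrable_P2_mult[OF integrable_mk integrable_mk] by (auto simp: kap_def power2_eq_square)
  have i1: "integrable P2 (\<lambda>p. (fst p * mk (fst p)) * mk (snd p))" by (rule integrable_P2_mult(1)[OF integrable_mk_ident integrable_mk])
  have i2: "integrable P2 (\<lambda>p. mk (fst p) * (snd p * mk (snd p)))" by (rule integrable_P2_mult(1)[OF integrable_mk integrable_mk_ident])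
  have i3: "integrable P2 (\<lambda>p. (exp ((-1/8) * fst p) * mk (fst p)) * (exp ((-1/8) * snd p) * mk (snd p)))"
    "(LINT p|P2. (exp ((-1/8) * fst p) * mk (fst p)) * (exp ((-1/8) * snd p) * mk (snd p))) = k2\<^sup>2"
    using integrable_P2_mult[OF im im] by (auto simp: k2_def power2_eq_square)
  define A where "A p = ((fst p + snd p) / 4 + em) * (mk (fst p) * mk (snd p))" for p
  have iA: "integrable P2 A"
  proof -
    have "A = (\<lambda>p. (1/4) * ((fst p * mk (fst p)) * mk (snd p)) + (1/4) * (mk (fst p) * (snd p * mk (snd p))) + em * (mk (fst p) * mk (snd p)))"
      by (auto simp: A_def fun_eq_iff field_simps)
    thus ?thesis using i1 i2 ikk(1) by simp
  qed
  define C1 where "C1 = integral\<^sup>L P2 A"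
  have main: "\<exists>J. (\<lambda>M. \<Sum>l<M. tailk (2 * ln ((real (Suc l))\<^sup>2 / T)) / real (Suc l)) \<longlonglongrightarrow> J \<and>
            \<bar>J - (kap\<^sup>2 / 2 * ln T + C1)\<bar> \<le> (2 * k2\<^sup>2) * T powr (-1/4)" if T: "T > 0" for T
  proof -
    define X where "X p = exp ((fst p + snd p) / 4) * sqrt T" for p :: "real \<times> real"
    have X0: "X p > 0" for p using T by (simp add: X_def)
    have lnX: "ln (X p) = (fst p + snd p) / 4 + ln T / 2" for p
      using T by (simp add: X_def ln_mult ln_sqrt)
    define n where "n p = nat (\<lceil>X p\<rceil> - 1)" for p
    define f where "f M p = (\<Sum>l<M. (1 / real (Suc l)) * (if fst p + snd p > 2 * ln ((real (Suc l))\<^sup>2 / T) then mk (fst p) * mk (snd p) else 0))" for M p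
    define g where "g p = harm (n p) * (mk (fst p) * mk (snd p))" for p
    have iff: "fst p + snd p > 2 * ln ((real (Suc l))\<^sup>2 / T) \<longleftrightarrow> l < n p" for p l
    proof -
      have "fst p + snd p > 2 * ln ((real (Suc l))\<^sup>2 / T) \<longleftrightarrow> ln (real (Suc l)) < ln (X p)"
      proof -
        have "2 * ln ((real (Suc l))\<^sup>2 / T) = 4 * ln (real (Suc l)) - 2 * ln T"
          using T by (simp add: ln_div ln_realpow del: of_nat_Suc)
        moreover have gen: "A < D \<longleftrightarrow> B < D / 4 + C / 2" if "A = 4 * B - 2 * C" for A B C D :: real
          using that by (auto simp: field_simps)
        ultimately show ?thesis unfolding lnX by blast
      qed
      also have "\<dots> \<longleftrightarrow> real (Suc l) < X p" using X0[of p] by (subst ln_less_cancel_iff) auto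
      also have "\<dots> \<longleftrightarrow> int (Suc l) < \<lceil>X p\<rceil>" by (simp add: less_ceiling_iff)
      also have "\<dots> \<longleftrightarrow> l < n p" unfolding n_def by linarith
      finally show ?thesis .
    qed
    have f_eq: "f M p = harm (min M (n p)) * (mk (fst p) * mk (snd p))" for M p
    proof -
      have "f M p = (\<Sum>l<M. if l < n p then (1 / real (Suc l)) * (mk (fst p) * mk (snd p)) else 0)"
        unfolding f_def iff by (intro sum.cong refl) auto
      also have "\<dots> = (\<Sum>l\<in>{..<M} \<inter> {l. l < n p}. (1 / real (Suc l)) * (mk (fst p) * mk (snd p)))"
        by (subst sum.inter_restrict) auto
      also have "{..<M} \<inter> {l. l < n p} = {..<min M (n p)}" by auto
      also have "(\<Sum>l<min M (n p). (1 / real (Suc l)) * (mk (fst p) * mk (snd p))) = harm (min M (n p)) * (mk (fst p) * mk (snd p))"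
        by (simp add: harm_altdef sum_distrib_right inverse_eq_divide del: of_nat_Suc)
      finally show ?thesis .
    qed
    have fi: "integrable P2 (f M)" for M
      unfolding f_def[abs_def] by (intro Bochner_Integration.integrable_sum integrable_mult_right tailk_integrable)
    have fm: "f M \<in> borel_measurable P2" for M by (rule borel_measurable_integrable[OF fi])
    have lim: "(\<lambda>M. f M p) \<longlonglongrightarrow> g p" for p
      unfolding f_eq g_def by (intro tendsto_eventually eventually_sequentiallyI[of "n p"]) (simp add: min_def)
    have gm: "g \<in> borel_measurable P2" by (rule borel_measurable_LIMSEQ_metric[OF fm lim])
    define B where "B p = (2 * T powr (-1/4)) * ((exp ((-1/8) * fst p) * mk (fst p)) * (exp ((-1/8) * snd p) * mk (snd p)))" for p
    have iB: "integrable P2 B" unfolding B_def[abs_def] by (intro integrable_mult_right i3)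
    define A' where "A' p = A p + (ln T / 2) * (mk (fst p) * mk (snd p))" for p
    have iA': "integrable P2 A'" unfolding A'_def[abs_def] using iA ikk(1) by simp
    have gA: "\<bar>g p - A' p\<bar> \<le> B p" for p
    proof -
      have "g p - A' p = (harm (n p) - ln (X p) - em) * (mk (fst p) * mk (snd p))"
        by (simp add: g_def A'_def A_def lnX algebra_simps)
      hence "\<bar>g p - A' p\<bar> = \<bar>harm (n p) - ln (X p) - em\<bar> * (mk (fst p) * mk (snd p))"
        using mk_pos[of "fst p"] mk_pos[of "snd p"] by (simp add: abs_mult)
      also have "\<dots> \<le> (2 * X p powr (-1/2)) * (mk (fst p) * mk (snd p))"
        using harm_approx[OF X0[of p]] mk_pos[of "fst p"] mk_pos[of "snd p"]
        by (intro mult_right_mono) (auto simp: n_def em_def)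
      also have "X p powr (-1/2) = exp ((-1/8) * fst p) * exp ((-1/8) * snd p) * T powr (-1/4)"
      proof -
        have "X p powr (-1/2) = exp ((-1/8) * fst p + (-1/8) * snd p + (-1/4) * ln T)"
          using X0[of p] by (simp add: powr_def lnX algebra_simps add_divide_distrib)
        thus ?thesis using T by (simp only: exp_add powr_def) simp
      qed
      finally show ?thesis by (simp add: B_def mult_ac)
    qed
    have dom: "integrable P2 (\<lambda>p. \<bar>A' p\<bar> + B p)" by (intro Bochner_Integration.integrable_add integrable_abs iA' iB)
    have fdom: "norm (f M p) \<le> \<bar>A' p\<bar> + B p" for M p
    proof -
      have "0 \<le> f M p" "f M p \<le> g p"
        unfolding f_eq g_def using mk_pos[of "fst p"] mk_pos[of "snd p"] 
        by (auto intro!: mult_right_mono harm_mono simp: harm_nonneg)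
      thus ?thesis using gA[of p] by simp
    qed
    have gi: "integrable P2 g"
      by (rule integrable_dominated_convergence[where s = f, OF gm fm dom AE_I2[OF lim] AE_I2[OF fdom]])
    have L: "(\<lambda>M. integral\<^sup>L P2 (f M)) \<longlonglongrightarrow> integral\<^sup>L P2 g"
      by (rule integral_dominated_convergence[where s = f, OF gm fm dom AE_I2[OF lim] AE_I2[OF fdom]])
    have "integral\<^sup>L P2 (f M) = (\<Sum>l<M. tailk (2 * ln ((real (Suc l))\<^sup>2 / T)) / real (Suc l))" for M
      unfolding f_def[abs_def] tailk_def
      by (subst Bochner_Integration.integral_sum) (auto intro!: tailk_integrable simp del: of_nat_Suc)
    with L have L': "(\<lambda>M. \<Sum>l<M. tailk (2 * ln ((real (Suc l))\<^sup>2 / T)) / real (Suc l)) \<longlonglongrightarrow> integral\<^sup>L P2 g" by simp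
    have IA': "integral\<^sup>L P2 A' = kap\<^sup>2 / 2 * ln T + C1"
      unfolding A'_def[abs_def] C1_def using iA ikk by simp
    have "\<bar>integral\<^sup>L P2 g - integral\<^sup>L P2 A'\<bar> = \<bar>LINT p|P2. g p - A' p\<bar>"
      using gi iA' by simp
    also have "\<dots> \<le> (LINT p|P2. \<bar>g p - A' p\<bar>)" by (rule integral_abs_bound)
    also have "\<dots> \<le> integral\<^sup>L P2 B"
      by (rule integral_mono) (use gi iA' iB gA in auto)
    also have "\<dots> = (2 * k2\<^sup>2) * T powr (-1/4)" unfolding B_def[abs_def] using i3(2) by simp
    finally show ?thesis using L' IA' by auto
  qed
  show ?thesis by (rule that[of "2 * k2\<^sup>2" C1]) (use main in auto)
qed

section \<open>Off-diagonal terms and the twisted moment\<close>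

definition zw :: "nat \<Rightarrow> real" where "zw n = real n powr (-3/2)"

definition zsum :: real where "zsum = (\<Sum>n. zw (Suc n))"

lemma zw_nonneg: "zw n \<ge> 0" by (simp add: zw_def)

lemma sum_zw_le:
  assumes "finite A" "0 \<notin> A"
  shows "sum zw A \<le> zsum"
proof -
  have "summable (\<lambda>n. real n powr (-3/2))" by (subst summable_real_powr_iff) auto
  hence s: "summable (\<lambda>n. zw (Suc n))" unfolding zw_def by (subst summable_Suc_iff)
  have "A \<subseteq> Suc ` {..Max (insert 0 A)}"
  proof
    fix x assume x: "x \<in> A"
    then obtain y where y: "x = Suc y" using assms(2) by (cases x) auto
    have "x \<le> Max (insert 0 A)" using x assms(1) by (intro Max_ge) auto
    thus "x \<in> Suc ` {..Max (insert 0 A)}" using y by auto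
  qed
  hence "sum zw A \<le> sum zw (Suc ` {..Max (insert 0 A)})"
    by (intro sum_mono2) (auto simp: zw_nonneg)
  also have "\<dots> = (\<Sum>n\<in>{..Max (insert 0 A)}. zw (Suc n))" by (simp add: sum.reindex)
  also have "\<dots> \<le> zsum" unfolding zsum_def using s by (intro sum_le_suminf) (auto simp: zw_nonneg)
  finally show ?thesis .
qed

lemma zsum_nonneg: "zsum \<ge> 0" using sum_zw_le[of "{}"] by simp

lemma sum_zw_product_le:
  assumes "finite S" "\<And>p. p \<in> S \<Longrightarrow> fst p \<noteq> 0 \<and> snd p \<noteq> 0"
  shows "(\<Sum>p\<in>S. zw (fst p) * zw (snd p)) \<le> zsum\<^sup>2"
proof -
  have "(\<Sum>p\<in>S. zw (fst p) * zw (snd p)) \<le> (\<Sum>p\<in>fst ` S \<times> snd ` S. zw (fst p) * zw (snd p))"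
    using assms(1) by (intro sum_mono2) (auto simp: zw_nonneg intro: rev_image_eqI)
  also have "\<dots> = sum zw (fst ` S) * sum zw (snd ` S)"
    by (simp add: sum_product sum.cartesian_product case_prod_unfold)
  also have "\<dots> \<le> zsum * zsum"
    using assms by (intro mult_mono sum_zw_le sum_nonneg zw_nonneg zsum_nonneg) force+
  finally show ?thesis by (simp add: power2_eq_square)
qed

text \<open>With \<open>p = (m, n)\<close>, the number \<open>a * m - \<sigma> * b * n\<close> is a
  positive multiple \<open>q * l\<close> and at most \<open>2 * a * m\<close>. So \<open>m\<close>
  is at least \<open>q * l / (2 * a)\<close>, and \<open>m\<close> can be exchanged for
  \<open>l\<close> as the new summation variable, because \<open>l\<close> and \<open>n\<close>
  determine \<open>m\<close>. The exchange gains the power \<open>q powr (-3/2)\<close>.\<close>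

lemma off_diagonal_half:
  fixes \<sigma> :: int
  assumes \<sigma>: "\<bar>\<sigma>\<bar> = 1" and a: "a > 0" and q: "q > 0" and S: "finite S"
    and SD: "\<And>p. p \<in> S \<Longrightarrow> fst p \<noteq> 0 \<and> snd p \<noteq> 0 \<and> b * snd p \<le> a * fst p \<and>
          int (a * fst p) \<noteq> \<sigma> * int (b * snd p) \<and> int q dvd int (a * fst p) - \<sigma> * int (b * snd p)"
  shows "(\<Sum>p\<in>S. zw (fst p) * zw (snd p)) \<le> (2 * real a / real q) powr (3/2) * zsum\<^sup>2"
proof -
  define l where "l p = nat ((int (a * fst p) - \<sigma> * int (b * snd p)) div int q)" for p
  have l: "int (a * fst p) - \<sigma> * int (b * snd p) = int q * int (l p) \<and> l p > 0 \<and> q * l p \<le> 2 * (a * fst p)" if pS: "p \<in> S" for p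
  proof -
    let ?D = "int (a * fst p) - \<sigma> * int (b * snd p)"
    have "\<sigma> = 1 \<or> \<sigma> = -1" using \<sigma> by linarith
    moreover have "int (b * snd p) \<le> int (a * fst p)" using SD[OF pS] by linarith
    ultimately have D: "?D > 0" "?D \<le> 2 * int (a * fst p)" using SD[OF pS] by (auto simp del: of_nat_mult)
    obtain k where k: "?D = int q * k" using SD[OF pS] by (auto elim: dvdE)
    have kp: "k > 0" using D(1)[unfolded k] q by (simp add: zero_less_mult_iff)
    have "l p = nat k" unfolding l_def k using q by simp
    hence lk: "int (l p) = k" using kp by simp
    have "int (q * l p) \<le> int (2 * (a * fst p))" using D(2) k lk by simp
    hence "q * l p \<le> 2 * (a * fst p)" by (simp only: of_nat_le_iff)
    thus ?thesis using k kp lk by simp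
  qed
  have inj: "inj_on (\<lambda>p. (l p, snd p)) S"
  proof (rule inj_onI)
    fix p p' assume p: "p \<in> S" "p' \<in> S" "(l p, snd p) = (l p', snd p')"
    have e: "l p = l p'" "snd p = snd p'" using p(3) by auto
    have "int (a * fst p) - \<sigma> * int (b * snd p) = int (a * fst p') - \<sigma> * int (b * snd p')"
      using l[OF p(1)] l[OF p(2)] e(1) by (simp only:)
    hence "int (a * fst p) = int (a * fst p')" unfolding e(2) by simp
    hence "fst p = fst p'" using a by simp
    thus "p = p'" using p(3) by (simp add: prod_eq_iff)
  qed
  have "(\<Sum>p\<in>S. zw (fst p) * zw (snd p)) \<le> (\<Sum>p\<in>S. (2 * real a / real q) powr (3/2) * (zw (l p) * zw (snd p)))"
  proof (rule sum_mono)
    fix p assume p: "p \<in> S"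
    have m0: "fst p > 0" using SD[OF p] by simp
    have "real (q * l p) \<le> real (2 * (a * fst p))" using l[OF p] by (simp only: of_nat_le_iff)
    hence "real q * real (l p) / (2 * real a) \<le> real (fst p)" using a by (simp add: field_simps)
    hence "real (fst p) powr (-3/2) \<le> (real q * real (l p) / (2 * real a)) powr (-3/2)"
      using a q l[OF p] by (intro powr_mono2') auto
    also have "\<dots> = (real q / (2 * real a)) powr (-3/2) * zw (l p)"
      unfolding zw_def by (simp add: powr_mult[symmetric])
    also have "(real q / (2 * real a)) powr (-3/2) = (2 * real a / real q) powr (3/2)"
      using a q by (simp add: powr_minus_divide powr_divide)
    finally have "zw (fst p) \<le> (2 * real a / real q) powr (3/2) * zw (l p)" unfolding zw_def .
    thus "zw (fst p) * zw (snd p) \<le> (2 * real a / real q) powr (3/2) * (zw (l p) * zw (snd p))"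
      using zw_nonneg[of "snd p"] by (simp only: mult.assoc[symmetric] mult_right_mono)
  qed
  also have "\<dots> = (2 * real a / real q) powr (3/2) * (\<Sum>p\<in>S. zw (l p) * zw (snd p))" by (simp add: sum_distrib_left)
  also have "(\<Sum>p\<in>S. zw (l p) * zw (snd p)) = (\<Sum>r\<in>(\<lambda>p. (l p, snd p)) ` S. zw (fst r) * zw (snd r))"
    by (simp add: sum.reindex[OF inj])
  also have "(2 * real a / real q) powr (3/2) * \<dots> \<le> (2 * real a / real q) powr (3/2) * zsum\<^sup>2"
    using S l SD by (intro mult_left_mono sum_zw_product_le) force+
  finally show ?thesis .
qed

lemma sum_Un_le:
  fixes f :: "'a \<Rightarrow> real"
  assumes "finite A" "finite B" "\<And>x. f x \<ge> 0"
  shows "sum f (A \<union> B) \<le> sum f A + sum f B"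
  using sum.union_inter[OF assms(1,2), of f] sum_nonneg[of "A \<inter> B" f] assms(3) by simp

text \<open>Up to the factor 2, the coefficient of \<open>\<psi> m * cnj (\<psi> n)\<close> in
  \<open>norm_L_square_limit\<close>.\<close>

definition Kq :: "nat \<Rightarrow> nat \<Rightarrow> nat \<Rightarrow> real" where
  "Kq q m n = tailk (2 * ln (real m * real n) - 2 * ln (real q)) / sqrt (real m * real n)"

definition kq0 :: real where "kq0 = (LINT s|lborel. exp (1/2 * s) * mk s)\<^sup>2"

lemma Kq_nonneg: "Kq q m n \<ge> 0"
  by (simp add: Kq_def tailk_nonneg)

text \<open>Here \<open>tailk_le\<close> contributes \<open>q / (m * n)\<close> and the square root
  a further power -1/2, which is the origin of the exponent -3/2 in \<open>zw\<close>.\<close>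

lemma Kq_le:
  assumes "m > 0" "n > 0" "q > 0"
  shows "Kq q m n \<le> kq0 * real q * (zw m * zw n)"
proof -
  have p: "real m * real n > 0" using assms by simp
  have "tailk (2 * ln (real m * real n) - 2 * ln (real q)) \<le> kq0 * exp (- (2 * ln (real m * real n) - 2 * ln (real q)) / 2)"
    unfolding kq0_def by (rule tailk_le)
  also have "- (2 * ln (real m * real n) - 2 * ln (real q)) / 2 = ln (real q) - ln (real m * real n)" by simp
  also have "exp (ln (real q) - ln (real m * real n)) = real q / (real m * real n)"
    unfolding exp_diff using p assms by (simp del: of_nat_mult)
  finally have "Kq q m n \<le> kq0 * (real q / (real m * real n)) / sqrt (real m * real n)"
    unfolding Kq_def by (rule divide_right_mono) simp
  also have "\<dots> = kq0 * real q * ((real m * real n) powr (-1) * (real m * real n) powr (-1/2))"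
    using p by (simp add: powr_minus_divide powr_half_sqrt[symmetric])
  also have "(real m * real n) powr (-1) * (real m * real n) powr (-1/2) = (real m * real n) powr (-3/2)"
  proof -
    have "(-1) + (-1/2) = (-3/2 :: real)" by simp
    thus ?thesis by (simp only: powr_add[symmetric])
  qed
  finally show ?thesis by (simp add: zw_def powr_mult)
qed

text \<open>\<open>W\<close> is what orthogonality selects and \<open>D\<close> the true diagonal. A
  pair in \<open>W - D\<close> falls into one of four cases, according to the sign in the congruence
  and the larger of the two products, each handled by \<open>off_diagonal_half\<close>. A pair in
  \<open>D - W\<close> has both entries divisible by \<open>q\<close>, because \<open>q\<close>
  divides neither \<open>a\<close> nor \<open>b\<close>, and the rescaling by \<open>q\<close> makes
  these negligible.\<close>

lemma congruence_sum_near_diagonal: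
  fixes N :: nat
  assumes q: "prime q" and a: "0 < a" "a \<le> Y" and b: "0 < b" "b \<le> Y" and Y: "Y < q"
  defines "B \<equiv> {1..N} \<times> {1..N}"
  defines "W \<equiv> {p \<in> B. coprime (int (a * fst p)) (int q) \<and> coprime (int (b * snd p)) (int q) \<and>
       ([int (a * fst p) = int (b * snd p)] (mod int q) \<or> [int (a * fst p) = - int (b * snd p)] (mod int q))}"
  defines "D \<equiv> {p \<in> B. a * fst p = b * snd p}"
  shows "\<bar>(\<Sum>p\<in>W. Kq q (fst p) (snd p)) - (\<Sum>p\<in>D. Kq q (fst p) (snd p))\<bar> \<le> 13 * kq0 * zsum\<^sup>2 * (real Y)\<^sup>2 * real q powr (-1/2)"
proof -
  let ?K = "\<lambda>p. Kq q (fst p) (snd p)" and ?z = "\<lambda>p. zw (fst p) * zw (snd p)"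
  have q0: "q > 0" using q prime_gt_0_nat by simp
  have fB: "finite B" by (simp add: B_def)
  have fW: "finite W" "finite D" using fB by (auto simp: W_def D_def)
  define A where "A \<sigma> = {p \<in> B. b * snd p \<le> a * fst p \<and> int (a * fst p) \<noteq> \<sigma> * int (b * snd p) \<and> int q dvd int (a * fst p) - \<sigma> * int (b * snd p)}" for \<sigma>
  define A' where "A' \<sigma> = {p \<in> B. a * fst p \<le> b * snd p \<and> int (a * fst p) \<noteq> \<sigma> * int (b * snd p) \<and> int q dvd int (a * fst p) - \<sigma> * int (b * snd p)}" for \<sigma>
  define C where "C = {p \<in> B. q dvd fst p \<and> q dvd snd p}"
  have fin: "finite (A \<sigma>)" "finite (A' \<sigma>)" "finite C" for \<sigma> using fB by (auto simp: A_def A'_def C_def)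
  define E where "E = (2 * real Y / real q) powr (3/2) * zsum\<^sup>2"
  have mono: "(2 * real x / real q) powr (3/2) * zsum\<^sup>2 \<le> E" if "x \<le> Y" for x
    unfolding E_def using that by (intro mult_right_mono powr_mono2 divide_right_mono) auto
  have SA: "sum ?z (A \<sigma>) \<le> E" if "\<bar>\<sigma>\<bar> = 1" for \<sigma>
    using off_diagonal_half[OF that a(1) q0 fin(1)[of \<sigma>], of b] mono[OF a(2)] by (force simp: A_def B_def)
  have SA': "sum ?z (A' \<sigma>) \<le> E" if s: "\<bar>\<sigma>\<bar> = 1" for \<sigma>
  proof -
    have s1: "\<sigma> = 1 \<or> \<sigma> = -1" using s by linarith
    have "sum ?z (A' \<sigma>) = sum ?z (prod.swap ` A' \<sigma>)"
      by (subst sum.reindex) (auto simp: mult.commute)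
    also have "\<dots> \<le> (2 * real b / real q) powr (3/2) * zsum\<^sup>2"
    proof (rule off_diagonal_half[OF s b(1) q0, where b = a])
      show "finite (prod.swap ` A' \<sigma>)" using fin by simp
      fix p assume "p \<in> prod.swap ` A' \<sigma>"
      then obtain p' where p': "p' \<in> A' \<sigma>" "p = prod.swap p'" by blast
      have d: "int q dvd int (a * fst p') - \<sigma> * int (b * snd p')" and ne: "int (a * fst p') \<noteq> \<sigma> * int (b * snd p')"
        using p'(1) by (auto simp: A'_def)
      have "int q dvd (- \<sigma>) * (int (a * fst p') - \<sigma> * int (b * snd p'))" by (rule dvd_mult[OF d])
      also have "(- \<sigma>) * (int (a * fst p') - \<sigma> * int (b * snd p')) = int (b * snd p') - \<sigma> * int (a * fst p')"
        using s1 by auto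
      finally have "int q dvd int (b * fst p) - \<sigma> * int (a * snd p)" using p'(2) by simp
      moreover have "int (b * fst p) \<noteq> \<sigma> * int (a * snd p)" using ne s1 p'(2) by auto
      moreover have "fst p \<noteq> 0" "snd p \<noteq> 0" "a * snd p \<le> b * fst p" using p' by (auto simp: A'_def B_def)
      ultimately show "fst p \<noteq> 0 \<and> snd p \<noteq> 0 \<and> a * snd p \<le> b * fst p \<and> int (b * fst p) \<noteq> \<sigma> * int (a * snd p) \<and> int q dvd int (b * fst p) - \<sigma> * int (a * snd p)"
        by blast
    qed
    also have "\<dots> \<le> E" by (rule mono[OF b(2)])
    finally show ?thesis .
  qed
  have SC: "sum ?z C \<le> real q powr (-3) * zsum\<^sup>2"
  proof -
    have inj: "inj_on (\<lambda>p. (fst p div q, snd p div q)) C"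
      by (rule inj_onI) (auto simp: C_def prod_eq_iff elim!: dvdE simp del: nonzero_mult_div_cancel_left dest: dvd_div_eq_iff[THEN iffD1, rotated 2])
    have "?z p = real q powr (-3) * (zw (fst p div q) * zw (snd p div q))" if "p \<in> C" for p
    proof -
      obtain u v where "fst p = q * u" "snd p = q * v" using \<open>p \<in> C\<close> by (auto simp: C_def elim!: dvdE)
      moreover have "real q powr (-3) = real q powr (-3/2) * real q powr (-3/2)" by (simp only: powr_add[symmetric]) simp
      ultimately show ?thesis using q0 by (simp add: zw_def powr_mult)
    qed
    hence "sum ?z C = real q powr (-3) * (\<Sum>p\<in>C. zw (fst p div q) * zw (snd p div q))"
      by (simp add: sum_distrib_left)
    also have "(\<Sum>p\<in>C. zw (fst p div q) * zw (snd p div q)) = sum ?z ((\<lambda>p. (fst p div q, snd p div q)) ` C)"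
      by (simp add: sum.reindex[OF inj])
    also have "real q powr (-3) * \<dots> \<le> real q powr (-3) * zsum\<^sup>2"
      using fin q0 by (intro mult_left_mono sum_zw_product_le) (auto simp: C_def B_def elim!: dvdE)
    finally show ?thesis .
  qed
  have WD: "W - D \<subseteq> (A 1 \<union> A' 1) \<union> (A (-1) \<union> A' (-1))"
  proof
    fix p assume p: "p \<in> W - D"
    hence pB: "p \<in> B" and ne: "a * fst p \<noteq> b * snd p" and p0: "fst p > 0" "snd p > 0" by (auto simp: W_def D_def B_def)
    have "int (a * fst p) \<noteq> 1 * int (b * snd p)" using ne by (simp only: mult_1 of_nat_eq_iff) simp
    moreover have "int (a * fst p) > 0" "int (b * snd p) > 0" using p0 a b by simp_all
    moreover from this have "int (a * fst p) \<noteq> (-1) * int (b * snd p)" by linarith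
    moreover have "int q dvd int (a * fst p) - 1 * int (b * snd p) \<or> int q dvd int (a * fst p) - (-1) * int (b * snd p)"
      using p by (auto simp: W_def cong_iff_dvd_diff)
    moreover have "b * snd p \<le> a * fst p \<or> a * fst p \<le> b * snd p" by linarith
    ultimately show "p \<in> (A 1 \<union> A' 1) \<union> (A (-1) \<union> A' (-1))" using pB unfolding A_def A'_def by blast
  qed
  have "\<not> q dvd a" "\<not> q dvd b" using a b Y by (auto dest: dvd_imp_le)
  hence copa: "coprime q a" "coprime q b" using q by (auto intro: prime_imp_coprime)
  have DW: "D - W \<subseteq> C"
  proof
    fix p assume p: "p \<in> D - W"
    hence pB: "p \<in> B" and eq: "a * fst p = b * snd p" by (auto simp: D_def)
    have "\<not> coprime (int (a * fst p)) (int q)"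
    proof
      assume c: "coprime (int (a * fst p)) (int q)"
      have "p \<in> W" unfolding W_def using pB c eq by (simp only: mem_Collect_eq cong_refl simp_thms)
      with p show False by blast
    qed
    hence "\<not> coprime (a * fst p) q" by (simp only: coprime_int_iff) simp
    hence "q dvd a * fst p" using q prime_imp_coprime[of q "a * fst p"] by (auto simp: coprime_commute)
    moreover from this have "q dvd b * snd p" using eq by simp
    ultimately have "q dvd fst p" "q dvd snd p" using copa by (auto simp: coprime_dvd_mult_right_iff)
    thus "p \<in> C" using pB by (simp add: C_def)
  qed
  have Kz: "?K p \<le> kq0 * real q * ?z p" if "p \<in> B" for p
    using Kq_le[of "fst p" "snd p" q] that q0 by (auto simp: B_def)
  have k0: "kq0 * real q \<ge> 0" by (simp add: kq0_def)
  have z0: "?z p \<ge> 0" for p by (simp add: zw_nonneg)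
  have "sum ?K W - sum ?K D = sum ?K (W - D) - sum ?K (D - W)"
    using sum.Int_Diff[OF fW(1), of ?K D] sum.Int_Diff[OF fW(2), of ?K W] by (simp add: Int_commute)
  hence "\<bar>sum ?K W - sum ?K D\<bar> \<le> sum ?K (W - D) + sum ?K (D - W)"
    using sum_nonneg[of "W - D" ?K] sum_nonneg[of "D - W" ?K] Kq_nonneg by (simp add: abs_le_iff)
  also have "sum ?K (W - D) \<le> (\<Sum>p\<in>W - D. kq0 * real q * ?z p)" by (intro sum_mono Kz) (auto simp: W_def)
  also have "\<dots> = kq0 * real q * sum ?z (W - D)" by (simp add: sum_distrib_left)
  also have "sum ?z (W - D) \<le> sum ?z ((A 1 \<union> A' 1) \<union> (A (-1) \<union> A' (-1)))"
    using fin z0 by (intro sum_mono2 WD) auto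
  also have "\<dots> \<le> (sum ?z (A 1) + sum ?z (A' 1)) + (sum ?z (A (-1)) + sum ?z (A' (-1)))"
    using fin z0 by (intro order_trans[OF sum_Un_le] add_mono sum_Un_le) auto
  also have "\<dots> \<le> (E + E) + (E + E)" by (intro add_mono SA SA') auto
  also have "sum ?K (D - W) \<le> (\<Sum>p\<in>D - W. kq0 * real q * ?z p)" by (intro sum_mono Kz) (auto simp: D_def)
  also have "\<dots> = kq0 * real q * sum ?z (D - W)" by (simp add: sum_distrib_left)
  also have "sum ?z (D - W) \<le> sum ?z C" using fin z0 by (intro sum_mono2 DW) auto
  also have "\<dots> \<le> real q powr (-3) * zsum\<^sup>2" by (rule SC)
  finally have fb: "\<bar>sum ?K W - sum ?K D\<bar> \<le> kq0 * real q * ((E + E) + (E + E)) + kq0 * real q * (real q powr (-3) * zsum\<^sup>2)"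
    using k0 by (simp add: mult_left_mono add_mono)
  have Y1: "real Y \<ge> 1" using a by simp
  \<comment> \<open>Origin of the constant 13: four half-sums, each with
    \<open>2 powr (3/2) \<le> 3\<close>, give 12, and the pairs divisible by \<open>q\<close> give
    1.\<close>
  have "(2 * real Y / real q) powr (3/2) = 2 powr (3/2) * real Y powr (3/2) * real q powr (-3/2)"
    using q0 by (simp add: powr_divide powr_mult powr_minus_divide)
  also have "\<dots> \<le> 3 * (real Y)\<^sup>2 * real q powr (-3/2)"
  proof (intro mult_right_mono mult_mono)
    have "((2::real) powr (3/2))\<^sup>2 = 2 powr 3" by (simp add: powr_power)
    hence "((2::real) powr (3/2))\<^sup>2 \<le> 3\<^sup>2" by simp
    thus "(2::real) powr (3/2) \<le> 3" by (rule power2_le_imp_le) simp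
    show "real Y powr (3/2) \<le> (real Y)\<^sup>2" using powr_mono[of "3/2" 2 "real Y"] Y1 by (simp add: powr_numeral)
  qed auto
  finally have E1: "E \<le> 3 * (real Y)\<^sup>2 * real q powr (-3/2) * zsum\<^sup>2" unfolding E_def by (rule mult_right_mono) simp
  have q1: "real q \<ge> 1" using q0 by simp
  have qq: "real q * real q powr (-3/2) = real q powr (-1/2)" using powr_add[of "real q" 1 "-3/2"] q0 by simp
  have "kq0 * real q * ((E + E) + (E + E)) = 4 * kq0 * (real q * E)" by simp
  also have "\<dots> \<le> 4 * kq0 * (real q * (3 * (real Y)\<^sup>2 * real q powr (-3/2) * zsum\<^sup>2))"
    using E1 by (intro mult_left_mono) (auto simp: kq0_def)
  also have "\<dots> = 12 * kq0 * zsum\<^sup>2 * (real Y)\<^sup>2 * real q powr (-1/2)"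
    unfolding qq[symmetric] by simp
  finally have t1: "kq0 * real q * ((E + E) + (E + E)) \<le> 12 * kq0 * zsum\<^sup>2 * (real Y)\<^sup>2 * real q powr (-1/2)" .
  have "real q * real q powr (-3) \<le> real q powr (-1/2)"
    using powr_add[of "real q" 1 "-3"] powr_mono[of "-2" "-1/2" "real q"] q1 by simp
  also have "\<dots> \<le> (real Y)\<^sup>2 * real q powr (-1/2)" using mult_right_mono[OF one_le_power[OF Y1, of 2], of "real q powr (-1/2)"] by simp
  finally have "kq0 * zsum\<^sup>2 * (real q * real q powr (-3)) \<le> kq0 * zsum\<^sup>2 * ((real Y)\<^sup>2 * real q powr (-1/2))"
    by (intro mult_left_mono) (auto simp: kq0_def)
  with fb t1 show ?thesis by (simp add: algebra_simps)
qed

text \<open>For \<open>a = d * a'\<close> and \<open>b = d * b'\<close> with \<open>a'\<close>,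
  \<open>b'\<close> coprime, the solutions are \<open>(b' * l, a' * l)\<close>. Their product
  \<open>a' * b' * l^2\<close> turns the weight into the summand of
  \<open>tailk_diagonal_sum\<close> with \<open>T = q * w\<^sup>2\<close>, as
  \<open>w = 1 / sqrt (a' * b')\<close>. The upper limit comes from truncating both entries at
  \<open>N\<close>.\<close>

lemma diagonal_sum:
  assumes a: "0 < a" and b: "0 < b" and q: "q > 0"
  defines "w \<equiv> real (gcd a b) / sqrt (real a * real b)"
  shows "(\<Sum>p\<in>{p \<in> {1..N} \<times> {1..N}. a * fst p = b * snd p}. Kq q (fst p) (snd p)) = 
    w * (\<Sum>l<N div max (a div gcd a b) (b div gcd a b). tailk (2 * ln ((real (Suc l))\<^sup>2 / (real q * w\<^sup>2))) / real (Suc l))"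
proof -
  define d where "d = gcd a b"
  obtain a' b' where ab: "a = d * a'" "b = d * b'" "coprime a' b'"
    unfolding d_def using gcd_coprime_exists[of a b] a by (auto simp: mult.commute)
  have d0: "d > 0" using a by (simp add: d_def)
  have a'0: "a' > 0" "b' > 0" using a b ab by auto
  have div: "a div d = a'" "b div d = b'" using ab d0 by auto
  have w: "w = 1 / sqrt (real a' * real b')"
  proof -
    have "sqrt (real a * real b) = real d * sqrt (real a' * real b')"
      unfolding ab using d0 by (simp add: real_sqrt_mult)
    thus ?thesis unfolding w_def d_def[symmetric] using d0 by simp
  qed
  have w2: "w\<^sup>2 = 1 / (real a' * real b')" unfolding w using a'0 by (simp add: power_divide)
  define M where "M = N div max a' b'"
  have set: "{p \<in> {1..N} \<times> {1..N}. a * fst p = b * snd p} = (\<lambda>l. (b' * Suc l, a' * Suc l)) ` {..<M}"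
  proof (intro equalityI subsetI)
    fix p assume p: "p \<in> {p \<in> {1..N} \<times> {1..N}. a * fst p = b * snd p}"
    hence eq: "a' * fst p = b' * snd p" using ab d0 by simp
    hence "b' dvd fst p" using ab(3) by (metis coprime_commute coprime_dvd_mult_right_iff dvd_triv_left)
    then obtain l where l: "fst p = b' * l" by (elim dvdE)
    hence l2: "snd p = a' * l" using eq a'0 by simp
    have l0: "l > 0" using p l by (auto intro: Nat.gr0I)
    have "max a' b' * l \<le> N" using p l l2 by (auto simp: max_def)
    hence "l \<le> M" unfolding M_def using a'0 by (simp add: less_eq_div_iff_mult_less_eq mult.commute max_def)
    moreover obtain l' where "l = Suc l'" using l0 by (cases l) auto
    ultimately show "p \<in> (\<lambda>l. (b' * Suc l, a' * Suc l)) ` {..<M}"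
      using l l2 by (auto intro!: image_eqI[of _ _ l'] simp: prod_eq_iff)
  next
    fix p assume "p \<in> (\<lambda>l. (b' * Suc l, a' * Suc l)) ` {..<M}"
    then obtain l where l: "l < M" "p = (b' * Suc l, a' * Suc l)" by blast
    have "max a' b' * Suc l \<le> max a' b' * M" using l by (intro mult_le_mono2) simp
    also have "\<dots> \<le> N" unfolding M_def by simp
    finally have "max a' b' * Suc l \<le> N" .
    moreover have "a' * Suc l \<le> max a' b' * Suc l" "b' * Suc l \<le> max a' b' * Suc l" by (intro mult_le_mono1; simp)+
    ultimately have "a' * Suc l \<le> N" "b' * Suc l \<le> N" by linarith+
    moreover have "a' * Suc l \<ge> 1" "b' * Suc l \<ge> 1" using a'0 by auto
    ultimately show "p \<in> {p \<in> {1..N} \<times> {1..N}. a * fst p = b * snd p}" using l ab by (simp add: algebra_simps)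
  qed
  have inj: "inj_on (\<lambda>l. (b' * Suc l, a' * Suc l)) {..<M}" using a'0 by (intro inj_onI) auto
  have "(\<Sum>p\<in>{p \<in> {1..N} \<times> {1..N}. a * fst p = b * snd p}. Kq q (fst p) (snd p)) = (\<Sum>l<M. Kq q (b' * Suc l) (a' * Suc l))"
    unfolding set by (subst sum.reindex[OF inj]) simp
  also have "\<dots> = (\<Sum>l<M. w * (tailk (2 * ln ((real (Suc l))\<^sup>2 / (real q * w\<^sup>2))) / real (Suc l)))"
  proof (rule sum.cong[OF refl])
    fix l
    let ?l = "real (Suc l)"
    have "real (b' * Suc l) * real (a' * Suc l) = (real a' * real b') * ?l\<^sup>2" by (simp add: power2_eq_square algebra_simps)
    hence e1: "sqrt (real (b' * Suc l) * real (a' * Suc l)) = sqrt (real a' * real b') * ?l"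
      and e2: "ln (real (b' * Suc l) * real (a' * Suc l)) = ln ((real a' * real b') * ?l\<^sup>2)"
      by (simp_all only: real_sqrt_mult real_sqrt_abs abs_of_nat)
    have p: "(real a' * real b') * ?l\<^sup>2 > 0" using a'0 by simp
    have "2 * ln ((real a' * real b') * ?l\<^sup>2) - 2 * ln (real q) = 2 * ln ((real a' * real b') * ?l\<^sup>2 / real q)"
      using p q a'0 by (subst ln_div) auto
    also have "(real a' * real b') * ?l\<^sup>2 / real q = ?l\<^sup>2 / (real q * w\<^sup>2)" unfolding w2 by simp
    finally show "Kq q (b' * Suc l) (a' * Suc l) = w * (tailk (2 * ln (?l\<^sup>2 / (real q * w\<^sup>2))) / ?l)"
      unfolding Kq_def e1 e2 by (simp add: w)
  qed
  also have "\<dots> = w * (\<Sum>l<M. tailk (2 * ln ((real (Suc l))\<^sup>2 / (real q * w\<^sup>2))) / real (Suc l))"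
    by (simp add: sum_distrib_left)
  finally show ?thesis unfolding M_def div d_def[symmetric] .
qed


text \<open>The central values are replaced by the truncated sums \<open>EE N\<close>, for which
  orthogonality over a finite family applies. What it selects is compared with the diagonal, and
  \<open>N\<close> tends to infinity only at the end. The index family \<open>\<Gamma>\<close> is
  kept abstract so that \<open>F\<close> may be the squared modulus of any short polynomial.\<close>

theorem twisted_second_moment:
  obtains C1 C2 :: real where "C2 \<ge> 0"
    "\<And>q Y (\<Gamma> :: 'i set) c a b F. \<lbrakk>prime q; q > 2; Y < q; finite \<Gamma>;
        \<And>i. i \<in> \<Gamma> \<Longrightarrow> 0 < a i \<and> a i \<le> Y \<and> 0 < b i \<and> b i \<le> Y;
        \<And>\<psi>. \<psi> \<in> even_characters q \<Longrightarrow>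
           of_real (F \<psi>) = (\<Sum>i\<in>\<Gamma>. of_real (c i) * (\<psi> (int (a i)) * cnj (\<psi> (int (b i)))));
        \<And>\<psi>. \<psi> \<in> even_characters q \<Longrightarrow> F \<psi> \<ge> 0\<rbrakk> \<Longrightarrow>
      (\<Sum>\<psi>\<in>even_characters q - {principal q}. (norm (dirichlet_L (1/2) \<psi>))\<^sup>2 * F \<psi>)
        \<le> real (card (even_characters q)) *
           ((\<Sum>i\<in>\<Gamma>. c i * (real (gcd (a i) (b i)) / sqrt (real (a i) * real (b i))) *
               (ln (real q) + 2 * ln (real (gcd (a i) (b i)) / sqrt (real (a i) * real (b i))) + C1))
             + C2 * (real Y)\<^sup>2 * real q powr (-1/4) * (\<Sum>i\<in>\<Gamma>. \<bar>c i\<bar>))"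
proof -
  obtain C1 C2 where C2: "C2 \<ge> 0" and
    diag: "\<And>T. T > 0 \<Longrightarrow> \<exists>J. (\<lambda>M. \<Sum>l<M. tailk (2 * ln ((real (Suc l))\<^sup>2 / T)) / real (Suc l)) \<longlonglongrightarrow> J \<and>
            \<bar>J - (kap\<^sup>2 / 2 * ln T + C1)\<bar> \<le> C2 * T powr (-1/4)"
    using tailk_diagonal_sum by blast
  define C3 where "C3 = 13 * kq0 * zsum\<^sup>2"
  have C3: "C3 \<ge> 0" by (simp add: C3_def kq0_def)
  have kap: "kap > 0" by (rule kap_pos)
  have main: "(\<Sum>\<psi>\<in>even_characters q - {principal q}. (norm (dirichlet_L (1/2) \<psi>))\<^sup>2 * F \<psi>)
        \<le> real (card (even_characters q)) *
           ((\<Sum>i\<in>\<Gamma>. c i * (real (gcd (a i) (b i)) / sqrt (real (a i) * real (b i))) *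
               (ln (real q) + 2 * ln (real (gcd (a i) (b i)) / sqrt (real (a i) * real (b i))) + 2 * C1 / kap\<^sup>2))
             + (2 * (C2 + C3) / kap\<^sup>2) * (real Y)\<^sup>2 * real q powr (-1/4) * (\<Sum>i\<in>\<Gamma>. \<bar>c i\<bar>))"
    if q: "prime q" "q > 2" and Y: "Y < q" and fin: "finite \<Gamma>"
      and ab: "\<And>i. i \<in> \<Gamma> \<Longrightarrow> 0 < a i \<and> a i \<le> Y \<and> 0 < b i \<and> b i \<le> Y"
      and F: "\<And>\<psi>. \<psi> \<in> even_characters q \<Longrightarrow>
           of_real (F \<psi>) = (\<Sum>i\<in>\<Gamma>. of_real (c i) * (\<psi> (int (a i)) * cnj (\<psi> (int (b i)))))"
      and Fn: "\<And>\<psi>. \<psi> \<in> even_characters q \<Longrightarrow> F \<psi> \<ge> 0"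
    for q Y and \<Gamma> :: "'i set" and c a b F
  proof -
    have q0: "q > 0" using q by simp
    have q1: "real q \<ge> 1" using q by simp
    let ?X = "even_characters q"
    define h where "h = real (card ?X)"
    have finX: "finite ?X" by (rule finite_even_characters[OF q(1)])
    define EE where "EE N \<psi> = 2 * Re (\<Sum>p\<in>{1..N} \<times> {1..N}. \<psi> (int (fst p)) * cnj (\<psi> (int (snd p))) * of_real (Kq q (fst p) (snd p)))" for N \<psi>
    have EElim: "(\<lambda>N. EE N \<psi>) \<longlonglongrightarrow> kap\<^sup>2 * (norm (dirichlet_L (1/2) \<psi>))\<^sup>2" if "\<psi> \<in> ?X - {principal q}" for \<psi>
    proof -
      have "EE N \<psi> = 2 * Re (\<Sum>m<N. \<Sum>n<N. \<psi> (int (Suc m)) * cnj (\<psi> (int (Suc n))) *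
            of_real (tailk (2 * ln (real (Suc m) * real (Suc n)) - 2 * ln (real q)) / sqrt (real (Suc m) * real (Suc n))))" for N
      proof -
        have i: "{1..N} = Suc ` {..<N}" by (simp add: image_Suc_lessThan)
        have "(\<Sum>p\<in>{1..N} \<times> {1..N}. \<psi> (int (fst p)) * cnj (\<psi> (int (snd p))) * of_real (Kq q (fst p) (snd p))) =
          (\<Sum>m\<in>{1..N}. \<Sum>n\<in>{1..N}. \<psi> (int m) * cnj (\<psi> (int n)) * of_real (Kq q m n))"
          by (simp add: sum.cartesian_product case_prod_unfold)
        also have "\<dots> = (\<Sum>m<N. \<Sum>n<N. \<psi> (int (Suc m)) * cnj (\<psi> (int (Suc n))) * of_real (Kq q (Suc m) (Suc n)))"
          unfolding i by (simp add: sum.reindex del: of_nat_Suc)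
        finally show ?thesis unfolding EE_def Kq_def by simp
      qed
      with norm_L_square_limit[OF q(1), of \<psi>] that show ?thesis by simp
    qed
    \<comment> \<open>The limit formula does not cover the principal character. Its truncated sum is
      nonnegative, and so is \<open>F\<close>, so it may be added to an upper bound in order to use
      orthogonality over the full group.\<close>
    have EEpr: "EE N (principal q) \<ge> 0" for N
    proof -
      have "EE N (principal q) = 2 * (\<Sum>p\<in>{1..N} \<times> {1..N}. Re (principal q (int (fst p)) * cnj (principal q (int (snd p))) * of_real (Kq q (fst p) (snd p))))"
        by (simp only: EE_def Re_sum)
      also have "\<dots> \<ge> 0"
        by (intro mult_nonneg_nonneg sum_nonneg) (auto simp: principal_def Kq_nonneg)
      finally show ?thesis .
    qed
    define W where "W N i = {p \<in> {1..N} \<times> {1..N}. coprime (int (a i * fst p)) (int q) \<and> coprime (int (b i * snd p)) (int q) \<and>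
       ([int (a i * fst p) = int (b i * snd p)] (mod int q) \<or> [int (a i * fst p) = - int (b i * snd p)] (mod int q))}" for N i
    define D where "D N i = {p \<in> {1..N} \<times> {1..N}. a i * fst p = b i * snd p}" for N i
    have orth: "(\<Sum>\<psi>\<in>?X. F \<psi> * EE N \<psi>) = 2 * h * (\<Sum>i\<in>\<Gamma>. c i * (\<Sum>p\<in>W N i. Kq q (fst p) (snd p)))" for N
    proof -
      have o: "(\<Sum>\<psi>\<in>?X. \<psi> x * cnj (\<psi> y)) = (if coprime x (int q) \<and> coprime y (int q) \<and> ([x = y] (mod int q) \<or> [x = -y] (mod int q)) then of_real h else 0)" for x y
      proof (cases "coprime x (int q) \<and> coprime y (int q)")
        case True
        thus ?thesis using even_characters_orthogonality[OF q, of x y] by (simp add: h_def)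
      next
        case False
        have "\<psi> x * cnj (\<psi> y) = 0" if "\<psi> \<in> ?X" for \<psi>
          using False that dirichlet_character_eq_0_iff[of q \<psi>] by (auto simp: even_characters_def)
        hence "(\<Sum>\<psi>\<in>?X. \<psi> x * cnj (\<psi> y)) = 0" by (rule sum.neutral[rule_format])
        moreover have "\<not> (coprime x (int q) \<and> coprime y (int q) \<and> ([x = y] (mod int q) \<or> [x = -y] (mod int q)))"
          using False by blast
        ultimately show ?thesis by (simp only: if_False)
      qed
      have "(\<Sum>\<psi>\<in>?X. F \<psi> * EE N \<psi>) = 2 * Re (\<Sum>\<psi>\<in>?X. of_real (F \<psi>) * (\<Sum>p\<in>{1..N} \<times> {1..N}. \<psi> (int (fst p)) * cnj (\<psi> (int (snd p))) * of_real (Kq q (fst p) (snd p))))"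
        unfolding EE_def Re_sum sum_distrib_left by (intro sum.cong refl) simp
      also have "(\<Sum>\<psi>\<in>?X. of_real (F \<psi>) * (\<Sum>p\<in>{1..N} \<times> {1..N}. \<psi> (int (fst p)) * cnj (\<psi> (int (snd p))) * of_real (Kq q (fst p) (snd p)))) =
          (\<Sum>\<psi>\<in>?X. \<Sum>i\<in>\<Gamma>. \<Sum>p\<in>{1..N} \<times> {1..N}. of_real (c i * Kq q (fst p) (snd p)) * (\<psi> (int (a i * fst p)) * cnj (\<psi> (int (b i * snd p)))))"
      proof (rule sum.cong[OF refl])
        fix \<psi> assume \<psi>: "\<psi> \<in> ?X"
        hence dc: "dirichlet_character q \<psi>" by (simp add: even_characters_def)
        have m: "\<psi> (int (x * y)) = \<psi> (int x) * \<psi> (int y)" for x y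
          using dirichlet_character_mult[OF dc, of "int x" "int y"] by simp
        show "of_real (F \<psi>) * (\<Sum>p\<in>{1..N} \<times> {1..N}. \<psi> (int (fst p)) * cnj (\<psi> (int (snd p))) * of_real (Kq q (fst p) (snd p))) =
          (\<Sum>i\<in>\<Gamma>. \<Sum>p\<in>{1..N} \<times> {1..N}. of_real (c i * Kq q (fst p) (snd p)) * (\<psi> (int (a i * fst p)) * cnj (\<psi> (int (b i * snd p)))))"
          unfolding F[OF \<psi>] sum_product m by (intro sum.cong refl) simp
      qed
      also have "\<dots> = (\<Sum>i\<in>\<Gamma>. \<Sum>p\<in>{1..N} \<times> {1..N}. \<Sum>\<psi>\<in>?X. of_real (c i * Kq q (fst p) (snd p)) * (\<psi> (int (a i * fst p)) * cnj (\<psi> (int (b i * snd p)))))"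
        by (subst sum.swap, intro sum.cong refl, subst sum.swap) (rule refl)
      also have "\<dots> = (\<Sum>i\<in>\<Gamma>. \<Sum>p\<in>W N i. of_real (h * (c i * Kq q (fst p) (snd p))))"
      proof (rule sum.cong[OF refl])
        fix i
        have "(\<Sum>p\<in>{1..N} \<times> {1..N}. \<Sum>\<psi>\<in>?X. of_real (c i * Kq q (fst p) (snd p)) * (\<psi> (int (a i * fst p)) * cnj (\<psi> (int (b i * snd p))))) =
           (\<Sum>p\<in>{1..N} \<times> {1..N}. if p \<in> W N i then of_real (h * (c i * Kq q (fst p) (snd p))) else (0 :: complex))"
          unfolding sum_distrib_left[symmetric] o by (intro sum.cong refl) (auto simp: W_def)
        also have "\<dots> = (\<Sum>p\<in>({1..N} \<times> {1..N}) \<inter> W N i. of_real (h * (c i * Kq q (fst p) (snd p))))"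
          by (rule sum.inter_restrict[symmetric]) simp
        also have "({1..N} \<times> {1..N}) \<inter> W N i = W N i" by (auto simp: W_def)
        finally show "(\<Sum>p\<in>{1..N} \<times> {1..N}. \<Sum>\<psi>\<in>?X. of_real (c i * Kq q (fst p) (snd p)) * (\<psi> (int (a i * fst p)) * cnj (\<psi> (int (b i * snd p))))) =
           (\<Sum>p\<in>W N i. of_real (h * (c i * Kq q (fst p) (snd p))))" .
      qed
      also have "Re \<dots> = h * (\<Sum>i\<in>\<Gamma>. c i * (\<Sum>p\<in>W N i. Kq q (fst p) (snd p)))"
        by (simp only: Re_sum Re_complex_of_real sum_distrib_left)
      finally show ?thesis by (simp only: mult.assoc)
    qed
    define w where "w i = real (gcd (a i) (b i)) / sqrt (real (a i) * real (b i))" for i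
    define mx where "mx i = max (a i div gcd (a i) (b i)) (b i div gcd (a i) (b i))" for i
    define S where "S i M = (\<Sum>l<M. tailk (2 * ln ((real (Suc l))\<^sup>2 / (real q * (w i)\<^sup>2))) / real (Suc l))" for i M
    have wpos: "w i > 0" if "i \<in> \<Gamma>" for i using ab[OF that] by (simp add: w_def)
    have "\<forall>i\<in>\<Gamma>. \<exists>J. S i \<longlonglongrightarrow> J \<and> \<bar>J - (kap\<^sup>2 / 2 * ln (real q * (w i)\<^sup>2) + C1)\<bar> \<le> C2 * (real q * (w i)\<^sup>2) powr (-1/4)"
    proof (intro ballI)
      fix i assume "i \<in> \<Gamma>"
      hence "real q * (w i)\<^sup>2 > 0" using wpos[of i] q0 by simp
      from diag[OF this] show "\<exists>J. S i \<longlonglongrightarrow> J \<and> \<bar>J - (kap\<^sup>2 / 2 * ln (real q * (w i)\<^sup>2) + C1)\<bar> \<le> C2 * (real q * (w i)\<^sup>2) powr (-1/4)"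
        unfolding S_def .
    qed
    then obtain J where J: "\<And>i. i \<in> \<Gamma> \<Longrightarrow> S i \<longlonglongrightarrow> J i"
       "\<And>i. i \<in> \<Gamma> \<Longrightarrow> \<bar>J i - (kap\<^sup>2 / 2 * ln (real q * (w i)\<^sup>2) + C1)\<bar> \<le> C2 * (real q * (w i)\<^sup>2) powr (-1/4)"
      by metis
    define err where "err = C3 * (real Y)\<^sup>2 * real q powr (-1/2)"
    have ineq: "(\<Sum>\<psi>\<in>?X - {principal q}. F \<psi> * EE N \<psi>) \<le> 2 * h * (\<Sum>i\<in>\<Gamma>. c i * (w i * S i (N div mx i)) + \<bar>c i\<bar> * err)" for N
    proof -
      have "(\<Sum>\<psi>\<in>?X - {principal q}. F \<psi> * EE N \<psi>) \<le> (\<Sum>\<psi>\<in>?X. F \<psi> * EE N \<psi>)"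
      proof (rule sum_mono2[OF finX])
        show "0 \<le> F \<psi> * EE N \<psi>" if "\<psi> \<in> ?X - (?X - {principal q})" for \<psi>
          using that EEpr Fn by auto
      qed auto
      also have "\<dots> \<le> 2 * h * (\<Sum>i\<in>\<Gamma>. c i * (w i * S i (N div mx i)) + \<bar>c i\<bar> * err)"
        unfolding orth
      proof (intro mult_left_mono sum_mono)
        fix i assume i: "i \<in> \<Gamma>"
        have d: "(\<Sum>p\<in>D N i. Kq q (fst p) (snd p)) = w i * S i (N div mx i)"
          unfolding D_def w_def mx_def S_def using diagonal_sum[of "a i" "b i" q N] ab[OF i] q0 by simp
        have "\<bar>(\<Sum>p\<in>W N i. Kq q (fst p) (snd p)) - (\<Sum>p\<in>D N i. Kq q (fst p) (snd p))\<bar> \<le> err"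
          unfolding W_def D_def err_def C3_def using congruence_sum_near_diagonal[OF q(1) _ _ _ _ Y, of "a i" "b i" N] ab[OF i] by simp
        hence "\<bar>c i * ((\<Sum>p\<in>W N i. Kq q (fst p) (snd p)) - w i * S i (N div mx i))\<bar> \<le> \<bar>c i\<bar> * err"
          unfolding d abs_mult by (intro mult_left_mono) auto
        thus "c i * (\<Sum>p\<in>W N i. Kq q (fst p) (snd p)) \<le> c i * (w i * S i (N div mx i)) + \<bar>c i\<bar> * err"
          by (simp add: right_diff_distrib abs_le_iff)
      qed (simp add: h_def)
      finally show ?thesis .
    qed
    have lim1: "(\<lambda>N. \<Sum>\<psi>\<in>?X - {principal q}. F \<psi> * EE N \<psi>) \<longlonglongrightarrow> (\<Sum>\<psi>\<in>?X - {principal q}. F \<psi> * (kap\<^sup>2 * (norm (dirichlet_L (1/2) \<psi>))\<^sup>2))"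
      by (intro tendsto_sum tendsto_mult tendsto_const EElim)
    have lim2: "(\<lambda>N. 2 * h * (\<Sum>i\<in>\<Gamma>. c i * (w i * S i (N div mx i)) + \<bar>c i\<bar> * err)) \<longlonglongrightarrow> 2 * h * (\<Sum>i\<in>\<Gamma>. c i * (w i * J i) + \<bar>c i\<bar> * err)"
    proof (intro tendsto_mult tendsto_sum tendsto_add tendsto_const)
      fix i assume i: "i \<in> \<Gamma>"
      have "mx i > 0"
      proof -
        have "gcd (a i) (b i) \<le> a i" using ab[OF i] by (intro gcd_le1_nat) simp
        hence "a i div gcd (a i) (b i) > 0" using ab[OF i] by (simp add: div_greater_zero_iff)
        thus ?thesis by (simp add: mx_def)
      qed
      hence "filterlim (\<lambda>N. N div mx i) at_top sequentially"
        by (intro filterlim_at_top_div_const_nat)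
      from filterlim_compose[OF J(1)[OF i] this] show "(\<lambda>N. S i (N div mx i)) \<longlonglongrightarrow> J i" .
    qed
    have "(\<Sum>\<psi>\<in>?X - {principal q}. F \<psi> * (kap\<^sup>2 * (norm (dirichlet_L (1/2) \<psi>))\<^sup>2)) \<le> 2 * h * (\<Sum>i\<in>\<Gamma>. c i * (w i * J i) + \<bar>c i\<bar> * err)"
      by (rule LIMSEQ_le[OF lim1 lim2]) (use ineq in auto)
    also have "\<dots> \<le> 2 * h * (\<Sum>i\<in>\<Gamma>. c i * (w i * (kap\<^sup>2 / 2 * (ln (real q) + 2 * ln (w i)) + C1)) + \<bar>c i\<bar> * ((C2 + C3) * (real Y)\<^sup>2 * real q powr (-1/4)))"
    proof (intro mult_left_mono sum_mono)
      fix i assume i: "i \<in> \<Gamma>"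
      have w0: "w i > 0" by (rule wpos[OF i])
      have w1: "w i \<le> 1"
      proof -
        have "gcd (a i) (b i) \<le> a i" "gcd (a i) (b i) \<le> b i" using ab[OF i] by (auto intro: gcd_le1_nat gcd_le2_nat)
        hence "real (gcd (a i) (b i)) * real (gcd (a i) (b i)) \<le> real (a i) * real (b i)" by (intro mult_mono) auto
        hence "sqrt (real (gcd (a i) (b i)) * real (gcd (a i) (b i))) \<le> sqrt (real (a i) * real (b i))" by (rule real_sqrt_le_mono)
        thus ?thesis using ab[OF i] unfolding w_def by (simp add: divide_le_eq)
      qed
      have Y1: "real Y \<ge> 1" using ab[OF i] by simp
      \<comment> \<open>The prefactor \<open>w i \<le> 1\<close> pays for the
        \<open>w i powr (-1/2)\<close> contained in the error term at
        \<open>T = q * (w i)\<^sup>2\<close>, so the error is uniform in \<open>i\<close>.\<close>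
      have "w i * (real q * (w i)\<^sup>2) powr (-1/4) = w i powr 1 * (real q powr (-1/4) * w i powr (-1/2))"
        using w0 q0 by (simp add: powr_mult powr_numeral[symmetric] powr_powr del: powr_numeral)
      also have "\<dots> = w i powr (1/2) * real q powr (-1/4)"
        using powr_add[of "w i" 1 "-1/2"] by simp
      also have "\<dots> \<le> 1 * real q powr (-1/4)" using w0 w1 by (intro mult_right_mono powr_le1) auto
      finally have wp: "w i * (real q * (w i)\<^sup>2) powr (-1/4) \<le> real q powr (-1/4)" by simp
      have lnq: "ln (real q * (w i)\<^sup>2) = ln (real q) + 2 * ln (w i)"
        using w0 q0 by (simp add: ln_mult ln_realpow)
      define t where "t = w i * (J i - (kap\<^sup>2 / 2 * ln (real q * (w i)\<^sup>2) + C1))"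
      have "\<bar>t\<bar> = w i * \<bar>J i - (kap\<^sup>2 / 2 * ln (real q * (w i)\<^sup>2) + C1)\<bar>" using w0 by (simp add: t_def abs_mult)
      also have "\<dots> \<le> w i * (C2 * (real q * (w i)\<^sup>2) powr (-1/4))" using J(2)[OF i] w0 by (intro mult_left_mono) auto
      also have "\<dots> = C2 * (w i * (real q * (w i)\<^sup>2) powr (-1/4))" by simp
      also have "\<dots> \<le> C2 * real q powr (-1/4)" by (rule mult_left_mono[OF wp C2])
      also have "\<dots> \<le> C2 * ((real Y)\<^sup>2 * real q powr (-1/4))"
        using mult_right_mono[OF one_le_power[OF Y1, of 2], of "real q powr (-1/4)"] C2 by (intro mult_left_mono) auto
      finally have t: "\<bar>t\<bar> \<le> C2 * ((real Y)\<^sup>2 * real q powr (-1/4))" .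
      have "real q powr (-1/2) \<le> real q powr (-1/4)" using q1 by (intro powr_mono) auto
      hence e: "err \<le> C3 * ((real Y)\<^sup>2 * real q powr (-1/4))"
        unfolding err_def mult.assoc using C3 by (intro mult_left_mono) auto
      have "c i * (w i * J i) = c i * (w i * (kap\<^sup>2 / 2 * (ln (real q) + 2 * ln (w i)) + C1)) + c i * t"
        unfolding t_def lnq by (simp add: algebra_simps)
      also have "c i * t \<le> \<bar>c i\<bar> * \<bar>t\<bar>" by (metis abs_ge_self abs_mult)
      also have "\<bar>c i\<bar> * \<bar>t\<bar> \<le> \<bar>c i\<bar> * (C2 * ((real Y)\<^sup>2 * real q powr (-1/4)))" by (intro mult_left_mono t) auto
      finally have "c i * (w i * J i) + \<bar>c i\<bar> * err \<le> c i * (w i * (kap\<^sup>2 / 2 * (ln (real q) + 2 * ln (w i)) + C1)) 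
          + \<bar>c i\<bar> * (C2 * ((real Y)\<^sup>2 * real q powr (-1/4))) + \<bar>c i\<bar> * (C3 * ((real Y)\<^sup>2 * real q powr (-1/4)))"
        using mult_left_mono[OF e, of "\<bar>c i\<bar>"] by simp
      thus "c i * (w i * J i) + \<bar>c i\<bar> * err \<le> c i * (w i * (kap\<^sup>2 / 2 * (ln (real q) + 2 * ln (w i)) + C1)) + \<bar>c i\<bar> * ((C2 + C3) * (real Y)\<^sup>2 * real q powr (-1/4))"
        by (simp add: algebra_simps)
    qed (simp add: h_def)
    finally have "kap\<^sup>2 * (\<Sum>\<psi>\<in>?X - {principal q}. (norm (dirichlet_L (1/2) \<psi>))\<^sup>2 * F \<psi>) \<le>
       2 * h * (\<Sum>i\<in>\<Gamma>. c i * (w i * (kap\<^sup>2 / 2 * (ln (real q) + 2 * ln (w i)) + C1)) + \<bar>c i\<bar> * ((C2 + C3) * (real Y)\<^sup>2 * real q powr (-1/4)))"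
      by (simp add: sum_distrib_left mult_ac)
    also have "\<dots> = kap\<^sup>2 * (h * ((\<Sum>i\<in>\<Gamma>. c i * w i * (ln (real q) + 2 * ln (w i) + 2 * C1 / kap\<^sup>2)) + 
         (2 * (C2 + C3) / kap\<^sup>2) * (real Y)\<^sup>2 * real q powr (-1/4) * (\<Sum>i\<in>\<Gamma>. \<bar>c i\<bar>)))"
    proof -
      define R where "R = (C2 + C3) * (real Y)\<^sup>2 * real q powr (-1/4)"
      have e1: "(\<Sum>i\<in>\<Gamma>. c i * (w i * (kap\<^sup>2 / 2 * (ln (real q) + 2 * ln (w i)) + C1)) + \<bar>c i\<bar> * R) =
         (kap\<^sup>2 / 2) * (\<Sum>i\<in>\<Gamma>. c i * w i * (ln (real q) + 2 * ln (w i) + 2 * C1 / kap\<^sup>2)) + R * (\<Sum>i\<in>\<Gamma>. \<bar>c i\<bar>)"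
        unfolding sum_distrib_left sum.distrib[symmetric] using kap
        by (intro sum.cong refl) (simp add: field_simps power2_eq_square)
      have e2: "(2 * (C2 + C3) / kap\<^sup>2) * (real Y)\<^sup>2 * real q powr (-1/4) = 2 / kap\<^sup>2 * R" by (simp add: R_def)
      show ?thesis unfolding e2 R_def[symmetric] e1 using kap by (simp add: field_simps)
    qed
    finally have "(\<Sum>\<psi>\<in>?X - {principal q}. (norm (dirichlet_L (1/2) \<psi>))\<^sup>2 * F \<psi>) \<le>
       h * ((\<Sum>i\<in>\<Gamma>. c i * w i * (ln (real q) + 2 * ln (w i) + 2 * C1 / kap\<^sup>2)) + 
         (2 * (C2 + C3) / kap\<^sup>2) * (real Y)\<^sup>2 * real q powr (-1/4) * (\<Sum>i\<in>\<Gamma>. \<bar>c i\<bar>))"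
      using kap by (subst (asm) mult_le_cancel_left_pos) auto
    thus ?thesis unfolding h_def w_def .
  qed
  show ?thesis
  proof (rule that)
    show "2 * (C2 + C3) / kap\<^sup>2 \<ge> 0" using C2 C3 by simp
  qed (rule main)
qed

section \<open>Mertens-type bounds over dyadic blocks of primes\<close>

lemma sum_ln_prime_factors_le:
  fixes n :: nat
  assumes "n > 0"
  shows "(\<Sum>p\<in>prime_factors n. ln (real p)) \<le> ln (real n)"
proof -
  have pos: "p > 0" if "p \<in> prime_factors n" for p using that by (auto intro: prime_gt_0_nat)
  have "ln (real n) = ln (real (\<Prod>p\<in>prime_factors n. p ^ multiplicity p n))"
    by (rule arg_cong[OF prime_factorization_nat[OF assms]])
  also have "\<dots> = (\<Sum>p\<in>prime_factors n. real (multiplicity p n) * ln (real p))"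
    using pos by (simp add: ln_prod ln_realpow)
  finally have eq: "ln (real n) = (\<Sum>p\<in>prime_factors n. real (multiplicity p n) * ln (real p))" .
  show ?thesis unfolding eq
  proof (rule sum_mono)
    fix p assume p: "p \<in> prime_factors n"
    hence "multiplicity p n \<ge> 1" by (simp add: prime_factors_multiplicity Suc_le_eq)
    moreover have "ln (real p) \<ge> 0" using pos[OF p] by simp
    ultimately show "ln (real p) \<le> real (multiplicity p n) * ln (real p)"
      using mult_right_mono[of 1 "real (multiplicity p n)" "ln (real p)"] by simp
  qed
qed

text \<open>Chebyshev's double count: the sum over \<open>n \<le> N\<close> of \<open>ln p\<close>
  over the primes \<open>p\<close> dividing \<open>n\<close> is at most \<open>N * ln N\<close>.
  Each \<open>p\<close> occurs \<open>N div p\<close> times, and the factor 2 comes from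
  \<open>N div p \<ge> N / (2 * p)\<close>.\<close>

lemma sum_ln_over_primes_le:
  fixes N :: nat
  assumes N: "N > 0"
  shows "(\<Sum>p | prime p \<and> p \<le> N. ln (real p) / real p) \<le> 2 * ln (real N)"
proof -
  let ?P = "{p. prime p \<and> p \<le> N}"
  have fin: "finite ?P" by (rule finite_subset[of _ "{..N}"]) auto
  have "(\<Sum>n\<in>{1..N}. \<Sum>p\<in>?P. if p dvd n then ln (real p) else 0) \<le> (\<Sum>n\<in>{1..N}. ln (real N))"
  proof (rule sum_mono)
    fix n assume n: "n \<in> {1..N}"
    have "(\<Sum>p\<in>?P. if p dvd n then ln (real p) else 0) = (\<Sum>p\<in>prime_factors n. ln (real p))"
      using n fin by (intro sum.mono_neutral_cong_right) (auto simp: prime_factors_dvd dest: dvd_imp_le)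
    also have "\<dots> \<le> ln (real n)" using n by (intro sum_ln_prime_factors_le) simp
    also have "\<dots> \<le> ln (real N)" using n by simp
    finally show "(\<Sum>p\<in>?P. if p dvd n then ln (real p) else 0) \<le> ln (real N)" .
  qed
  also have "\<dots> = real N * ln (real N)" by simp
  also have "(\<Sum>n\<in>{1..N}. \<Sum>p\<in>?P. if p dvd n then ln (real p) else 0) = (\<Sum>p\<in>?P. \<Sum>n\<in>{1..N}. if p dvd n then ln (real p) else 0)"
    by (rule sum.swap)
  finally have up: "(\<Sum>p\<in>?P. \<Sum>n\<in>{1..N}. if p dvd n then ln (real p) else 0) \<le> real N * ln (real N)" .
  have "(\<Sum>p\<in>?P. real N / 2 * (ln (real p) / real p)) \<le> (\<Sum>p\<in>?P. \<Sum>n\<in>{1..N}. if p dvd n then ln (real p) else 0)"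
  proof (rule sum_mono)
    fix p assume p: "p \<in> ?P"
    hence p0: "p > 0" and lp: "ln (real p) \<ge> 0" using prime_gt_0_nat[of p] by auto
    have k1: "N div p \<ge> 1" using p p0 by (simp add: Suc_le_eq div_greater_zero_iff)
    have inj: "inj_on (times p) {1..N div p}" using p0 by (auto intro: inj_onI)
    have sub: "times p ` {1..N div p} \<subseteq> {n \<in> {1..N}. p dvd n}"
    proof
      fix x assume "x \<in> times p ` {1..N div p}"
      then obtain k where k: "1 \<le> k" "k \<le> N div p" "x = p * k" by auto
      have "p * k \<le> p * (N div p)" using k by simp
      also have "\<dots> \<le> N" by simp
      finally show "x \<in> {n \<in> {1..N}. p dvd n}" using k p0 by simp
    qed
    have "N div p \<le> card {n \<in> {1..N}. p dvd n}"
      using card_mono[OF _ sub] card_image[OF inj] by simp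
    moreover have "real N / (2 * real p) \<le> real (N div p)"
    proof -
      have "N < p * (N div p) + p" using p0 using mod_less_divisor[OF p0, of N] mult_div_mod_eq[of p N] by linarith
      also have "\<dots> \<le> 2 * (p * (N div p))" using k1 p0 by simp
      finally have "real N \<le> real (2 * (p * (N div p)))" by (intro of_nat_mono) simp
      thus ?thesis using p0 by (simp add: field_simps)
    qed
    ultimately have "real N / (2 * real p) * ln (real p) \<le> real (card {n \<in> {1..N}. p dvd n}) * ln (real p)"
      using lp by (intro mult_right_mono) auto
    moreover have "(\<Sum>n\<in>{1..N}. if p dvd n then ln (real p) else 0) = real (card {n \<in> {1..N}. p dvd n}) * ln (real p)"
      by (simp only: sum.inter_filter[symmetric] finite_atLeastAtMost sum_constant)
    moreover have "real N / 2 * (ln (real p) / real p) = real N / (2 * real p) * ln (real p)" by simp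
    ultimately show "real N / 2 * (ln (real p) / real p) \<le> (\<Sum>n\<in>{1..N}. if p dvd n then ln (real p) else 0)"
      by linarith
  qed
  with up have "real N / 2 * (\<Sum>p\<in>?P. ln (real p) / real p) \<le> real N * ln (real N)"
    unfolding sum_distrib_left[symmetric] by linarith
  thus ?thesis using N by (simp add: field_simps)
qed

text \<open>The logarithm doubles across a block, which keeps the sum of reciprocals bounded
  independently of \<open>j\<close>. Block 0 starts above 2, so the prime 2 belongs to no
  block.\<close>

definition prime_block :: "nat \<Rightarrow> nat set" where
  "prime_block j = {p. prime p \<and> 2 ^ 2 ^ j < p \<and> p \<le> 2 ^ 2 ^ Suc j}"

lemma finite_prime_block [simp]: "finite (prime_block j)"
  by (rule finite_subset[of _ "{..2 ^ 2 ^ Suc j}"]) (auto simp: prime_block_def)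

lemma prime_block_disjoint: "i \<noteq> j \<Longrightarrow> prime_block i \<inter> prime_block j = {}"
proof -
  have "prime_block i \<inter> prime_block j = {}" if "i < j" for i j
  proof -
    have le: "(2::nat) ^ 2 ^ Suc i \<le> 2 ^ 2 ^ j" using that by (intro power_increasing) auto
    show ?thesis
    proof (rule equals0I)
      fix p assume "p \<in> prime_block i \<inter> prime_block j"
      hence "p \<le> 2 ^ 2 ^ Suc i" "2 ^ 2 ^ j < p" unfolding prime_block_def by blast+
      with le show False by linarith
    qed
  qed
  from this[of i j] this[of j i] show "i \<noteq> j \<Longrightarrow> prime_block i \<inter> prime_block j = {}"
    by (cases "i < j") auto
qed

text \<open>On the block \<open>ln p\<close> is at least \<open>2 ^ j * ln 2\<close>, while the sum
  of \<open>ln p / p\<close> up to its end is at most \<open>4 * 2 ^ j * ln 2\<close>.\<close>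

lemma sum_inverse_prime_block_le: "(\<Sum>p\<in>prime_block j. 1 / real p) \<le> 4"
proof -
  define N :: nat where "N = 2 ^ 2 ^ Suc j"
  have lnN: "ln (real N) = 2 ^ Suc j * ln 2" unfolding N_def by (simp add: ln_realpow)
  have c: "(2::real) ^ j * ln 2 > 0" by simp
  have "(\<Sum>p\<in>prime_block j. 1 / real p) \<le> (\<Sum>p\<in>prime_block j. (1 / (2 ^ j * ln 2)) * (ln (real p) / real p))"
  proof (rule sum_mono)
    fix p assume p: "p \<in> prime_block j"
    hence p0: "real p > 0" and "real (2 ^ 2 ^ j) \<le> real p" unfolding prime_block_def by (auto intro: prime_gt_0_nat simp del: of_nat_power)
    hence "ln (real (2 ^ 2 ^ j)) \<le> ln (real p)" by (intro ln_mono) auto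
    hence "2 ^ j * ln 2 \<le> ln (real p)" by (simp add: ln_realpow)
    thus "1 / real p \<le> (1 / (2 ^ j * ln 2)) * (ln (real p) / real p)"
      using c p0 by (simp add: field_simps)
  qed
  also have "\<dots> = (1 / (2 ^ j * ln 2)) * (\<Sum>p\<in>prime_block j. ln (real p) / real p)" by (simp add: sum_distrib_left)
  also have "\<dots> \<le> (1 / (2 ^ j * ln 2)) * (2 * ln (real N))"
  proof (rule mult_left_mono)
    have "(\<Sum>p\<in>prime_block j. ln (real p) / real p) \<le> (\<Sum>p | prime p \<and> p \<le> N. ln (real p) / real p)"
    proof (rule sum_mono2)
      show "finite {p. prime p \<and> p \<le> N}" by (rule finite_subset[of _ "{..N}"]) auto
      show "prime_block j \<subseteq> {p. prime p \<and> p \<le> N}" by (auto simp: prime_block_def N_def)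
      fix p assume "p \<in> {p. prime p \<and> p \<le> N} - prime_block j"
      hence "p > 0" by (auto intro: prime_gt_0_nat)
      thus "0 \<le> ln (real p) / real p" by simp
    qed
    also have "\<dots> \<le> 2 * ln (real N)" by (rule sum_ln_over_primes_le) (simp add: N_def)
    finally show "(\<Sum>p\<in>prime_block j. ln (real p) / real p) \<le> 2 * ln (real N)" .
  qed (use c in simp)
  also have "\<dots> = 4" unfolding lnN using c by (simp add: field_simps)
  finally show ?thesis .
qed

text \<open>Every \<open>n \<le> N\<close> has prime factors at most \<open>N\<close> and
  multiplicities at most \<open>N\<close>, so by unique factorization \<open>1 / n\<close> occurs
  among the terms of the expanded finite Euler product.\<close>

lemma harm_le_prime_product:
  fixes N :: nat
  assumes N: "N > 0"
  shows "(harm N :: real) \<le> (\<Prod>p | prime p \<and> p \<le> N. \<Sum>k\<le>N. (1 / real p) ^ k)"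
proof -
  let ?P = "{p. prime p \<and> p \<le> N}"
  have fin: "finite ?P" by (rule finite_subset[of _ "{..N}"]) auto
  define e where "e n = (\<lambda>p\<in>?P. multiplicity p n)" for n :: nat
  have val: "(\<Prod>p\<in>?P. p ^ e n p) = n" if "n \<in> {1..N}" for n
  proof -
    have "(\<Prod>p\<in>?P. p ^ e n p) = (\<Prod>p\<in>prime_factors n. p ^ multiplicity p n)"
    proof (rule prod.mono_neutral_cong_right[OF fin])
      show "prime_factors n \<subseteq> ?P" using that by (auto simp: prime_factors_dvd dest: dvd_imp_le)
      show "\<forall>p\<in>?P - prime_factors n. p ^ e n p = 1"
        using that by (auto simp: e_def prime_factors_dvd not_dvd_imp_multiplicity_0)
      show "p ^ e n p = p ^ multiplicity p n" if "p \<in> prime_factors n" for p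
        using that \<open>prime_factors n \<subseteq> ?P\<close> by (auto simp: e_def)
    qed
    also have "\<dots> = n" by (rule prime_factorization_nat[symmetric]) (use that in simp)
    finally show ?thesis .
  qed
  have inj: "inj_on e {1..N}"
  proof (rule inj_onI)
    fix x y assume xy: "x \<in> {1..N}" "y \<in> {1..N}" "e x = e y"
    have "x = (\<Prod>p\<in>?P. p ^ e x p)" by (rule val[OF xy(1), symmetric])
    also have "\<dots> = (\<Prod>p\<in>?P. p ^ e y p)" by (simp only: xy(3))
    also have "\<dots> = y" by (rule val[OF xy(2)])
    finally show "x = y" .
  qed
  have img: "e ` {1..N} \<subseteq> PiE ?P (\<lambda>_. {..N})"
  proof
    fix f assume "f \<in> e ` {1..N}"
    then obtain n where n: "n \<in> {1..N}" "f = e n" by blast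
    have "multiplicity p n \<le> N" if "p \<in> ?P" for p
    proof -
      have "p ^ multiplicity p n \<le> n" using n by (intro dvd_imp_le multiplicity_dvd) auto
      moreover have "multiplicity p n < 2 ^ multiplicity p n" by (rule less_exp)
      moreover have "(2::nat) ^ multiplicity p n \<le> p ^ multiplicity p n"
        using that prime_ge_2_nat[of p] by (intro power_mono) auto
      moreover have "n \<le> N" using n by simp
      ultimately show ?thesis by linarith
    qed
    thus "f \<in> PiE ?P (\<lambda>_. {..N})" using n by (auto simp: e_def)
  qed
  have "(harm N :: real) = (\<Sum>n\<in>{1..N}. \<Prod>p\<in>?P. (1 / real p) ^ e n p)"
  proof -
    have "(\<Prod>p\<in>?P. (1 / real p) ^ e n p) = inverse (real n)" if "n \<in> {1..N}" for n
    proof -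
      have "(\<Prod>p\<in>?P. (1 / real p) ^ e n p) = inverse (real (\<Prod>p\<in>?P. p ^ e n p))"
        by (simp add: prod_inversef[symmetric] power_inverse inverse_eq_divide power_one_over prod_dividef)
      thus ?thesis using val[OF that] by simp
    qed
    thus ?thesis by (simp add: harm_def)
  qed
  also have "\<dots> = (\<Sum>f\<in>e ` {1..N}. \<Prod>p\<in>?P. (1 / real p) ^ f p)" by (subst sum.reindex[OF inj]) (simp only: o_def)
  also have "\<dots> \<le> (\<Sum>f\<in>PiE ?P (\<lambda>_. {..N}). \<Prod>p\<in>?P. (1 / real p) ^ f p)"
    using fin by (intro sum_mono2 img finite_PiE prod_nonneg) auto
  also have "\<dots> = (\<Prod>p\<in>?P. \<Sum>k\<le>N. (1 / real p) ^ k)"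
    using fin by (intro prod_sum_PiE[symmetric]) auto
  finally show ?thesis .
qed

lemma sum_inverse_square_le: 
  assumes "finite A" "\<And>n. n \<in> A \<Longrightarrow> n \<ge> 2"
  shows "(\<Sum>n\<in>A. 1 / (real n)\<^sup>2) \<le> 1"
proof -
  have s1: "(\<Sum>n\<in>{2..<Suc M + 1}. 1 / (real n)\<^sup>2) \<le> 1 - 1 / real (Suc M)" for M
  proof (induction M)
    case (Suc M)
    have "1 / (real (Suc (Suc M)))\<^sup>2 \<le> 1 / real (Suc M) - 1 / real (Suc (Suc M))"
    proof -
      define x where "x = real (Suc M)"
      have x: "x > 0" by (simp add: x_def)
      have "1 / (x + 1)\<^sup>2 \<le> 1 / (x * (x + 1))"
        using x by (intro divide_left_mono) (auto simp: power2_eq_square)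
      also have "\<dots> = 1 / x - 1 / (x + 1)" using x by (simp add: field_simps)
      finally show ?thesis by (simp add: x_def add_ac)
    qed
    with Suc show ?case by simp
  qed simp
  define M where "M = Max (insert 0 A)"
  have "A \<subseteq> {2..<Suc M + 1}"
  proof
    fix x assume x: "x \<in> A"
    have "x \<le> M" unfolding M_def using x assms(1) by (intro Max_ge) auto
    thus "x \<in> {2..<Suc M + 1}" using assms(2)[OF x] by simp
  qed
  hence "(\<Sum>n\<in>A. 1 / (real n)\<^sup>2) \<le> (\<Sum>n\<in>{2..<Suc M + 1}. 1 / (real n)\<^sup>2)"
    by (intro sum_mono2) auto
  also have "\<dots> \<le> 1 - 1 / real (Suc M)" by (rule s1)
  also have "\<dots> \<le> 1" by simp
  finally show ?thesis .
qed

lemma union_prime_blocks: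
  "(\<Union>j<n. prime_block j) = {p. prime p \<and> p \<le> 2 ^ 2 ^ n} - {2}"
proof (induction n)
  case 0
  have "{p::nat. prime p \<and> p \<le> 2 ^ 2 ^ 0} - {2} = {}"
  proof (rule equals0I)
    fix p :: nat assume "p \<in> {p. prime p \<and> p \<le> 2 ^ 2 ^ 0} - {2}"
    hence "prime p" "p \<le> 2" "p \<noteq> 2" by auto
    with prime_ge_2_nat[of p] show False by linarith
  qed
  thus ?case by simp
next
  case (Suc n)
  have le: "(2::nat) ^ 2 ^ n \<le> 2 ^ 2 ^ Suc n" by (intro power_increasing) auto
  have le2: "(2::nat) \<le> 2 ^ 2 ^ n" using power_increasing[of 1 "2 ^ n" "2::nat"] by simp
  have gen: "{p. prime p \<and> A < p \<and> p \<le> B} \<union> ({p. prime p \<and> p \<le> A} - {2}) = {p. prime p \<and> p \<le> B} - {2}"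
    if "A \<le> B" "2 \<le> A" for A B :: nat
    using that by auto
  show ?case unfolding lessThan_Suc UN_insert Suc unfolding prime_block_def by (rule gen[OF le le2])
qed

definition prime_sum :: "nat \<Rightarrow> real" where
  "prime_sum n = (\<Sum>j<n. \<Sum>p\<in>prime_block j. 1 / real p)"

text \<open>The lower half of Mertens' theorem, from \<open>ln N \<le> harm N\<close>, the finite
  Euler product and \<open>- ln (1 - x) \<le> x + 2 * x\<^sup>2\<close>. The constant 3 covers 1/2
  for the prime 2, absent from the blocks, and 2 for the squares. The bound serves twice: to
  exchange \<open>2 ^ n\<close> for \<open>exp (prime_sum n)\<close> and to bring in
  \<open>ln q\<close> at the end.\<close>

lemma exp_prime_sum_ge: "exp (prime_sum n) \<ge> exp (-3) * ln 2 * 2 ^ n"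
proof -
  define N :: nat where "N = 2 ^ 2 ^ n"
  let ?P = "{p. prime p \<and> p \<le> N}"
  have fin: "finite ?P" by (rule finite_subset[of _ "{..N}"]) auto
  have N2: "N \<ge> 2" unfolding N_def using power_increasing[of 1 "2 ^ n" "2::nat"] by simp
  have "2 ^ n * ln 2 = ln (real N)" unfolding N_def by (simp add: ln_realpow)
  also have "\<dots> \<le> harm N" using ln_le_harm[of N] N2 ln_less_cancel_iff[of "real N" "real N + 1"] by linarith
  also have "\<dots> \<le> (\<Prod>p\<in>?P. \<Sum>k\<le>N. (1 / real p) ^ k)" using N2 by (intro harm_le_prime_product) simp
  also have "\<dots> \<le> (\<Prod>p\<in>?P. exp (1 / real p + 2 * (1 / (real p)\<^sup>2)))"
  proof (intro prod_mono conjI)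
    fix p assume p: "p \<in> ?P"
    hence p2: "real p \<ge> 2" using prime_ge_2_nat[of p] by auto
    show "0 \<le> (\<Sum>k\<le>N. (1 / real p) ^ k)" by (intro sum_nonneg) auto
    have "(\<Sum>k\<le>N. (1 / real p) ^ k) = (\<Sum>k<Suc N. (1 / real p) ^ k)" by (simp add: lessThan_Suc_atMost)
    also have "\<dots> \<le> (\<Sum>k. (1 / real p) ^ k)"
      using p2 by (intro sum_le_suminf summable_geometric) auto
    also have "\<dots> = 1 / (1 - 1 / real p)" using p2 by (intro suminf_geometric) auto
    also have "\<dots> = inverse (1 - 1 / real p)" by (simp add: inverse_eq_divide)
    also have "\<dots> \<le> exp (1 / real p + 2 * (1 / (real p)\<^sup>2))"
    proof -
      have x: "0 \<le> 1 / real p" "1 / real p \<le> 1/2" "1 - 1 / real p > 0" using p2 by (auto simp: field_simps)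
      have "- (1 / real p) - 2 * (1 / real p)\<^sup>2 \<le> ln (1 - 1 / real p)"
        by (rule ln_one_minus_pos_lower_bound[OF x(1,2)])
      hence "- ln (1 - 1 / real p) \<le> 1 / real p + 2 * (1 / (real p)\<^sup>2)" by (simp add: power_divide)
      hence "exp (- ln (1 - 1 / real p)) \<le> exp (1 / real p + 2 * (1 / (real p)\<^sup>2))" by simp
      thus ?thesis using x(3) by (simp add: exp_minus)
    qed
    finally show "(\<Sum>k\<le>N. (1 / real p) ^ k) \<le> exp (1 / real p + 2 * (1 / (real p)\<^sup>2))" .
  qed
  also have "\<dots> = exp ((\<Sum>p\<in>?P. 1 / real p) + 2 * (\<Sum>p\<in>?P. 1 / (real p)\<^sup>2))"
    unfolding sum_distrib_left sum.distrib[symmetric] by (rule exp_sum[OF fin, symmetric])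
  also have "\<dots> \<le> exp (1/2 + prime_sum n + 2)"
  proof -
    have "(\<Sum>p\<in>?P. 1 / (real p)\<^sup>2) \<le> 1" using fin prime_ge_2_nat by (intro sum_inverse_square_le) auto
    moreover have "(\<Sum>p\<in>?P. 1 / real p) = 1/2 + prime_sum n"
    proof -
      have "prime_sum n = (\<Sum>p\<in>(\<Union>j<n. prime_block j). 1 / real p)"
        unfolding prime_sum_def by (rule sum.UNION_disjoint[symmetric]) (auto simp: prime_block_disjoint)
      also have "\<dots> = (\<Sum>p\<in>?P - {2}. 1 / real p)" unfolding union_prime_blocks N_def ..
      also have "(\<Sum>p\<in>?P. 1 / real p) = 1 / real 2 + \<dots>"
        using fin N2 by (intro sum.remove) auto
      finally show ?thesis by simp
    qed
    ultimately show ?thesis by simp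
  qed
  finally have "2 ^ n * ln 2 \<le> exp (prime_sum n + 5/2)" by (simp add: add_ac)
  also have "\<dots> \<le> exp (prime_sum n + 3)" by simp
  also have "\<dots> = exp (prime_sum n) * exp 3" by (rule exp_add)
  finally show ?thesis by (simp add: exp_minus field_simps)
qed

section \<open>Truncated exponentials of prime polynomials\<close>

lemma coprime_prod_prod:
  fixes a b :: "'i \<Rightarrow> nat"
  assumes "\<And>i j. i \<in> A \<Longrightarrow> j \<in> B \<Longrightarrow> coprime (a i) (b j)"
  shows "coprime (\<Prod>i\<in>A. a i) (\<Prod>j\<in>B. b j)"
  using assms by (intro prod_coprime_left prod_coprime_right) auto

lemma gcd_prod_coprime_families:
  fixes a b :: "'i \<Rightarrow> nat"
  assumes "finite J" "\<And>i j. i \<in> J \<Longrightarrow> j \<in> J \<Longrightarrow> i \<noteq> j \<Longrightarrow> coprime (a i) (b j)"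
    and "\<And>i. i \<in> J \<Longrightarrow> a i > 0"
  shows "gcd (\<Prod>j\<in>J. a j) (\<Prod>j\<in>J. b j) = (\<Prod>j\<in>J. gcd (a j) (b j))"
  using assms
proof (induction J rule: finite_induct)
  case (insert x J)
  have c1: "coprime (a x) (\<Prod>j\<in>J. b j)"
    using insert.prems insert.hyps(2) by (intro prod_coprime_right) auto
  have c2: "coprime (\<Prod>j\<in>J. a j) (b x)"
    using insert.prems insert.hyps(2) by (intro prod_coprime_left) auto
  have g: "gcd (a * A) (b * B) = gcd a b * gcd A B" if "coprime a B" "coprime A b" "a > 0" for a A b B :: nat
  proof -
    define d where "d = gcd a b"
    have "d \<noteq> 0" using that(3) by (simp add: d_def)
    then obtain a' b' where ab: "a = a' * d" "b = b' * d" "coprime a' b'"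
      unfolding d_def using gcd_coprime_exists by blast
    have "coprime a' B" "coprime A b'" using that ab by auto
    have "gcd (a * A) (b * B) = d * gcd (A * a') (B * b')"
      unfolding gcd_mult_distrib_nat ab by (simp add: mult_ac)
    also have "gcd (A * a') (B * b') = gcd A (B * b')"
      using \<open>coprime a' B\<close> ab(3) by (intro gcd_mult_left_right_cancel) (simp add: coprime_commute)
    also have "\<dots> = gcd A B" by (rule gcd_mult_right_right_cancel[OF \<open>coprime A b'\<close>])
    finally show ?thesis by (simp add: d_def)
  qed
  show ?case using insert g[OF c1 c2] by simp
qed simp


lemma prod_eq_coprime_families:
  fixes a b :: "'i \<Rightarrow> nat"
  assumes fin: "finite J" and cop: "\<And>i j. i \<in> J \<Longrightarrow> j \<in> J \<Longrightarrow> i \<noteq> j \<Longrightarrow> coprime (a i) (b j)"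
    and eq: "(\<Prod>j\<in>J. a j) = (\<Prod>j\<in>J. b j)" and k: "k \<in> J"
  shows "a k = b k"
proof (rule dvd_antisym)
  have "a k dvd (\<Prod>j\<in>J. b j)" using fin k by (simp add: eq[symmetric] dvd_prod_eqI)
  also have "(\<Prod>j\<in>J. b j) = b k * (\<Prod>j\<in>J - {k}. b j)" by (rule prod.remove[OF fin k])
  finally have "a k dvd b k * (\<Prod>j\<in>J - {k}. b j)" .
  moreover have "coprime (a k) (\<Prod>j\<in>J - {k}. b j)" using cop k by (intro prod_coprime_right) auto
  ultimately show "a k dvd b k" by (simp add: coprime_dvd_mult_left_iff)
  have "b k dvd (\<Prod>j\<in>J. a j)" using fin k by (simp add: eq dvd_prod_eqI)
  also have "(\<Prod>j\<in>J. a j) = a k * (\<Prod>j\<in>J - {k}. a j)" by (rule prod.remove[OF fin k])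
  finally have "b k dvd a k * (\<Prod>j\<in>J - {k}. a j)" .
  moreover have "coprime (b k) (\<Prod>j\<in>J - {k}. a j)"
    using cop k by (intro prod_coprime_right) (auto simp: coprime_commute)
  ultimately show "b k dvd a k" by (simp add: coprime_dvd_mult_left_iff)
qed

lemma prod_double_sum_PiE:
  fixes G :: "'i \<Rightarrow> 'b \<Rightarrow> 'b \<Rightarrow> 'c :: comm_semiring_1"
  assumes "finite J" "\<And>j. j \<in> J \<Longrightarrow> finite (A j)"
  shows "(\<Prod>j\<in>J. \<Sum>x\<in>A j. \<Sum>y\<in>A j. G j x y) = (\<Sum>u\<in>PiE J A. \<Sum>v\<in>PiE J A. \<Prod>j\<in>J. G j (u j) (v j))"
proof -
  have "(\<Prod>j\<in>J. \<Sum>x\<in>A j. \<Sum>y\<in>A j. G j x y) = (\<Sum>u\<in>PiE J A. \<Prod>j\<in>J. \<Sum>y\<in>A j. G j (u j) y)"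
    by (rule prod_sum_PiE[OF assms])
  also have "\<dots> = (\<Sum>u\<in>PiE J A. \<Sum>v\<in>PiE J A. \<Prod>j\<in>J. G j (u j) (v j))"
    by (intro sum.cong refl prod_sum_PiE assms)
  finally show ?thesis .
qed

section \<open>Exponent vectors over the primes of one block\<close>

definition edeg :: "nat set \<Rightarrow> (nat \<Rightarrow> nat) \<Rightarrow> nat" where
  "edeg I \<alpha> = (\<Sum>p\<in>I. \<alpha> p)"

definition ebox :: "nat set \<Rightarrow> nat \<Rightarrow> (nat \<Rightarrow> nat) set" where
  "ebox I L = PiE I (\<lambda>_. {..L})"

text \<open>The terms of a truncated exponential have total degree at most \<open>L\<close>. The box
  loses none of them and makes the set finite; sums over the box, in contrast to those over
  \<open>expo\<close>, factor over the primes.\<close>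

definition expo :: "nat set \<Rightarrow> nat \<Rightarrow> (nat \<Rightarrow> nat) set" where
  "expo I L = {\<alpha> \<in> ebox I L. edeg I \<alpha> \<le> L}"

definition enum :: "nat set \<Rightarrow> (nat \<Rightarrow> nat) \<Rightarrow> nat" where
  "enum I \<alpha> = (\<Prod>p\<in>I. p ^ \<alpha> p)"

lemma finite_ebox: "finite I \<Longrightarrow> finite (ebox I L)"
  unfolding ebox_def by (intro finite_PiE) auto

lemma expo_subset_ebox: "expo I L \<subseteq> ebox I L"
  by (auto simp: expo_def)

lemma finite_expo: "finite I \<Longrightarrow> finite (expo I L)"
  by (rule finite_subset[OF expo_subset_ebox finite_ebox])

text \<open>The multinomial theorem divided by \<open>fact r\<close>, by splitting off one prime and
  using the binomial theorem. For \<open>r \<le> L\<close> the box excludes no exponent vector of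
  degree \<open>r\<close>.\<close>

lemma multinomial_ebox:
  fixes z :: "nat \<Rightarrow> 'a :: field_char_0"
  assumes "finite I" "r \<le> L"
  shows "(\<Sum>\<alpha> | \<alpha> \<in> ebox I L \<and> edeg I \<alpha> = r. \<Prod>p\<in>I. z p ^ \<alpha> p / fact (\<alpha> p)) = (\<Sum>p\<in>I. z p) ^ r / fact r"
  using assms
proof (induction I arbitrary: r rule: finite_induct)
  case empty
  have eq: "{\<alpha>. \<alpha> \<in> ebox {} L \<and> edeg {} \<alpha> = r} = (if r = 0 then {\<lambda>_. undefined} else {})"
    by (auto simp: ebox_def edeg_def)
  show ?case unfolding eq by (cases r) auto
next
  case (insert x I)
  let ?w = "\<lambda>\<alpha>. \<Prod>p\<in>I. z p ^ \<alpha> p / fact (\<alpha> p)"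
  define S where "S = (\<Sum>p\<in>I. z p)"
  have upd: "?w (g(x := k)) = ?w g" "edeg I (g(x := k)) = edeg I g" for g k
    using insert.hyps(2) by (auto simp: edeg_def intro!: prod.cong sum.cong)
  have e1: "edeg (insert x I) (g(x := k)) = k + edeg I g" for g k
    using insert.hyps upd(2)[of g k] by (simp add: edeg_def)
  have e2: "(\<Prod>p\<in>insert x I. z p ^ (g(x := k)) p / fact ((g(x := k)) p)) = z x ^ k / fact k * ?w g" for g k
    unfolding prod.insert[OF insert.hyps(1,2)] upd(1) by (simp only: fun_upd_same)
  have box: "ebox (insert x I) L = (\<lambda>(k, g). g(x := k)) ` ({..L} \<times> ebox I L)"
    unfolding ebox_def by (rule PiE_insert_eq)
  have inj: "inj_on (\<lambda>(k, g). g(x := k)) ({..L} \<times> ebox I L)"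
    unfolding ebox_def by (rule inj_combinator[OF insert.hyps(2)])
  have "(\<Sum>\<alpha> | \<alpha> \<in> ebox (insert x I) L \<and> edeg (insert x I) \<alpha> = r. \<Prod>p\<in>insert x I. z p ^ \<alpha> p / fact (\<alpha> p)) =
     (\<Sum>\<alpha>\<in>ebox (insert x I) L. if edeg (insert x I) \<alpha> = r then \<Prod>p\<in>insert x I. z p ^ \<alpha> p / fact (\<alpha> p) else 0)"
    using insert.hyps(1) by (subst sum.inter_filter[symmetric]) (auto intro: finite_ebox)
  also have "\<dots> = (\<Sum>(k, g)\<in>{..L} \<times> ebox I L. if k + edeg I g = r then z x ^ k / fact k * ?w g else 0)"
    unfolding box sum.reindex[OF inj] by (simp only: o_def case_prod_unfold e1 e2)
  also have "\<dots> = (\<Sum>k\<le>L. \<Sum>g\<in>ebox I L. if k + edeg I g = r then z x ^ k / fact k * ?w g else 0)"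
    by (simp add: sum.cartesian_product)
  also have "\<dots> = (\<Sum>k\<le>r. z x ^ k / fact k * (S ^ (r - k) / fact (r - k)))"
  proof (rule sum.mono_neutral_cong_right)
    show "{..r} \<subseteq> {..L}" using insert.prems by auto
    show "\<forall>k\<in>{..L} - {..r}. (\<Sum>g\<in>ebox I L. if k + edeg I g = r then z x ^ k / fact k * ?w g else 0) = 0"
      by (auto intro!: sum.neutral)
    fix k assume k: "k \<in> {..r}"
    have "(\<Sum>g\<in>ebox I L. if k + edeg I g = r then z x ^ k / fact k * ?w g else 0) = 
      z x ^ k / fact k * (\<Sum>g\<in>ebox I L. if edeg I g = r - k then ?w g else 0)"
      unfolding sum_distrib_left using k by (intro sum.cong refl) auto
    also have "(\<Sum>g\<in>ebox I L. if edeg I g = r - k then ?w g else 0) = (\<Sum>\<alpha> | \<alpha> \<in> ebox I L \<and> edeg I \<alpha> = r - k. ?w \<alpha>)"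
      using insert.hyps(1) by (subst sum.inter_filter[symmetric]) (auto intro: finite_ebox)
    also have "\<dots> = S ^ (r - k) / fact (r - k)" unfolding S_def using insert.prems by (intro insert.IH) simp
    finally show "(\<Sum>g\<in>ebox I L. if k + edeg I g = r then z x ^ k / fact k * ?w g else 0) = z x ^ k / fact k * (S ^ (r - k) / fact (r - k))" .
  qed simp
  also have "\<dots> = (\<Sum>k\<le>r. of_nat (r choose k) * z x ^ k * S ^ (r - k)) / fact r"
    unfolding sum_divide_distrib by (intro sum.cong refl) (simp add: binomial_fact)
  also have "\<dots> = (z x + S) ^ r / fact r" by (simp only: binomial_ring)
  finally show ?case using insert.hyps by (simp add: S_def)
qed

text \<open>Used with three choices of \<open>z p\<close>: the terms of a prime polynomial for
  values, \<open>1 / sqrt p\<close> for sums of absolute coefficients, and \<open>1 / p\<close> for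
  sums of squares.\<close>

lemma sum_expo:
  fixes z :: "nat \<Rightarrow> 'a :: field_char_0"
  assumes fin: "finite I"
  shows "(\<Sum>\<alpha>\<in>expo I L. d (edeg I \<alpha>) * (\<Prod>p\<in>I. z p ^ \<alpha> p / fact (\<alpha> p))) = (\<Sum>r\<le>L. d r * ((\<Sum>p\<in>I. z p) ^ r / fact r))"
proof -
  have "(\<Sum>\<alpha>\<in>expo I L. d (edeg I \<alpha>) * (\<Prod>p\<in>I. z p ^ \<alpha> p / fact (\<alpha> p))) =
    (\<Sum>r\<le>L. \<Sum>\<alpha> | \<alpha> \<in> expo I L \<and> edeg I \<alpha> = r. d (edeg I \<alpha>) * (\<Prod>p\<in>I. z p ^ \<alpha> p / fact (\<alpha> p)))"
    by (rule sum.group[symmetric]) (auto simp: finite_expo[OF fin], auto simp: expo_def)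
  also have "\<dots> = (\<Sum>r\<le>L. d r * ((\<Sum>p\<in>I. z p) ^ r / fact r))"
  proof (rule sum.cong[OF refl])
    fix r assume r: "r \<in> {..L}"
    have "{\<alpha>. \<alpha> \<in> expo I L \<and> edeg I \<alpha> = r} = {\<alpha>. \<alpha> \<in> ebox I L \<and> edeg I \<alpha> = r}" using r by (auto simp: expo_def)
    hence "(\<Sum>\<alpha> | \<alpha> \<in> expo I L \<and> edeg I \<alpha> = r. d (edeg I \<alpha>) * (\<Prod>p\<in>I. z p ^ \<alpha> p / fact (\<alpha> p))) = 
      d r * (\<Sum>\<alpha> | \<alpha> \<in> ebox I L \<and> edeg I \<alpha> = r. \<Prod>p\<in>I. z p ^ \<alpha> p / fact (\<alpha> p))"
      unfolding sum_distrib_left by (intro sum.cong) auto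
    thus "(\<Sum>\<alpha> | \<alpha> \<in> expo I L \<and> edeg I \<alpha> = r. d (edeg I \<alpha>) * (\<Prod>p\<in>I. z p ^ \<alpha> p / fact (\<alpha> p))) = d r * ((\<Sum>p\<in>I. z p) ^ r / fact r)"
      using multinomial_ebox[OF fin, of r L z] r by simp
  qed
  finally show ?thesis .
qed

text \<open>Taking \<open>d r = \<rho> ^ r\<close> gives the truncated exponential of
  \<open>\<rho>\<close> times the prime polynomial. General \<open>d\<close> is kept because the
  product of such an exponential with a power of the prime polynomial has the same shape.\<close>

definition ecoef :: "nat set \<Rightarrow> (nat \<Rightarrow> real) \<Rightarrow> (nat \<Rightarrow> nat) \<Rightarrow> real" where
  "ecoef I d \<alpha> = d (edeg I \<alpha>) * (\<Prod>p\<in>I. (1 / sqrt (real p)) ^ \<alpha> p / fact (\<alpha> p))"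

definition prime_poly :: "nat set \<Rightarrow> (int \<Rightarrow> complex) \<Rightarrow> complex" where
  "prime_poly I \<psi> = (\<Sum>p\<in>I. \<psi> (int p) / of_real (sqrt (real p)))"

definition block_poly :: "nat set \<Rightarrow> nat \<Rightarrow> (nat \<Rightarrow> real) \<Rightarrow> (int \<Rightarrow> complex) \<Rightarrow> complex" where
  "block_poly I L d \<psi> = (\<Sum>\<alpha>\<in>expo I L. of_real (ecoef I d \<alpha>) * \<psi> (int (enum I \<alpha>)))"

lemma dirichlet_character_prod:
  assumes dc: "dirichlet_character q \<psi>"
  shows "\<psi> (int (\<Prod>i\<in>A. f i)) = (\<Prod>i\<in>A. \<psi> (int (f i)))"
proof (induction A rule: infinite_finite_induct)
  case (insert x A)
  thus ?case using dirichlet_character_mult[OF dc, of "int (f x)" "int (prod f A)"] by simp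
qed (use dirichlet_character_1[OF dc] in auto)

lemma block_poly_eq:
  assumes fin: "finite I" and dc: "dirichlet_character q \<psi>"
  shows "block_poly I L d \<psi> = (\<Sum>r\<le>L. of_real (d r) * (prime_poly I \<psi> ^ r / fact r))"
proof -
  have "of_real (ecoef I d \<alpha>) * \<psi> (int (enum I \<alpha>)) = 
     of_real (d (edeg I \<alpha>)) * (\<Prod>p\<in>I. (\<psi> (int p) / of_real (sqrt (real p))) ^ \<alpha> p / fact (\<alpha> p))" for \<alpha>
  proof -
    have "\<psi> (int (enum I \<alpha>)) = (\<Prod>p\<in>I. \<psi> (int p) ^ \<alpha> p)"
      unfolding enum_def dirichlet_character_prod[OF dc] using dirichlet_character_power[OF dc] by simp
    moreover have "of_real (ecoef I d \<alpha>) = of_real (d (edeg I \<alpha>)) * (\<Prod>p\<in>I. (1 / complex_of_real (sqrt (real p))) ^ \<alpha> p / fact (\<alpha> p))"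
      by (simp add: ecoef_def)
    ultimately show ?thesis
      by (simp add: mult.assoc prod.distrib[symmetric] power_divide power_one_over divide_inverse power_mult_distrib power_inverse mult_ac)
  qed
  hence "block_poly I L d \<psi> = (\<Sum>\<alpha>\<in>expo I L. of_real (d (edeg I \<alpha>)) * (\<Prod>p\<in>I. (\<psi> (int p) / of_real (sqrt (real p))) ^ \<alpha> p / fact (\<alpha> p)))"
    unfolding block_poly_def by (intro sum.cong refl)
  also have "\<dots> = (\<Sum>r\<le>L. of_real (d r) * ((\<Sum>p\<in>I. \<psi> (int p) / of_real (sqrt (real p))) ^ r / fact r))"
    by (rule sum_expo[OF fin, where d = "\<lambda>r. of_real (d r)"])
  finally show ?thesis unfolding prime_poly_def .
qed

lemma abs_ecoef: "\<bar>ecoef I d \<alpha>\<bar> = ecoef I (\<lambda>r. \<bar>d r\<bar>) \<alpha>"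
  by (simp add: ecoef_def abs_mult abs_prod prod_nonneg)

lemma sum_abs_ecoef:
  assumes "finite I"
  shows "(\<Sum>\<alpha>\<in>expo I L. \<bar>ecoef I d \<alpha>\<bar>) = (\<Sum>r\<le>L. \<bar>d r\<bar> * ((\<Sum>p\<in>I. 1 / sqrt (real p)) ^ r / fact r))"
  unfolding abs_ecoef unfolding ecoef_def
  by (rule sum_expo[OF assms, where d = "\<lambda>r. \<bar>d r\<bar>" and z = "\<lambda>p. 1 / sqrt (real p)"])

text \<open>One of the two factors \<open>1 / fact (\<alpha> p)\<close> in the square is discarded,
  so that \<open>sum_expo\<close> applies.\<close>

lemma sum_ecoef_square_le:
  assumes "finite I"
  shows "(\<Sum>\<alpha>\<in>expo I L. (ecoef I d \<alpha>)\<^sup>2) \<le> (\<Sum>r\<le>L. (d r)\<^sup>2 * ((\<Sum>p\<in>I. 1 / real p) ^ r / fact r))"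
proof -
  have "(\<Sum>\<alpha>\<in>expo I L. (ecoef I d \<alpha>)\<^sup>2) \<le> (\<Sum>\<alpha>\<in>expo I L. (d (edeg I \<alpha>))\<^sup>2 * (\<Prod>p\<in>I. (1 / real p) ^ \<alpha> p / fact (\<alpha> p)))"
  proof (rule sum_mono)
    fix \<alpha>
    have "((\<Prod>p\<in>I. (1 / sqrt (real p)) ^ \<alpha> p / fact (\<alpha> p)))\<^sup>2 = (\<Prod>p\<in>I. ((1 / sqrt (real p)) ^ \<alpha> p / fact (\<alpha> p))\<^sup>2)"
      by (rule prod_power_distrib)
    also have "\<dots> \<le> (\<Prod>p\<in>I. (1 / real p) ^ \<alpha> p / fact (\<alpha> p))"
    proof (intro prod_mono conjI)
      fix p
      have "((1 / sqrt (real p)) ^ \<alpha> p / fact (\<alpha> p))\<^sup>2 = ((1 / sqrt (real p))\<^sup>2) ^ \<alpha> p / (fact (\<alpha> p))\<^sup>2"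
        by (simp only: power_divide power_mult[symmetric] mult.commute)
      also have "(1 / sqrt (real p))\<^sup>2 = 1 / real p" by (simp add: power_divide)
      also have "(1 / real p) ^ \<alpha> p / (fact (\<alpha> p))\<^sup>2 \<le> (1 / real p) ^ \<alpha> p / fact (\<alpha> p)"
        by (intro divide_left_mono) (auto simp: power2_eq_square fact_ge_1)
      finally show "((1 / sqrt (real p)) ^ \<alpha> p / fact (\<alpha> p))\<^sup>2 \<le> (1 / real p) ^ \<alpha> p / fact (\<alpha> p)" .
    qed simp
    finally show "(ecoef I d \<alpha>)\<^sup>2 \<le> (d (edeg I \<alpha>))\<^sup>2 * (\<Prod>p\<in>I. (1 / real p) ^ \<alpha> p / fact (\<alpha> p))"
      unfolding ecoef_def power_mult_distrib by (intro mult_left_mono) auto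
  qed
  also have "\<dots> = (\<Sum>r\<le>L. (d r)\<^sup>2 * ((\<Sum>p\<in>I. 1 / real p) ^ r / fact r))"
    by (rule sum_expo[OF assms, where d = "\<lambda>r. (d r)\<^sup>2" and z = "\<lambda>p. 1 / real p"])
  finally show ?thesis .
qed

lemma sum_power_div_fact_le_exp: "x \<ge> 0 \<Longrightarrow> finite A \<Longrightarrow> (\<Sum>k\<in>A. x ^ k / fact k) \<le> exp (x :: real)"
  using sum_le_suminf[OF summable_exp[of x], of A] by (simp add: exp_def divide_inverse mult.commute)

text \<open>Rankin's trick: outside \<open>expo I L\<close> the factor \<open>exp (edeg I \<alpha> - L)\<close> is at least \<open>1\<close>.\<close>
lemma sum_ebox_minus_expo_le:
  fixes F :: "nat \<Rightarrow> nat \<Rightarrow> real"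
  assumes fin: "finite I" and F: "\<And>p k. p \<in> I \<Longrightarrow> F p k \<ge> 0"
  shows "(\<Sum>\<alpha>\<in>ebox I L - expo I L. \<Prod>p\<in>I. F p (\<alpha> p)) \<le> exp (- real L) * (\<Prod>p\<in>I. \<Sum>k\<le>L. exp (real k) * F p k)"
proof -
  have "(\<Sum>\<alpha>\<in>ebox I L - expo I L. \<Prod>p\<in>I. F p (\<alpha> p)) \<le> (\<Sum>\<alpha>\<in>ebox I L. exp (- real L) * (\<Prod>p\<in>I. exp (real (\<alpha> p)) * F p (\<alpha> p)))"
  proof (rule sum_le_included[where i = "\<lambda>\<alpha>. \<alpha>"])
    show "\<forall>\<alpha>\<in>ebox I L. 0 \<le> exp (- real L) * (\<Prod>p\<in>I. exp (real (\<alpha> p)) * F p (\<alpha> p))"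
      using F by (auto intro!: mult_nonneg_nonneg prod_nonneg)
    show "\<forall>\<alpha>\<in>ebox I L - expo I L. \<exists>\<beta>\<in>ebox I L. \<beta> = \<alpha> \<and> (\<Prod>p\<in>I. F p (\<alpha> p)) \<le> exp (- real L) * (\<Prod>p\<in>I. exp (real (\<beta> p)) * F p (\<beta> p))"
    proof
      fix \<alpha> assume \<alpha>: "\<alpha> \<in> ebox I L - expo I L"
      hence "real L \<le> real (edeg I \<alpha>)" by (auto simp: expo_def)
      hence "1 \<le> exp (- real L) * exp (real (edeg I \<alpha>))" unfolding exp_add[symmetric] by simp
      moreover have "(\<Prod>p\<in>I. F p (\<alpha> p)) \<ge> 0" using F by (intro prod_nonneg) auto
      ultimately have "1 * (\<Prod>p\<in>I. F p (\<alpha> p)) \<le> exp (- real L) * exp (real (edeg I \<alpha>)) * (\<Prod>p\<in>I. F p (\<alpha> p))"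
        by (rule mult_right_mono)
      also have "\<dots> = exp (- real L) * (\<Prod>p\<in>I. exp (real (\<alpha> p)) * F p (\<alpha> p))"
        using fin by (simp add: edeg_def exp_sum prod.distrib mult.assoc)
      finally show "\<exists>\<beta>\<in>ebox I L. \<beta> = \<alpha> \<and> (\<Prod>p\<in>I. F p (\<alpha> p)) \<le> exp (- real L) * (\<Prod>p\<in>I. exp (real (\<beta> p)) * F p (\<beta> p))"
        using \<alpha> by auto
    qed
  qed (auto intro: finite_ebox fin)
  also have "\<dots> = exp (- real L) * (\<Prod>p\<in>I. \<Sum>k\<le>L. exp (real k) * F p k)"
    unfolding ebox_def using fin by (subst prod_sum_PiE) (auto simp: sum_distrib_left)
  finally show ?thesis .
qed

text \<open>The squares are multiplicative, so over the whole box they sum to a product over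
  \<open>I\<close>, whose terms \<open>k = 0\<close> and \<open>k = 1\<close> already give
  \<open>1 + m\<^sup>2 / p\<close>. The exponent vectors of degree above \<open>L\<close> are
  subtracted by Rankin's trick.\<close>

lemma sum_ecoef_square_ge:
  fixes m :: real
  assumes fin: "finite I" and I: "\<And>p. p \<in> I \<Longrightarrow> p > 0" and v: "(\<Sum>p\<in>I. 1 / real p) \<le> 4" and L: "L \<ge> 1"
  shows "(\<Sum>\<alpha>\<in>expo I L. (ecoef I (\<lambda>r. (- m) ^ r) \<alpha>)\<^sup>2) \<ge> (\<Prod>p\<in>I. 1 + m\<^sup>2 / real p) - exp (- real L) * exp (4 * exp 1 * m\<^sup>2)"
proof -
  define F where "F p k = (m\<^sup>2 / real p) ^ k / (fact k)\<^sup>2" for p k :: nat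
  have F0: "F p k \<ge> 0" for p k by (simp add: F_def)
  have sq: "(ecoef I (\<lambda>r. (- m) ^ r) \<alpha>)\<^sup>2 = (\<Prod>p\<in>I. F p (\<alpha> p))" for \<alpha>
  proof -
    have "(- m) ^ edeg I \<alpha> = (\<Prod>p\<in>I. (- m) ^ \<alpha> p)" unfolding edeg_def by (rule power_sum)
    hence "(ecoef I (\<lambda>r. (- m) ^ r) \<alpha>)\<^sup>2 = (\<Prod>p\<in>I. ((- m) ^ \<alpha> p * ((1 / sqrt (real p)) ^ \<alpha> p / fact (\<alpha> p)))\<^sup>2)"
      unfolding ecoef_def by (simp only: prod.distrib[symmetric] prod_power_distrib)
    also have "\<dots> = (\<Prod>p\<in>I. F p (\<alpha> p))"
    proof (rule prod.cong[OF refl])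
      fix p
      have "((- m) ^ \<alpha> p * ((1 / sqrt (real p)) ^ \<alpha> p / fact (\<alpha> p)))\<^sup>2 = ((- m)\<^sup>2) ^ \<alpha> p * ((1 / sqrt (real p))\<^sup>2) ^ \<alpha> p / (fact (\<alpha> p))\<^sup>2"
        by (simp only: power_mult_distrib power_divide power_mult[symmetric] mult.commute[of 2] times_divide_eq_right)
      also have "\<dots> = F p (\<alpha> p)" by (simp add: F_def power_divide)
      finally show "((- m) ^ \<alpha> p * ((1 / sqrt (real p)) ^ \<alpha> p / fact (\<alpha> p)))\<^sup>2 = F p (\<alpha> p)" .
    qed
    finally show ?thesis .
  qed
  have "(\<Prod>p\<in>I. 1 + m\<^sup>2 / real p) \<le> (\<Prod>p\<in>I. \<Sum>k\<le>L. F p k)"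
  proof (intro prod_mono conjI)
    fix p
    have "1 + m\<^sup>2 / real p = (\<Sum>k\<in>{0, 1}. F p k)" by (simp add: F_def)
    also have "\<dots> \<le> (\<Sum>k\<le>L. F p k)" using L F0 by (intro sum_mono2) auto
    finally show "1 + m\<^sup>2 / real p \<le> (\<Sum>k\<le>L. F p k)" .
  qed simp
  also have "\<dots> = (\<Sum>\<alpha>\<in>ebox I L. \<Prod>p\<in>I. F p (\<alpha> p))" unfolding ebox_def using fin by (intro prod_sum_PiE) auto
  also have "\<dots> = (\<Sum>\<alpha>\<in>expo I L. \<Prod>p\<in>I. F p (\<alpha> p)) + (\<Sum>\<alpha>\<in>ebox I L - expo I L. \<Prod>p\<in>I. F p (\<alpha> p))"
    using sum.subset_diff[OF expo_subset_ebox finite_ebox[OF fin]] by (simp add: add.commute)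
  also have "(\<Sum>\<alpha>\<in>ebox I L - expo I L. \<Prod>p\<in>I. F p (\<alpha> p)) \<le> exp (- real L) * (\<Prod>p\<in>I. \<Sum>k\<le>L. exp (real k) * F p k)"
    by (rule sum_ebox_minus_expo_le[OF fin F0])
  also have "(\<Prod>p\<in>I. \<Sum>k\<le>L. exp (real k) * F p k) \<le> (\<Prod>p\<in>I. exp (exp 1 * m\<^sup>2 / real p))"
  proof (intro prod_mono conjI)
    fix p
    show "0 \<le> (\<Sum>k\<le>L. exp (real k) * F p k)" by (intro sum_nonneg mult_nonneg_nonneg F0) auto
    have "(\<Sum>k\<le>L. exp (real k) * F p k) \<le> (\<Sum>k\<le>L. (exp 1 * m\<^sup>2 / real p) ^ k / fact k)"
    proof (rule sum_mono)
      fix k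
      have "F p k \<le> (m\<^sup>2 / real p) ^ k / fact k" unfolding F_def
        by (intro divide_left_mono) (auto simp: power2_eq_square fact_ge_1)
      hence "exp (real k) * F p k \<le> exp (real k) * ((m\<^sup>2 / real p) ^ k / fact k)" by (intro mult_left_mono) auto
      also have "\<dots> = (exp 1 * m\<^sup>2 / real p) ^ k / fact k"
        using exp_of_nat_mult[of k "1::real"] by (simp add: power_mult_distrib power_divide)
      finally show "exp (real k) * F p k \<le> (exp 1 * m\<^sup>2 / real p) ^ k / fact k" .
    qed
    also have "\<dots> \<le> exp (exp 1 * m\<^sup>2 / real p)" by (intro sum_power_div_fact_le_exp) auto
    finally show "(\<Sum>k\<le>L. exp (real k) * F p k) \<le> exp (exp 1 * m\<^sup>2 / real p)" .
  qed
  also have "(\<Prod>p\<in>I. exp (exp 1 * m\<^sup>2 / real p)) = exp (exp 1 * m\<^sup>2 * (\<Sum>p\<in>I. 1 / real p))"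
    using fin by (simp add: exp_sum[symmetric] sum_distrib_left)
  also have "\<dots> \<le> exp (4 * exp 1 * m\<^sup>2)"
    using mult_left_mono[OF v, of "exp 1 * m\<^sup>2"] by (simp add: mult_ac)
  finally show ?thesis unfolding sq by simp
qed


text \<open>These are the coefficients of the \<open>L\<close>-th power of the prime polynomial
  times the truncated exponential: the degree is shifted by \<open>L\<close>, and the quotient of
  factorials undoes the division by \<open>fact r\<close>. The bound rests on
  \<open>(s + L)! \<le> 2 ^ (s + L) * s! * L!\<close>.\<close>

lemma sum_geometric_ecoef_square_le:
  fixes m v :: real
  assumes fin: "finite I"
  defines "v \<equiv> (\<Sum>p\<in>I. 1 / real p)"
  shows "(\<Sum>\<alpha>\<in>expo I (2 * L). (ecoef I (\<lambda>r. if L \<le> r then (- m) ^ (r - L) * (fact r / fact (r - L)) else 0) \<alpha>)\<^sup>2)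
            \<le> fact L * (2 * v) ^ L * exp (2 * m\<^sup>2 * v)"
proof -
  define d where "d r = (if L \<le> r then (- m) ^ (r - L) * (fact r / fact (r - L)) else 0)" for r
  have v0: "v \<ge> 0" by (simp add: v_def sum_nonneg)
  have "(\<Sum>\<alpha>\<in>expo I (2 * L). (ecoef I d \<alpha>)\<^sup>2) \<le> (\<Sum>r\<le>2 * L. (d r)\<^sup>2 * (v ^ r / fact r))"
    unfolding v_def by (rule sum_ecoef_square_le[OF fin])
  also have "\<dots> = (\<Sum>r\<in>{L..2 * L}. (d r)\<^sup>2 * (v ^ r / fact r))"
    by (rule sum.mono_neutral_right) (auto simp: d_def)
  also have "\<dots> = (\<Sum>s\<in>{0..L}. (d (s + L))\<^sup>2 * (v ^ (s + L) / fact (s + L)))"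
    using sum.shift_bounds_cl_nat_ivl[of "\<lambda>r. (d r)\<^sup>2 * (v ^ r / fact r)" 0 L L] by (simp add: mult_2)
  also have "\<dots> \<le> (\<Sum>s\<in>{0..L}. fact L * (2 * v) ^ L * ((2 * m\<^sup>2 * v) ^ s / fact s))"
  proof (rule sum_mono)
    fix s
    have c: "(fact (s + L) :: real) \<le> 2 ^ (s + L) * (fact s * fact L)"
    proof -
      have "real ((s + L) choose s) = fact (s + L) / (fact s * fact L)"
        using binomial_fact[of s "s + L", where 'a = real] by simp
      hence "(fact (s + L) :: real) = real ((s + L) choose s) * (fact s * fact L)" by simp
      also have "\<dots> \<le> 2 ^ (s + L) * (fact s * fact L)"
      proof (rule mult_right_mono)
        have "((s + L) choose s) \<le> 2 ^ (s + L)" by (rule binomial_le_pow2)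
        hence "real ((s + L) choose s) \<le> real (2 ^ (s + L))" by (simp only: of_nat_le_iff)
        thus "real ((s + L) choose s) \<le> 2 ^ (s + L)" by simp
      qed simp
      finally show ?thesis .
    qed
    have "(d (s + L))\<^sup>2 * (v ^ (s + L) / fact (s + L)) = (m\<^sup>2) ^ s * v ^ (s + L) / (fact s)\<^sup>2 * fact (s + L)"
    proof -
      have "((- m) ^ s)\<^sup>2 = ((- m)\<^sup>2) ^ s" by (simp only: power_mult[symmetric] mult.commute)
      hence "(d (s + L))\<^sup>2 = (m\<^sup>2) ^ s * (fact (s + L))\<^sup>2 / (fact s)\<^sup>2"
        by (simp add: d_def power_mult_distrib power_divide)
      thus ?thesis by (simp add: power2_eq_square)
    qed
    also have "\<dots> \<le> (m\<^sup>2) ^ s * v ^ (s + L) / (fact s)\<^sup>2 * (2 ^ (s + L) * (fact s * fact L))"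
      using v0 by (intro mult_left_mono c) auto
    also have "\<dots> = fact L * (2 * v) ^ L * ((2 * m\<^sup>2 * v) ^ s / fact s)"
    proof -
      have "fact s * X / (fact s)\<^sup>2 = X / fact s" for X :: real by (simp add: power2_eq_square)
      from this[of "fact L * (2 * v) ^ L * (2 * m\<^sup>2 * v) ^ s"] show ?thesis
        by (simp add: power_mult_distrib power_add mult_ac)
    qed
    finally show "(d (s + L))\<^sup>2 * (v ^ (s + L) / fact (s + L)) \<le> fact L * (2 * v) ^ L * ((2 * m\<^sup>2 * v) ^ s / fact s)" .
  qed
  also have "\<dots> = fact L * (2 * v) ^ L * (\<Sum>s\<in>{0..L}. (2 * m\<^sup>2 * v) ^ s / fact s)" by (simp add: sum_distrib_left)
  also have "\<dots> \<le> fact L * (2 * v) ^ L * exp (2 * m\<^sup>2 * v)"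
    using v0 by (intro mult_left_mono sum_power_div_fact_le_exp) auto
  finally show ?thesis unfolding d_def .
qed

section \<open>Local factors of the gcd-weighted sums\<close>

definition tcoef :: "real \<Rightarrow> nat \<Rightarrow> nat \<Rightarrow> nat \<Rightarrow> real" where
  "tcoef \<rho> p k l = \<rho> ^ k * \<rho> ^ l / (fact k * fact l) * (1 / real p) ^ max k l"

text \<open>The weight that the diagonal of the second moment attaches to a pair of twists. It is
  multiplicative over coprime families, which turns the main term into a product over
  primes.\<close>

definition gcd_weight :: "nat \<Rightarrow> nat \<Rightarrow> real" where
  "gcd_weight a b = real (gcd a b) / sqrt (real a * real b)"

lemma gcd_weight_prod:
  assumes "finite J" "\<And>i j. i \<in> J \<Longrightarrow> j \<in> J \<Longrightarrow> i \<noteq> j \<Longrightarrow> coprime (a i) (b j)" "\<And>i. i \<in> J \<Longrightarrow> a i > 0"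
  shows "gcd_weight (\<Prod>j\<in>J. a j) (\<Prod>j\<in>J. b j) = (\<Prod>j\<in>J. gcd_weight (a j) (b j))"
proof -
  have s: "sqrt (\<Prod>j\<in>J. f j) = (\<Prod>j\<in>J. sqrt (f j))" for f :: "_ \<Rightarrow> real"
    by (induction J rule: infinite_finite_induct) (auto simp: real_sqrt_mult)
  have G: "real (gcd (\<Prod>j\<in>J. a j) (\<Prod>j\<in>J. b j)) = (\<Prod>j\<in>J. real (gcd (a j) (b j)))"
  proof -
    have "gcd (\<Prod>j\<in>J. a j) (\<Prod>j\<in>J. b j) = (\<Prod>j\<in>J. gcd (a j) (b j))"
      using assms by (rule gcd_prod_coprime_families)
    thus ?thesis by simp
  qed
  have S: "sqrt (real (\<Prod>j\<in>J. a j) * real (\<Prod>j\<in>J. b j)) = (\<Prod>j\<in>J. sqrt (real (a j) * real (b j)))"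
    by (simp only: of_nat_prod prod.distrib[symmetric] s)
  show ?thesis unfolding gcd_weight_def G S by (rule prod_dividef[symmetric])
qed

text \<open>At a prime \<open>p\<close> with exponents \<open>k\<close> and \<open>l\<close>, the
  normalization by square roots occurs once in the coefficients and once in the weight, which makes
  \<open>p ^ (k + l)\<close> in the denominator; the gcd cancels \<open>p ^ min k l\<close>, leaving
  the exponent \<open>max k l\<close> of \<open>tcoef\<close>.\<close>

lemma ecoef_gcd_weight:
  assumes fin: "finite I" and I: "\<And>p. p \<in> I \<Longrightarrow> prime p"
  shows "ecoef I (\<lambda>r. \<rho> ^ r) \<alpha> * ecoef I (\<lambda>r. \<rho> ^ r) \<beta> * gcd_weight (enum I \<alpha>) (enum I \<beta>) = (\<Prod>p\<in>I. tcoef \<rho> p (\<alpha> p) (\<beta> p))"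
proof -
  have p0: "p > 0" if "p \<in> I" for p using I[OF that] by (rule prime_gt_0_nat)
  have g: "gcd_weight (enum I \<alpha>) (enum I \<beta>) = (\<Prod>p\<in>I. gcd_weight (p ^ \<alpha> p) (p ^ \<beta> p))"
    unfolding enum_def
  proof (rule gcd_weight_prod[OF fin])
    show "coprime (i ^ \<alpha> i) (j ^ \<beta> j)" if "i \<in> I" "j \<in> I" "i \<noteq> j" for i j
      using primes_coprime[OF I[OF that(1)] I[OF that(2)] that(3)] by simp
  qed (use p0 in simp)
  have e: "ecoef I (\<lambda>r. \<rho> ^ r) \<alpha> = (\<Prod>p\<in>I. \<rho> ^ \<alpha> p * ((1 / sqrt (real p)) ^ \<alpha> p / fact (\<alpha> p)))" for \<alpha>
    unfolding ecoef_def edeg_def power_sum by (rule prod.distrib[symmetric])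
  show ?thesis unfolding e g prod.distrib[symmetric]
  proof (rule prod.cong[OF refl])
    fix p assume "p \<in> I"
    hence p: "p > 0" by (rule p0)
    have gen: "(1 / sqrt (real p)) ^ k * (1 / sqrt (real p)) ^ l * gcd_weight (p ^ k) (p ^ l) = (1 / real p) ^ max k l" for k l
    proof -
      have "gcd (p ^ k) (p ^ l) = p ^ min k l"
        by (cases "k \<le> l") (auto simp: min_def gcd_nat.absorb1 gcd_nat.absorb2 le_imp_power_dvd)
      hence "(1 / sqrt (real p)) ^ k * (1 / sqrt (real p)) ^ l * gcd_weight (p ^ k) (p ^ l) = 
          real p ^ min k l / ((sqrt (real p) ^ k * sqrt (real p) ^ l) * (sqrt (real p) ^ k * sqrt (real p) ^ l))"
        by (simp add: gcd_weight_def real_sqrt_mult real_sqrt_power power_one_over)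
      also have "(sqrt (real p) ^ k * sqrt (real p) ^ l) * (sqrt (real p) ^ k * sqrt (real p) ^ l) = real p ^ (k + l)"
      proof -
        have "(x ^ k * x ^ l) * (x ^ k * x ^ l) = (x * x) ^ (k + l)" for x :: real
          by (simp add: power_add power_mult_distrib mult_ac)
        thus ?thesis by simp
      qed
      also have "k + l = min k l + max k l" by simp
      also have "real p ^ min k l / real p ^ (min k l + max k l) = (1 / real p) ^ max k l"
        using p by (simp add: power_add power_one_over field_simps)
      finally show ?thesis .
    qed
    show "\<rho> ^ \<alpha> p * ((1 / sqrt (real p)) ^ \<alpha> p / fact (\<alpha> p)) * (\<rho> ^ \<beta> p * ((1 / sqrt (real p)) ^ \<beta> p / fact (\<beta> p))) * gcd_weight (p ^ \<alpha> p) (p ^ \<beta> p) = tcoef \<rho> p (\<alpha> p) (\<beta> p)"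
      unfolding tcoef_def gen[symmetric] by simp
  qed
qed

text \<open>Apart from \<open>k = l = 0\<close> every term contains at least one factor
  \<open>1 / p\<close>, and what remains is a product of exponential series. The weight
  \<open>exp k\<close> is the one demanded by Rankin's trick.\<close>

lemma sum_sum_abs_tcoef_le:
  fixes \<rho> :: real
  assumes p: "p \<ge> 2"
  shows "(\<Sum>k\<le>L. \<Sum>l\<le>L. exp (real k) * \<bar>tcoef \<rho> p k l\<bar>) \<le> exp (exp ((exp 1 + 1) * \<bar>\<rho>\<bar>) / real p)"
proof -
  let ?a = "\<bar>\<rho>\<bar>"
  have "(\<Sum>k\<le>L. \<Sum>l\<le>L. exp (real k) * \<bar>tcoef \<rho> p k l\<bar>) \<le>
     (\<Sum>k\<le>L. \<Sum>l\<le>L. (if k = 0 \<and> l = 0 then 1 else 0) + (1 / real p) * ((exp 1 * ?a) ^ k / fact k * (?a ^ l / fact l)))"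
  proof (intro sum_mono)
    fix k l
    have e: "exp (real k) = exp 1 ^ k" using exp_of_nat_mult[of k "1::real"] by simp
    have t: "exp (real k) * \<bar>tcoef \<rho> p k l\<bar> = (exp 1 * ?a) ^ k / fact k * (?a ^ l / fact l) * (1 / real p) ^ max k l"
      by (simp add: tcoef_def abs_mult power_abs e power_mult_distrib)
    show "exp (real k) * \<bar>tcoef \<rho> p k l\<bar> \<le> (if k = 0 \<and> l = 0 then 1 else 0) + (1 / real p) * ((exp 1 * ?a) ^ k / fact k * (?a ^ l / fact l))"
    proof (cases "k = 0 \<and> l = 0")
      case True
      thus ?thesis by (simp add: tcoef_def)
    next
      case False
      hence "(1 / real p) ^ max k l \<le> (1 / real p) ^ 1" using p by (intro power_decreasing) auto
      hence "(exp 1 * ?a) ^ k / fact k * (?a ^ l / fact l) * (1 / real p) ^ max k l \<le> (exp 1 * ?a) ^ k / fact k * (?a ^ l / fact l) * (1 / real p) ^ 1"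
        by (intro mult_left_mono) auto
      moreover have "(if k = 0 \<and> l = 0 then 1 else 0 :: real) = 0" using False by auto
      ultimately show ?thesis unfolding t by (simp add: mult_ac)
    qed
  qed
  also have "\<dots> = (\<Sum>k\<le>L. \<Sum>l\<le>L. (if k = 0 \<and> l = 0 then 1 else 0)) + (1 / real p) * ((\<Sum>k\<le>L. (exp 1 * ?a) ^ k / fact k) * (\<Sum>l\<le>L. ?a ^ l / fact l))"
  proof -
    have "(\<Sum>k\<le>L. \<Sum>l\<le>L. A k l + c * (x k * y l)) = (\<Sum>k\<le>L. \<Sum>l\<le>L. A k l) + c * (sum x {..L} * sum y {..L})"
      for A :: "nat \<Rightarrow> nat \<Rightarrow> real" and c x y
    proof -
      have "(\<Sum>k\<le>L. \<Sum>l\<le>L. c * (x k * y l)) = c * (\<Sum>k\<le>L. \<Sum>l\<le>L. x k * y l)"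
        by (simp only: sum_distrib_left)
      thus ?thesis by (simp only: sum.distrib sum_product[of x "{..L}" y "{..L}"])
    qed
    thus ?thesis .
  qed
  also have "(\<Sum>k\<le>L. \<Sum>l\<le>L. (if k = 0 \<and> l = 0 then 1 else 0)) = (1 :: real)"
  proof -
    have "(\<Sum>k\<le>L. \<Sum>l\<le>L. (if k = 0 \<and> l = 0 then 1 else 0)) = (\<Sum>k\<le>L. if k = 0 then 1 else (0::real))"
      by (intro sum.cong refl) (auto simp: sum.delta)
    thus ?thesis by (simp add: sum.delta)
  qed
  also have "(\<Sum>k\<le>L. (exp 1 * ?a) ^ k / fact k) * (\<Sum>l\<le>L. ?a ^ l / fact l) \<le> exp (exp 1 * ?a) * exp ?a"
    by (intro mult_mono sum_power_div_fact_le_exp sum_nonneg) auto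
  also have "exp (exp 1 * ?a) * exp ?a = exp ((exp 1 + 1) * ?a)" by (simp add: exp_add[symmetric] algebra_simps)
  also have "1 + 1 / real p * exp ((exp 1 + 1) * ?a) \<le> exp (exp ((exp 1 + 1) * ?a) / real p)"
    using exp_ge_add_one_self[of "exp ((exp 1 + 1) * ?a) / real p"] by simp
  finally show ?thesis by (simp add: divide_right_mono)
qed


definition twist_const :: "real \<Rightarrow> real" where
  "twist_const \<rho> = exp ((exp 1 + 1) * \<bar>\<rho>\<bar>)"

text \<open>The terms with \<open>k, l \<le> 1\<close> are \<open>1 - 2 * (m + 1) / p + (m +
  1)\<^sup>2 / p = 1 + (m\<^sup>2 - 1) / p\<close>, the origin of the exponent
  \<open>m\<^sup>2 - 1\<close> in the twisted moment. All others carry at least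
  \<open>1 / p\<^sup>2\<close>.\<close>

lemma abs_sum_tcoef_le:
  fixes m :: real
  assumes p: "p \<ge> 2" and L: "L \<ge> 1"
  shows "\<bar>\<Sum>k\<le>L. \<Sum>l\<le>L. tcoef (- (m + 1)) p k l\<bar> \<le> exp ((m\<^sup>2 - 1) / real p + twist_const (m + 1) / (real p)\<^sup>2)"
proof -
  let ?a = "\<bar>m + 1\<bar>" and ?r = "- (m + 1)"
  define M where "M k l = (if k \<le> 1 \<and> l \<le> 1 then tcoef ?r p k l else 0)" for k l
  define R where "R k l = (if k \<le> 1 \<and> l \<le> 1 then 0 else tcoef ?r p k l)" for k l
  have split: "(\<Sum>k\<le>L. \<Sum>l\<le>L. tcoef ?r p k l) = (\<Sum>k\<le>L. \<Sum>l\<le>L. M k l) + (\<Sum>k\<le>L. \<Sum>l\<le>L. R k l)"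
    unfolding sum.distrib[symmetric] by (intro sum.cong refl) (simp add: M_def R_def)
    have s: "(\<Sum>k\<le>L. f k) = f 0 + f 1" if "\<And>k. k > 1 \<Longrightarrow> f k = 0" for f :: "nat \<Rightarrow> real"
    proof -
      have "(\<Sum>k\<le>L. f k) = (\<Sum>k\<in>{0, 1}. f k)"
        using L that by (intro sum.mono_neutral_right) auto
      thus ?thesis by simp
    qed
    have "(\<Sum>k\<le>L. \<Sum>l\<le>L. M k l) = (M 0 0 + M 0 1) + (M 1 0 + M 1 1)"
      by (subst s | simp add: M_def)+
    also have "\<dots> = 1 + (m\<^sup>2 - 1) / real p"
      using p by (simp add: M_def tcoef_def field_simps power2_eq_square)
    finally have eq: "(\<Sum>k\<le>L. \<Sum>l\<le>L. M k l) = 1 + (m\<^sup>2 - 1) / real p" .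
    have "1 + (m\<^sup>2 - 1) / real p = (real p - 1 + m\<^sup>2) / real p" using p by (simp add: field_simps)
    also have "\<dots> \<ge> 0" using p by (intro divide_nonneg_nonneg add_nonneg_nonneg) auto
    finally have nn: "0 \<le> 1 + (m\<^sup>2 - 1) / real p" .
  have "\<bar>\<Sum>k\<le>L. \<Sum>l\<le>L. R k l\<bar> \<le> exp (2 * ?a) / (real p)\<^sup>2"
  proof -
    have "\<bar>\<Sum>k\<le>L. \<Sum>l\<le>L. R k l\<bar> \<le> (\<Sum>k\<le>L. \<Sum>l\<le>L. \<bar>R k l\<bar>)"
      by (rule order_trans[OF sum_abs]) (intro sum_mono sum_abs)
    also have "\<dots> \<le> (\<Sum>k\<le>L. \<Sum>l\<le>L. (?a ^ k / fact k * (?a ^ l / fact l)) * (1 / (real p)\<^sup>2))"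
    proof (intro sum_mono)
      fix k l
      show "\<bar>R k l\<bar> \<le> (?a ^ k / fact k * (?a ^ l / fact l)) * (1 / (real p)\<^sup>2)"
      proof (cases "k \<le> 1 \<and> l \<le> 1")
        case False
        hence "2 \<le> max k l" by auto
        hence "(1 / real p) ^ max k l \<le> (1 / real p) ^ 2" using p by (intro power_decreasing) auto
        hence "(?a ^ k / fact k * (?a ^ l / fact l)) * (1 / real p) ^ max k l \<le> (?a ^ k / fact k * (?a ^ l / fact l)) * (1 / real p) ^ 2"
          by (intro mult_left_mono) auto
        moreover have "\<bar>R k l\<bar> = (?a ^ k / fact k * (?a ^ l / fact l)) * (1 / real p) ^ max k l"
        proof -
          have "R k l = tcoef ?r p k l" by (simp only: R_def False if_False)
          moreover have "\<bar>- (m + 1)\<bar> = ?a" by (rule abs_minus_cancel)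
          ultimately show ?thesis by (simp only: tcoef_def abs_mult abs_divide power_abs) simp
        qed
        ultimately show ?thesis by (simp add: power_one_over)
      qed (simp add: R_def)
    qed
    also have "\<dots> = (\<Sum>k\<le>L. ?a ^ k / fact k) * (\<Sum>l\<le>L. ?a ^ l / fact l) * (1 / (real p)\<^sup>2)"
    proof -
      have "(\<Sum>k\<le>L. \<Sum>l\<le>L. (x k * y l) * c) = sum x {..L} * sum y {..L} * c" for x y :: "nat \<Rightarrow> real" and c
        by (simp only: sum_product[of x "{..L}" y "{..L}"]) (simp only: sum_distrib_right)
      thus ?thesis .
    qed
    also have "\<dots> \<le> exp ?a * exp ?a * (1 / (real p)\<^sup>2)"
      by (intro mult_right_mono mult_mono sum_power_div_fact_le_exp sum_nonneg) auto
    also have "exp ?a * exp ?a = exp (2 * ?a)" by (simp add: exp_add[symmetric])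
    finally show ?thesis by simp
  qed
  hence "\<bar>\<Sum>k\<le>L. \<Sum>l\<le>L. tcoef ?r p k l\<bar> \<le> 1 + (m\<^sup>2 - 1) / real p + exp (2 * ?a) / (real p)\<^sup>2"
    unfolding split eq using nn by linarith
  moreover have "exp (2 * ?a) \<le> twist_const (m + 1)"
  proof -
    have "2 * ?a \<le> (exp 1 + 1) * ?a" by (intro mult_right_mono) auto
    thus ?thesis by (simp add: twist_const_def)
  qed
  hence "exp (2 * ?a) / (real p)\<^sup>2 \<le> twist_const (m + 1) / (real p)\<^sup>2" by (rule divide_right_mono) simp
  ultimately have "\<bar>\<Sum>k\<le>L. \<Sum>l\<le>L. tcoef ?r p k l\<bar> \<le> 1 + ((m\<^sup>2 - 1) / real p + twist_const (m + 1) / (real p)\<^sup>2)"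
    by linarith
  also have "\<dots> \<le> exp ((m\<^sup>2 - 1) / real p + twist_const (m + 1) / (real p)\<^sup>2)" by (rule exp_ge_add_one_self)
  finally show ?thesis .
qed

lemma tcoef_commute: "tcoef \<rho> p k l = tcoef \<rho> p l k"
  by (simp add: tcoef_def mult.commute max.commute)

context
  fixes I :: "nat set" and L :: nat and m :: real
  assumes fin: "finite I" and I: "\<And>p. p \<in> I \<Longrightarrow> prime p" and v: "(\<Sum>p\<in>I. 1 / real p) \<le> 4"
begin

private abbreviation "\<tau> \<alpha> \<beta> \<equiv> \<Prod>p\<in>I. tcoef (- (m + 1)) p (\<alpha> p) (\<beta> p)"
private abbreviation "K \<equiv> twist_const (m + 1)"

private lemma ew: "ecoef I (\<lambda>r. (- (m + 1)) ^ r) \<alpha> * ecoef I (\<lambda>r. (- (m + 1)) ^ r) \<beta> * gcd_weight (enum I \<alpha>) (enum I \<beta>) = \<tau> \<alpha> \<beta>"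
  by (rule ecoef_gcd_weight[OF fin I])

private lemma p2: "p \<in> I \<Longrightarrow> p \<ge> 2"
  using I by (rule prime_ge_2_nat)

private lemma prod_abs_tcoef_le: 
  "(\<Prod>p\<in>I. \<Sum>k\<le>L. exp (real k) * (\<Sum>l\<le>L. \<bar>tcoef (- (m + 1)) p k l\<bar>)) \<le> exp (4 * K)"
proof -
  have "(\<Prod>p\<in>I. \<Sum>k\<le>L. exp (real k) * (\<Sum>l\<le>L. \<bar>tcoef (- (m + 1)) p k l\<bar>)) \<le> (\<Prod>p\<in>I. exp (K / real p))"
  proof (intro prod_mono conjI)
    fix p assume "p \<in> I"
    show "0 \<le> (\<Sum>k\<le>L. exp (real k) * (\<Sum>l\<le>L. \<bar>tcoef (- (m + 1)) p k l\<bar>))"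
      by (intro sum_nonneg mult_nonneg_nonneg) auto
    have "\<bar>- (m + 1)\<bar> = \<bar>m + 1\<bar>" by (rule abs_minus_cancel)
    thus "(\<Sum>k\<le>L. exp (real k) * (\<Sum>l\<le>L. \<bar>tcoef (- (m + 1)) p k l\<bar>)) \<le> exp (K / real p)"
      using sum_sum_abs_tcoef_le[OF p2[OF \<open>p \<in> I\<close>], where \<rho> = "- (m + 1)" and L = L]
      by (simp only: sum_distrib_left twist_const_def)
  qed
  also have "\<dots> = exp (K * (\<Sum>p\<in>I. 1 / real p))"
    using fin by (simp add: exp_sum[symmetric] sum_distrib_left)
  also have "\<dots> \<le> exp (4 * K)" using mult_left_mono[OF v, of K] by (simp add: twist_const_def)
  finally show ?thesis .
qed

private lemma sum_ebox_ebox_abs: "(\<Sum>\<alpha>\<in>A. \<Sum>\<beta>\<in>ebox I L. \<bar>\<tau> \<alpha> \<beta>\<bar>) = (\<Sum>\<alpha>\<in>A. \<Prod>p\<in>I. \<Sum>l\<le>L. \<bar>tcoef (- (m + 1)) p (\<alpha> p) l\<bar>)"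
proof (rule sum.cong[OF refl])
  fix \<alpha>
  show "(\<Sum>\<beta>\<in>ebox I L. \<bar>\<tau> \<alpha> \<beta>\<bar>) = (\<Prod>p\<in>I. \<Sum>l\<le>L. \<bar>tcoef (- (m + 1)) p (\<alpha> p) l\<bar>)"
    unfolding ebox_def abs_prod using fin by (intro prod_sum_PiE[symmetric]) auto
qed

private lemma tail_le: "(\<Sum>\<alpha>\<in>ebox I L - expo I L. \<Sum>\<beta>\<in>ebox I L. \<bar>\<tau> \<alpha> \<beta>\<bar>) \<le> exp (- real L) * exp (4 * K)"
  unfolding sum_ebox_ebox_abs
  by (rule order_trans[OF sum_ebox_minus_expo_le[OF fin] mult_left_mono[OF prod_abs_tcoef_le]]) (auto intro: sum_nonneg)

lemma sum_expo_gcd_weight_abs_le: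
  "(\<Sum>\<alpha>\<in>expo I L. \<Sum>\<beta>\<in>expo I L. \<bar>ecoef I (\<lambda>r. (- (m + 1)) ^ r) \<alpha> * ecoef I (\<lambda>r. (- (m + 1)) ^ r) \<beta> * gcd_weight (enum I \<alpha>) (enum I \<beta>)\<bar>) \<le> exp (4 * K)"
proof -
  have "(\<Sum>\<alpha>\<in>expo I L. \<Sum>\<beta>\<in>expo I L. \<bar>\<tau> \<alpha> \<beta>\<bar>) \<le> (\<Sum>\<alpha>\<in>ebox I L. \<Sum>\<beta>\<in>ebox I L. \<bar>\<tau> \<alpha> \<beta>\<bar>)"
    by (intro order_trans[OF sum_mono sum_mono2] sum_mono2 finite_ebox fin expo_subset_ebox sum_nonneg) auto
  also have "\<dots> = (\<Prod>p\<in>I. \<Sum>k\<le>L. \<Sum>l\<le>L. \<bar>tcoef (- (m + 1)) p k l\<bar>)"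
    unfolding sum_ebox_ebox_abs unfolding ebox_def using fin by (intro prod_sum_PiE[symmetric]) auto
  also have "\<dots> \<le> (\<Prod>p\<in>I. \<Sum>k\<le>L. exp (real k) * (\<Sum>l\<le>L. \<bar>tcoef (- (m + 1)) p k l\<bar>))"
  proof (intro prod_mono conjI sum_mono sum_nonneg)
    fix p k
    have "1 * (\<Sum>l\<le>L. \<bar>tcoef (- (m + 1)) p k l\<bar>) \<le> exp (real k) * (\<Sum>l\<le>L. \<bar>tcoef (- (m + 1)) p k l\<bar>)"
      by (intro mult_right_mono sum_nonneg) auto
    thus "(\<Sum>l\<le>L. \<bar>tcoef (- (m + 1)) p k l\<bar>) \<le> exp (real k) * (\<Sum>l\<le>L. \<bar>tcoef (- (m + 1)) p k l\<bar>)" by simp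
  qed auto
  also have "\<dots> \<le> exp (4 * K)" by (rule prod_abs_tcoef_le)
  finally show ?thesis unfolding ew .
qed

text \<open>Over the full box in both variables the sum is a product of the local sums. Passing to
  \<open>expo\<close> removes one tail in each variable, hence the factor 2; by symmetry of
  \<open>tcoef\<close> both tails have the same bound.\<close>

lemma sum_expo_gcd_weight_le:
  assumes L: "L \<ge> 1"
  shows "\<bar>\<Sum>\<alpha>\<in>expo I L. \<Sum>\<beta>\<in>expo I L. ecoef I (\<lambda>r. (- (m + 1)) ^ r) \<alpha> * ecoef I (\<lambda>r. (- (m + 1)) ^ r) \<beta> * gcd_weight (enum I \<alpha>) (enum I \<beta>)\<bar>
     \<le> exp ((m\<^sup>2 - 1) * (\<Sum>p\<in>I. 1 / real p) + K * (\<Sum>p\<in>I. 1 / (real p)\<^sup>2)) + 2 * exp (- real L) * exp (4 * K)"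
proof -
  let ?B = "ebox I L" and ?E = "expo I L"
  have fB: "finite ?B" by (rule finite_ebox[OF fin])
  have split: "sum f ?B = sum f ?E + sum f (?B - ?E)" for f :: "(nat \<Rightarrow> nat) \<Rightarrow> real"
    using sum.subset_diff[OF expo_subset_ebox fB, of f] by simp
  have "(\<Sum>\<alpha>\<in>?B. \<Sum>\<beta>\<in>?B. \<tau> \<alpha> \<beta>) = (\<Prod>p\<in>I. \<Sum>k\<le>L. \<Sum>l\<le>L. tcoef (- (m + 1)) p k l)"
    unfolding ebox_def using fin by (intro prod_double_sum_PiE[symmetric]) auto
  also have "\<bar>\<dots>\<bar> \<le> (\<Prod>p\<in>I. exp ((m\<^sup>2 - 1) / real p + K / (real p)\<^sup>2))"
    unfolding abs_prod using p2 L by (intro prod_mono conjI abs_sum_tcoef_le) auto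
  also have "\<dots> = exp ((m\<^sup>2 - 1) * (\<Sum>p\<in>I. 1 / real p) + K * (\<Sum>p\<in>I. 1 / (real p)\<^sup>2))"
    using fin by (simp add: exp_sum[symmetric] sum_distrib_left sum.distrib)
  finally have b1: "\<bar>\<Sum>\<alpha>\<in>?B. \<Sum>\<beta>\<in>?B. \<tau> \<alpha> \<beta>\<bar> \<le> exp ((m\<^sup>2 - 1) * (\<Sum>p\<in>I. 1 / real p) + K * (\<Sum>p\<in>I. 1 / (real p)\<^sup>2))" .
  have "\<bar>\<Sum>\<alpha>\<in>?B - ?E. \<Sum>\<beta>\<in>?B. \<tau> \<alpha> \<beta>\<bar> \<le> (\<Sum>\<alpha>\<in>?B - ?E. \<Sum>\<beta>\<in>?B. \<bar>\<tau> \<alpha> \<beta>\<bar>)"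
    by (rule order_trans[OF sum_abs]) (intro sum_mono sum_abs)
  hence b2: "\<bar>\<Sum>\<alpha>\<in>?B - ?E. \<Sum>\<beta>\<in>?B. \<tau> \<alpha> \<beta>\<bar> \<le> exp (- real L) * exp (4 * K)" using tail_le by linarith
  have "\<bar>\<Sum>\<alpha>\<in>?E. \<Sum>\<beta>\<in>?B - ?E. \<tau> \<alpha> \<beta>\<bar> \<le> (\<Sum>\<alpha>\<in>?E. \<Sum>\<beta>\<in>?B - ?E. \<bar>\<tau> \<alpha> \<beta>\<bar>)"
    by (rule order_trans[OF sum_abs]) (intro sum_mono sum_abs)
  also have "\<dots> \<le> (\<Sum>\<alpha>\<in>?B. \<Sum>\<beta>\<in>?B - ?E. \<bar>\<tau> \<alpha> \<beta>\<bar>)"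
    by (intro sum_mono2 fB expo_subset_ebox sum_nonneg) auto
  also have "\<dots> = (\<Sum>\<alpha>\<in>?B - ?E. \<Sum>\<beta>\<in>?B. \<bar>\<tau> \<alpha> \<beta>\<bar>)"
    by (subst sum.swap) (simp only: tcoef_commute)
  finally have b3: "\<bar>\<Sum>\<alpha>\<in>?E. \<Sum>\<beta>\<in>?B - ?E. \<tau> \<alpha> \<beta>\<bar> \<le> exp (- real L) * exp (4 * K)" using tail_le by linarith
  have "(\<Sum>\<alpha>\<in>?B. \<Sum>\<beta>\<in>?B. \<tau> \<alpha> \<beta>) = (\<Sum>\<alpha>\<in>?E. \<Sum>\<beta>\<in>?B. \<tau> \<alpha> \<beta>) + (\<Sum>\<alpha>\<in>?B - ?E. \<Sum>\<beta>\<in>?B. \<tau> \<alpha> \<beta>)" by (rule split)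
  also have "(\<Sum>\<alpha>\<in>?E. \<Sum>\<beta>\<in>?B. \<tau> \<alpha> \<beta>) = (\<Sum>\<alpha>\<in>?E. \<Sum>\<beta>\<in>?E. \<tau> \<alpha> \<beta>) + (\<Sum>\<alpha>\<in>?E. \<Sum>\<beta>\<in>?B - ?E. \<tau> \<alpha> \<beta>)"
    unfolding sum.distrib[symmetric] by (intro sum.cong refl split)
  finally have "\<bar>\<Sum>\<alpha>\<in>?E. \<Sum>\<beta>\<in>?E. \<tau> \<alpha> \<beta>\<bar> \<le> exp ((m\<^sup>2 - 1) * (\<Sum>p\<in>I. 1 / real p) + K * (\<Sum>p\<in>I. 1 / (real p)\<^sup>2)) + 2 * exp (- real L) * exp (4 * K)"
    using b1 b2 b3 by linarith
  thus ?thesis unfolding ew .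
qed

end

lemma enum_le:
  assumes "finite I" "\<alpha> \<in> expo I L" "\<And>p. p \<in> I \<Longrightarrow> p \<le> y" "y \<ge> 1"
  shows "enum I \<alpha> \<le> y ^ L"
proof -
  have "enum I \<alpha> \<le> (\<Prod>p\<in>I. y ^ \<alpha> p)" unfolding enum_def using assms by (intro prod_mono) (auto intro: power_mono)
  also have "\<dots> = y ^ edeg I \<alpha>" by (simp add: edeg_def power_sum)
  also have "\<dots> \<le> y ^ L" using assms by (intro power_increasing) (auto simp: expo_def)
  finally show ?thesis .
qed

lemma enum_pos: "(\<And>p. p \<in> I \<Longrightarrow> p > 0) \<Longrightarrow> enum I \<alpha> > 0"
  unfolding enum_def by (intro prod_pos) auto

lemma enum_inj:
  assumes fin: "finite I" and I: "\<And>p. p \<in> I \<Longrightarrow> prime p" and \<alpha>: "\<alpha> \<in> expo I L" and \<beta>: "\<beta> \<in> expo I L"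
    and eq: "enum I \<alpha> = enum I \<beta>"
  shows "\<alpha> = \<beta>"
proof
  fix p
  show "\<alpha> p = \<beta> p"
  proof (cases "p \<in> I")
    case True
    have "coprime (i ^ \<alpha> i) (j ^ \<beta> j)" if "i \<in> I" "j \<in> I" "i \<noteq> j" for i j
      using primes_coprime[OF I[OF that(1)] I[OF that(2)] that(3)] by simp
    hence "p ^ \<alpha> p = p ^ \<beta> p"
      by (rule prod_eq_coprime_families[OF fin _ eq[unfolded enum_def] True])
    thus ?thesis using prime_gt_1_nat[OF I[OF True]] by simp
  next
    case False
    thus ?thesis using \<alpha> \<beta> by (auto simp: expo_def ebox_def PiE_def extensional_def)
  qed
qed

section \<open>Products over all blocks\<close>

definition midx :: "nat \<Rightarrow> (nat \<Rightarrow> nat) \<Rightarrow> (nat \<Rightarrow> nat \<Rightarrow> nat) set" where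
  "midx n L = PiE {..<n} (\<lambda>j. expo (prime_block j) (L j))"

definition mnum :: "nat \<Rightarrow> (nat \<Rightarrow> nat \<Rightarrow> nat) \<Rightarrow> nat" where
  "mnum n u = (\<Prod>j<n. enum (prime_block j) (u j))"

definition mcoef :: "nat \<Rightarrow> (nat \<Rightarrow> nat \<Rightarrow> real) \<Rightarrow> (nat \<Rightarrow> nat \<Rightarrow> nat) \<Rightarrow> real" where
  "mcoef n d u = (\<Prod>j<n. ecoef (prime_block j) (d j) (u j))"

text \<open>The product of \<open>(2 ^ 2 ^ Suc j) ^ L j\<close> over the blocks, an upper bound for
  the integers occurring in the polynomial.\<close>

definition mlen :: "nat \<Rightarrow> (nat \<Rightarrow> nat) \<Rightarrow> nat" where
  "mlen n L = 2 ^ (\<Sum>j<n. 2 ^ Suc j * L j)"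

definition mpoly :: "nat \<Rightarrow> (nat \<Rightarrow> nat) \<Rightarrow> (nat \<Rightarrow> nat \<Rightarrow> real) \<Rightarrow> (int \<Rightarrow> complex) \<Rightarrow> complex" where
  "mpoly n L d \<psi> = (\<Prod>j<n. block_poly (prime_block j) (L j) (d j) \<psi>)"

lemma prime_block_prime: "p \<in> prime_block j \<Longrightarrow> prime p"
  by (simp add: prime_block_def)

lemma prime_block_pos: "p \<in> prime_block j \<Longrightarrow> p > 0"
  by (rule prime_gt_0_nat[OF prime_block_prime])

lemma enum_prime_block_pos: "enum (prime_block j) \<alpha> > 0"
  by (rule enum_pos) (rule prime_block_pos)

lemma finite_midx: "finite (midx n L)"
  unfolding midx_def by (intro finite_PiE finite_expo) auto

lemma mpoly_expand:
  assumes "dirichlet_character q \<psi>"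
  shows "mpoly n L d \<psi> = (\<Sum>u\<in>midx n L. of_real (mcoef n d u) * \<psi> (int (mnum n u)))"
proof -
  have "mpoly n L d \<psi> = (\<Sum>u\<in>midx n L. \<Prod>j<n. of_real (ecoef (prime_block j) (d j) (u j)) * \<psi> (int (enum (prime_block j) (u j))))"
    unfolding mpoly_def block_poly_def midx_def by (rule prod_sum_PiE) (auto intro: finite_expo)
  thus ?thesis unfolding mnum_def dirichlet_character_prod[OF assms] mcoef_def by (simp add: prod.distrib)
qed

lemma norm_mpoly_square_expand:
  assumes "dirichlet_character q \<psi>"
  shows "of_real ((norm (mpoly n L d \<psi>))\<^sup>2) = 
     (\<Sum>u\<in>midx n L. \<Sum>v\<in>midx n L. of_real (mcoef n d u * mcoef n d v) * (\<psi> (int (mnum n u)) * cnj (\<psi> (int (mnum n v)))))"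
  unfolding complex_norm_square mpoly_expand[OF assms] cnj_sum sum_product
  by (intro sum.cong refl) simp

lemma enum_coprime:
  assumes "i \<noteq> j"
  shows "coprime (enum (prime_block i) \<alpha>) (enum (prime_block j) \<beta>)"
  unfolding enum_def
proof (rule coprime_prod_prod)
  fix p q assume pq: "p \<in> prime_block i" "q \<in> prime_block j"
  hence "p \<noteq> q" using prime_block_disjoint[OF assms] by auto
  from primes_coprime[OF prime_block_prime[OF pq(1)] prime_block_prime[OF pq(2)] this]
  show "coprime (p ^ \<alpha> p) (q ^ \<beta> q)" by simp
qed

lemma mnum_pos: "mnum n u > 0"
  unfolding mnum_def by (intro prod_pos) (auto intro: enum_pos prime_block_pos)

lemma mnum_le:
  assumes "u \<in> midx n L"
  shows "mnum n u \<le> mlen n L"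
proof -
  have "mnum n u \<le> (\<Prod>j<n. (2 ^ 2 ^ Suc j) ^ L j)"
    unfolding mnum_def
  proof (intro prod_mono conjI)
    fix j assume j: "j \<in> {..<n}"
    show "enum (prime_block j) (u j) \<le> (2 ^ 2 ^ Suc j) ^ L j"
    proof (rule enum_le)
      show "u j \<in> expo (prime_block j) (L j)" using assms j by (auto simp: midx_def PiE_def)
      show "p \<le> 2 ^ 2 ^ Suc j" if "p \<in> prime_block j" for p using that by (simp only: prime_block_def mem_Collect_eq)
    qed auto
  qed simp
  also have "\<dots> = mlen n L" unfolding mlen_def power_sum by (simp only: power_mult)
  finally show ?thesis .
qed

lemma mnum_inj:
  assumes u: "u \<in> midx n L" and v: "v \<in> midx n L" and eq: "mnum n u = mnum n v"
  shows "u = v"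
proof
  fix j show "u j = v j"
  proof (cases "j < n")
    case True
    have "enum (prime_block j) (u j) = enum (prime_block j) (v j)"
      by (rule prod_eq_coprime_families[OF _ _ eq[unfolded mnum_def]]) (use True in \<open>auto intro: enum_coprime\<close>)
    moreover have "u j \<in> expo (prime_block j) (L j)" "v j \<in> expo (prime_block j) (L j)"
      using u v True by (auto simp: midx_def PiE_def)
    ultimately show ?thesis 
      by (intro enum_inj[of "prime_block j" "u j" "L j" "v j"]) (auto intro: prime_block_prime)
  next
    case False
    thus ?thesis using u v by (auto simp: midx_def PiE_def extensional_def)
  qed
qed

lemma gcd_weight_mnum:
  "gcd_weight (mnum n u) (mnum n v) = (\<Prod>j<n. gcd_weight (enum (prime_block j) (u j)) (enum (prime_block j) (v j)))"
  unfolding mnum_def by (rule gcd_weight_prod) (auto intro: enum_coprime enum_pos prime_block_pos)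

text \<open>Two integers of the polynomial add up to less than \<open>q\<close>, so a congruence
  between them up to sign is an equality and unique factorization identifies the indices. Only
  diagonal terms survive, and their sum factors over the blocks.\<close>

theorem mean_square_mpoly:
  assumes q: "prime q" "q > 2" and len: "2 * mlen n L < q"
  shows "(\<Sum>\<psi>\<in>even_characters q. (norm (mpoly n L d \<psi>))\<^sup>2) = 
     real (card (even_characters q)) * (\<Prod>j<n. \<Sum>\<alpha>\<in>expo (prime_block j) (L j). (ecoef (prime_block j) (d j) \<alpha>)\<^sup>2)"
proof -
  let ?X = "even_characters q" and ?I = "midx n L"
  have lt: "mnum n u < q" "coprime (int (mnum n u)) (int q)" if "u \<in> ?I" for u
  proof -
    show l: "mnum n u < q" using mnum_le[OF that] len by simp
    have "\<not> q dvd mnum n u" using l mnum_pos[of n u] by (auto dest: dvd_imp_le)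
    hence "coprime q (mnum n u)" using q(1) by (intro prime_imp_coprime)
    thus "coprime (int (mnum n u)) (int q)" by (simp add: coprime_commute)
  qed
  have o: "(\<Sum>\<psi>\<in>?X. \<psi> (int (mnum n u)) * cnj (\<psi> (int (mnum n v)))) = (if u = v then of_nat (card ?X) else 0)"
    if uv: "u \<in> ?I" "v \<in> ?I" for u v
  proof -
    let ?a = "mnum n u" and ?b = "mnum n v"
    have le: "?a + ?b < q" using mnum_le[OF uv(1)] mnum_le[OF uv(2)] len by simp
    have "\<not> [int ?a = - int ?b] (mod int q)"
    proof
      assume "[int ?a = - int ?b] (mod int q)"
      hence "int q dvd int ?a + int ?b" by (simp add: cong_iff_dvd_diff)
      hence "int q \<le> int ?a + int ?b" using mnum_pos[of n u] by (intro zdvd_imp_le) auto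
      with le show False by simp
    qed
    moreover have "[int ?a = int ?b] (mod int q) \<longleftrightarrow> u = v"
    proof
      assume "[int ?a = int ?b] (mod int q)"
      hence "[?a = ?b] (mod q)" by (simp add: cong_int_iff)
      hence "?a = ?b" using lt(1)[OF uv(1)] lt(1)[OF uv(2)] by (simp add: cong_def)
      thus "u = v" by (rule mnum_inj[OF uv])
    qed simp
    ultimately show ?thesis using even_characters_orthogonality[OF q lt(2)[OF uv(1)] lt(2)[OF uv(2)]] by simp
  qed
  have "complex_of_real (\<Sum>\<psi>\<in>?X. (norm (mpoly n L d \<psi>))\<^sup>2) = (\<Sum>\<psi>\<in>?X. \<Sum>u\<in>?I. \<Sum>v\<in>?I. of_real (mcoef n d u * mcoef n d v) * (\<psi> (int (mnum n u)) * cnj (\<psi> (int (mnum n v)))))"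
    unfolding of_real_sum by (intro sum.cong refl norm_mpoly_square_expand[of q]) (simp add: even_characters_def)
  also have "\<dots> = (\<Sum>u\<in>?I. \<Sum>v\<in>?I. \<Sum>\<psi>\<in>?X. of_real (mcoef n d u * mcoef n d v) * (\<psi> (int (mnum n u)) * cnj (\<psi> (int (mnum n v)))))"
    by (subst sum.swap, intro sum.cong refl, subst sum.swap) (rule refl)
  also have "\<dots> = (\<Sum>u\<in>?I. \<Sum>v\<in>?I. if u = v then of_real (real (card ?X) * (mcoef n d u)\<^sup>2) else 0)"
    unfolding sum_distrib_left[symmetric] by (intro sum.cong refl) (simp add: o power2_eq_square)
  also have "\<dots> = (\<Sum>u\<in>?I. of_real (real (card ?X) * (mcoef n d u)\<^sup>2))"
    by (intro sum.cong refl) (simp add: finite_midx)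
  also have "\<dots> = complex_of_real (real (card ?X) * (\<Sum>u\<in>?I. (mcoef n d u)\<^sup>2))"
    by (simp only: of_real_sum sum_distrib_left)
  finally have "(\<Sum>\<psi>\<in>?X. (norm (mpoly n L d \<psi>))\<^sup>2) = real (card ?X) * (\<Sum>u\<in>?I. (mcoef n d u)\<^sup>2)"
    by (simp only: of_real_eq_iff)
  also have "(\<Sum>u\<in>?I. (mcoef n d u)\<^sup>2) = (\<Prod>j<n. \<Sum>\<alpha>\<in>expo (prime_block j) (L j). (ecoef (prime_block j) (d j) \<alpha>)\<^sup>2)"
    unfolding mcoef_def prod_power_distrib midx_def by (rule prod_sum_PiE[symmetric]) (auto intro: finite_expo)
  finally show ?thesis .
qed

lemma sum_abs_mcoef: "(\<Sum>u\<in>midx n L. \<bar>mcoef n d u\<bar>) = (\<Prod>j<n. \<Sum>\<alpha>\<in>expo (prime_block j) (L j). \<bar>ecoef (prime_block j) (d j) \<alpha>\<bar>)"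
  unfolding mcoef_def abs_prod midx_def by (rule prod_sum_PiE[symmetric]) (auto intro: finite_expo)

text \<open>In each block the sum of \<open>1 / sqrt p\<close> is crudely bounded by the end of the
  block. The resulting power of the length is affordable because the length is a small power of
  \<open>q\<close>; this controls the remainder of the second moment and the principal
  character.\<close>

lemma sum_abs_mcoef_power_le:
  fixes \<rho> :: real
  shows "(\<Sum>u\<in>midx n L. \<bar>mcoef n (\<lambda>_ r. \<rho> ^ r) u\<bar>) \<le> exp (\<bar>\<rho>\<bar> * real n) * real (mlen n L)"
proof -
  have "(\<Sum>\<alpha>\<in>expo (prime_block j) (L j). \<bar>ecoef (prime_block j) (\<lambda>r. \<rho> ^ r) \<alpha>\<bar>) \<le> exp \<bar>\<rho>\<bar> * real ((2 ^ 2 ^ Suc j) ^ L j)" for j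
  proof -
    define y :: real where "y = 2 ^ 2 ^ Suc j"
    have y1: "y \<ge> 1" by (simp add: y_def)
    have "(\<Sum>p\<in>prime_block j. 1 / sqrt (real p)) \<le> (\<Sum>p\<in>prime_block j. 1)"
    proof (rule sum_mono)
      fix p assume "p \<in> prime_block j"
      hence "real p \<ge> 1" using prime_block_pos[of p j] by simp
      hence "sqrt (real p) \<ge> 1" by simp
      thus "1 / sqrt (real p) \<le> 1" by simp
    qed
    also have "\<dots> \<le> y"
    proof -
      have "prime_block j \<subseteq> {1..2 ^ 2 ^ Suc j}" using prime_block_pos by (auto simp: prime_block_def Suc_le_eq)
      from card_mono[OF _ this] have "card (prime_block j) \<le> 2 ^ 2 ^ Suc j" by simp
      hence "real (card (prime_block j)) \<le> real (2 ^ 2 ^ Suc j)" by (simp only: of_nat_le_iff)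
      thus ?thesis by (simp add: y_def)
    qed
    finally have s: "(\<Sum>p\<in>prime_block j. 1 / sqrt (real p)) \<le> y" .
    have s0: "(\<Sum>p\<in>prime_block j. 1 / sqrt (real p)) \<ge> 0" by (intro sum_nonneg) auto
    have "(\<Sum>\<alpha>\<in>expo (prime_block j) (L j). \<bar>ecoef (prime_block j) (\<lambda>r. \<rho> ^ r) \<alpha>\<bar>) = 
      (\<Sum>r\<le>L j. \<bar>\<rho> ^ r\<bar> * ((\<Sum>p\<in>prime_block j. 1 / sqrt (real p)) ^ r / fact r))"
      by (rule sum_abs_ecoef) simp
    also have "\<dots> \<le> (\<Sum>r\<le>L j. (\<bar>\<rho>\<bar> ^ r / fact r) * y ^ L j)"
    proof (rule sum_mono)
      fix r assume r: "r \<in> {..L j}"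
      have "(\<Sum>p\<in>prime_block j. 1 / sqrt (real p)) ^ r \<le> y ^ r" by (rule power_mono[OF s s0])
      also have "\<dots> \<le> y ^ L j" using r y1 by (intro power_increasing) auto
      finally have "\<bar>\<rho>\<bar> ^ r / fact r * (\<Sum>p\<in>prime_block j. 1 / sqrt (real p)) ^ r \<le> \<bar>\<rho>\<bar> ^ r / fact r * y ^ L j"
        by (intro mult_left_mono) auto
      thus "\<bar>\<rho> ^ r\<bar> * ((\<Sum>p\<in>prime_block j. 1 / sqrt (real p)) ^ r / fact r) \<le> (\<bar>\<rho>\<bar> ^ r / fact r) * y ^ L j"
        by (simp add: power_abs)
    qed
    also have "\<dots> = (\<Sum>r\<le>L j. \<bar>\<rho>\<bar> ^ r / fact r) * y ^ L j" by (simp only: sum_distrib_right)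
    also have "\<dots> \<le> exp \<bar>\<rho>\<bar> * y ^ L j" using y1 by (intro mult_right_mono sum_power_div_fact_le_exp) auto
    finally show ?thesis by (simp add: y_def)
  qed
  hence "(\<Prod>j<n. \<Sum>\<alpha>\<in>expo (prime_block j) (L j). \<bar>ecoef (prime_block j) (\<lambda>r. \<rho> ^ r) \<alpha>\<bar>) \<le> (\<Prod>j<n. exp \<bar>\<rho>\<bar> * real ((2 ^ 2 ^ Suc j) ^ L j))"
    by (intro prod_mono conjI sum_nonneg) auto
  also have "\<dots> = exp \<bar>\<rho>\<bar> ^ n * real (\<Prod>j<n. (2 ^ 2 ^ Suc j) ^ L j)" by (simp add: prod.distrib)
  also have "exp \<bar>\<rho>\<bar> ^ n = exp (\<bar>\<rho>\<bar> * real n)" by (simp add: exp_of_nat_mult[symmetric] mult.commute)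
  also have "(\<Prod>j<n. (2 ^ 2 ^ Suc j) ^ L j) = mlen n L" unfolding mlen_def power_sum by (simp only: power_mult)
  finally show ?thesis unfolding sum_abs_mcoef .
qed

definition bsum :: "nat \<Rightarrow> real" where "bsum j = (\<Sum>p\<in>prime_block j. 1 / real p)"
definition bsum2 :: "nat \<Rightarrow> real" where "bsum2 j = (\<Sum>p\<in>prime_block j. 1 / (real p)\<^sup>2)"

lemma bsum_bounds: "0 \<le> bsum j" "bsum j \<le> 4" "0 \<le> bsum2 j"
  using sum_inverse_prime_block_le[of j] by (auto simp: bsum_def bsum2_def sum_nonneg)

lemma abs_two_ln_gcd_weight_le:
  assumes "0 < a" "a \<le> N" "0 < b" "b \<le> N"
  shows "\<bar>2 * ln (gcd_weight a b)\<bar> \<le> 2 * ln (real N)"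
proof -
  have g: "0 < gcd a b" "gcd a b \<le> a" "gcd a b \<le> b" using assms by (auto intro: gcd_le1_nat gcd_le2_nat)
  have "2 * ln (t / sqrt (x * y)) = 2 * ln t - (ln x + ln y)" if "t > 0" "x > 0" "y > 0" for t x y :: real
    using that by (simp add: ln_div ln_sqrt ln_mult_pos field_simps)
  from this[of "real (gcd a b)" "real a" "real b"]
  have "2 * ln (gcd_weight a b) = 2 * ln (real (gcd a b)) - (ln (real a) + ln (real b))"
    unfolding gcd_weight_def using assms(1,3) g(1) by (simp only: of_nat_0_less_iff)
  moreover have l: "ln (real x) \<le> ln (real y)" if "0 < x" "x \<le> y" for x y :: nat using that by simp
  note l[OF g(1,2)] l[OF g(1,3)] l[OF assms(1,2)] l[OF assms(3,4)]
  moreover have "0 \<le> ln (real (gcd a b))" 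
    using l[OF zero_less_one, of "gcd a b"] g(1) unfolding Suc_le_eq[symmetric] One_nat_def[symmetric] of_nat_1 ln_one by blast
  ultimately show ?thesis by linarith
qed

text \<open>The logarithm of the weight is additive over the blocks. So the sum splits into
  \<open>A\<close> times the product of the block sums \<open>T j\<close>, and for each
  \<open>k\<close> a product in which block \<open>k\<close> carries the logarithm
  (\<open>V k\<close>). There absolute values suffice, at a cost of order
  \<open>2 ^ Suc k * L k\<close>; the other blocks keep their precise size.\<close>

lemma twisted_main_term_le:
  fixes m A :: real
  assumes m: "m > 0" and L: "\<And>j. j < n \<Longrightarrow> L j \<ge> 1" and A: "A \<ge> 0"
  defines "K \<equiv> twist_const (m + 1)"
  defines "c \<equiv> mcoef n (\<lambda>_ r. (- (m + 1)) ^ r)"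
  shows "(\<Sum>u\<in>midx n L. \<Sum>v\<in>midx n L. c u * c v * gcd_weight (mnum n u) (mnum n v) * (A + 2 * ln (gcd_weight (mnum n u) (mnum n v))))
     \<le> exp (\<Sum>j<n. (m\<^sup>2 - 1) * bsum j + K * bsum2 j + 2 * exp (4 * K + 4) * exp (- real (L j))) * (A + 2 * exp (4 * K + 4) * real (\<Sum>j<n. 2 ^ Suc j * L j))"
proof -
  let ?I = "midx n L"
  define G where "G j x y = ecoef (prime_block j) (\<lambda>r. (- (m + 1)) ^ r) x * ecoef (prime_block j) (\<lambda>r. (- (m + 1)) ^ r) y * gcd_weight (enum (prime_block j) x) (enum (prime_block j) y)" for j x y
  define w where "w j x y = gcd_weight (enum (prime_block j) x) (enum (prime_block j) y)" for j x y
  let ?E = "\<lambda>j. expo (prime_block j) (L j)"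
  have K0: "K \<ge> 0" by (simp add: K_def twist_const_def)
  define s where "s j = (m\<^sup>2 - 1) * bsum j + K * bsum2 j + 2 * exp (4 * K + 4) * exp (- real (L j))" for j
  define T where "T j = (\<Sum>x\<in>?E j. \<Sum>y\<in>?E j. G j x y)" for j
  define V where "V j = (\<Sum>x\<in>?E j. \<Sum>y\<in>?E j. G j x y * (2 * ln (w j x y)))" for j
  have T: "\<bar>T j\<bar> \<le> exp (s j)" if "j < n" for j
  proof -
    \<comment> \<open>Bounded below by -4, since \<open>m\<^sup>2 - 1 \<ge> -1\<close> and
      \<open>bsum j \<le> 4\<close>. Hence \<open>exp x * exp 4 \<ge> 1\<close>, and the additive
      tail can be made a factor close to 1 that is summable over blocks.\<close>
    define x where "x = (m\<^sup>2 - 1) * bsum j + K * bsum2 j"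
    have "\<bar>T j\<bar> \<le> exp x + 2 * exp (- real (L j)) * exp (4 * K)"
      unfolding T_def G_def K_def x_def bsum_def bsum2_def
      by (rule sum_expo_gcd_weight_le[OF finite_prime_block prime_block_prime sum_inverse_prime_block_le L[OF that]])
    also have "(m\<^sup>2 - 1) * bsum j \<ge> (-1) * bsum j" using bsum_bounds[of j] by (intro mult_right_mono) auto
    hence "x \<ge> -4" unfolding x_def using bsum_bounds[of j] K0 by (smt (verit) mult_nonneg_nonneg)
    hence "1 \<le> exp x * exp 4" unfolding exp_add[symmetric] by simp
    hence "2 * exp (- real (L j)) * exp (4 * K) * 1 \<le> 2 * exp (- real (L j)) * exp (4 * K) * (exp x * exp 4)"
      by (intro mult_left_mono) auto
    hence "exp x + 2 * exp (- real (L j)) * exp (4 * K) \<le> exp x * (1 + 2 * exp (4 * K + 4) * exp (- real (L j)))"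
      by (simp add: exp_add algebra_simps)
    also have "\<dots> \<le> exp x * exp (2 * exp (4 * K + 4) * exp (- real (L j)))" by (intro mult_left_mono exp_ge_add_one_self) auto
    also have "\<dots> = exp (s j)" by (simp add: s_def x_def exp_add)
    finally show ?thesis .
  qed
  have s4: "s j \<ge> -4" for j
  proof -
    have "(m\<^sup>2 - 1) * bsum j \<ge> (-1) * bsum j" using bsum_bounds[of j] by (intro mult_right_mono) auto
    moreover have "K * bsum2 j \<ge> 0" "2 * exp (4 * K + 4) * exp (- real (L j)) \<ge> 0" using K0 bsum_bounds[of j] by auto
    ultimately show ?thesis unfolding s_def using bsum_bounds[of j] by linarith
  qed
  have V: "\<bar>V j\<bar> \<le> exp (4 * K) * (2 * real (2 ^ Suc j * L j))" if "j < n" for j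
  proof -
    have "\<bar>V j\<bar> \<le> (\<Sum>x\<in>?E j. \<Sum>y\<in>?E j. \<bar>G j x y * (2 * ln (w j x y))\<bar>)"
      unfolding V_def by (rule order_trans[OF sum_abs]) (intro sum_mono sum_abs)
    also have "\<dots> \<le> (\<Sum>x\<in>?E j. \<Sum>y\<in>?E j. \<bar>G j x y\<bar> * (2 * real (2 ^ Suc j * L j)))"
    proof (intro sum_mono)
      fix x y assume xy: "x \<in> ?E j" "y \<in> ?E j"
      have e: "0 < enum (prime_block j) z \<and> enum (prime_block j) z \<le> (2 ^ 2 ^ Suc j) ^ L j" if "z \<in> ?E j" for z
      proof
        show "enum (prime_block j) z \<le> (2 ^ 2 ^ Suc j) ^ L j"
          by (rule enum_le[OF finite_prime_block that]) (simp_all only: prime_block_def mem_Collect_eq, simp)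
      qed (rule enum_prime_block_pos)
      have "\<bar>2 * ln (w j x y)\<bar> \<le> 2 * ln (real ((2 ^ 2 ^ Suc j) ^ L j))"
        unfolding w_def using e[OF xy(1)] e[OF xy(2)] by (intro abs_two_ln_gcd_weight_le) auto
      also have "ln (real ((2 ^ 2 ^ Suc j) ^ L j)) = real (2 ^ Suc j * L j) * ln 2"
        by (simp add: ln_realpow)
      also have "\<dots> \<le> real (2 ^ Suc j * L j) * 1" using ln_2_less_1 by (intro mult_left_mono) auto
      finally have "\<bar>2 * ln (w j x y)\<bar> \<le> 2 * real (2 ^ Suc j * L j)" by simp
      thus "\<bar>G j x y * (2 * ln (w j x y))\<bar> \<le> \<bar>G j x y\<bar> * (2 * real (2 ^ Suc j * L j))"
        unfolding abs_mult[of "G j x y"] by (intro mult_left_mono) auto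
    qed
    also have "\<dots> = (\<Sum>x\<in>?E j. \<Sum>y\<in>?E j. \<bar>G j x y\<bar>) * (2 * real (2 ^ Suc j * L j))" by (simp only: sum_distrib_right)
    also have "\<dots> \<le> exp (4 * K) * (2 * real (2 ^ Suc j * L j))"
      unfolding G_def K_def
      by (intro mult_right_mono sum_expo_gcd_weight_abs_le[OF finite_prime_block prime_block_prime sum_inverse_prime_block_le]) auto
    finally show ?thesis .
  qed
  have cw: "c u * c v * gcd_weight (mnum n u) (mnum n v) = (\<Prod>j<n. G j (u j) (v j))" for u v
    unfolding c_def mcoef_def gcd_weight_mnum G_def by (simp only: prod.distrib)
  have wpos: "w j x y > 0" for j x y
    unfolding w_def gcd_weight_def using enum_prime_block_pos[of j x] enum_prime_block_pos[of j y] by simp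
  have lw: "2 * ln (gcd_weight (mnum n u) (mnum n v)) = (\<Sum>j<n. 2 * ln (w j (u j) (v j)))" for u v
    unfolding gcd_weight_mnum w_def[symmetric] using wpos by (subst ln_prod) (auto simp: sum_distrib_left less_imp_neq[symmetric])
  have main: "(\<Sum>u\<in>?I. \<Sum>v\<in>?I. \<Prod>j<n. G j (u j) (v j)) = (\<Prod>j<n. T j)"
    unfolding T_def midx_def by (rule prod_double_sum_PiE[symmetric]) (auto intro: finite_expo)
  have one: "(\<Sum>u\<in>?I. \<Sum>v\<in>?I. (\<Prod>j<n. G j (u j) (v j)) * (2 * ln (w k (u k) (v k)))) = V k * (\<Prod>j\<in>{..<n} - {k}. T j)" if k: "k < n" for k
  proof -
    define G' where "G' j x y = G j x y * (if j = k then 2 * ln (w k x y) else 1)" for j x y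
    have "(\<Prod>j<n. G j (u j) (v j)) * (2 * ln (w k (u k) (v k))) = (\<Prod>j<n. G' j (u j) (v j))" for u v
    proof -
      have "(\<Prod>j<n. if j = k then 2 * ln (w k (u j) (v j)) else 1) = 2 * ln (w k (u k) (v k))"
        using k by (subst prod.delta) auto
      thus ?thesis unfolding G'_def prod.distrib by simp
    qed
    hence "(\<Sum>u\<in>?I. \<Sum>v\<in>?I. (\<Prod>j<n. G j (u j) (v j)) * (2 * ln (w k (u k) (v k)))) = (\<Sum>u\<in>?I. \<Sum>v\<in>?I. \<Prod>j<n. G' j (u j) (v j))" by simp
    also have "\<dots> = (\<Prod>j<n. \<Sum>x\<in>?E j. \<Sum>y\<in>?E j. G' j x y)"
      unfolding midx_def by (rule prod_double_sum_PiE[symmetric]) (auto intro: finite_expo)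
    also have "\<dots> = (\<Sum>x\<in>?E k. \<Sum>y\<in>?E k. G' k x y) * (\<Prod>j\<in>{..<n} - {k}. \<Sum>x\<in>?E j. \<Sum>y\<in>?E j. G' j x y)"
      using k by (intro prod.remove) auto
    also have "(\<Sum>x\<in>?E k. \<Sum>y\<in>?E k. G' k x y) = V k" by (simp add: G'_def V_def)
    also have "(\<Prod>j\<in>{..<n} - {k}. \<Sum>x\<in>?E j. \<Sum>y\<in>?E j. G' j x y) = (\<Prod>j\<in>{..<n} - {k}. T j)"
      by (intro prod.cong refl) (simp add: G'_def T_def)
    finally show ?thesis .
  qed
  have Tall: "\<bar>\<Prod>j<n. T j\<bar> \<le> exp (\<Sum>j<n. s j)"
    unfolding abs_prod exp_sum[OF finite_lessThan] using T by (intro prod_mono) auto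
  \<comment> \<open>Leaving out block \<open>k\<close> loses at most \<open>exp 4\<close> against
    the full product, because \<open>s k \<ge> -4\<close>.\<close>
  have Vk: "\<bar>V k * (\<Prod>j\<in>{..<n} - {k}. T j)\<bar> \<le> exp (\<Sum>j<n. s j) * (2 * exp (4 * K + 4) * real (2 ^ Suc k * L k))" if k: "k < n" for k
  proof -
    have "\<bar>\<Prod>j\<in>{..<n} - {k}. T j\<bar> \<le> exp (\<Sum>j\<in>{..<n} - {k}. s j)"
      unfolding abs_prod using T by (subst exp_sum) (auto intro!: prod_mono)
    also have "(\<Sum>j\<in>{..<n} - {k}. s j) \<le> (\<Sum>j<n. s j) + 4"
      using sum.remove[of "{..<n}" k s] k s4[of k] by simp
    finally have "\<bar>\<Prod>j\<in>{..<n} - {k}. T j\<bar> \<le> exp ((\<Sum>j<n. s j) + 4)" by simp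
    hence "\<bar>V k * (\<Prod>j\<in>{..<n} - {k}. T j)\<bar> \<le> (exp (4 * K) * (2 * real (2 ^ Suc k * L k))) * exp ((\<Sum>j<n. s j) + 4)"
      unfolding abs_mult using V[OF k] by (intro mult_mono) auto
    thus ?thesis by (simp add: exp_add mult_ac)
  qed
  have "(\<Sum>u\<in>?I. \<Sum>v\<in>?I. c u * c v * gcd_weight (mnum n u) (mnum n v) * (A + 2 * ln (gcd_weight (mnum n u) (mnum n v)))) = 
     A * (\<Prod>j<n. T j) + (\<Sum>k<n. V k * (\<Prod>j\<in>{..<n} - {k}. T j))"
  proof -
    have "(\<Sum>u\<in>?I. \<Sum>v\<in>?I. c u * c v * gcd_weight (mnum n u) (mnum n v) * (A + 2 * ln (gcd_weight (mnum n u) (mnum n v)))) =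
      (\<Sum>u\<in>?I. \<Sum>v\<in>?I. A * (\<Prod>j<n. G j (u j) (v j)) + (\<Sum>k<n. (\<Prod>j<n. G j (u j) (v j)) * (2 * ln (w k (u k) (v k)))))"
      unfolding cw lw by (intro sum.cong refl) (simp add: distrib_left sum_distrib_left mult.commute)
    also have "\<dots> = A * (\<Sum>u\<in>?I. \<Sum>v\<in>?I. \<Prod>j<n. G j (u j) (v j)) + (\<Sum>u\<in>?I. \<Sum>v\<in>?I. \<Sum>k<n. (\<Prod>j<n. G j (u j) (v j)) * (2 * ln (w k (u k) (v k))))"
      by (simp only: sum.distrib sum_distrib_left)
    also have "(\<Sum>u\<in>?I. \<Sum>v\<in>?I. \<Sum>k<n. (\<Prod>j<n. G j (u j) (v j)) * (2 * ln (w k (u k) (v k)))) = 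
       (\<Sum>k<n. \<Sum>u\<in>?I. \<Sum>v\<in>?I. (\<Prod>j<n. G j (u j) (v j)) * (2 * ln (w k (u k) (v k))))"
    proof -
      have "(\<Sum>u\<in>?I. \<Sum>v\<in>?I. \<Sum>k<n. H u v k) = (\<Sum>k<n. \<Sum>u\<in>?I. \<Sum>v\<in>?I. H u v k)" for H :: "_ \<Rightarrow> _ \<Rightarrow> nat \<Rightarrow> real"
      proof -
        have "(\<Sum>u\<in>?I. \<Sum>v\<in>?I. \<Sum>k<n. H u v k) = (\<Sum>u\<in>?I. \<Sum>k<n. \<Sum>v\<in>?I. H u v k)"
          by (intro sum.cong refl sum.swap)
        also have "\<dots> = (\<Sum>k<n. \<Sum>u\<in>?I. \<Sum>v\<in>?I. H u v k)" by (rule sum.swap)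
        finally show ?thesis .
      qed
      thus ?thesis .
    qed
    also have "\<dots> = (\<Sum>k<n. V k * (\<Prod>j\<in>{..<n} - {k}. T j))" by (intro sum.cong refl one) simp
    finally show ?thesis unfolding main .
  qed
  also have "\<dots> \<le> A * exp (\<Sum>j<n. s j) + (\<Sum>k<n. exp (\<Sum>j<n. s j) * (2 * exp (4 * K + 4) * real (2 ^ Suc k * L k)))"
    using Tall Vk by (intro add_mono mult_left_mono sum_mono A) (auto simp: abs_le_iff)
  also have "\<dots> = exp (\<Sum>j<n. s j) * (A + 2 * exp (4 * K + 4) * real (\<Sum>j<n. 2 ^ Suc j * L j))"
    by (simp only: of_nat_sum sum_distrib_left distrib_left mult_ac)
  finally show ?thesis unfolding s_def .
qed

section \<open>Pointwise comparison of the two polynomials\<close>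

lemma exp_2_le: "exp 2 \<le> (8::real)"
proof -
  have "exp (1::real) \<le> 272 / 100" using e_less_272 by linarith
  hence "exp (1::real) ^ 2 \<le> (272 / 100) ^ 2" by (rule power_mono) simp
  moreover have "exp 2 = exp (1::real) ^ 2" by (simp add: exp_of_nat_mult[symmetric])
  ultimately have "exp 2 \<le> (272 / 100 :: real) ^ 2" by simp
  also have "\<dots> \<le> 8" by (simp add: power2_eq_square)
  finally show ?thesis .
qed

text \<open>The error is relative to \<open>norm (exp z)\<close>, so that it can be multiplied over
  blocks. With \<open>t = norm z\<close>, the estimate
  \<open>t ^ l / l! \<le> exp (8 * t - 2 * l)\<close>, from \<open>exp 2 \<le> 8\<close>, and two
  further factors \<open>exp t\<close> require \<open>11 * t \<le> l\<close>; the bound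
  \<open>l / 12\<close> provides this.\<close>

lemma exp_Taylor_error_le:
  fixes z :: complex
  assumes z: "norm z \<le> real l / 12"
  shows "norm (exp z - (\<Sum>r\<le>l. z ^ r / fact r)) \<le> exp (- real l) * norm (exp z)"
proof -
  define t where "t = norm z"
  have t0: "t \<ge> 0" by (simp add: t_def)
  have "norm (exp z - (\<Sum>r\<le>l. z ^ r / fact r)) \<le> exp \<bar>Re z\<bar> * t ^ Suc l / fact l"
    unfolding t_def by (rule Taylor_exp)
  also have "\<dots> = exp \<bar>Re z\<bar> * t * (t ^ l / fact l)" by simp
  also have "\<dots> \<le> exp t * exp t * (exp (- 2 * real l) * exp (8 * t))"
  proof (intro mult_mono)
    show "exp \<bar>Re z\<bar> \<le> exp t" using abs_Re_le_cmod by (simp add: t_def)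
    show "t \<le> exp t" using exp_ge_add_one_self[of t] by linarith
    have "(exp 2 * t) ^ l / fact l \<le> exp (exp 2 * t)"
      using sum_power_div_fact_le_exp[of "exp 2 * t" "{l}"] t0 by simp
    also have "\<dots> \<le> exp (8 * t)" using mult_right_mono[OF exp_2_le t0] by simp
    finally have "exp (- 2 * real l) * ((exp 2 * t) ^ l / fact l) \<le> exp (- 2 * real l) * exp (8 * t)"
      by (rule mult_left_mono) simp
    also have "exp (- 2 * real l) * ((exp 2 * t) ^ l / fact l) = (exp (- 2 * real l) * exp (2 * real l)) * (t ^ l / fact l)"
      by (simp add: power_mult_distrib exp_of_nat_mult[symmetric] mult.commute)
    also have "exp (- 2 * real l) * exp (2 * real l) = 1" by (simp add: exp_add[symmetric])
    finally show "t ^ l / fact l \<le> exp (- 2 * real l) * exp (8 * t)" by simp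
  qed (use t0 in auto)
  also have "\<dots> = exp (10 * t - 2 * real l)" by (simp add: exp_add[symmetric])
  also have "\<dots> \<le> exp (- real l - t)" using z by (simp add: t_def[symmetric])
  also have "\<dots> = exp (- real l) * exp (- t)" by (simp add: exp_add[symmetric])
  also have "\<dots> \<le> exp (- real l) * norm (exp z)"
    using abs_Re_le_cmod[of z] by (intro mult_left_mono) (auto simp: t_def)
  finally show ?thesis .
qed

text \<open>For true exponentials equality holds: the power \<open>2 * m / (m + 1)\<close> of the
  modulus of \<open>exp (- (m + 1) * z)\<close> is the square of that of
  \<open>exp (- m * z)\<close>. Relative errors \<open>\<eta>\<close> on both sides cost at most the
  factor \<open>1 - 4 * \<eta>\<close>, where the exponent being at most 2 is used.\<close>

lemma truncated_exp_powr_ge: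
  fixes z :: complex and m :: real
  assumes m: "m > 0" and z: "12 * (m + 1) * norm z \<le> real l" and l: "l \<ge> 1"
  shows "(1 - 4 * exp (- real l)) * (norm (\<Sum>r\<le>l. of_real ((- m) ^ r) * (z ^ r / fact r)))\<^sup>2
           \<le> norm (\<Sum>r\<le>l. of_real ((- (m + 1)) ^ r) * (z ^ r / fact r)) powr (2 * m / (m + 1))"
proof -
  define E where "E w = (\<Sum>r\<le>l. w ^ r / fact r)" for w :: complex
  have E: "(\<Sum>r\<le>l. of_real (\<rho> ^ r) * (z ^ r / fact r)) = E (of_real \<rho> * z)" for \<rho> :: real
    unfolding E_def by (intro sum.cong refl) (simp add: power_mult_distrib)
  define \<eta> where "\<eta> = exp (- real l)"
  define b where "b = norm (E (of_real (- (m + 1)) * z))"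
  define c where "c = norm (E (of_real (- m) * z))"
  have \<eta>: "0 < \<eta>" "\<eta> < 1" using l by (auto simp: \<eta>_def)
  have "(m + 1) * norm z \<le> real l / 12" using z by (simp only: mult.assoc)
  moreover have "m * norm z \<le> (m + 1) * norm z" by (intro mult_right_mono) auto
  ultimately have n: "norm (of_real (- (m + 1)) * z) \<le> real l / 12" "norm (of_real (- m) * z) \<le> real l / 12"
    using m unfolding norm_mult norm_of_real by (auto simp: add.commute)
  have nb: "norm (exp (of_real \<rho> * z)) = exp (\<rho> * Re z)" for \<rho> :: real by simp
  have b: "b \<ge> (1 - \<eta>) * exp (- (m + 1) * Re z)"
  proof -
    have "exp (- (m + 1) * Re z) - b \<le> norm (exp (of_real (- (m + 1)) * z) - E (of_real (- (m + 1)) * z))"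
      unfolding b_def nb[symmetric] by (rule norm_triangle_ineq2)
    also have "\<dots> \<le> \<eta> * exp (- (m + 1) * Re z)" using exp_Taylor_error_le[OF n(1)] unfolding E_def \<eta>_def nb .
    finally show ?thesis by (simp only: left_diff_distrib) 
  qed
  have c: "c \<le> (1 + \<eta>) * exp (- m * Re z)"
  proof -
    have "c - exp (- m * Re z) \<le> norm (E (of_real (- m) * z) - exp (of_real (- m) * z))"
      unfolding c_def nb[symmetric] by (rule norm_triangle_ineq2)
    also have "\<dots> \<le> \<eta> * exp (- m * Re z)" using exp_Taylor_error_le[OF n(2)] unfolding E_def \<eta>_def nb by (simp only: norm_minus_commute)
    finally show ?thesis by (simp only: distrib_right) 
  qed
  define X where "X = exp (- (2 * m) * Re z)"
  have X: "X > 0" by (simp add: X_def)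
  have p: "0 \<le> 2 * m / (m + 1)" "2 * m / (m + 1) \<le> 2" using m by (auto simp: field_simps)
  have "(1 - 4 * \<eta>) * (1 + \<eta>)\<^sup>2 \<le> (1 - \<eta>)\<^sup>2"
  proof -
    have "(1 - \<eta>)\<^sup>2 - (1 - 4 * \<eta>) * (1 + \<eta>)\<^sup>2 = 8 * \<eta>\<^sup>2 + 4 * \<eta> ^ 3"
      by (simp add: power2_eq_square power3_eq_cube algebra_simps)
    moreover have "8 * \<eta>\<^sup>2 + 4 * \<eta> ^ 3 \<ge> 0" using \<eta> by simp
    ultimately show ?thesis by linarith
  qed
  hence core: "(1 - 4 * \<eta>) * (1 + \<eta>)\<^sup>2 * X \<le> (1 - \<eta>)\<^sup>2 * X" using X by (intro mult_right_mono) auto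
  have bb: "(1 - \<eta>)\<^sup>2 * X \<le> b powr (2 * m / (m + 1))"
  proof -
    have Xe: "X = exp (- (m + 1) * Re z) powr (2 * m / (m + 1))"
      unfolding X_def powr_def using m by (simp add: field_simps)
    have "(1 - \<eta>)\<^sup>2 = (1 - \<eta>) powr 2" using \<eta> by simp
    also have "\<dots> \<le> (1 - \<eta>) powr (2 * m / (m + 1))" using \<eta> p by (intro powr_mono') auto
    finally have "(1 - \<eta>)\<^sup>2 * X \<le> (1 - \<eta>) powr (2 * m / (m + 1)) * X" using X by (intro mult_right_mono) auto
    also have "(1 - \<eta>) powr (2 * m / (m + 1)) * X = ((1 - \<eta>) * exp (- (m + 1) * Re z)) powr (2 * m / (m + 1))"
      using \<eta> unfolding Xe by (simp add: powr_mult)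
    also have "\<dots> \<le> b powr (2 * m / (m + 1))" using b \<eta> p by (intro powr_mono2) auto
    finally show ?thesis .
  qed
  have "(1 - 4 * \<eta>) * c\<^sup>2 \<le> b powr (2 * m / (m + 1))"
  proof (cases "4 * \<eta> \<le> 1")
    case True
    have "c\<^sup>2 \<le> ((1 + \<eta>) * exp (- m * Re z))\<^sup>2" using c by (intro power_mono) (auto simp: c_def)
    also have "\<dots> = (1 + \<eta>)\<^sup>2 * X" by (simp add: X_def power_mult_distrib exp_double[symmetric])
    finally have "(1 - 4 * \<eta>) * c\<^sup>2 \<le> (1 - 4 * \<eta>) * ((1 + \<eta>)\<^sup>2 * X)" using True by (intro mult_left_mono) auto
    with core bb show ?thesis by (simp add: mult.assoc)
  next
    case False
    hence "(1 - 4 * \<eta>) * c\<^sup>2 \<le> 0" by (intro mult_nonpos_nonneg) auto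
    also have "0 \<le> b powr (2 * m / (m + 1))" by simp
    finally show ?thesis .
  qed
  thus ?thesis unfolding b_def c_def \<eta>_def E[symmetric] .
qed

text \<open>A form of Young's inequality: either the second term dominates, or division by a power
  of \<open>b\<close> gives \<open>b powr (2 / (m + 1)) \<le> 1 / (\<tau> * x\<^sup>2)\<close>,
  whose \<open>m\<close>-th power is the bound by the first term.\<close>

lemma powr_interpolation:
  fixes b x \<tau> m :: real
  assumes b: "b \<ge> 0" and x: "x > 0" and \<tau>: "\<tau> > 0" and m: "m > 0"
  shows "b powr (2 * m / (m + 1)) \<le> \<tau> powr (- m) * x powr (- 2 * m) + \<tau> * (x\<^sup>2 * b\<^sup>2)"
proof (cases "b powr (2 * m / (m + 1)) \<le> \<tau> * (x\<^sup>2 * b\<^sup>2)")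
  case True
  thus ?thesis by (simp add: add.commute add_increasing2)
next
  case False
  hence b0: "b > 0" using b by (cases "b = 0") auto
  define s where "s = 2 / (m + 1)"
  have e: "s * m = 2 * m / (m + 1)" "2 = s + s * m"
  proof -
    have "s + s * m = s * (m + 1)" by (simp add: distrib_left)
    also have "\<dots> = 2"
    proof -
      have "m + 1 \<noteq> 0" using m by simp
      thus ?thesis unfolding s_def by (rule nonzero_eq_divide_eq[THEN iffD1]) (rule refl)
    qed
    finally show "2 = s + s * m" by simp
  qed (simp add: s_def)
  have "\<tau> * (x\<^sup>2 * b\<^sup>2) = (\<tau> * x\<^sup>2) * b powr s * b powr (s * m)"
    using b0 e(2) by (simp add: powr_add[symmetric] powr_numeral flip: mult.assoc)
  hence "(\<tau> * x\<^sup>2) * b powr s * b powr (s * m) < 1 * b powr (s * m)" using False unfolding e(1)[symmetric] by linarith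
  hence "(\<tau> * x\<^sup>2) * b powr s < 1" using b0 by (simp only: mult_less_cancel_right_pos powr_gt_zero)
  hence "b powr s \<le> inverse (\<tau> * x\<^sup>2)" using \<tau> x by (simp add: field_simps)
  hence "(b powr s) powr m \<le> inverse (\<tau> * x\<^sup>2) powr m" using m by (intro powr_mono2) auto
  also have "(b powr s) powr m = b powr (2 * m / (m + 1))" by (simp add: powr_powr e(1))
  also have "inverse (\<tau> * x\<^sup>2) powr m = \<tau> powr (- m) * (x\<^sup>2) powr (- m)"
    using \<tau> x by (simp add: powr_mult powr_minus inverse_powr)
  also have "(x\<^sup>2) powr (- m) = x powr (- 2 * m)"
    using x by (simp add: powr_powr flip: powr_numeral)
  finally show ?thesis using \<tau> by (simp add: add_increasing2)
qed

section \<open>Sums over the levels and the mass of the tame characters\<close>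

lemma sum_exp_levels_le:
  assumes "Q \<ge> 1"
  shows "(\<Sum>j<n. exp (- real (Q * (n - j)))) \<le> 2 * exp (- real Q)"
proof -
  define x where "x = exp (- real Q)"
  have x: "0 < x" "x \<le> 1/2"
  proof -
    have "exp (real Q) \<ge> 1 + real Q" by (rule exp_ge_add_one_self)
    hence "exp (real Q) \<ge> 2" using assms by linarith
    thus "x \<le> 1/2" by (simp add: x_def exp_minus field_simps)
  qed (simp add: x_def)
  have "(\<Sum>j<n. exp (- real (Q * (n - j)))) = (\<Sum>j<n. x ^ (n - j))"
    by (intro sum.cong refl) (simp add: x_def exp_of_nat_mult[symmetric] mult.commute)
  also have "\<dots> = (\<Sum>j<n. x ^ Suc j)" by (rule sum.reindex_bij_witness[of _ "\<lambda>j. n - Suc j" "\<lambda>j. n - Suc j"]) (auto simp: Suc_diff_Suc simp flip: power_Suc)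
  also have "\<dots> = x * (\<Sum>j<n. x ^ j)" by (simp add: sum_distrib_left)
  also have "(\<Sum>j<n. x ^ j) \<le> (\<Sum>j<n. (1/2) ^ j)" using x by (intro sum_mono power_mono) auto
  also have "(\<Sum>j<n. (1/2) ^ j) \<le> (2::real)" by (simp add: sum_gp_strict)
  finally show ?thesis using x by (simp add: x_def)
qed

text \<open>Multiplied by \<open>Q\<close> this is the binary logarithm of \<open>mlen\<close>.
  Being \<open>O(2 ^ n)\<close>, with no extra factor \<open>n\<close>, it lets the degrees grow
  linearly towards the small primes while the length remains a power of \<open>q\<close>.\<close>

lemma sum_levels_eq: "(\<Sum>j<n. 2 ^ Suc j * (n - j)) + 2 * n + 4 = 4 * 2 ^ n"
proof (induction n)
  case (Suc n)
  have "(\<Sum>j<n. 2 ^ Suc j * (Suc n - j)) = (\<Sum>j<n. 2 ^ Suc j * (n - j)) + (\<Sum>j<n. 2 ^ Suc j)"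
    unfolding sum.distrib[symmetric] by (intro sum.cong refl) (simp add: Suc_diff_le)
  moreover have "(\<Sum>j<n. 2 ^ Suc j) + 2 = (2 ^ Suc n :: nat)" by (induction n) auto
  ultimately show ?case using Suc by simp
qed simp

lemma one_minus_sum_le_prod:
  fixes a :: "'i \<Rightarrow> real"
  assumes "finite J" "\<And>j. j \<in> J \<Longrightarrow> 0 \<le> a j \<and> a j \<le> 1"
  shows "1 - (\<Sum>j\<in>J. a j) \<le> (\<Prod>j\<in>J. 1 - a j)"
  using assms
proof (induction J rule: finite_induct)
  case (insert k J)
  have "(\<Prod>j\<in>J. 1 - a j) \<le> 1" using insert.prems by (intro prod_le_1) auto
  hence "a k * (\<Prod>j\<in>J. 1 - a j) \<le> a k * 1" using insert.prems by (intro mult_left_mono) auto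
  with insert show ?case by (simp add: left_diff_distrib)
qed simp

lemma prime_sum_eq_bsum: "prime_sum n = (\<Sum>j<n. bsum j)"
  by (simp add: prime_sum_def bsum_def)

lemma sum_bsum2_le: "(\<Sum>j<n. bsum2 j) \<le> 1"
proof -
  have "(\<Sum>j<n. bsum2 j) = (\<Sum>p\<in>(\<Union>j\<in>{..<n}. prime_block j). 1 / (real p)\<^sup>2)"
    unfolding bsum2_def by (rule sum.UNION_disjoint[symmetric]) (auto simp: prime_block_disjoint)
  also have "\<dots> \<le> 1" by (rule sum_inverse_square_le) (auto intro: prime_ge_2_nat prime_block_prime)
  finally show ?thesis .
qed

text \<open>The contribution of block \<open>j\<close> to the mean square of the polynomial
  imitating the power \<open>-m\<close>.\<close>

definition block_mass :: "real \<Rightarrow> nat \<Rightarrow> nat \<Rightarrow> real" where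
  "block_mass m l j = (\<Sum>\<alpha>\<in>expo (prime_block j) l. (ecoef (prime_block j) (\<lambda>r. (- m) ^ r) \<alpha>)\<^sup>2)"

lemma block_mass_ge_1: "block_mass m l j \<ge> 1"
proof -
  let ?I = "prime_block j"
  define z where "z = (\<lambda>p\<in>?I. 0::nat)"
  have z: "z \<in> expo ?I l" by (auto simp: expo_def ebox_def z_def edeg_def)
  have "(ecoef ?I (\<lambda>r. (- m) ^ r) z)\<^sup>2 \<le> block_mass m l j"
    unfolding block_mass_def by (rule member_le_sum[OF z]) (auto intro: finite_expo)
  moreover have "ecoef ?I (\<lambda>r. (- m) ^ r) z = 1" by (simp add: ecoef_def z_def edeg_def)
  ultimately show ?thesis by simp
qed

lemma exp_minus_square_le:
  fixes x :: real
  assumes "x \<ge> 0"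
  shows "exp (x - x\<^sup>2) \<le> 1 + x"
proof (cases "x \<le> 1")
  case True
  from ln_one_plus_pos_lower_bound[OF assms True] have "exp (x - x\<^sup>2) \<le> exp (ln (1 + x))" by simp
  thus ?thesis using assms by simp
next
  case False
  hence "1 * x \<le> x * x" by (intro mult_right_mono) auto
  hence "x - x\<^sup>2 \<le> 0" by (simp add: power2_eq_square)
  hence "exp (x - x\<^sup>2) \<le> 1" by simp
  with assms show ?thesis by linarith
qed

text \<open>The factor \<open>exp (- (m ^ 4))\<close> comes from
  \<open>1 + x \<ge> exp (x - x\<^sup>2)\<close> at \<open>x = m\<^sup>2 / p\<close> and the bounded
  sum of \<open>1 / p\<^sup>2\<close>. The factor 1/2 comes from the truncations:
  \<open>12 * m\<^sup>2\<close> exceeds \<open>4 * exp 1 * m\<^sup>2\<close>, and the 2 makes the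
  relative losses \<open>h\<close> add up to at most 1/2.\<close>

lemma prod_block_mass_ge:
  fixes m :: real
  assumes Q: "real Q \<ge> 12 * m\<^sup>2 + 2"
  shows "(\<Prod>j<n. block_mass m (Q * (n - j)) j) \<ge> exp (- (m ^ 4)) / 2 * exp (m\<^sup>2 * prime_sum n)"
proof -
  have Q1: "Q \<ge> 1"
  proof -
    have "0 \<le> 12 * m\<^sup>2" by simp
    with Q have "real Q \<ge> 1" by linarith
    thus ?thesis by simp
  qed
  define P where "P j = (\<Prod>p\<in>prime_block j. 1 + m\<^sup>2 / real p)" for j
  define h where "h j = exp (4 * exp 1 * m\<^sup>2) * exp (- real (Q * (n - j)))" for j
  have P1: "P j \<ge> 1" for j unfolding P_def by (intro prod_ge_1) auto
  have h0: "h j \<ge> 0" for j by (simp add: h_def)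
  have "(\<Sum>j<n. h j) = exp (4 * exp 1 * m\<^sup>2) * (\<Sum>j<n. exp (- real (Q * (n - j))))" by (simp add: h_def sum_distrib_left)
  also have "\<dots> \<le> exp (4 * exp 1 * m\<^sup>2) * (2 * exp (- real Q))" by (intro mult_left_mono sum_exp_levels_le Q1) auto
  also have "\<dots> = 2 * exp (4 * exp 1 * m\<^sup>2 - real Q)" by (simp add: exp_diff exp_minus field_simps)
  also have "\<dots> \<le> 2 * exp (- 2)"
  proof -
    have "exp 1 * (4 * m\<^sup>2) \<le> 3 * (4 * m\<^sup>2)" by (intro mult_right_mono exp_le) auto
    thus ?thesis using Q by simp
  qed
  also have "exp (-2) \<le> (1/4 :: real)"
  proof -
    have "(2::real) ^ 2 \<le> exp 1 ^ 2" using exp_ge_add_one_self[of "1::real"] by (intro power_mono) auto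
    thus ?thesis by (simp add: exp_minus exp_of_nat_mult[symmetric] field_simps)
  qed
  finally have hs: "(\<Sum>j<n. h j) \<le> 1/2" by simp
  have h1: "h j \<le> 1" if "j < n" for j
    using member_le_sum[of j "{..<n}" h] h0 hs that by simp
  have M: "P j * (1 - h j) \<le> block_mass m (Q * (n - j)) j" if j: "j < n" for j
  proof -
    have "Q * (n - j) \<ge> 1" using Q1 j by simp
    hence "P j - h j \<le> block_mass m (Q * (n - j)) j"
      using sum_ecoef_square_ge[of "prime_block j" "Q * (n - j)" m] sum_inverse_prime_block_le[of j] 
      by (simp add: P_def h_def block_mass_def mult.commute prime_block_pos del: of_nat_mult)
    moreover have "1 * h j \<le> P j * h j" using P1 h0 by (intro mult_right_mono)
    ultimately show ?thesis by (simp add: right_diff_distrib)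
  qed
  have PE: "exp (m\<^sup>2 * bsum j - m ^ 4 * bsum2 j) \<le> P j" for j
  proof -
    have "exp (m\<^sup>2 * bsum j - m ^ 4 * bsum2 j) = (\<Prod>p\<in>prime_block j. exp (m\<^sup>2 / real p - (m\<^sup>2 / real p)\<^sup>2))"
      by (simp add: exp_sum[symmetric] bsum_def bsum2_def sum_distrib_left sum_subtractf power_divide power_mult[symmetric])
    also have "\<dots> \<le> P j" unfolding P_def by (intro prod_mono conjI exp_minus_square_le) auto
    finally show ?thesis .
  qed
  have "exp (m\<^sup>2 * prime_sum n - m ^ 4) \<le> exp (\<Sum>j<n. m\<^sup>2 * bsum j - m ^ 4 * bsum2 j)"
    using mult_left_mono[OF sum_bsum2_le[of n], of "m ^ 4"]
    by (simp add: prime_sum_eq_bsum sum_subtractf sum_distrib_left)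
  also have "\<dots> \<le> (\<Prod>j<n. P j)" unfolding exp_sum[OF finite_lessThan] by (intro prod_mono conjI PE) auto
  finally have A: "exp (m\<^sup>2 * prime_sum n - m ^ 4) \<le> (\<Prod>j<n. P j)" .
  have B: "1/2 \<le> (\<Prod>j<n. 1 - h j)" using one_minus_sum_le_prod[of "{..<n}" h] h0 h1 hs by simp
  have "exp (m\<^sup>2 * prime_sum n - m ^ 4) * (1/2) \<le> (\<Prod>j<n. P j) * (\<Prod>j<n. 1 - h j)"
    using A B by (intro mult_mono) (auto intro: order_trans[OF _ A])
  also have "\<dots> = (\<Prod>j<n. P j * (1 - h j))" by (simp add: prod.distrib)
  also have "\<dots> \<le> (\<Prod>j<n. block_mass m (Q * (n - j)) j)"
  proof (intro prod_mono conjI M)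
    fix j assume "j \<in> {..<n}"
    thus "0 \<le> P j * (1 - h j)" using h1[of j] P1[of j] by (intro mult_nonneg_nonneg) auto
  qed auto
  finally show ?thesis by (simp add: exp_diff exp_minus field_simps)
qed

lemma norm_mpoly_le:
  assumes "dirichlet_character q \<psi>"
  shows "norm (mpoly n L d \<psi>) \<le> (\<Sum>u\<in>midx n L. \<bar>mcoef n d u\<bar>)"
  unfolding mpoly_expand[OF assms]
  using dirichlet_character_norm_le_1[OF assms]
  by (intro order_trans[OF norm_sum] sum_mono) (auto simp: norm_mult mult_left_le)

text \<open>A block polynomial times a power of its prime polynomial is again a block polynomial, of
  degree \<open>2 * l\<close>; so the high moments below are again plain mean squares.\<close>

lemma block_poly_shift:
  assumes fin: "finite I" and dc: "dirichlet_character q \<psi>"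
  shows "block_poly I (2 * l) (\<lambda>r. if l \<le> r then (- m) ^ (r - l) * (fact r / fact (r - l)) else 0) \<psi>
     = block_poly I l (\<lambda>r. (- m) ^ r) \<psi> * prime_poly I \<psi> ^ l"
proof -
  let ?z = "prime_poly I \<psi>"
  let ?d = "\<lambda>r. if l \<le> r then (- m) ^ (r - l) * (fact r / fact (r - l)) else (0::real)"
  have "block_poly I (2 * l) ?d \<psi> = (\<Sum>r\<le>2 * l. of_real (?d r) * (?z ^ r / fact r))" by (rule block_poly_eq[OF fin dc])
  also have "\<dots> = (\<Sum>r\<in>{l..2 * l}. of_real (?d r) * (?z ^ r / fact r))" by (intro sum.mono_neutral_right) auto
  also have "\<dots> = (\<Sum>s\<le>l. of_real (?d (s + l)) * (?z ^ (s + l) / fact (s + l)))"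
    by (rule sum.reindex_bij_witness[of _ "\<lambda>s. s + l" "\<lambda>r. r - l"]) auto
  also have "\<dots> = (\<Sum>s\<le>l. of_real ((- m) ^ s) * (?z ^ s / fact s) * ?z ^ l)"
    by (intro sum.cong refl) (simp add: power_add)
  also have "\<dots> = block_poly I l (\<lambda>r. (- m) ^ r) \<psi> * ?z ^ l" by (simp only: block_poly_eq[OF fin dc] sum_distrib_right)
  finally show ?thesis .
qed

text \<open>Only the factor of block \<open>j\<close> changes. Doubling its degree at most squares
  the length, hence the stronger assumption \<open>len\<close>. The constants 8 come from
  \<open>bsum j \<le> 4\<close>.\<close>

lemma mean_square_mpoly_prime_poly_le:
  fixes m :: real
  assumes q: "prime q" "q > 2" and len: "2 * (mlen n L)\<^sup>2 < q" and j: "j < n"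
  shows "(\<Sum>\<psi>\<in>even_characters q. (norm (mpoly n L (\<lambda>_ r. (- m) ^ r) \<psi>))\<^sup>2 * norm (prime_poly (prime_block j) \<psi>) ^ (2 * L j))
     \<le> real (card (even_characters q)) * (fact (L j) * 8 ^ L j * exp (8 * m\<^sup>2) * (\<Prod>i<n. block_mass m (L i) i))"
proof -
  define L' where "L' = L(j := 2 * L j)"
  define d' where "d' = (\<lambda>i r. if i = j then (if L j \<le> r then (- m) ^ (r - L j) * (fact r / fact (r - L j)) else 0) else (- m) ^ r)"
  have fj: "(\<Prod>i<n. f i) = f j * (\<Prod>i\<in>{..<n} - {j}. f i)" for f :: "nat \<Rightarrow> 'a :: comm_monoid_mult"
    using j by (intro prod.remove) auto
  have mp: "mpoly n L' d' \<psi> = mpoly n L (\<lambda>_ r. (- m) ^ r) \<psi> * prime_poly (prime_block j) \<psi> ^ L j" if "\<psi> \<in> even_characters q" for \<psi>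
  proof -
    have dc: "dirichlet_character q \<psi>" using that by (simp add: even_characters_def)
    have "(\<Prod>i\<in>{..<n} - {j}. block_poly (prime_block i) (L' i) (d' i) \<psi>) = (\<Prod>i\<in>{..<n} - {j}. block_poly (prime_block i) (L i) (\<lambda>r. (- m) ^ r) \<psi>)"
      by (intro prod.cong refl) (simp add: L'_def d'_def)
    moreover have "block_poly (prime_block j) (L' j) (d' j) \<psi> = block_poly (prime_block j) (L j) (\<lambda>r. (- m) ^ r) \<psi> * prime_poly (prime_block j) \<psi> ^ L j"
      using block_poly_shift[OF finite_prime_block dc, of j "L j" m] by (simp add: L'_def d'_def)
    ultimately show ?thesis unfolding mpoly_def fj by (simp add: mult_ac)
  qed
  have "mlen n L' \<le> (mlen n L)\<^sup>2"
    unfolding mlen_def power_mult[symmetric] by (intro power_increasing) (auto simp: L'_def sum_distrib_right intro!: sum_mono)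
  hence len': "2 * mlen n L' < q" using len by linarith
  have "(\<Sum>\<psi>\<in>even_characters q. (norm (mpoly n L (\<lambda>_ r. (- m) ^ r) \<psi>))\<^sup>2 * norm (prime_poly (prime_block j) \<psi>) ^ (2 * L j))
     = (\<Sum>\<psi>\<in>even_characters q. (norm (mpoly n L' d' \<psi>))\<^sup>2)"
    by (intro sum.cong refl) (simp add: mp norm_mult norm_power power_mult_distrib power_mult[symmetric] mult.commute)
  also have "\<dots> = real (card (even_characters q)) * (\<Prod>i<n. \<Sum>\<alpha>\<in>expo (prime_block i) (L' i). (ecoef (prime_block i) (d' i) \<alpha>)\<^sup>2)"
    by (rule mean_square_mpoly[OF q len'])
  also have "(\<Prod>i<n. \<Sum>\<alpha>\<in>expo (prime_block i) (L' i). (ecoef (prime_block i) (d' i) \<alpha>)\<^sup>2) = 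
      (\<Sum>\<alpha>\<in>expo (prime_block j) (L' j). (ecoef (prime_block j) (d' j) \<alpha>)\<^sup>2) * (\<Prod>i\<in>{..<n} - {j}. block_mass m (L i) i)"
    unfolding fj by (intro arg_cong2[where f = times] refl prod.cong) (simp_all add: L'_def d'_def block_mass_def)
  also have "\<dots> \<le> (fact (L j) * 8 ^ L j * exp (8 * m\<^sup>2)) * (\<Prod>i<n. block_mass m (L i) i)"
  proof (intro mult_mono)
    have "(\<Sum>\<alpha>\<in>expo (prime_block j) (L' j). (ecoef (prime_block j) (d' j) \<alpha>)\<^sup>2) \<le> fact (L j) * (2 * bsum j) ^ L j * exp (2 * m\<^sup>2 * bsum j)"
      using sum_geometric_ecoef_square_le[of "prime_block j" "L j" m] by (simp add: L'_def d'_def bsum_def)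
    also have "\<dots> \<le> fact (L j) * 8 ^ L j * exp (8 * m\<^sup>2)"
      using bsum_bounds[of j] mult_left_mono[OF bsum_bounds(2)[of j], of "2 * m\<^sup>2"] by (intro mult_mono power_mono) auto
    finally show "(\<Sum>\<alpha>\<in>expo (prime_block j) (L' j). (ecoef (prime_block j) (d' j) \<alpha>)\<^sup>2) \<le> fact (L j) * 8 ^ L j * exp (8 * m\<^sup>2)" .
    have nn: "0 \<le> (\<Prod>i\<in>{..<n} - {j}. block_mass m (L i) i)"
      using block_mass_ge_1 by (intro prod_nonneg) (smt (verit))
    thus "0 \<le> (\<Prod>i\<in>{..<n} - {j}. block_mass m (L i) i)" .
    show "(\<Prod>i\<in>{..<n} - {j}. block_mass m (L i) i) \<le> (\<Prod>i<n. block_mass m (L i) i)"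
      unfolding fj using mult_right_mono[OF block_mass_ge_1[of m "L j" j] nn] by simp
  qed simp
  finally show ?thesis by (simp add: mult_left_mono)
qed

text \<open>The bound is exactly the hypothesis of \<open>truncated_exp_powr_ge\<close> in every
  block.\<close>

definition tame :: "nat \<Rightarrow> (nat \<Rightarrow> nat) \<Rightarrow> real \<Rightarrow> (int \<Rightarrow> complex) \<Rightarrow> bool" where
  "tame n L m \<psi> \<longleftrightarrow> (\<forall>j<n. 12 * (m + 1) * norm (prime_poly (prime_block j) \<psi>) \<le> real (L j))"

text \<open>Markov's inequality weighted by \<open>C\<close>, with the moment of order
  \<open>2 * l j\<close> in block \<open>j\<close>. As \<open>Q\<close> is at least
  \<open>24 * \<kappa>\<^sup>2\<close> and thus more than
  \<open>8 * exp 1 * \<kappa>\<^sup>2\<close>, this moment is at most of order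
  \<open>exp (- l j)\<close>, which is summable over the blocks. The characters that are not tame
  and the principal one take at most a quarter of the total each.\<close>

lemma tame_mass_ge:
  fixes m :: real
  assumes m: "m > 0" and Q: "real Q \<ge> 24 * (12 * (m + 1))\<^sup>2"
  defines "L \<equiv> \<lambda>n j. Q * (n - j)"
  assumes q: "prime q" "q > 3" and len: "2 * (mlen n (L n))\<^sup>2 < q" and big: "16 * (exp (m * real n) * real (mlen n (L n)))\<^sup>2 \<le> real q"
  shows "(\<Sum>\<psi> | \<psi> \<in> even_characters q - {principal q} \<and> tame n (L n) m \<psi>. (norm (mpoly n (L n) (\<lambda>_ r. (- m) ^ r) \<psi>))\<^sup>2)
     \<ge> real (card (even_characters q)) * (exp (- (m ^ 4)) / 4 * exp (m\<^sup>2 * prime_sum n))"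
proof -
  let ?X = "even_characters q"
  let ?c = "real (card ?X)"
  define l where "l = L n"
  define C where "C \<psi> = (norm (mpoly n l (\<lambda>_ r. (- m) ^ r) \<psi>))\<^sup>2" for \<psi>
  define W where "W = (\<Prod>j<n. block_mass m (l j) j)"
  define G where "G = {\<psi>. \<psi> \<in> ?X - {principal q} \<and> tame n l m \<psi>}"
  define \<kappa> where "\<kappa> = 12 * (m + 1)"
  \<comment> \<open>At least 1 as soon as block \<open>j\<close> violates tameness.\<close>
  define R where "R j \<psi> = (\<kappa> * norm (prime_poly (prime_block j) \<psi>) / real (l j)) ^ (2 * l j)" for j \<psi>
  have q2: "q > 2" using q by simp
  have k12: "\<kappa> > 12" using m by (simp add: \<kappa>_def)
  have Qm: "real Q \<ge> 12 * m\<^sup>2 + 3"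
  proof -
    have "24 * (12 * (m + 1))\<^sup>2 - (12 * m\<^sup>2 + 3) = 3444 * m\<^sup>2 + 6912 * m + 3453"
      by (simp add: power2_eq_square algebra_simps)
    moreover have "3444 * m\<^sup>2 \<ge> 0" by simp
    ultimately show ?thesis using Q m by linarith
  qed
  have Q1: "Q \<ge> 1"
  proof -
    have "0 \<le> 12 * m\<^sup>2" by simp
    with Qm have "real Q \<ge> 1" by linarith
    thus ?thesis by simp
  qed
  have fin: "finite ?X" by (rule finite_even_characters[OF q(1)])
  have C0: "C \<psi> \<ge> 0" for \<psi> by (simp add: C_def)
  have W1: "W \<ge> 1" unfolding W_def by (intro prod_ge_1 block_mass_ge_1)
  have len1: "2 * mlen n l < q"
  proof -
    have "mlen n l * 1 \<le> (mlen n l)\<^sup>2" unfolding power2_eq_square by (intro mult_left_mono) (auto simp: mlen_def)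
    thus ?thesis using len by (simp add: l_def)
  qed
  have tot: "(\<Sum>\<psi>\<in>?X. C \<psi>) = ?c * W"
    unfolding C_def W_def block_mass_def by (rule mean_square_mpoly[OF q(1) q2 len1])
  have cq: "?c \<ge> real q / 4"
  proof -
    have "real (card ?X) \<ge> real ((q - 1) div 2)" using card_even_characters_ge[OF q(1) q2] by simp
    moreover have "4 * ((q - 1) div 2) \<ge> q" using q by presburger
    hence "4 * real ((q - 1) div 2) \<ge> real q" by linarith
    ultimately show ?thesis by linarith
  qed
  \<comment> \<open>The trivial bound suffices for a single character: the total grows with the
    number of characters, at least \<open>q / 4\<close>, while the assumption \<open>big\<close>
    keeps \<open>C (principal q)\<close> below \<open>q / 16\<close>.\<close>
  have pr: "C (principal q) \<le> ?c * W / 4"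
  proof -
    have "norm (mpoly n l (\<lambda>_ r. (- m) ^ r) (principal q)) \<le> (\<Sum>u\<in>midx n l. \<bar>mcoef n (\<lambda>_ r. (- m) ^ r) u\<bar>)"
      using q by (intro norm_mpoly_le[OF dirichlet_character_principal[of q]]) auto
    also have "\<dots> \<le> exp (m * real n) * real (mlen n l)" using sum_abs_mcoef_power_le[of n "- m" l] m by simp
    finally have "C (principal q) \<le> (exp (m * real n) * real (mlen n l))\<^sup>2" unfolding C_def by (intro power_mono) auto
    also have "\<dots> \<le> ?c / 4" using big cq by (simp add: l_def)
    also have "\<dots> \<le> ?c * W / 4" using W1 mult_left_mono[OF W1, of ?c] by simp
    finally show ?thesis .
  qed
  have l1: "l j \<ge> 1" "l j \<ge> Q" if "j < n" for j using Q1 that by (auto simp: l_def L_def Suc_le_eq)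
  have Rj: "(\<Sum>\<psi>\<in>?X. C \<psi> * R j \<psi>) \<le> ?c * W * exp (8 * m\<^sup>2) * exp (- real (l j))" if j: "j < n" for j
  proof -
    define x where "x = real (l j)"
    have x: "x \<ge> 24 * \<kappa>\<^sup>2" using l1(2)[OF j] Q by (simp add: x_def \<kappa>_def)
    have x0: "x > 0" using l1(1)[OF j] by (simp add: x_def)
    have "(\<Sum>\<psi>\<in>?X. C \<psi> * R j \<psi>) = (\<kappa> / x) ^ (2 * l j) * (\<Sum>\<psi>\<in>?X. C \<psi> * norm (prime_poly (prime_block j) \<psi>) ^ (2 * l j))"
      unfolding sum_distrib_left R_def x_def times_divide_eq_left[symmetric] power_mult_distrib
      by (intro sum.cong refl) (rule mult.left_commute)
    also have "\<dots> \<le> (\<kappa> / x) ^ (2 * l j) * (?c * (fact (l j) * 8 ^ l j * exp (8 * m\<^sup>2) * W))"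
      unfolding C_def W_def using len k12 x0
      by (intro mult_left_mono mean_square_mpoly_prime_poly_le[OF q(1) q2 _ j]) (auto simp: l_def)
    also have "\<dots> \<le> (\<kappa> / x) ^ (2 * l j) * (?c * (x ^ l j * 8 ^ l j * exp (8 * m\<^sup>2) * W))"
    proof -
      have "fact (l j) \<le> x ^ l j" using fact_le_power[of "l j", where ?'a = real] unfolding x_def by simp
      thus ?thesis using W1 k12 x0 by (intro mult_left_mono mult_right_mono) auto
    qed
    also have "\<dots> = (\<kappa> / x) ^ (2 * l j) * (x ^ l j * 8 ^ l j) * (?c * W * exp (8 * m\<^sup>2))"
      by (simp only: mult_ac)
    also have "(\<kappa> / x) ^ (2 * l j) * (x ^ l j * 8 ^ l j) = ((\<kappa> / x)\<^sup>2 * (x * 8)) ^ l j" by (simp only: power_mult power_mult_distrib)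
    also have "(\<kappa> / x)\<^sup>2 * (x * 8) = 8 * \<kappa>\<^sup>2 / x" using x0 by (simp add: power2_eq_square)
    also have "(8 * \<kappa>\<^sup>2 / x) ^ l j * (?c * W * exp (8 * m\<^sup>2)) \<le> exp (- 1) ^ l j * (?c * W * exp (8 * m\<^sup>2))"
    proof (intro mult_right_mono power_mono)
      have "exp 1 * (8 * \<kappa>\<^sup>2) \<le> 3 * (8 * \<kappa>\<^sup>2)" by (intro mult_right_mono exp_le) auto
      hence "exp 1 * (8 * \<kappa>\<^sup>2) \<le> x" using x by linarith
      thus "8 * \<kappa>\<^sup>2 / x \<le> exp (- 1)" using x0 by (simp add: exp_minus field_simps)
    qed (use W1 x0 in auto)
    also have "exp (- 1) ^ l j = exp (- real (l j))" by (simp add: exp_of_nat_mult[symmetric])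
    finally show ?thesis by (simp add: mult_ac)
  qed
  have bad: "(\<Sum>j<n. \<Sum>\<psi>\<in>?X. C \<psi> * R j \<psi>) \<le> ?c * W / 4"
  proof -
    have "(\<Sum>j<n. \<Sum>\<psi>\<in>?X. C \<psi> * R j \<psi>) \<le> (\<Sum>j<n. ?c * W * exp (8 * m\<^sup>2) * exp (- real (l j)))" by (intro sum_mono Rj) auto
    also have "\<dots> = ?c * W * exp (8 * m\<^sup>2) * (\<Sum>j<n. exp (- real (l j)))" by (simp only: sum_distrib_left)
    also have "\<dots> \<le> ?c * W * exp (8 * m\<^sup>2) * (2 * exp (- real Q))"
      unfolding l_def L_def using W1 by (intro mult_left_mono sum_exp_levels_le Q1) auto
    also have "\<dots> = 2 * ?c * W * exp (8 * m\<^sup>2 - real Q)" by (simp add: exp_diff exp_minus field_simps)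
    also have "\<dots> \<le> 2 * ?c * W * exp (- 3)"
    proof -
      have "8 * m\<^sup>2 \<le> 12 * m\<^sup>2" by simp
      hence "8 * m\<^sup>2 - real Q \<le> - 3" using Qm by linarith
      thus ?thesis using W1 by (intro mult_left_mono) auto
    qed
    also have "exp (- 3) \<le> (1/8 :: real)"
    proof -
      have "(2::real) ^ 3 \<le> exp 1 ^ 3" using exp_ge_add_one_self[of "1::real"] by (intro power_mono) auto
      thus ?thesis by (simp add: exp_minus exp_of_nat_mult[symmetric] field_simps)
    qed
    hence "2 * ?c * W * exp (- 3) \<le> 2 * ?c * W * (1/8)" using W1 by (intro mult_left_mono) auto
    finally show ?thesis by (simp add: mult.commute)
  qed
  have R0: "R j \<psi> \<ge> 0" for j \<psi> unfolding R_def using k12 by (intro zero_le_power divide_nonneg_nonneg mult_nonneg_nonneg) auto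
  have S0: "(\<Sum>j<n. C \<psi> * R j \<psi>) \<ge> 0" for \<psi> by (intro sum_nonneg mult_nonneg_nonneg C0 R0)
  have pt: "C \<psi> \<le> (if \<psi> \<in> G then C \<psi> else 0) + (if \<psi> = principal q then C \<psi> else 0) + (\<Sum>j<n. C \<psi> * R j \<psi>)" if "\<psi> \<in> ?X" for \<psi>
  proof (cases "\<psi> \<in> G \<or> \<psi> = principal q")
    case True
    thus ?thesis using S0[of \<psi>] C0[of \<psi>] by auto
  next
    case False
    hence "\<not> tame n l m \<psi>" using that by (auto simp: G_def)
    then obtain j where j: "j < n" "\<kappa> * norm (prime_poly (prime_block j) \<psi>) > real (l j)"
      unfolding tame_def \<kappa>_def by (metis not_le)
    have "1 \<le> R j \<psi>" unfolding R_def using j l1(1)[OF j(1)] by (intro one_le_power) (simp add: field_simps)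
    hence "C \<psi> \<le> C \<psi> * R j \<psi>" using mult_left_mono[OF _ C0[of \<psi>], of 1] by simp
    also have "\<dots> \<le> (\<Sum>j<n. C \<psi> * R j \<psi>)" using j(1) by (intro member_le_sum mult_nonneg_nonneg C0 R0) auto
    finally show ?thesis using False by simp
  qed
  have "?c * W \<le> (\<Sum>\<psi>\<in>?X. (if \<psi> \<in> G then C \<psi> else 0) + (if \<psi> = principal q then C \<psi> else 0) + (\<Sum>j<n. C \<psi> * R j \<psi>))"
    unfolding tot[symmetric] by (rule sum_mono[OF pt])
  also have "\<dots> = (\<Sum>\<psi>\<in>?X. if \<psi> \<in> G then C \<psi> else 0) + (\<Sum>\<psi>\<in>?X. if \<psi> = principal q then C \<psi> else 0) + (\<Sum>j<n. \<Sum>\<psi>\<in>?X. C \<psi> * R j \<psi>)"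
    unfolding sum.distrib by (subst sum.swap) (rule refl)
  also have "(\<Sum>\<psi>\<in>?X. if \<psi> \<in> G then C \<psi> else 0) = (\<Sum>\<psi>\<in>G. C \<psi>)"
  proof -
    have "?X \<inter> {\<psi>. \<psi> \<in> G} = G" by (auto simp: G_def)
    thus ?thesis using sum.inter_restrict[OF fin, of C G] by (simp add: Int_def)
  qed
  also have "(\<Sum>\<psi>\<in>?X. if \<psi> = principal q then C \<psi> else 0) \<le> ?c * W / 4"
    using pr fin W1 by (simp add: sum.delta)
  finally have main: "(\<Sum>\<psi>\<in>G. C \<psi>) \<ge> ?c * W / 2" using bad by simp
  have "W \<ge> exp (- (m ^ 4)) / 2 * exp (m\<^sup>2 * prime_sum n)"
    unfolding W_def l_def L_def using Qm by (intro prod_block_mass_ge) auto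
  hence "?c * (exp (- (m ^ 4)) / 2 * exp (m\<^sup>2 * prime_sum n)) \<le> ?c * W" by (rule mult_left_mono) simp
  with main show ?thesis unfolding G_def C_def l_def by simp
qed

section \<open>The moment inequality\<close>

text \<open>The main term of \<open>twisted_second_moment\<close> goes to
  \<open>twisted_main_term_le\<close> with \<open>A = ln q + C1\<close>; the lower bound on
  \<open>ln q\<close> makes \<open>A\<close> nonnegative. The parameter \<open>a\<close> compares
  \<open>ln q\<close> with \<open>2 ^ n\<close>, so that \<open>A\<close> and the logarithmic
  contributions of the blocks are both of order \<open>2 ^ n\<close>.\<close>

lemma twisted_mpoly_second_moment_le:
  fixes m :: real
  assumes m: "m > 0" and Q: "Q \<ge> 1"
  defines "L \<equiv> \<lambda>n j. Q * (n - j)"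
  obtains C D :: real where "D > 0"
    "\<And>q n a. \<lbrakk>prime q; q > 2; C \<le> ln (real q); 0 \<le> a; ln (real q) \<le> a * 2 ^ n; mlen n (L n) < q;
        real (mlen n (L n)) ^ 4 * exp ((2 * m + 6) * real n) \<le> real q powr (1/4)\<rbrakk> \<Longrightarrow>
      (\<Sum>\<psi>\<in>even_characters q - {principal q}. (norm (dirichlet_L (1/2) \<psi>))\<^sup>2 * (norm (mpoly n (L n) (\<lambda>_ r. (- (m + 1)) ^ r) \<psi>))\<^sup>2)
        \<le> D * (1 + a) * real (card (even_characters q)) * (2 ^ n * exp ((m\<^sup>2 - 1) * prime_sum n))"
proof (rule twisted_second_moment[where 'i = "(nat \<Rightarrow> nat \<Rightarrow> nat) \<times> (nat \<Rightarrow> nat \<Rightarrow> nat)"])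
  fix C1 C2 :: real
  assume C2: "C2 \<ge> 0" and tsm: "\<And>q Y (\<Gamma> :: ((nat \<Rightarrow> nat \<Rightarrow> nat) \<times> (nat \<Rightarrow> nat \<Rightarrow> nat)) set) c a b F. \<lbrakk>prime q; q > 2; Y < q; finite \<Gamma>;
        \<And>i. i \<in> \<Gamma> \<Longrightarrow> 0 < a i \<and> a i \<le> Y \<and> 0 < b i \<and> b i \<le> Y;
        \<And>\<psi>. \<psi> \<in> even_characters q \<Longrightarrow>
           of_real (F \<psi>) = (\<Sum>i\<in>\<Gamma>. of_real (c i) * (\<psi> (int (a i)) * cnj (\<psi> (int (b i)))));
        \<And>\<psi>. \<psi> \<in> even_characters q \<Longrightarrow> F \<psi> \<ge> 0\<rbrakk> \<Longrightarrow>
      (\<Sum>\<psi>\<in>even_characters q - {principal q}. (norm (dirichlet_L (1/2) \<psi>))\<^sup>2 * F \<psi>)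
        \<le> real (card (even_characters q)) *
           ((\<Sum>i\<in>\<Gamma>. c i * (real (gcd (a i) (b i)) / sqrt (real (a i) * real (b i))) *
               (ln (real q) + 2 * ln (real (gcd (a i) (b i)) / sqrt (real (a i) * real (b i))) + C1))
             + C2 * (real Y)\<^sup>2 * real q powr (-1/4) * (\<Sum>i\<in>\<Gamma>. \<bar>c i\<bar>))"
  define K where "K = twist_const (m + 1)"
  define e4 where "e4 = exp (4 * K + 4)"
  have K0: "K \<ge> 0" by (simp add: K_def twist_const_def)
  have e4: "e4 > 0" by (simp add: e4_def)
  define H where "H = 1 + \<bar>C1\<bar> + 8 * e4 * real Q"
  have H: "H \<ge> 1" using e4 by (simp add: H_def)
  define D where "D = exp (K + 4 * e4) * H + C2"
  have D: "D > 0" using H C2 by (simp add: D_def add_pos_nonneg)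
  show thesis
  proof (rule that[OF D])
    fix q n :: nat and a :: real
    assume q: "prime q" "q > 2" and C: "\<bar>C1\<bar> \<le> ln (real q)" and a: "0 \<le> a" "ln (real q) \<le> a * 2 ^ n"
      and Y: "mlen n (L n) < q" and YY: "real (mlen n (L n)) ^ 4 * exp ((2 * m + 6) * real n) \<le> real q powr (1/4)"
    let ?X = "even_characters q" and ?I = "midx n (L n)"
    define y where "y = real (mlen n (L n))"
    define S where "S = prime_sum n"
    define cc where "cc = mcoef n (\<lambda>_ r. (- (m + 1)) ^ r)"
    define E where "E = exp ((m\<^sup>2 - 1) * S)"
    have S: "0 \<le> S" "S \<le> 4 * real n"
    proof -
      show "0 \<le> S" unfolding S_def prime_sum_eq_bsum by (intro sum_nonneg bsum_bounds)
      have "S \<le> (\<Sum>j<n. 4)" unfolding S_def prime_sum_eq_bsum by (intro sum_mono bsum_bounds)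
      thus "S \<le> 4 * real n" by simp
    qed
    have q0: "real q > 0" using q by simp
    have "(\<Sum>\<psi>\<in>?X - {principal q}. (norm (dirichlet_L (1/2) \<psi>))\<^sup>2 * (norm (mpoly n (L n) (\<lambda>_ r. (- (m + 1)) ^ r) \<psi>))\<^sup>2)
      \<le> real (card ?X) *
           ((\<Sum>i\<in>?I \<times> ?I. (cc (fst i) * cc (snd i)) * (real (gcd (mnum n (fst i)) (mnum n (snd i))) / sqrt (real (mnum n (fst i)) * real (mnum n (snd i)))) *
               (ln (real q) + 2 * ln (real (gcd (mnum n (fst i)) (mnum n (snd i))) / sqrt (real (mnum n (fst i)) * real (mnum n (snd i)))) + C1))
             + C2 * (real (mlen n (L n)))\<^sup>2 * real q powr (-1/4) * (\<Sum>i\<in>?I \<times> ?I. \<bar>cc (fst i) * cc (snd i)\<bar>))"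
    proof (rule tsm[OF q Y])
      show "finite (?I \<times> ?I)" by (simp add: finite_midx)
      show "0 < mnum n (fst i) \<and> mnum n (fst i) \<le> mlen n (L n) \<and> 0 < mnum n (snd i) \<and> mnum n (snd i) \<le> mlen n (L n)"
        if "i \<in> ?I \<times> ?I" for i using that by (auto intro: mnum_pos mnum_le)
      show "complex_of_real ((norm (mpoly n (L n) (\<lambda>_ r. (- (m + 1)) ^ r) \<psi>))\<^sup>2) =
        (\<Sum>i\<in>?I \<times> ?I. of_real (cc (fst i) * cc (snd i)) * (\<psi> (int (mnum n (fst i))) * cnj (\<psi> (int (mnum n (snd i))))))"
        if "\<psi> \<in> ?X" for \<psi>
      proof -
        have "dirichlet_character q \<psi>" using that by (simp add: even_characters_def)
        from norm_mpoly_square_expand[OF this] show ?thesis unfolding cc_def sum.cartesian_product by (simp only: case_prod_unfold)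
      qed
    qed simp
    also have "(\<Sum>i\<in>?I \<times> ?I. (cc (fst i) * cc (snd i)) * (real (gcd (mnum n (fst i)) (mnum n (snd i))) / sqrt (real (mnum n (fst i)) * real (mnum n (snd i)))) *
               (ln (real q) + 2 * ln (real (gcd (mnum n (fst i)) (mnum n (snd i))) / sqrt (real (mnum n (fst i)) * real (mnum n (snd i)))) + C1)) = 
        (\<Sum>u\<in>?I. \<Sum>v\<in>?I. cc u * cc v * gcd_weight (mnum n u) (mnum n v) * ((ln (real q) + C1) + 2 * ln (gcd_weight (mnum n u) (mnum n v))))"
      unfolding sum.cartesian_product gcd_weight_def case_prod_unfold by (intro sum.cong refl arg_cong2[where f = times]) simp
    also have "(\<Sum>i\<in>?I \<times> ?I. \<bar>cc (fst i) * cc (snd i)\<bar>) = (\<Sum>u\<in>?I. \<bar>cc u\<bar>) * (\<Sum>u\<in>?I. \<bar>cc u\<bar>)"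
      unfolding sum_product sum.cartesian_product abs_mult by (simp only: case_prod_unfold)
    finally have "(\<Sum>\<psi>\<in>?X - {principal q}. (norm (dirichlet_L (1/2) \<psi>))\<^sup>2 * (norm (mpoly n (L n) (\<lambda>_ r. (- (m + 1)) ^ r) \<psi>))\<^sup>2)
      \<le> real (card ?X) * ((\<Sum>u\<in>?I. \<Sum>v\<in>?I. cc u * cc v * gcd_weight (mnum n u) (mnum n v) * ((ln (real q) + C1) + 2 * ln (gcd_weight (mnum n u) (mnum n v))))
         + C2 * y\<^sup>2 * real q powr (-1/4) * ((\<Sum>u\<in>?I. \<bar>cc u\<bar>) * (\<Sum>u\<in>?I. \<bar>cc u\<bar>)))" (is "_ \<le> _ * (?M + ?R)")
      unfolding y_def .
    moreover have "?M \<le> exp (K + 4 * e4) * H * (1 + a) * (2 ^ n * E)"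
    proof -
      have "?M \<le> exp (\<Sum>j<n. (m\<^sup>2 - 1) * bsum j + K * bsum2 j + 2 * e4 * exp (- real (L n j))) * ((ln (real q) + C1) + 2 * e4 * real (\<Sum>j<n. 2 ^ Suc j * L n j))"
        unfolding cc_def K_def e4_def using m C Q by (intro twisted_main_term_le) (auto simp: L_def Suc_le_eq)
      also have "\<dots> \<le> exp ((m\<^sup>2 - 1) * S + K + 4 * e4) * (H * (1 + a) * 2 ^ n)"
      proof (intro mult_mono)
        have "(\<Sum>j<n. (m\<^sup>2 - 1) * bsum j + K * bsum2 j + 2 * e4 * exp (- real (L n j))) = 
           (m\<^sup>2 - 1) * S + K * (\<Sum>j<n. bsum2 j) + 2 * e4 * (\<Sum>j<n. exp (- real (L n j)))"
          by (simp only: sum.distrib sum_distrib_left S_def prime_sum_eq_bsum)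
        also have "\<dots> \<le> (m\<^sup>2 - 1) * S + K * 1 + 2 * e4 * (2 * 1)"
        proof -
          have "(\<Sum>j<n. exp (- real (L n j))) \<le> 2 * exp (- real Q)" unfolding L_def by (rule sum_exp_levels_le[OF Q])
          also have "\<dots> \<le> 2 * 1" by (intro mult_left_mono) auto
          finally have "2 * e4 * (\<Sum>j<n. exp (- real (L n j))) \<le> 2 * e4 * (2 * 1)" using e4 by (intro mult_left_mono) auto
          moreover have "K * (\<Sum>j<n. bsum2 j) \<le> K * 1" by (intro mult_left_mono sum_bsum2_le K0)
          ultimately show ?thesis by linarith
        qed
        finally show "exp (\<Sum>j<n. (m\<^sup>2 - 1) * bsum j + K * bsum2 j + 2 * e4 * exp (- real (L n j))) \<le> exp ((m\<^sup>2 - 1) * S + K + 4 * e4)"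
          by simp
        have "(\<Sum>j<n. 2 ^ Suc j * L n j) = Q * (\<Sum>j<n. 2 ^ Suc j * (n - j))" unfolding L_def sum_distrib_left by (intro sum.cong refl) simp
        also have "(\<Sum>j<n. 2 ^ Suc j * (n - j)) \<le> 4 * 2 ^ n" using sum_levels_eq[of n] by linarith
        finally have "(\<Sum>j<n. 2 ^ Suc j * L n j) \<le> Q * (4 * 2 ^ n)" by simp
        hence "real (\<Sum>j<n. 2 ^ Suc j * L n j) \<le> real (Q * (4 * 2 ^ n))" by (simp only: of_nat_le_iff)
        hence "2 * e4 * real (\<Sum>j<n. 2 ^ Suc j * L n j) \<le> 2 * e4 * real (Q * (4 * 2 ^ n))" using e4 by (intro mult_left_mono) auto
        hence 1: "2 * e4 * real (\<Sum>j<n. 2 ^ Suc j * L n j) \<le> 8 * e4 * real Q * 2 ^ n" by simp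
        have 2: "\<bar>C1\<bar> * 1 \<le> \<bar>C1\<bar> * 2 ^ n" by (intro mult_left_mono) auto
        have "(ln (real q) + C1) + 2 * e4 * real (\<Sum>j<n. 2 ^ Suc j * L n j) \<le> (a + \<bar>C1\<bar> + 8 * e4 * real Q) * 2 ^ n"
          unfolding distrib_right using 1 2 a(2) by linarith
        also have "\<dots> \<le> (H * (1 + a)) * 2 ^ n"
        proof (intro mult_right_mono)
          have "a * (H - 1) \<ge> 0" using a(1) H by simp
          thus "a + \<bar>C1\<bar> + 8 * e4 * real Q \<le> H * (1 + a)" unfolding H_def by (simp add: algebra_simps)
        qed simp
        finally show "(ln (real q) + C1) + 2 * e4 * real (\<Sum>j<n. 2 ^ Suc j * L n j) \<le> H * (1 + a) * 2 ^ n" .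
        have "0 \<le> ln (real q) + C1" using C by linarith
        moreover have "0 \<le> 2 * e4 * real (\<Sum>j<n. 2 ^ Suc j * L n j)" using e4 by (intro mult_nonneg_nonneg of_nat_0_le_iff) auto
        ultimately show "0 \<le> (ln (real q) + C1) + 2 * e4 * real (\<Sum>j<n. 2 ^ Suc j * L n j)" by linarith
      qed simp
      also have "exp ((m\<^sup>2 - 1) * S + K + 4 * e4) = E * exp (K + 4 * e4)" by (simp add: E_def exp_add)
      finally show ?thesis by (simp only: mult_ac)
    qed
    moreover have "?R \<le> C2 * (1 + a) * (2 ^ n * E)"
    proof -
      \<comment> \<open>Origin of \<open>2 * m + 6\<close>: squaring the coefficient sum produces
        \<open>2 * (m + 1)\<close>, and the remaining 4 makes the remainder at most
        \<open>C2 * exp (- 4 * n)\<close>, which stays below the main term because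
        \<open>(m\<^sup>2 - 1) * S \<ge> - 4 * n\<close>.\<close>
      have c: "(\<Sum>u\<in>?I. \<bar>cc u\<bar>) \<le> exp ((m + 1) * real n) * y"
        using sum_abs_mcoef_power_le[of n "- (m + 1)" "L n"] m unfolding cc_def y_def by (simp add: add.commute)
      have "(\<Sum>u\<in>?I. \<bar>cc u\<bar>) * (\<Sum>u\<in>?I. \<bar>cc u\<bar>) \<le> (exp ((m + 1) * real n) * y) * (exp ((m + 1) * real n) * y)"
        by (intro mult_mono c sum_nonneg) (auto simp: y_def)
      also have "\<dots> = y\<^sup>2 * (exp ((2 * m + 6) * real n) * exp (- 4 * real n))"
        by (simp add: power2_eq_square exp_add[symmetric] algebra_simps)
      finally have "?R \<le> C2 * y\<^sup>2 * real q powr (-1/4) * (y\<^sup>2 * (exp ((2 * m + 6) * real n) * exp (- 4 * real n)))"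
        using C2 by (intro mult_left_mono) auto
      also have "\<dots> = C2 * real q powr (-1/4) * exp (- 4 * real n) * (y ^ 4 * exp ((2 * m + 6) * real n))"
        by (simp add: power4_eq_xxxx power2_eq_square mult_ac)
      also have "\<dots> \<le> C2 * real q powr (-1/4) * exp (- 4 * real n) * real q powr (1/4)"
        using C2 YY unfolding y_def by (intro mult_left_mono) auto
      also have "\<dots> = C2 * exp (- 4 * real n) * (real q powr (-1/4) * real q powr (1/4))" by (simp only: mult_ac)
      also have "real q powr (-1/4) * real q powr (1/4) = 1" using q0 by (simp add: powr_add[symmetric])
      also have "C2 * exp (- 4 * real n) * 1 \<le> C2 * ((1 + a) * (2 ^ n * E))"
      proof -
        have "m\<^sup>2 * S \<ge> 0" using S by simp
        hence "- 4 * real n \<le> (m\<^sup>2 - 1) * S" unfolding left_diff_distrib using S by linarith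
        hence "exp (- 4 * real n) \<le> E" by (simp add: E_def)
        also have "\<dots> \<le> 2 ^ n * E" by (simp add: E_def)
        also have "\<dots> \<le> (1 + a) * (2 ^ n * E)" using a(1) by (simp add: E_def)
        finally show ?thesis using C2 by (simp add: mult_left_mono)
      qed
      finally show ?thesis by (simp only: mult.assoc)
    qed
    ultimately have "(\<Sum>\<psi>\<in>?X - {principal q}. (norm (dirichlet_L (1/2) \<psi>))\<^sup>2 * (norm (mpoly n (L n) (\<lambda>_ r. (- (m + 1)) ^ r) \<psi>))\<^sup>2)
      \<le> real (card ?X) * (exp (K + 4 * e4) * H * (1 + a) * (2 ^ n * E) + C2 * (1 + a) * (2 ^ n * E))"
      by (elim order_trans) (intro mult_left_mono add_mono, auto)
    also have "\<dots> = D * (1 + a) * real (card ?X) * (2 ^ n * E)" unfolding D_def by (simp only: distrib_left distrib_right mult_ac)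
    finally show "(\<Sum>\<psi>\<in>?X - {principal q}. (norm (dirichlet_L (1/2) \<psi>))\<^sup>2 * (norm (mpoly n (L n) (\<lambda>_ r. (- (m + 1)) ^ r) \<psi>))\<^sup>2)
      \<le> D * (1 + a) * real (card ?X) * (2 ^ n * exp ((m\<^sup>2 - 1) * prime_sum n))" unfolding E_def S_def .
  qed
qed

text \<open>The comparisons in the single blocks are multiplied. For \<open>Q \<ge> 15\<close> the
  relative losses add up to at most 1/2, so their product leaves the factor 1/2.\<close>

lemma tame_powr_ge:
  fixes m :: real and n Q :: nat
  assumes m: "m > 0" and Q: "Q \<ge> 15" and dc: "dirichlet_character q \<psi>"
  defines "L \<equiv> \<lambda>j. Q * (n - j)"
  assumes t: "tame n L m \<psi>"
  shows "(norm (mpoly n L (\<lambda>_ r. (- m) ^ r) \<psi>))\<^sup>2 / 2 \<le> norm (mpoly n L (\<lambda>_ r. (- (m + 1)) ^ r) \<psi>) powr (2 * m / (m + 1))"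
proof -
  define c where "c j = norm (block_poly (prime_block j) (L j) (\<lambda>r. (- m) ^ r) \<psi>)" for j
  define b where "b j = norm (block_poly (prime_block j) (L j) (\<lambda>r. (- (m + 1)) ^ r) \<psi>)" for j
  define h where "h j = 4 * exp (- real (L j))" for j
  have h0: "h j \<ge> 0" for j by (simp add: h_def)
  have bc: "(1 - h j) * (c j)\<^sup>2 \<le> b j powr (2 * m / (m + 1))" if j: "j < n" for j
  proof -
    have "L j \<ge> 1" using Q j by (simp add: L_def)
    thus ?thesis unfolding h_def c_def b_def block_poly_eq[OF finite_prime_block dc]
      using t j by (intro truncated_exp_powr_ge[OF m]) (auto simp: tame_def)
  qed
  have hs: "(\<Sum>j<n. h j) \<le> 1/2"
  proof -
    have "(\<Sum>j<n. h j) = 4 * (\<Sum>j<n. exp (- real (L j)))" by (simp add: h_def sum_distrib_left)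
    also have "\<dots> \<le> 4 * (2 * exp (- real Q))" unfolding L_def using Q by (intro mult_left_mono sum_exp_levels_le) auto
    also have "exp (- real Q) \<le> 1/16"
    proof -
      have "exp (real Q) \<ge> 16" using exp_ge_add_one_self[of "real Q"] Q by linarith
      thus ?thesis by (simp add: exp_minus field_simps)
    qed
    finally show ?thesis by simp
  qed
  have h1: "h j \<le> 1" if "j < n" for j
    using member_le_sum[of j "{..<n}" h] h0 hs that by simp
  have "1/2 \<le> (\<Prod>j<n. 1 - h j)" using one_minus_sum_le_prod[of "{..<n}" h] h0 h1 hs by simp
  hence "1/2 * (\<Prod>j<n. (c j)\<^sup>2) \<le> (\<Prod>j<n. 1 - h j) * (\<Prod>j<n. (c j)\<^sup>2)" by (intro mult_right_mono prod_nonneg) auto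
  also have "\<dots> = (\<Prod>j<n. (1 - h j) * (c j)\<^sup>2)" by (simp add: prod.distrib)
  also have "\<dots> \<le> (\<Prod>j<n. b j powr (2 * m / (m + 1)))" using bc h1 by (intro prod_mono conjI mult_nonneg_nonneg) auto
  also have "\<dots> = norm (mpoly n L (\<lambda>_ r. (- (m + 1)) ^ r) \<psi>) powr (2 * m / (m + 1))"
    unfolding mpoly_def b_def prod_norm[symmetric] prod_powr_distrib ..
  also have "(\<Prod>j<n. (c j)\<^sup>2) = (norm (mpoly n L (\<lambda>_ r. (- m) ^ r) \<psi>))\<^sup>2"
    unfolding mpoly_def c_def prod_norm[symmetric] prod_power_distrib ..
  finally show ?thesis by simp
qed

section \<open>Choice of the scale and conclusion\<close>

lemma dyadic_scale:
  fixes a q :: nat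
  assumes a: "a > 0" and q: "2 ^ a \<le> q"
  obtains n where "2 ^ (a * 2 ^ n) \<le> q" "q < 2 ^ (a * 2 ^ Suc n)"
proof -
  define P where "P k \<longleftrightarrow> q < 2 ^ (a * 2 ^ k)" for k
  have "q < 2 ^ q" by simp
  also have "q \<le> a * 2 ^ q" using a less_exp[of q] by (metis One_nat_def Suc_leI less_imp_le mult.left_neutral mult_le_mono)
  hence "(2::nat) ^ q \<le> 2 ^ (a * 2 ^ q)" by (rule power_increasing) simp
  finally have "P q" unfolding P_def .
  hence L: "P (Least P)" by (rule LeastI)
  have "\<not> P 0" using q by (simp add: P_def)
  with L obtain n where n: "Least P = Suc n" by (cases "Least P") auto
  have "\<not> P n" using not_less_Least[of n P] n by simp
  with L n that show thesis unfolding P_def by (metis not_less)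
qed

lemma mlen_le_exp:
  "real (mlen n (\<lambda>j. Q * (n - j))) \<le> exp (4 * real Q * 2 ^ n)"
proof -
  have "(\<Sum>j<n. 2 ^ Suc j * (Q * (n - j))) = Q * (\<Sum>j<n. 2 ^ Suc j * (n - j))" unfolding sum_distrib_left by (intro sum.cong refl) simp
  also have "(\<Sum>j<n. 2 ^ Suc j * (n - j)) \<le> 4 * 2 ^ n" using sum_levels_eq[of n] by linarith
  finally have "(\<Sum>j<n. 2 ^ Suc j * (Q * (n - j))) \<le> Q * (4 * 2 ^ n)" by simp
  hence "mlen n (\<lambda>j. Q * (n - j)) \<le> 2 ^ (Q * (4 * 2 ^ n))" unfolding mlen_def by (rule power_increasing) simp
  hence "real (mlen n (\<lambda>j. Q * (n - j))) \<le> real (2 ^ (Q * (4 * 2 ^ n)))" by (simp only: of_nat_le_iff)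
  also have "\<dots> = 2 ^ (Q * (4 * 2 ^ n))" by simp
  also have "\<dots> \<le> exp 1 ^ (Q * (4 * 2 ^ n))" using exp_ge_add_one_self[of "1::real"] by (intro power_mono) auto
  also have "\<dots> = exp (4 * real Q * 2 ^ n)" by (simp add: exp_of_nat_mult[symmetric] mult_ac)
  finally show ?thesis .
qed

text \<open>Since \<open>2 \<ge> exp (1/2)\<close>, the modulus is at least
  \<open>exp (a * 2 ^ n / 2)\<close>, and the length is at most \<open>exp (4 * Q * 2 ^ n)\<close>.
  The most demanding requirement compares \<open>exp ((16 * Q + 2 * m + 6) * 2 ^ n)\<close> with
  \<open>q powr (1/4)\<close>; this dictates the factor 8 in the condition on
  \<open>a\<close>.\<close>

lemma scale_bounds:
  fixes m :: real and Q n a q :: nat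
  defines "Y \<equiv> mlen n (\<lambda>j. Q * (n - j))"
  assumes m: "m > 0" and a: "real a \<ge> 8 * (16 * real Q + 2 * m + 6)" and q: "2 ^ (a * 2 ^ n) \<le> q"
  shows "real Y ^ 4 * exp ((2 * m + 6) * real n) \<le> real q powr (1/4)" (is ?A)
    and "2 * Y\<^sup>2 < q" (is ?B)
    and "16 * (exp (m * real n) * real Y)\<^sup>2 \<le> real q" (is ?C)
proof -
  define w :: real where "w = 2 ^ n"
  have w: "w \<ge> 1" "real n \<le> w" 
  proof -
    have "n \<le> 2 ^ n" by (rule less_imp_le[OF less_exp])
    hence "real n \<le> real (2 ^ n)" by (simp only: of_nat_le_iff)
    thus "real n \<le> w" by (simp add: w_def)
  qed (simp add: w_def)
  have Y: "real Y \<le> exp (4 * real Q * w)" "real Y \<ge> 0" unfolding Y_def w_def by (rule mlen_le_exp) simp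
  have "exp (1/2) \<le> (2::real)"
  proof -
    have "ln 2 \<ge> (1/2::real)" using ln2_ge_two_thirds by simp
    hence "exp (1/2) \<le> exp (ln (2::real))" by (simp only: exp_le_cancel_iff)
    thus ?thesis by simp
  qed
  hence "exp (1/2) ^ (a * 2 ^ n) \<le> (2::real) ^ (a * 2 ^ n)" by (rule power_mono) simp
  also have "\<dots> = real (2 ^ (a * 2 ^ n))" by simp
  also have "\<dots> \<le> real q" using q by (simp only: of_nat_le_iff)
  also have "exp (1/2) ^ (a * 2 ^ n) = exp (real a * w / 2)" by (simp add: exp_of_nat_mult[symmetric] w_def)
  finally have qe: "exp (real a * w / 2) \<le> real q" .
  have aw: "real a * w \<ge> 128 * real Q * w + 16 * m * w + 48 * w" 
    using mult_right_mono[OF a, of w] w by (simp add: algebra_simps)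
  have mn: "m * real n \<le> m * w" using m w by simp
  have Qw: "real Q * w \<ge> 0" using w by simp
  have mw: "m * w \<ge> 0" using m w by simp
  show ?A
  proof -
    have "real Y ^ 4 * exp ((2 * m + 6) * real n) \<le> exp (4 * real Q * w) ^ 4 * exp ((2 * m + 6) * w)"
      using Y w m by (intro mult_mono power_mono) auto
    also have "\<dots> = exp (16 * real Q * w + (2 * m + 6) * w)" by (simp add: exp_add exp_of_nat_mult[symmetric])
    also have "\<dots> \<le> exp (real a * w / 8)"
      unfolding exp_le_cancel_iff distrib_right using aw Qw mw by linarith
    also have "\<dots> = exp (real a * w / 2) powr (1/4)" by (simp add: powr_def)
    also have "\<dots> \<le> real q powr (1/4)" using qe by (intro powr_mono2) auto
    finally show ?thesis .
  qed
  show ?B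
  proof -
    have "2 * (real Y)\<^sup>2 \<le> exp 1 * (exp (4 * real Q * w))\<^sup>2"
      using exp_ge_add_one_self[of "1::real"] Y by (intro mult_mono power_mono) auto
    also have "\<dots> = exp (1 + 8 * real Q * w)" by (simp add: exp_add exp_double[symmetric])
    also have "\<dots> < exp (real a * w / 2)" unfolding exp_less_cancel_iff using aw Qw mw w by linarith
    also have "\<dots> \<le> real q" by (rule qe)
    finally have "real (2 * Y\<^sup>2) < real q" by simp
    thus ?thesis by (simp only: of_nat_less_iff)
  qed
  show ?C
  proof -
    have "(2::real) ^ 4 \<le> exp 1 ^ 4" using exp_ge_add_one_self[of "1::real"] by (intro power_mono) auto
    hence 16: "16 \<le> exp (4::real)" by (simp add: exp_of_nat_mult[symmetric])
    have "16 * (exp (m * real n) * real Y)\<^sup>2 \<le> exp 4 * (exp (m * w) * exp (4 * real Q * w))\<^sup>2"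
      using 16 Y mn by (intro mult_mono power_mono) auto
    also have "\<dots> = exp (4 + 2 * (m * w) + 8 * real Q * w)"
      by (simp add: exp_add power_mult_distrib exp_double[symmetric] mult_ac)
    also have "\<dots> \<le> exp (real a * w / 2)" unfolding exp_le_cancel_iff using aw Qw mw w by linarith
    also have "\<dots> \<le> real q" by (rule qe)
    finally show ?thesis .
  qed
qed

text \<open>On the tame characters the interpolation inequality is summed. The mass of
  \<open>C\<close> is bounded below by \<open>tame_mass_ge\<close> and the mass of
  \<open>|L B|\<close> squared above by the twisted moment, so that half of the lower bound remains
  for the negative moment.\<close>

lemma negative_moment_lower_bound_large:
  fixes m :: real
  assumes m: "m > 0"
  shows "\<exists>N c. c > 0 \<and> (\<forall>q\<ge>N. prime q \<longrightarrow> (\<forall>\<psi>. primitive_character q \<psi> \<longrightarrow> dirichlet_L (1/2) \<psi> \<noteq> 0) \<longrightarrow>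
     c * real (phi_star q) * ln (real q) powr (m\<^sup>2) \<le> (\<Sum>\<psi>\<in>primitive_characters q. norm (dirichlet_L (1/2) \<psi>) powr (- 2 * m)))"
proof -
  define Q where "Q = nat \<lceil>24 * (12 * (m + 1))\<^sup>2\<rceil>"
  have Q: "real Q \<ge> 24 * (12 * (m + 1))\<^sup>2" unfolding Q_def by (rule real_nat_ceiling_ge)
  have "(12 * (m + 1))\<^sup>2 \<ge> 12\<^sup>2" using m by (intro power_mono) auto
  with Q have "real Q \<ge> 15" by simp
  hence Q15: "Q \<ge> 15" by linarith
  hence Q1: "Q \<ge> 1" by simp
  define L where "L = (\<lambda>n j. Q * (n - j))"
  define a where "a = nat \<lceil>8 * (16 * real Q + 2 * m + 6)\<rceil>"
  have a: "real a \<ge> 8 * (16 * real Q + 2 * m + 6)" unfolding a_def by (rule real_nat_ceiling_ge)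
  have a2: "a \<ge> 2"
  proof -
    have "8 * (16 * real Q + 2 * m + 6) = 128 * real Q + 16 * m + 48" by simp
    moreover have "real Q \<ge> 0" by simp
    ultimately have "real a \<ge> 2" using a m by linarith
    thus ?thesis by simp
  qed
  define B where "B n \<psi> = norm (mpoly n (L n) (\<lambda>_ r. (- (m + 1)) ^ r) \<psi>)" for n \<psi>
  define C where "C n \<psi> = (norm (mpoly n (L n) (\<lambda>_ r. (- m) ^ r) \<psi>))\<^sup>2" for n \<psi>
  define x where "x \<psi> = norm (dirichlet_L (1/2) \<psi>)" for \<psi>
  show ?thesis
  proof (rule twisted_mpoly_second_moment_le[OF m Q1])
    fix C0 D :: real
    assume D: "D > 0" and up: "\<And>q n a. \<lbrakk>prime q; q > 2; C0 \<le> ln (real q); 0 \<le> a; ln (real q) \<le> a * 2 ^ n; mlen n (\<lambda>j. Q * (n - j)) < q;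
        real (mlen n (\<lambda>j. Q * (n - j))) ^ 4 * exp ((2 * m + 6) * real n) \<le> real q powr (1/4)\<rbrakk> \<Longrightarrow>
      (\<Sum>\<psi>\<in>even_characters q - {principal q}. (norm (dirichlet_L (1/2) \<psi>))\<^sup>2 * (norm (mpoly n (\<lambda>j. Q * (n - j)) (\<lambda>_ r. (- (m + 1)) ^ r) \<psi>))\<^sup>2)
        \<le> D * (1 + a) * real (card (even_characters q)) * (2 ^ n * exp ((m\<^sup>2 - 1) * prime_sum n))"
    define N where "N = max (2 ^ a) (nat \<lceil>exp C0\<rceil>)"
    define E0 where "E0 = exp (- (m ^ 4))"
    define D' where "D' = D * (1 + 2 * real a)"
    \<comment> \<open>Fits \<open>ln q \<le> 2 * a * 2 ^ n\<close> and the Mertens bound, so that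
      \<open>\<kappa> * ln q \<le> exp S\<close>.\<close>
    define \<kappa> where "\<kappa> = exp (- 3) * ln 2 / (2 * real a)"
    \<comment> \<open>Makes \<open>\<tau>\<close> times the upper bound for the second moment at
      most \<open>E0 / 16 * E\<close> per even character, half of the available
      \<open>E0 / 8 * E\<close>.\<close>
    define \<tau> where "\<tau> = E0 * (exp (- 3) * ln 2) / (16 * D')"
    have E0: "E0 > 0" by (simp add: E0_def)
    have D': "D' > 0" using D by (simp add: D'_def add_pos_nonneg)
    have k: "\<kappa> > 0" using a2 by (simp add: \<kappa>_def)
    have t: "\<tau> > 0" using E0 D' by (simp add: \<tau>_def)
    \<comment> \<open>The 64 is 16, left over after subtracting the second moment, times 4, since at
      least a quarter of \<open>phi_star q\<close> counts even characters.\<close>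
    define c where "c = \<tau> powr m * (E0 / 64) * \<kappa> powr (m\<^sup>2)"
    have c: "c > 0" using t E0 k by (simp add: c_def)
    have "c * real (phi_star q) * ln (real q) powr (m\<^sup>2) \<le> (\<Sum>\<psi>\<in>primitive_characters q. x \<psi> powr (- 2 * m))"
      if qN: "q \<ge> N" and q: "prime q" and nz: "\<forall>\<psi>. primitive_character q \<psi> \<longrightarrow> dirichlet_L (1/2) \<psi> \<noteq> 0" for q
    proof -
      have q2a: "2 ^ a \<le> q" using qN by (simp add: N_def)
      have "(2::nat) ^ 2 \<le> 2 ^ a" using a2 by (intro power_increasing) auto
      hence q3: "q > 3" "q > 2" using q2a by simp_all
      have qC: "C0 \<le> ln (real q)"
      proof -
        have "exp C0 \<le> real (nat \<lceil>exp C0\<rceil>)" by (rule real_nat_ceiling_ge)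
        also have "nat \<lceil>exp C0\<rceil> \<le> q" using qN unfolding N_def by (rule max.boundedE)
        finally show ?thesis using q3 by (simp add: ln_ge_iff)
      qed
      obtain n where n: "2 ^ (a * 2 ^ n) \<le> q" "q < 2 ^ (a * 2 ^ Suc n)" using dyadic_scale[OF _ q2a] a2 by auto
      have lnq: "ln (real q) \<le> 2 * real a * 2 ^ n"
      proof -
        have "real q \<le> real (2 ^ (a * 2 ^ Suc n))" using n(2) by (simp only: of_nat_le_iff less_imp_le)
        hence "ln (real q) \<le> ln (real (2 ^ (a * 2 ^ Suc n)))" using q3 by (intro ln_mono) auto
        also have "\<dots> = real (a * 2 ^ Suc n) * ln 2" by (simp add: ln_realpow)
        also have "\<dots> \<le> real (a * 2 ^ Suc n) * 1" using ln_2_less_1 by (intro mult_left_mono) auto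
        finally show ?thesis by simp
      qed
      define Y where "Y = mlen n (\<lambda>j. Q * (n - j))"
      note sb = scale_bounds[OF m a n(1), folded Y_def]
      have Yq: "Y < q"
      proof -
        have "Y * 1 \<le> Y\<^sup>2" unfolding power2_eq_square by (intro mult_left_mono) (auto simp: Y_def mlen_def)
        thus ?thesis using sb(2) by simp
      qed
      let ?X = "even_characters q - {principal q}"
      let ?c = "real (card (even_characters q))"
      define S where "S = prime_sum n"
      define E where "E = exp (m\<^sup>2 * S)"
      define G where "G = {\<psi>. \<psi> \<in> ?X \<and> tame n (L n) m \<psi>}"
      define V where "V = (\<Sum>\<psi>\<in>G. x \<psi> powr (- 2 * m))"
      have E: "E > 0" by (simp add: E_def)
      have S: "exp (- 3) * ln 2 * 2 ^ n \<le> exp S" unfolding S_def by (rule exp_prime_sum_ge)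
      have finX: "finite ?X" using finite_even_characters[OF q] by simp
      have GX: "G \<subseteq> ?X" by (auto simp: G_def)
      have dc: "dirichlet_character q \<psi>" if "\<psi> \<in> ?X" for \<psi> using that by (simp add: even_characters_def)
      have prim: "primitive_character q \<psi>" if "\<psi> \<in> ?X" for \<psi>
        using primitive_character_prime[OF q dc[OF that]] that by simp
      have low: "?c * (E0 / 4 * E) \<le> (\<Sum>\<psi>\<in>G. C n \<psi>)"
        unfolding E0_def E_def S_def G_def C_def L_def
        by (rule tame_mass_ge[OF m Q q q3(1) sb(2)[unfolded Y_def] sb(3)[unfolded Y_def]])
      have upp: "(\<Sum>\<psi>\<in>?X. (x \<psi>)\<^sup>2 * (B n \<psi>)\<^sup>2) \<le> D' * ?c * (2 ^ n * exp ((m\<^sup>2 - 1) * S))"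
        unfolding x_def B_def L_def D'_def S_def
        using up[OF q q3(2) qC _ lnq Yq[unfolded Y_def] sb(1)[unfolded Y_def]] by simp
      have pt: "C n \<psi> / 2 \<le> \<tau> powr (- m) * x \<psi> powr (- 2 * m) + \<tau> * ((x \<psi>)\<^sup>2 * (B n \<psi>)\<^sup>2)" if g: "\<psi> \<in> G" for \<psi>
      proof -
        have gX: "\<psi> \<in> ?X" using g GX by blast
        have "x \<psi> > 0" using nz prim[OF gX] by (simp add: x_def)
        have "C n \<psi> / 2 \<le> B n \<psi> powr (2 * m / (m + 1))"
          unfolding C_def B_def L_def using g by (intro tame_powr_ge[OF m Q15 dc[OF gX]]) (simp add: G_def L_def)
        also have "\<dots> \<le> \<tau> powr (- m) * x \<psi> powr (- 2 * m) + \<tau> * ((x \<psi>)\<^sup>2 * (B n \<psi>)\<^sup>2)"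
          by (rule powr_interpolation[OF _ \<open>x \<psi> > 0\<close> t m]) (simp add: B_def)
        finally show ?thesis .
      qed
      have "?c * (E0 / 8 * E) \<le> (\<Sum>\<psi>\<in>G. C n \<psi> / 2)" using low by (simp add: sum_divide_distrib[symmetric] mult_ac)
      also have "\<dots> \<le> (\<Sum>\<psi>\<in>G. \<tau> powr (- m) * x \<psi> powr (- 2 * m) + \<tau> * ((x \<psi>)\<^sup>2 * (B n \<psi>)\<^sup>2))" by (rule sum_mono[OF pt])
      also have "\<dots> = \<tau> powr (- m) * V + \<tau> * (\<Sum>\<psi>\<in>G. (x \<psi>)\<^sup>2 * (B n \<psi>)\<^sup>2)"
        unfolding V_def by (simp only: sum.distrib sum_distrib_left)
      also have "(\<Sum>\<psi>\<in>G. (x \<psi>)\<^sup>2 * (B n \<psi>)\<^sup>2) \<le> (\<Sum>\<psi>\<in>?X. (x \<psi>)\<^sup>2 * (B n \<psi>)\<^sup>2)"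
        by (rule sum_mono2[OF finX GX]) simp
      also note upp
      also have "\<tau> * (D' * ?c * (2 ^ n * exp ((m\<^sup>2 - 1) * S))) \<le> ?c * (E0 / 16 * E)"
      proof -
        have "\<tau> * (D' * ?c * (2 ^ n * exp ((m\<^sup>2 - 1) * S))) = (?c * (E0 / 16) * exp ((m\<^sup>2 - 1) * S)) * (exp (- 3) * ln 2 * 2 ^ n)"
          using D' by (simp add: \<tau>_def field_simps)
        also have "\<dots> \<le> (?c * (E0 / 16) * exp ((m\<^sup>2 - 1) * S)) * exp S" using S E0 by (intro mult_left_mono) auto
        also have "\<dots> = ?c * (E0 / 16) * (exp ((m\<^sup>2 - 1) * S) * exp S)" by (simp only: mult.assoc)
        also have "exp ((m\<^sup>2 - 1) * S) * exp S = E" unfolding E_def exp_add[symmetric] by (simp add: left_diff_distrib)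
        finally show ?thesis by (simp add: mult.assoc)
      qed
      finally have "?c * (E0 / 8 * E) \<le> \<tau> powr (- m) * V + ?c * (E0 / 16 * E)" using t by simp
      moreover have "?c * (E0 / 8 * E) = 2 * (?c * (E0 / 16 * E))" by simp
      ultimately have "?c * (E0 / 16 * E) \<le> \<tau> powr (- m) * V" by linarith
      hence "\<tau> powr m * (?c * (E0 / 16 * E)) \<le> \<tau> powr m * (\<tau> powr (- m) * V)" by (rule mult_left_mono) simp
      also have "\<tau> powr m * (\<tau> powr (- m) * V) = V" using t by (simp add: powr_minus)
      also have "V \<le> (\<Sum>\<psi>\<in>primitive_characters q. x \<psi> powr (- 2 * m))"
        unfolding V_def using GX prim by (intro sum_mono2 finite_primitive_characters q) (auto simp: primitive_characters_def)
      finally have main: "\<tau> powr m * (?c * (E0 / 16 * E)) \<le> (\<Sum>\<psi>\<in>primitive_characters q. x \<psi> powr (- 2 * m))" .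
      have "\<kappa> powr (m\<^sup>2) * ln (real q) powr (m\<^sup>2) = (\<kappa> * ln (real q)) powr (m\<^sup>2)"
        using k q3 by (simp add: powr_mult)
      also have "\<dots> \<le> exp S powr (m\<^sup>2)"
      proof (intro powr_mono2)
        have "\<kappa> * ln (real q) \<le> \<kappa> * (2 * real a * 2 ^ n)" using lnq k by (intro mult_left_mono) auto
        also have "\<dots> = exp (- 3) * ln 2 * 2 ^ n" using a2 by (simp add: \<kappa>_def)
        finally show "\<kappa> * ln (real q) \<le> exp S" using S by linarith
        show "0 \<le> \<kappa> * ln (real q)" using k q3 by simp
      qed simp
      also have "\<dots> = E" by (simp add: E_def powr_def)
      finally have EL: "\<kappa> powr (m\<^sup>2) * ln (real q) powr (m\<^sup>2) \<le> E" .
      have cphi: "real (phi_star q) / 4 \<le> ?c"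
      proof -
        have "card (even_characters q) \<ge> (q - 1) div 2" by (rule card_even_characters_ge[OF q q3(2)])
        moreover have "phi_star q \<le> q - 1" by (rule phi_star_le[OF q])
        moreover have "4 * ((q - 1) div 2) \<ge> q - 1" using q3 by presburger
        ultimately have "phi_star q \<le> 4 * card (even_characters q)" by linarith
        hence "real (phi_star q) \<le> real (4 * card (even_characters q))" by (simp only: of_nat_le_iff)
        thus ?thesis by simp
      qed
      have "c * real (phi_star q) * ln (real q) powr (m\<^sup>2) = \<tau> powr m * ((real (phi_star q) / 4) * (E0 / 16 * (\<kappa> powr (m\<^sup>2) * ln (real q) powr (m\<^sup>2))))"
        by (simp add: c_def)
      also have "\<dots> \<le> \<tau> powr m * (?c * (E0 / 16 * E))"
        using cphi EL E0 by (intro mult_left_mono mult_mono) auto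
      also note main
      finally show ?thesis .
    qed
    with c show ?thesis unfolding x_def by blast
  qed
qed

text \<open>Absorbs the finitely many moduli below the threshold into the constant: each has a
  positive constant of its own, and the minimum serves them all.\<close>

lemma finite_uniform_constant:
  fixes f g :: "'a \<Rightarrow> real"
  assumes "finite A" "\<And>y. y \<in> A \<Longrightarrow> f y \<ge> 0" "\<And>y. y \<in> A \<Longrightarrow> \<exists>c>0. c * f y \<le> g y"
  shows "\<exists>c>0. \<forall>y\<in>A. c * f y \<le> g y"
  using assms
proof (induction A rule: finite_induct)
  case (insert z A)
  then obtain c d where c: "c > 0" "\<forall>y\<in>A. c * f y \<le> g y" and d: "d > 0" "d * f z \<le> g z" by blast
  have "min c d * f y \<le> g y" if "y \<in> insert z A" for y
  proof (cases "y = z")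
    case True
    have "min c d * f z \<le> d * f z" using insert.prems(1)[of z] by (intro mult_right_mono) auto
    thus ?thesis using d True by simp
  next
    case False
    hence y: "y \<in> A" using that by simp
    have "min c d * f y \<le> c * f y" using insert.prems(1)[OF that] by (intro mult_right_mono) auto
    thus ?thesis using c(2) y by (meson order_trans)
  qed
  moreover have "min c d > 0" using c d by simp
  ultimately show ?case by blast
qed (auto intro: exI[of _ 1])

lemma negative_moment_lower_bound:
  fixes m :: real
  assumes m: "m > 0"
  shows "\<exists>c>0. \<forall>q. prime q \<and> (\<forall>\<psi>. primitive_character q \<psi> \<longrightarrow> dirichlet_L (1/2) \<psi> \<noteq> 0) \<longrightarrow>
     c * real (phi_star q) * ln (real q) powr (m\<^sup>2) \<le> (\<Sum>\<psi>\<in>primitive_characters q. norm (dirichlet_L (1/2) \<psi>) powr (- 2 * m))"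
proof -
  define f where "f q = real (phi_star q) * ln (real q) powr (m\<^sup>2)" for q
  define g where "g q = (\<Sum>\<psi>\<in>primitive_characters q. norm (dirichlet_L (1/2) \<psi>) powr (- 2 * m))" for q
  define A where "A = {q. prime q \<and> (\<forall>\<psi>. primitive_character q \<psi> \<longrightarrow> dirichlet_L (1/2) \<psi> \<noteq> 0)}"
  obtain N c where c: "c > 0" and large: "\<And>q. q \<ge> N \<Longrightarrow> q \<in> A \<Longrightarrow> c * f q \<le> g q"
    using negative_moment_lower_bound_large[OF m] unfolding f_def g_def A_def mem_Collect_eq mult.assoc by blast
  have f0: "f q \<ge> 0" for q by (simp add: f_def)
  have "\<exists>d>0. \<forall>q\<in>A \<inter> {..<N}. d * f q \<le> g q"
  proof (rule finite_uniform_constant)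
    fix q assume q: "q \<in> A \<inter> {..<N}"
    show "\<exists>d>0. d * f q \<le> g q"
    \<comment> \<open>For the prime 2 there is no primitive character and both sides are 0;
      otherwise nonvanishing makes the moment strictly positive.\<close>
    proof (cases "primitive_characters q = {}")
      case True
      thus ?thesis by (intro exI[of _ 1]) (simp add: f_def g_def phi_star_def)
    next
      case False
      have "g q > 0" unfolding g_def
      proof (rule sum_pos)
        show "finite (primitive_characters q)" using q by (intro finite_primitive_characters) (simp add: A_def)
        show "norm (dirichlet_L (1/2) \<psi>) powr (- 2 * m) > 0" if "\<psi> \<in> primitive_characters q" for \<psi>
          using that q by (simp add: A_def primitive_characters_def)
      qed (rule False)
      \<comment> \<open>Adding \<open>g q\<close> to the denominator keeps it positive without a
        separate argument about \<open>f q\<close>.\<close>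
      moreover have "g q / (f q + g q) * f q \<le> g q"
        using f0[of q] \<open>g q > 0\<close> by (simp add: field_simps)
      ultimately show ?thesis using f0[of q] by (intro exI[of _ "g q / (f q + g q)"]) simp
    qed
  qed (auto simp: f0)
  then obtain d where d: "d > 0" "\<And>q. q \<in> A \<Longrightarrow> q < N \<Longrightarrow> d * f q \<le> g q" by auto
  have "min c d * f q \<le> g q" if "q \<in> A" for q
  proof (cases "q < N")
    case True
    have "min c d * f q \<le> d * f q" by (intro mult_right_mono f0) auto
    with d(2)[OF that True] show ?thesis by linarith
  next
    case False
    have "min c d * f q \<le> c * f q" by (intro mult_right_mono f0) auto
    with large[OF _ that] False show ?thesis by simp
  qed
  moreover have "min c d > 0" using c d by simp
  ultimately show ?thesis unfolding f_def g_def A_def mem_Collect_eq mult.assoc by blast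
qed

theorem theorem1p1:
  "\<exists>Q::nat. \<forall>k::real. k < 0 \<longrightarrow>
     (\<exists>c::real. c > 0 \<and>
       (\<forall>q::nat. prime q \<and> q \<ge> Q \<and>
          (\<forall>\<psi>. primitive_character q \<psi> \<longrightarrow> dirichlet_L (1/2) \<psi> \<noteq> 0) \<longrightarrow>
          (\<Sum>\<psi>\<in>primitive_characters q. norm (dirichlet_L (1/2) \<psi>) powr (2 * k))
            \<ge> c * real (phi_star q) * ln (real q) powr (k^2)))"
proof (rule exI[of _ 0], intro allI impI)
  fix k :: real
  assume "k < 0"
  hence "- k > 0" by simp
  from negative_moment_lower_bound[OF this]
  show "\<exists>c>0. \<forall>q. prime q \<and> 0 \<le> q \<and> (\<forall>\<psi>. primitive_character q \<psi> \<longrightarrow> dirichlet_L (1/2) \<psi> \<noteq> 0) \<longrightarrow>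
          c * real (phi_star q) * ln (real q) powr (k^2) \<le> (\<Sum>\<psi>\<in>primitive_characters q. norm (dirichlet_L (1/2) \<psi>) powr (2 * k))"
    by simp
qed

end
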